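(* Let $\mathcal{C}$ be a pivotal finite tensor category, let $\mathcal{M}$ be a pivotal exact left $\mathcal{C}$-module category, and let $\{L_1,\dots,L_n\}$ be a complete set of representatives of isomorphism classes of simple objects of $\mathcal{M}$. Then the set of internal characters $\{\mathrm{ch}_{\mathcal{M}}(L_i)\}_{i=1}^n\subset\mathrm{CF}(\mathcal{M})$ is linearly independent over $k$.
   Context: $k$ is an algebraically closed field. A finite abelian category is a $k$-linear category equivalent to finite-dimensional left modules over a finite-dimensional $k$-algebra. A finite tensor category is a rigid monoidal category $\mathcal{C}$ that is finite abelian, with $k$-linear tensor product in each variable and simple unit $\mathbf{1}$. A finite left $\mathcal{C}$-module category is a left $\mathcal{C}$-module category that is finite abelian with action $\otimes$ $k$-linear and right exact in each variable; it is exact if $P\otimes M$ is projective for all projective $P\in\mathcal{C}$ and all $M$. Associativity constraints are suppressed. $(X^*,\mathrm{ev}_X,\mathrm{coev}_X:\mathbf{1}\to X\otimes X^* )$ is the left dual of $X$. Write $[M,N]=\underline{\mathrm{Hom}}(M,N)$: $[M,-]$ is right adjoint to $X\mapsto X\otimes M$, with unit $\underline{\mathrm{coev}}_{X,M}$ and counit $\underline{\mathrm{ev}}_{M,N}$. Let $\mathfrak{a}_{X,M,N}:X\otimes[M,N]\to[M,X\otimes N]$ correspond to $\mathrm{id}_X\otimes\underline{\mathrm{ev}}_{M,N}$, let $\mathfrak{b}^{\natural}_{Y,M,N}:[Y\otimes M,N]\otimes Y\to[M,N]$ correspond to $\underline{\mathrm{ev}}_{Y\otimes M,N}$, let $\mathfrak{b}_{Y,M,N}=(\mathfrak{b}^{\natural}_{Y,M,N}\otimes\mathrm{id}_{Y^*})\circ(\mathrm{id}\otimes\mathrm{coev}_Y):[Y\otimes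 M,N]\to[M,N]\otimes Y^*$, and $\mathfrak{c}_{X,M,N,Y}=\mathfrak{b}_{Y,M,X\otimes N}^{-1}\circ(\mathfrak{a}_{X,M,N}\otimes\mathrm{id}_{Y^*}):X\otimes[M,N]\otimes Y^*\to[Y\otimes M,X\otimes N]$ (all but $\mathfrak{b}^\natural$ are isomorphisms). $A_{\mathcal{M}}=\int_{M\in\mathcal{M}}[M,M]$ is the end (which exists) with universal dinatural transformation $\pi_{\mathcal{M}}(M):A_{\mathcal{M}}\to[M,M]$, and $\mathrm{CF}(\mathcal{M})=\mathrm{Hom}_{\mathcal{C}}(A_{\mathcal{M}},\mathbf{1})$. A pivotal structure of $\mathcal{C}$ is a monoidal natural isomorphism $j_X:X\to X^{**}$. For exact $\mathcal{M}$, the relative Serre functor $\mathbb{S}=\mathbb{S}_{\mathcal{M}}:\mathcal{M}\to\mathcal{M}$ is the (unique) functor with a natural isomorphism $\mathfrak{d}_{M,N}:[M,N]^*\to[N,\mathbb{S}(M)]$. There is a unique natural isomorphism $\zeta_{X,M}:X^{**}\otimes\mathbb{S}(M)\to\mathbb{S}(X\otimes M)$ making $\mathbb{S}$ a $\mathcal{C}$-module functor from $\mathcal{M}$ to $\mathcal{M}$ with action twisted by $(-)^{**}$, such that $\mathfrak{d}_{Y\otimes M,X\otimes N}\circ(\mathfrak{c}_{X,M,N,Y}^* )^{-1}=[\mathrm{id}_{X\otimes N},\zeta_{Y,M}]\circ\mathfrak{c}_{Y^{**},N,\mathbb{S}(M),X}\circ(\mathrm{id}_{Y^{**}}\otimes\mathfrak{d}_{M,N}\otimes\mathrm{id}_{X^*})$.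 A pivotal structure of $\mathcal{M}$ is a natural isomorphism $j':\mathrm{id}_{\mathcal{M}}\to\mathbb{S}$ with $j'_{X\otimes M}=\zeta_{X,M}\circ(j_X\otimes j'_M)$; a pivotal left $\mathcal{C}$-module category is an exact one equipped with a pivotal structure. The trace $\mathrm{tr}_{\mathcal{M}}(M):[M,M]\to\mathbf{1}$ is the morphism with $\mathfrak{d}_{M,M}\circ\mathrm{tr}_{\mathcal{M}}(M)^*=[\mathrm{id}_M,j'_M]\circ\underline{\mathrm{coev}}_{\mathbf{1},M}$, and the internal character of $M$ is $\mathrm{ch}_{\mathcal{M}}(M)=\mathrm{tr}_{\mathcal{M}}(M)\circ\pi_{\mathcal{M}}(M)\in\mathrm{CF}(\mathcal{M})$. *)

theory Defs
  imports "Jordan_Normal_Form.VS_Connect"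
begin

section \<open>Linear categories\<close>

text \<open>The Hom spaces are vector spaces over the ground field \<open>class_ring\<close> (the type \<open>'k\<close> seen as
  a ring record); only the additive structure and \<open>smult\<close> of the \<open>module\<close> records matter. Arrows
  determine their source and target (\<open>arr_unique\<close> below), so that composition needs no object
  arguments. Composition is written in the usual order: \<open>g \<cdot> f\<close> is \<open>f\<close> followed by \<open>g\<close>.\<close>

record ('o, 'm, 'k) lin_cat =
  Ob :: "'o set"
  Hom :: "'o \<Rightarrow> 'o \<Rightarrow> ('k, 'm) module"
  Idn :: "'o \<Rightarrow> 'm" ("\<iota>\<index>")
  Comp :: "'m \<Rightarrow> 'm \<Rightarrow> 'm" (infixr "\<cdot>\<index>" 70)

abbreviation Arr :: "('o, 'm, 'k, 'z) lin_cat_scheme \<Rightarrow> 'o \<Rightarrow> 'o \<Rightarrow> 'm set" where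
  "Arr C X Y \<equiv> carrier (Hom C X Y)"

abbreviation lin_maps ::
  "('k::field, 'v) module \<Rightarrow> ('k, 'w) module \<Rightarrow> ('v \<Rightarrow> 'w) set" where
  "lin_maps V W \<equiv> LinearCombinations.module_hom (class_ring :: 'k ring) V W"

locale linear_category =
  fixes C :: "('o, 'm, 'k::field, 'z) lin_cat_scheme" (structure)
  assumes hom_space: "X \<in> Ob C \<Longrightarrow> Y \<in> Ob C \<Longrightarrow> vectorspace class_ring (Hom C X Y)"
    and arr_unique: "X \<in> Ob C \<Longrightarrow> Y \<in> Ob C \<Longrightarrow> X' \<in> Ob C \<Longrightarrow> Y' \<in> Ob C \<Longrightarrow>
      f \<in> Arr C X Y \<Longrightarrow> f \<in> Arr C X' Y' \<Longrightarrow> X = X' \<and> Y = Y'"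
    and idn_arr: "X \<in> Ob C \<Longrightarrow> \<iota> X \<in> Arr C X X"
    and comp_linear_right: "X \<in> Ob C \<Longrightarrow> Y \<in> Ob C \<Longrightarrow> Z \<in> Ob C \<Longrightarrow> g \<in> Arr C Y Z \<Longrightarrow>
      (\<lambda>f. g \<cdot> f) \<in> lin_maps (Hom C X Y) (Hom C X Z)"
    and comp_linear_left: "X \<in> Ob C \<Longrightarrow> Y \<in> Ob C \<Longrightarrow> Z \<in> Ob C \<Longrightarrow> f \<in> Arr C X Y \<Longrightarrow>
      (\<lambda>g. g \<cdot> f) \<in> lin_maps (Hom C Y Z) (Hom C X Z)"
    and comp_assoc: "W \<in> Ob C \<Longrightarrow> X \<in> Ob C \<Longrightarrow> Y \<in> Ob C \<Longrightarrow> Z \<in> Ob C \<Longrightarrow>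
      f \<in> Arr C W X \<Longrightarrow> g \<in> Arr C X Y \<Longrightarrow> h \<in> Arr C Y Z \<Longrightarrow> (h \<cdot> g) \<cdot> f = h \<cdot> (g \<cdot> f)"
    and comp_idn_left: "X \<in> Ob C \<Longrightarrow> Y \<in> Ob C \<Longrightarrow> f \<in> Arr C X Y \<Longrightarrow> \<iota> Y \<cdot> f = f"
    and comp_idn_right: "X \<in> Ob C \<Longrightarrow> Y \<in> Ob C \<Longrightarrow> f \<in> Arr C X Y \<Longrightarrow> f \<cdot> \<iota> X = f"

context
  fixes C :: "('o, 'm, 'k, 'z) lin_cat_scheme" (structure)
begin

definition is_inverse :: "'o \<Rightarrow> 'o \<Rightarrow> 'm \<Rightarrow> 'm \<Rightarrow> bool" where
  "is_inverse X Y f g \<longleftrightarrow>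
     f \<in> Arr C X Y \<and> g \<in> Arr C Y X \<and> g \<cdot> f = \<iota> X \<and> f \<cdot> g = \<iota> Y"

definition iso_arr :: "'o \<Rightarrow> 'o \<Rightarrow> 'm \<Rightarrow> bool" where
  "iso_arr X Y f \<longleftrightarrow> (\<exists>g. is_inverse X Y f g)"

definition inv_arr :: "'o \<Rightarrow> 'o \<Rightarrow> 'm \<Rightarrow> 'm" where
  "inv_arr X Y f = (THE g. is_inverse X Y f g)"

definition isomorphic :: "'o \<Rightarrow> 'o \<Rightarrow> bool" where
  "isomorphic X Y \<longleftrightarrow> (\<exists>f. iso_arr X Y f)"

definition zero_object :: "'o \<Rightarrow> bool" where
  "zero_object Z \<longleftrightarrow> Z \<in> Ob C \<and>
     (\<forall>X\<in>Ob C. (\<exists>!f. f \<in> Arr C X Z) \<and> (\<exists>!f. f \<in> Arr C Z X))"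

definition mono_arr :: "'o \<Rightarrow> 'o \<Rightarrow> 'm \<Rightarrow> bool" where
  "mono_arr X Y f \<longleftrightarrow> f \<in> Arr C X Y \<and>
     (\<forall>W\<in>Ob C. \<forall>g\<in>Arr C W X. \<forall>h\<in>Arr C W X. f \<cdot> g = f \<cdot> h \<longrightarrow> g = h)"

definition epi_arr :: "'o \<Rightarrow> 'o \<Rightarrow> 'm \<Rightarrow> bool" where
  "epi_arr X Y f \<longleftrightarrow> f \<in> Arr C X Y \<and>
     (\<forall>Z\<in>Ob C. \<forall>g\<in>Arr C Y Z. \<forall>h\<in>Arr C Y Z. g \<cdot> f = h \<cdot> f \<longrightarrow> g = h)"

definition simple_object :: "'o \<Rightarrow> bool" where
  "simple_object X \<longleftrightarrow> X \<in> Ob C \<and> \<not> zero_object X \<and>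
     (\<forall>Y\<in>Ob C. \<forall>f. mono_arr Y X f \<longrightarrow> zero_object Y \<or> iso_arr Y X f)"

definition projective_object :: "'o \<Rightarrow> bool" where
  "projective_object P \<longleftrightarrow> P \<in> Ob C \<and>
     (\<forall>X\<in>Ob C. \<forall>Y\<in>Ob C. \<forall>e f. epi_arr X Y e \<longrightarrow> f \<in> Arr C P Y \<longrightarrow>
       (\<exists>g\<in>Arr C P X. e \<cdot> g = f))"

definition is_cokernel :: "'o \<Rightarrow> 'o \<Rightarrow> 'o \<Rightarrow> 'm \<Rightarrow> 'm \<Rightarrow> bool" where
  "is_cokernel X Y Z f q \<longleftrightarrow>
     f \<in> Arr C X Y \<and> q \<in> Arr C Y Z \<and> q \<cdot> f = \<zero>\<^bsub>Hom C X Z\<^esub> \<and>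
     (\<forall>W\<in>Ob C. \<forall>h\<in>Arr C Y W. h \<cdot> f = \<zero>\<^bsub>Hom C X W\<^esub> \<longrightarrow> (\<exists>!u. u \<in> Arr C Z W \<and> u \<cdot> q = h))"

end

definition is_functor :: "('o1, 'm1, 'k, 'z1) lin_cat_scheme \<Rightarrow> ('o2, 'm2, 'k, 'z2) lin_cat_scheme
    \<Rightarrow> ('o1 \<Rightarrow> 'o2) \<Rightarrow> ('m1 \<Rightarrow> 'm2) \<Rightarrow> bool" where
  "is_functor C D Fo Fm \<longleftrightarrow>
     (\<forall>X\<in>Ob C. Fo X \<in> Ob D \<and> Fm (\<iota>\<^bsub>C\<^esub> X) = \<iota>\<^bsub>D\<^esub> (Fo X)) \<and>
     (\<forall>X\<in>Ob C. \<forall>Y\<in>Ob C. \<forall>f\<in>Arr C X Y. Fm f \<in> Arr D (Fo X) (Fo Y)) \<and>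
     (\<forall>X\<in>Ob C. \<forall>Y\<in>Ob C. \<forall>Z\<in>Ob C. \<forall>f\<in>Arr C X Y. \<forall>g\<in>Arr C Y Z.
        Fm (g \<cdot>\<^bsub>C\<^esub> f) = Fm g \<cdot>\<^bsub>D\<^esub> Fm f)"

definition linear_functor ::
  "('o1, 'm1, 'k::field, 'z1) lin_cat_scheme \<Rightarrow> ('o2, 'm2, 'k, 'z2) lin_cat_scheme
    \<Rightarrow> ('o1 \<Rightarrow> 'o2) \<Rightarrow> ('m1 \<Rightarrow> 'm2) \<Rightarrow> bool" where
  "linear_functor C D Fo Fm \<longleftrightarrow> is_functor C D Fo Fm \<and>
     (\<forall>X\<in>Ob C. \<forall>Y\<in>Ob C. Fm \<in> lin_maps (Hom C X Y) (Hom D (Fo X) (Fo Y)))"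

text \<open>A linear functor between finite abelian categories is right exact iff it preserves
  exactness of sequences of the form \<open>X \<rightarrow> Y \<rightarrow> Z \<rightarrow> 0\<close>, that is, cokernels.\<close>

definition right_exact_functor ::
  "('o1, 'm1, 'k::field, 'z1) lin_cat_scheme \<Rightarrow> ('o2, 'm2, 'k, 'z2) lin_cat_scheme
    \<Rightarrow> ('o1 \<Rightarrow> 'o2) \<Rightarrow> ('m1 \<Rightarrow> 'm2) \<Rightarrow> bool" where
  "right_exact_functor C D Fo Fm \<longleftrightarrow> linear_functor C D Fo Fm \<and>
     (\<forall>X\<in>Ob C. \<forall>Y\<in>Ob C. \<forall>Z\<in>Ob C. \<forall>f q. is_cokernel C X Y Z f q \<longrightarrow>
        is_cokernel D (Fo X) (Fo Y) (Fo Z) (Fm f) (Fm q))"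

definition natural_iso ::
  "('o1, 'm1, 'k, 'z1) lin_cat_scheme \<Rightarrow> ('o2, 'm2, 'k, 'z2) lin_cat_scheme
    \<Rightarrow> ('o1 \<Rightarrow> 'o2) \<Rightarrow> ('m1 \<Rightarrow> 'm2) \<Rightarrow> ('o1 \<Rightarrow> 'o2) \<Rightarrow> ('m1 \<Rightarrow> 'm2) \<Rightarrow> ('o1 \<Rightarrow> 'm2) \<Rightarrow> bool" where
  "natural_iso C D Fo Fm Go Gm \<eta> \<longleftrightarrow>
     (\<forall>X\<in>Ob C. iso_arr D (Fo X) (Go X) (\<eta> X)) \<and>
     (\<forall>X\<in>Ob C. \<forall>Y\<in>Ob C. \<forall>f\<in>Arr C X Y. Gm f \<cdot>\<^bsub>D\<^esub> \<eta> X = \<eta> Y \<cdot>\<^bsub>D\<^esub> Fm f)"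

definition linear_equivalent ::
  "('o1, 'm1, 'k::field, 'z1) lin_cat_scheme \<Rightarrow> ('o2, 'm2, 'k, 'z2) lin_cat_scheme \<Rightarrow> bool" where
  "linear_equivalent C D \<longleftrightarrow> (\<exists>Fo Fm Go Gm \<eta> \<epsilon>.
     linear_functor C D Fo Fm \<and> linear_functor D C Go Gm \<and>
     natural_iso C C (\<lambda>X. X) (\<lambda>f. f) (\<lambda>X. Go (Fo X)) (\<lambda>f. Gm (Fm f)) \<eta> \<and>
     natural_iso D D (\<lambda>X. Fo (Go X)) (\<lambda>f. Fm (Gm f)) (\<lambda>X. X) (\<lambda>f. f) \<epsilon>)"

section \<open>Finite abelian categories\<close>

text \<open>A finite-dimensional algebra is given on the coordinate space \<open>'k\<^sup>n\<close>, and a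
  finite-dimensional left module on some \<open>'k\<^sup>d\<close> with the action given by matrices. Choosing
  bases brings every finite-dimensional algebra and module into this form, so up to equivalence
  this is the category of all finite-dimensional left modules. An arrow carries its source and
  target besides the intertwining matrix.\<close>

definition fd_algebra :: "nat \<Rightarrow> ('k::field vec \<Rightarrow> 'k vec \<Rightarrow> 'k vec) \<Rightarrow> 'k vec \<Rightarrow> bool" where
  "fd_algebra n mul u \<longleftrightarrow>
     (let V = module_vec TYPE('k) n in
     u \<in> carrier V \<and>
     (\<forall>a\<in>carrier V. mul a \<in> lin_maps V V \<and> (\<lambda>b. mul b a) \<in> lin_maps V V \<and>
        mul u a = a \<and> mul a u = a) \<and>
     (\<forall>a\<in>carrier V. \<forall>b\<in>carrier V. \<forall>c\<in>carrier V. mul (mul a b) c = mul a (mul b c)))"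

type_synonym 'k fd_module = "nat \<times> ('k vec \<Rightarrow> 'k mat)"

definition fd_modules :: "nat \<Rightarrow> ('k::field vec \<Rightarrow> 'k vec \<Rightarrow> 'k vec) \<Rightarrow> 'k vec \<Rightarrow>
    ('k fd_module, 'k fd_module \<times> 'k mat \<times> 'k fd_module, 'k) lin_cat" where
  "fd_modules n mul u = \<lparr>
     Ob = {(d, \<rho>). \<rho> \<in> lin_maps (module_vec TYPE('k) n) (module_mat TYPE('k) d d) \<and>
            \<rho> u = 1\<^sub>m d \<and>
            (\<forall>a\<in>carrier_vec n. \<forall>b\<in>carrier_vec n. \<rho> (mul a b) = \<rho> a * \<rho> b)},
     Hom = (\<lambda>M N. \<lparr>
       carrier = {(M, T, N) | T. T \<in> carrier_mat (fst N) (fst M) \<and>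
                   (\<forall>a\<in>carrier_vec n. T * snd M a = snd N a * T)},
       mult = undefined,
       one = undefined,
       zero = (M, 0\<^sub>m (fst N) (fst M), N),
       add = (\<lambda>(_, S, _) (_, T, _). (M, S + T, N)),
       smult = (\<lambda>c (_, T, _). (M, c \<cdot>\<^sub>m T, N)) \<rparr>),
     Idn = (\<lambda>M. (M, 1\<^sub>m (fst M), M)),
     Comp = (\<lambda>(_, T, P) (M, S, _). (M, T * S, P)) \<rparr>"

locale finite_abelian_category = linear_category C
  for C :: "('o, 'm, 'k::field, 'z) lin_cat_scheme" (structure) +
  assumes equivalent_fd_modules:
    "\<exists>n mul (u :: 'k vec). fd_algebra n mul u \<and> linear_equivalent C (fd_modules n mul u)"

section \<open>Finite tensor categories\<close>

text \<open>Nothing is assumed strict: \<open>Assoc X Y Z : (X \<boxtimes> Y) \<boxtimes> Z \<rightarrow> X \<boxtimes> (Y \<boxtimes> Z)\<close>,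
  \<open>LUnit X : \<I> \<boxtimes> X \<rightarrow> X\<close> and \<open>RUnit X : X \<boxtimes> \<I> \<rightarrow> X\<close>. The record also carries a choice of left
  duals, \<open>Ev X : X\<^sup>\<or> \<boxtimes> X \<rightarrow> \<I>\<close> and \<open>Coev X : \<I> \<rightarrow> X \<boxtimes> X\<^sup>\<or>\<close>.\<close>

record ('o, 'm, 'k) tensor_cat = "('o, 'm, 'k) lin_cat" +
  TensO :: "'o \<Rightarrow> 'o \<Rightarrow> 'o" (infixl "\<boxtimes>\<index>" 75)
  TensM :: "'m \<Rightarrow> 'm \<Rightarrow> 'm" (infixl "\<boxtimes>\<^sub>m\<index>" 75)
  Unit :: "'o" ("\<I>\<index>")
  Assoc :: "'o \<Rightarrow> 'o \<Rightarrow> 'o \<Rightarrow> 'm"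
  LUnit :: "'o \<Rightarrow> 'm"
  RUnit :: "'o \<Rightarrow> 'm"
  Dual :: "'o \<Rightarrow> 'o" ("(_\<^sup>\<or>\<index>)" [1000] 1000)
  Ev :: "'o \<Rightarrow> 'm"
  Coev :: "'o \<Rightarrow> 'm"

locale tensor_data =
  fixes C :: "('o, 'm, 'k::field, 'z) tensor_cat_scheme" (structure)
begin

abbreviation "assoc X Y Z \<equiv> Assoc C X Y Z"
abbreviation "lunit X \<equiv> LUnit C X"
abbreviation "runit X \<equiv> RUnit C X"
abbreviation "ev X \<equiv> Ev C X"
abbreviation "coev X \<equiv> Coev C X"

definition assoc_inv :: "'o \<Rightarrow> 'o \<Rightarrow> 'o \<Rightarrow> 'm" where
  "assoc_inv X Y Z = inv_arr C ((X \<boxtimes> Y) \<boxtimes> Z) (X \<boxtimes> (Y \<boxtimes> Z)) (assoc X Y Z)"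

definition runit_inv :: "'o \<Rightarrow> 'm" where
  "runit_inv X = inv_arr C (X \<boxtimes> \<I>) X (runit X)"

definition is_left_dual :: "'o \<Rightarrow> 'o \<Rightarrow> 'm \<Rightarrow> 'm \<Rightarrow> bool" where
  "is_left_dual X D e c \<longleftrightarrow> D \<in> Ob C \<and> e \<in> Arr C (D \<boxtimes> X) \<I> \<and> c \<in> Arr C \<I> (X \<boxtimes> D) \<and>
     runit X \<cdot> (\<iota> X \<boxtimes>\<^sub>m e) \<cdot> assoc X D X \<cdot> (c \<boxtimes>\<^sub>m \<iota> X) = lunit X \<and>
     lunit D \<cdot> (e \<boxtimes>\<^sub>m \<iota> D) \<cdot> assoc_inv D X D \<cdot> (\<iota> D \<boxtimes>\<^sub>m c) = runit D"

text \<open>For \<open>f : X \<rightarrow> Y\<close>, \<open>dual_arr X Y f : Y\<^sup>\<or> \<rightarrow> X\<^sup>\<or>\<close> is the transpose and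
  \<open>ddual_arr X Y f : X\<^sup>\<or>\<^sup>\<or> \<rightarrow> Y\<^sup>\<or>\<^sup>\<or>\<close> the double transpose.\<close>

definition dual_arr :: "'o \<Rightarrow> 'o \<Rightarrow> 'm \<Rightarrow> 'm" where
  "dual_arr X Y f =
     lunit (X\<^sup>\<or>) \<cdot> (ev Y \<boxtimes>\<^sub>m \<iota> (X\<^sup>\<or>)) \<cdot> assoc_inv (Y\<^sup>\<or>) Y (X\<^sup>\<or>) \<cdot>
     (\<iota> (Y\<^sup>\<or>) \<boxtimes>\<^sub>m (f \<boxtimes>\<^sub>m \<iota> (X\<^sup>\<or>))) \<cdot> (\<iota> (Y\<^sup>\<or>) \<boxtimes>\<^sub>m coev X) \<cdot> runit_inv (Y\<^sup>\<or>)"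

definition ddual_arr :: "'o \<Rightarrow> 'o \<Rightarrow> 'm \<Rightarrow> 'm" where
  "ddual_arr X Y f = dual_arr (Y\<^sup>\<or>) (X\<^sup>\<or>) (dual_arr X Y f)"

text \<open>The canonical isomorphisms \<open>Y\<^sup>\<or> \<boxtimes> X\<^sup>\<or> \<rightarrow> (X \<boxtimes> Y)\<^sup>\<or>\<close> and \<open>\<I> \<rightarrow> \<I>\<^sup>\<or>\<close>: the unique morphisms
  compatible with the evaluations.\<close>

definition dual_tensor :: "'o \<Rightarrow> 'o \<Rightarrow> 'm" where
  "dual_tensor X Y = (THE g. g \<in> Arr C (Y\<^sup>\<or> \<boxtimes> X\<^sup>\<or>) ((X \<boxtimes> Y)\<^sup>\<or>) \<and>
     ev (X \<boxtimes> Y) \<cdot> (g \<boxtimes>\<^sub>m \<iota> (X \<boxtimes> Y)) =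
     ev Y \<cdot> (\<iota> (Y\<^sup>\<or>) \<boxtimes>\<^sub>m (lunit Y \<cdot> (ev X \<boxtimes>\<^sub>m \<iota> Y) \<cdot> assoc_inv (X\<^sup>\<or>) X Y)) \<cdot>
     assoc (Y\<^sup>\<or>) (X\<^sup>\<or>) (X \<boxtimes> Y))"

definition dual_unit :: "'m" where
  "dual_unit = (THE g. g \<in> Arr C \<I> (\<I>\<^sup>\<or>) \<and> ev \<I> \<cdot> (g \<boxtimes>\<^sub>m \<iota> \<I>) = lunit \<I>)"

text \<open>The monoidal structure \<open>X\<^sup>\<or>\<^sup>\<or> \<boxtimes> Y\<^sup>\<or>\<^sup>\<or> \<rightarrow> (X \<boxtimes> Y)\<^sup>\<or>\<^sup>\<or>\<close> and \<open>\<I> \<rightarrow> \<I>\<^sup>\<or>\<^sup>\<or>\<close> of the double dual functor.\<close>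

definition ddual_tensor :: "'o \<Rightarrow> 'o \<Rightarrow> 'm" where
  "ddual_tensor X Y =
     inv_arr C ((X \<boxtimes> Y)\<^sup>\<or>\<^sup>\<or>) ((Y\<^sup>\<or> \<boxtimes> X\<^sup>\<or>)\<^sup>\<or>)
       (dual_arr (Y\<^sup>\<or> \<boxtimes> X\<^sup>\<or>) ((X \<boxtimes> Y)\<^sup>\<or>) (dual_tensor X Y)) \<cdot>
     dual_tensor (Y\<^sup>\<or>) (X\<^sup>\<or>)"

definition ddual_unit :: "'m" where
  "ddual_unit = inv_arr C (\<I>\<^sup>\<or>\<^sup>\<or>) (\<I>\<^sup>\<or>) (dual_arr \<I> (\<I>\<^sup>\<or>) dual_unit) \<cdot> dual_unit"

end

locale finite_tensor_category =
  tensor_data C + finite_abelian_category C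
  for C :: "('o, 'm, 'k::field, 'z) tensor_cat_scheme" (structure) +
  assumes unit_ob: "\<I> \<in> Ob C"
    and tens_ob: "X \<in> Ob C \<Longrightarrow> Y \<in> Ob C \<Longrightarrow> X \<boxtimes> Y \<in> Ob C"
    and tens_idn: "X \<in> Ob C \<Longrightarrow> Y \<in> Ob C \<Longrightarrow> \<iota> X \<boxtimes>\<^sub>m \<iota> Y = \<iota> (X \<boxtimes> Y)"
    and tens_comp:
      "X \<in> Ob C \<Longrightarrow> Y \<in> Ob C \<Longrightarrow> Z \<in> Ob C \<Longrightarrow> X' \<in> Ob C \<Longrightarrow> Y' \<in> Ob C \<Longrightarrow> Z' \<in> Ob C \<Longrightarrow>
       f \<in> Arr C X Y \<Longrightarrow> g \<in> Arr C Y Z \<Longrightarrow> f' \<in> Arr C X' Y' \<Longrightarrow> g' \<in> Arr C Y' Z' \<Longrightarrow>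
       (g \<cdot> f) \<boxtimes>\<^sub>m (g' \<cdot> f') = (g \<boxtimes>\<^sub>m g') \<cdot> (f \<boxtimes>\<^sub>m f')"
    and tens_linear_right:
      "X \<in> Ob C \<Longrightarrow> Y \<in> Ob C \<Longrightarrow> X' \<in> Ob C \<Longrightarrow> Y' \<in> Ob C \<Longrightarrow> f \<in> Arr C X Y \<Longrightarrow>
       (\<lambda>g. f \<boxtimes>\<^sub>m g) \<in> lin_maps (Hom C X' Y') (Hom C (X \<boxtimes> X') (Y \<boxtimes> Y'))"
    and tens_linear_left:
      "X \<in> Ob C \<Longrightarrow> Y \<in> Ob C \<Longrightarrow> X' \<in> Ob C \<Longrightarrow> Y' \<in> Ob C \<Longrightarrow> g \<in> Arr C X' Y' \<Longrightarrow>
       (\<lambda>f. f \<boxtimes>\<^sub>m g) \<in> lin_maps (Hom C X Y) (Hom C (X \<boxtimes> X') (Y \<boxtimes> Y'))"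
    and assoc_iso: "X \<in> Ob C \<Longrightarrow> Y \<in> Ob C \<Longrightarrow> Z \<in> Ob C \<Longrightarrow>
       iso_arr C ((X \<boxtimes> Y) \<boxtimes> Z) (X \<boxtimes> (Y \<boxtimes> Z)) (assoc X Y Z)"
    and assoc_natural:
      "X \<in> Ob C \<Longrightarrow> Y \<in> Ob C \<Longrightarrow> Z \<in> Ob C \<Longrightarrow> X' \<in> Ob C \<Longrightarrow> Y' \<in> Ob C \<Longrightarrow> Z' \<in> Ob C \<Longrightarrow>
       f \<in> Arr C X X' \<Longrightarrow> g \<in> Arr C Y Y' \<Longrightarrow> h \<in> Arr C Z Z' \<Longrightarrow>
       assoc X' Y' Z' \<cdot> ((f \<boxtimes>\<^sub>m g) \<boxtimes>\<^sub>m h) = (f \<boxtimes>\<^sub>m (g \<boxtimes>\<^sub>m h)) \<cdot> assoc X Y Z"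
    and lunit_iso: "X \<in> Ob C \<Longrightarrow> iso_arr C (\<I> \<boxtimes> X) X (lunit X)"
    and lunit_natural: "X \<in> Ob C \<Longrightarrow> Y \<in> Ob C \<Longrightarrow> f \<in> Arr C X Y \<Longrightarrow>
       lunit Y \<cdot> (\<iota> \<I> \<boxtimes>\<^sub>m f) = f \<cdot> lunit X"
    and runit_iso: "X \<in> Ob C \<Longrightarrow> iso_arr C (X \<boxtimes> \<I>) X (runit X)"
    and runit_natural: "X \<in> Ob C \<Longrightarrow> Y \<in> Ob C \<Longrightarrow> f \<in> Arr C X Y \<Longrightarrow>
       runit Y \<cdot> (f \<boxtimes>\<^sub>m \<iota> \<I>) = f \<cdot> runit X"
    and pentagon: "W \<in> Ob C \<Longrightarrow> X \<in> Ob C \<Longrightarrow> Y \<in> Ob C \<Longrightarrow> Z \<in> Ob C \<Longrightarrow>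
       assoc W X (Y \<boxtimes> Z) \<cdot> assoc (W \<boxtimes> X) Y Z =
       (\<iota> W \<boxtimes>\<^sub>m assoc X Y Z) \<cdot> assoc W (X \<boxtimes> Y) Z \<cdot> (assoc W X Y \<boxtimes>\<^sub>m \<iota> Z)"
    and triangle: "X \<in> Ob C \<Longrightarrow> Y \<in> Ob C \<Longrightarrow>
       (\<iota> X \<boxtimes>\<^sub>m lunit Y) \<cdot> assoc X \<I> Y = runit X \<boxtimes>\<^sub>m \<iota> Y"
    and left_dual: "X \<in> Ob C \<Longrightarrow> is_left_dual X (X\<^sup>\<or>) (ev X) (coev X)"
    and right_dual_ex: "X \<in> Ob C \<Longrightarrow> \<exists>R\<in>Ob C. \<exists>e c. is_left_dual R X e c"
    and unit_simple: "simple_object C \<I>"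

record ('o, 'm, 'k) pivotal_tensor_cat = "('o, 'm, 'k) tensor_cat" +
  Piv :: "'o \<Rightarrow> 'm"

locale pivotal_finite_tensor_category = finite_tensor_category C
  for C :: "('o, 'm, 'k::field, 'z) pivotal_tensor_cat_scheme" (structure) +
  assumes piv_iso: "X \<in> Ob C \<Longrightarrow> iso_arr C X (X\<^sup>\<or>\<^sup>\<or>) (Piv C X)"
    and piv_natural: "X \<in> Ob C \<Longrightarrow> Y \<in> Ob C \<Longrightarrow> f \<in> Arr C X Y \<Longrightarrow>
      ddual_arr X Y f \<cdot> Piv C X = Piv C Y \<cdot> f"
    and piv_tensor: "X \<in> Ob C \<Longrightarrow> Y \<in> Ob C \<Longrightarrow>
      Piv C (X \<boxtimes> Y) = ddual_tensor X Y \<cdot> (Piv C X \<boxtimes>\<^sub>m Piv C Y)"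
    and piv_unit: "Piv C \<I> = ddual_unit"

section \<open>Module categories\<close>

text \<open>\<open>MAssoc X Y K : (X \<boxtimes> Y) \<rhd> K \<rightarrow> X \<rhd> (Y \<rhd> K)\<close> and \<open>MUnit K : \<I> \<rhd> K \<rightarrow> K\<close> are the
  constraints of the action. The record also carries a choice of internal Homs with their
  counits \<open>IEv K N : IHom K N \<rhd> K \<rightarrow> N\<close>.\<close>

record ('om, 'mm, 'k, 'oc, 'mc) module_cat = "('om, 'mm, 'k) lin_cat" +
  ActO :: "'oc \<Rightarrow> 'om \<Rightarrow> 'om"
  ActM :: "'mc \<Rightarrow> 'mm \<Rightarrow> 'mm"
  MAssoc :: "'oc \<Rightarrow> 'oc \<Rightarrow> 'om \<Rightarrow> 'mm"
  MUnit :: "'om \<Rightarrow> 'mm"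
  IHom :: "'om \<Rightarrow> 'om \<Rightarrow> 'oc"
  IEv :: "'om \<Rightarrow> 'om \<Rightarrow> 'mm"

locale module_data = tensor_data C
  for C :: "('oc, 'mc, 'k::field, 'z) tensor_cat_scheme" (structure) +
  fixes M :: "('om, 'mm, 'k, 'oc, 'mc, 'y) module_cat_scheme"
begin

abbreviation act_ob (infixr "\<rhd>" 73) where "X \<rhd> K \<equiv> ActO M X K"
abbreviation act_arr (infixr "\<rhd>\<^sub>m" 73) where "f \<rhd>\<^sub>m g \<equiv> ActM M f g"
abbreviation "massoc X Y K \<equiv> MAssoc M X Y K"
abbreviation "munit K \<equiv> MUnit M K"
abbreviation "ihom K N \<equiv> IHom M K N"
abbreviation "iev K N \<equiv> IEv M K N"

text \<open>The morphism \<open>X \<rightarrow> [K, N]\<close> corresponding to \<open>f : X \<rhd> K \<rightarrow> N\<close>.\<close>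

definition adjunct :: "'oc \<Rightarrow> 'om \<Rightarrow> 'om \<Rightarrow> 'mm \<Rightarrow> 'mc" where
  "adjunct X K N f =
     (THE g. g \<in> Arr C X (ihom K N) \<and> iev K N \<cdot>\<^bsub>M\<^esub> (g \<rhd>\<^sub>m \<iota>\<^bsub>M\<^esub> K) = f)"

text \<open>\<open>ihom_post K N N' f = [K, f] : [K, N] \<rightarrow> [K, N']\<close> for \<open>f : N \<rightarrow> N'\<close>, and
  \<open>ihom_pre K K' N f = [f, N] : [K', N] \<rightarrow> [K, N]\<close> for \<open>f : K \<rightarrow> K'\<close>.\<close>

definition ihom_post :: "'om \<Rightarrow> 'om \<Rightarrow> 'om \<Rightarrow> 'mm \<Rightarrow> 'mc" where
  "ihom_post K N N' f = adjunct (ihom K N) K N' (f \<cdot>\<^bsub>M\<^esub> iev K N)"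

definition ihom_pre :: "'om \<Rightarrow> 'om \<Rightarrow> 'om \<Rightarrow> 'mm \<Rightarrow> 'mc" where
  "ihom_pre K K' N f =
     adjunct (ihom K' N) K N (iev K' N \<cdot>\<^bsub>M\<^esub> (\<iota> (ihom K' N) \<rhd>\<^sub>m f))"

definition icoev :: "'oc \<Rightarrow> 'om \<Rightarrow> 'mc" where
  "icoev X K = adjunct X K (X \<rhd> K) (\<iota>\<^bsub>M\<^esub> (X \<rhd> K))"

text \<open>The canonical morphisms \<open>\<aa>\<close>, \<open>\<bb>\<^sup>\<natural>\<close>, \<open>\<bb>\<close> and \<open>\<cc>\<close>:
  \<open>\<aa> : X \<boxtimes> [K, N] \<rightarrow> [K, X \<rhd> N]\<close>, \<open>\<bb>\<^sup>\<natural> : [Y \<rhd> K, N] \<boxtimes> Y \<rightarrow> [K, N]\<close>,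
  \<open>\<bb> : [Y \<rhd> K, N] \<rightarrow> [K, N] \<boxtimes> Y\<^sup>\<or>\<close> and \<open>\<cc> : (X \<boxtimes> [K, N]) \<boxtimes> Y\<^sup>\<or> \<rightarrow> [Y \<rhd> K, X \<rhd> N]\<close>.\<close>

definition ihom_a :: "'oc \<Rightarrow> 'om \<Rightarrow> 'om \<Rightarrow> 'mc" where
  "ihom_a X K N = adjunct (X \<boxtimes> ihom K N) K (X \<rhd> N)
     ((\<iota> X \<rhd>\<^sub>m iev K N) \<cdot>\<^bsub>M\<^esub> massoc X (ihom K N) K)"

definition ihom_b_nat :: "'oc \<Rightarrow> 'om \<Rightarrow> 'om \<Rightarrow> 'mc" where
  "ihom_b_nat Y K N = adjunct (ihom (Y \<rhd> K) N \<boxtimes> Y) K N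
     (iev (Y \<rhd> K) N \<cdot>\<^bsub>M\<^esub> massoc (ihom (Y \<rhd> K) N) Y K)"

definition ihom_b :: "'oc \<Rightarrow> 'om \<Rightarrow> 'om \<Rightarrow> 'mc" where
  "ihom_b Y K N =
     (ihom_b_nat Y K N \<boxtimes>\<^sub>m \<iota> (Y\<^sup>\<or>)) \<cdot> assoc_inv (ihom (Y \<rhd> K) N) Y (Y\<^sup>\<or>) \<cdot>
     (\<iota> (ihom (Y \<rhd> K) N) \<boxtimes>\<^sub>m coev Y) \<cdot> runit_inv (ihom (Y \<rhd> K) N)"

definition ihom_c :: "'oc \<Rightarrow> 'om \<Rightarrow> 'om \<Rightarrow> 'oc \<Rightarrow> 'mc" where
  "ihom_c X K N Y =
     inv_arr C (ihom (Y \<rhd> K) (X \<rhd> N)) (ihom K (X \<rhd> N) \<boxtimes> Y\<^sup>\<or>) (ihom_b Y K (X \<rhd> N)) \<cdot>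
     (ihom_a X K N \<boxtimes>\<^sub>m \<iota> (Y\<^sup>\<or>))"

text \<open>\<open>(A, \<pi>)\<close> is the end of \<open>K \<mapsto> [K, K]\<close>.\<close>

definition dinatural :: "'oc \<Rightarrow> ('om \<Rightarrow> 'mc) \<Rightarrow> bool" where
  "dinatural X p \<longleftrightarrow>
     (\<forall>K\<in>Ob M. p K \<in> Arr C X (ihom K K)) \<and>
     (\<forall>K\<in>Ob M. \<forall>N\<in>Ob M. \<forall>f\<in>Arr M K N.
        ihom_post K K N f \<cdot> p K = ihom_pre K N N f \<cdot> p N)"

definition is_end :: "'oc \<Rightarrow> ('om \<Rightarrow> 'mc) \<Rightarrow> bool" where
  "is_end A \<pi> \<longleftrightarrow> A \<in> Ob C \<and> dinatural A \<pi> \<and>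
     (\<forall>X\<in>Ob C. \<forall>p. dinatural X p \<longrightarrow>
        (\<exists>!g. g \<in> Arr C X A \<and> (\<forall>K\<in>Ob M. \<pi> K \<cdot> g = p K)))"

end

locale finite_module_category =
  module_data C M + finite_tensor_category C
  for C :: "('oc, 'mc, 'k::field, 'z) tensor_cat_scheme" (structure)
    and M :: "('om, 'mm, 'k, 'oc, 'mc, 'y) module_cat_scheme" +
  assumes finite_abelian: "finite_abelian_category M"
    and act_ob_closed: "X \<in> Ob C \<Longrightarrow> K \<in> Ob M \<Longrightarrow> X \<rhd> K \<in> Ob M"
    and act_arr_closed:
      "X \<in> Ob C \<Longrightarrow> Y \<in> Ob C \<Longrightarrow> K \<in> Ob M \<Longrightarrow> N \<in> Ob M \<Longrightarrow>
       f \<in> Arr C X Y \<Longrightarrow> u \<in> Arr M K N \<Longrightarrow> f \<rhd>\<^sub>m u \<in> Arr M (X \<rhd> K) (Y \<rhd> N)"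
    and act_comp:
      "X \<in> Ob C \<Longrightarrow> Y \<in> Ob C \<Longrightarrow> Z \<in> Ob C \<Longrightarrow> K \<in> Ob M \<Longrightarrow> N \<in> Ob M \<Longrightarrow> P \<in> Ob M \<Longrightarrow>
       f \<in> Arr C X Y \<Longrightarrow> g \<in> Arr C Y Z \<Longrightarrow> u \<in> Arr M K N \<Longrightarrow> v \<in> Arr M N P \<Longrightarrow>
       (g \<cdot> f) \<rhd>\<^sub>m (v \<cdot>\<^bsub>M\<^esub> u) = (g \<rhd>\<^sub>m v) \<cdot>\<^bsub>M\<^esub> (f \<rhd>\<^sub>m u)"
    and act_right_exact_right: "X \<in> Ob C \<Longrightarrow>
       right_exact_functor M M (\<lambda>K. X \<rhd> K) (\<lambda>g. \<iota> X \<rhd>\<^sub>m g)"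
    and act_right_exact_left: "K \<in> Ob M \<Longrightarrow>
       right_exact_functor C M (\<lambda>X. X \<rhd> K) (\<lambda>f. f \<rhd>\<^sub>m \<iota>\<^bsub>M\<^esub> K)"
    and massoc_iso: "X \<in> Ob C \<Longrightarrow> Y \<in> Ob C \<Longrightarrow> K \<in> Ob M \<Longrightarrow>
       iso_arr M ((X \<boxtimes> Y) \<rhd> K) (X \<rhd> (Y \<rhd> K)) (massoc X Y K)"
    and massoc_natural:
      "X \<in> Ob C \<Longrightarrow> X' \<in> Ob C \<Longrightarrow> Y \<in> Ob C \<Longrightarrow> Y' \<in> Ob C \<Longrightarrow> K \<in> Ob M \<Longrightarrow> K' \<in> Ob M \<Longrightarrow>
       f \<in> Arr C X X' \<Longrightarrow> g \<in> Arr C Y Y' \<Longrightarrow> u \<in> Arr M K K' \<Longrightarrow>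
       massoc X' Y' K' \<cdot>\<^bsub>M\<^esub> ((f \<boxtimes>\<^sub>m g) \<rhd>\<^sub>m u) = (f \<rhd>\<^sub>m (g \<rhd>\<^sub>m u)) \<cdot>\<^bsub>M\<^esub> massoc X Y K"
    and munit_iso: "K \<in> Ob M \<Longrightarrow> iso_arr M (\<I> \<rhd> K) K (munit K)"
    and munit_natural: "K \<in> Ob M \<Longrightarrow> N \<in> Ob M \<Longrightarrow> u \<in> Arr M K N \<Longrightarrow>
       munit N \<cdot>\<^bsub>M\<^esub> (\<iota> \<I> \<rhd>\<^sub>m u) = u \<cdot>\<^bsub>M\<^esub> munit K"
    and act_pentagon: "X \<in> Ob C \<Longrightarrow> Y \<in> Ob C \<Longrightarrow> Z \<in> Ob C \<Longrightarrow> K \<in> Ob M \<Longrightarrow>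
       massoc X Y (Z \<rhd> K) \<cdot>\<^bsub>M\<^esub> massoc (X \<boxtimes> Y) Z K =
       (\<iota> X \<rhd>\<^sub>m massoc Y Z K) \<cdot>\<^bsub>M\<^esub> massoc X (Y \<boxtimes> Z) K \<cdot>\<^bsub>M\<^esub> (assoc X Y Z \<rhd>\<^sub>m \<iota>\<^bsub>M\<^esub> K)"
    and act_triangle: "X \<in> Ob C \<Longrightarrow> K \<in> Ob M \<Longrightarrow>
       (\<iota> X \<rhd>\<^sub>m munit K) \<cdot>\<^bsub>M\<^esub> massoc X \<I> K = runit X \<rhd>\<^sub>m \<iota>\<^bsub>M\<^esub> K"

text \<open>In a finite module category the internal Homs exist because \<open>X \<mapsto> X \<rhd> K\<close> is right exact;
  the assumptions on \<open>ihom\<close> and \<open>iev\<close> only say that the chosen ones are internal Homs.\<close>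

locale exact_module_category = finite_module_category C M
  for C :: "('oc, 'mc, 'k::field, 'z) tensor_cat_scheme" (structure)
    and M :: "('om, 'mm, 'k, 'oc, 'mc, 'y) module_cat_scheme" +
  assumes exact: "projective_object C P \<Longrightarrow> K \<in> Ob M \<Longrightarrow> projective_object M (P \<rhd> K)"
    and ihom_ob: "K \<in> Ob M \<Longrightarrow> N \<in> Ob M \<Longrightarrow> ihom K N \<in> Ob C"
    and iev_arr: "K \<in> Ob M \<Longrightarrow> N \<in> Ob M \<Longrightarrow> iev K N \<in> Arr M (ihom K N \<rhd> K) N"
    and ihom_universal:
      "X \<in> Ob C \<Longrightarrow> K \<in> Ob M \<Longrightarrow> N \<in> Ob M \<Longrightarrow> u \<in> Arr M (X \<rhd> K) N \<Longrightarrow>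
       \<exists>!g. g \<in> Arr C X (ihom K N) \<and> iev K N \<cdot>\<^bsub>M\<^esub> (g \<rhd>\<^sub>m \<iota>\<^bsub>M\<^esub> K) = u"

section \<open>Relative Serre functors and pivotal module categories\<close>

text \<open>\<open>(SerO, SerM)\<close> is the relative Serre functor with
  \<open>SerD K N : [K, N]\<^sup>\<or> \<rightarrow> [N, SerO K]\<close>, \<open>Zeta X K : X\<^sup>\<or>\<^sup>\<or> \<rhd> SerO K \<rightarrow> SerO (X \<rhd> K)\<close> is its twisted
  module structure and \<open>PivM\<close> is the pivotal structure of the module category.\<close>

record ('om, 'mm, 'k, 'oc, 'mc) pivotal_module_cat = "('om, 'mm, 'k, 'oc, 'mc) module_cat" +
  SerO :: "'om \<Rightarrow> 'om"
  SerM :: "'mm \<Rightarrow> 'mm"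
  SerD :: "'om \<Rightarrow> 'om \<Rightarrow> 'mc"
  Zeta :: "'oc \<Rightarrow> 'om \<Rightarrow> 'mm"
  PivM :: "'om \<Rightarrow> 'mm"

locale pivotal_module_data = module_data C M
  for C :: "('oc, 'mc, 'k::field, 'z) pivotal_tensor_cat_scheme" (structure)
    and M :: "('om, 'mm, 'k, 'oc, 'mc, 'y) pivotal_module_cat_scheme"
begin

abbreviation "ser_o K \<equiv> SerO M K"
abbreviation "ser_m f \<equiv> SerM M f"
abbreviation "ser_d K N \<equiv> SerD M K N"
abbreviation "zeta X K \<equiv> Zeta M X K"

definition is_relative_serre_functor :: bool where
  "is_relative_serre_functor \<longleftrightarrow> is_functor M M (SerO M) (SerM M) \<and>
     (\<forall>K\<in>Ob M. \<forall>N\<in>Ob M. iso_arr C ((ihom K N)\<^sup>\<or>) (ihom N (ser_o K)) (ser_d K N)) \<and>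
     (\<forall>K\<in>Ob M. \<forall>K'\<in>Ob M. \<forall>N\<in>Ob M. \<forall>f\<in>Arr M K K'.
        ser_d K' N \<cdot> dual_arr (ihom K' N) (ihom K N) (ihom_pre K K' N f) =
        ihom_post N (ser_o K) (ser_o K') (ser_m f) \<cdot> ser_d K N) \<and>
     (\<forall>K\<in>Ob M. \<forall>N\<in>Ob M. \<forall>N'\<in>Ob M. \<forall>f\<in>Arr M N N'.
        ser_d K N \<cdot> dual_arr (ihom K N) (ihom K N') (ihom_post K N N' f) =
        ihom_pre N N' (ser_o K) f \<cdot> ser_d K N')"

text \<open>The canonical isomorphism \<open>(Y\<^sup>\<or> \<boxtimes> H\<^sup>\<or>) \<boxtimes> X\<^sup>\<or> \<rightarrow> ((X \<boxtimes> H) \<boxtimes> Y)\<^sup>\<or>\<close>.\<close>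

definition dual_tensor3 :: "'oc \<Rightarrow> 'oc \<Rightarrow> 'oc \<Rightarrow> 'mc" where
  "dual_tensor3 X H Y =
     dual_tensor (X \<boxtimes> H) Y \<cdot> (\<iota> (Y\<^sup>\<or>) \<boxtimes>\<^sub>m dual_tensor X H) \<cdot> assoc (Y\<^sup>\<or>) (H\<^sup>\<or>) (X\<^sup>\<or>)"

definition is_twisted_module_structure :: bool where
  "is_twisted_module_structure \<longleftrightarrow>
     (\<forall>X\<in>Ob C. \<forall>K\<in>Ob M. iso_arr M (X\<^sup>\<or>\<^sup>\<or> \<rhd> ser_o K) (ser_o (X \<rhd> K)) (zeta X K)) \<and>
     (\<forall>X\<in>Ob C. \<forall>Y\<in>Ob C. \<forall>K\<in>Ob M. \<forall>N\<in>Ob M. \<forall>f\<in>Arr C X Y. \<forall>g\<in>Arr M K N.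
        ser_m (f \<rhd>\<^sub>m g) \<cdot>\<^bsub>M\<^esub> zeta X K = zeta Y N \<cdot>\<^bsub>M\<^esub> (ddual_arr X Y f \<rhd>\<^sub>m ser_m g)) \<and>
     (\<forall>X\<in>Ob C. \<forall>Y\<in>Ob C. \<forall>K\<in>Ob M.
        ser_m (massoc X Y K) \<cdot>\<^bsub>M\<^esub> zeta (X \<boxtimes> Y) K \<cdot>\<^bsub>M\<^esub> (ddual_tensor X Y \<rhd>\<^sub>m \<iota>\<^bsub>M\<^esub> (ser_o K)) =
        zeta X (Y \<rhd> K) \<cdot>\<^bsub>M\<^esub> (\<iota> (X\<^sup>\<or>\<^sup>\<or>) \<rhd>\<^sub>m zeta Y K) \<cdot>\<^bsub>M\<^esub> massoc (X\<^sup>\<or>\<^sup>\<or>) (Y\<^sup>\<or>\<^sup>\<or>) (ser_o K)) \<and>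
     (\<forall>K\<in>Ob M.
        ser_m (munit K) \<cdot>\<^bsub>M\<^esub> zeta \<I> K \<cdot>\<^bsub>M\<^esub> (ddual_unit \<rhd>\<^sub>m \<iota>\<^bsub>M\<^esub> (ser_o K)) = munit (ser_o K))"

definition serre_compatible :: bool where
  "serre_compatible \<longleftrightarrow>
     (\<forall>X\<in>Ob C. \<forall>Y\<in>Ob C. \<forall>K\<in>Ob M. \<forall>N\<in>Ob M.
        ser_d (Y \<rhd> K) (X \<rhd> N) \<cdot>
        inv_arr C ((ihom (Y \<rhd> K) (X \<rhd> N))\<^sup>\<or>) (((X \<boxtimes> ihom K N) \<boxtimes> Y\<^sup>\<or>)\<^sup>\<or>)
          (dual_arr ((X \<boxtimes> ihom K N) \<boxtimes> Y\<^sup>\<or>) (ihom (Y \<rhd> K) (X \<rhd> N)) (ihom_c X K N Y)) \<cdot>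
        dual_tensor3 X (ihom K N) (Y\<^sup>\<or>) =
        ihom_post (X \<rhd> N) (Y\<^sup>\<or>\<^sup>\<or> \<rhd> ser_o K) (ser_o (Y \<rhd> K)) (zeta Y K) \<cdot>
        ihom_c (Y\<^sup>\<or>\<^sup>\<or>) N (ser_o K) X \<cdot>
        ((\<iota> (Y\<^sup>\<or>\<^sup>\<or>) \<boxtimes>\<^sub>m ser_d K N) \<boxtimes>\<^sub>m \<iota> (X\<^sup>\<or>)))"

definition is_module_pivotal_structure :: bool where
  "is_module_pivotal_structure \<longleftrightarrow>
     natural_iso M M (\<lambda>K. K) (\<lambda>f. f) (SerO M) (SerM M) (PivM M) \<and>
     (\<forall>X\<in>Ob C. \<forall>K\<in>Ob M. PivM M (X \<rhd> K) = zeta X K \<cdot>\<^bsub>M\<^esub> (Piv C X \<rhd>\<^sub>m PivM M K))"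

text \<open>\<open>dual_unit\<close> identifies \<open>\<I>\<close> with the source \<open>\<I>\<^sup>\<or>\<close> of the transpose of \<open>t\<close>, and \<open>munit K\<close>
  the target of \<open>icoev \<I> K : \<I> \<rightarrow> [K, \<I> \<rhd> K]\<close> with \<open>[K, K]\<close>.\<close>

definition itrace :: "'om \<Rightarrow> 'mc" where
  "itrace K = (THE t. t \<in> Arr C (ihom K K) \<I> \<and>
     ser_d K K \<cdot> dual_arr (ihom K K) \<I> t \<cdot> dual_unit =
     ihom_post K K (ser_o K) (PivM M K) \<cdot> ihom_post K (\<I> \<rhd> K) K (munit K) \<cdot> icoev \<I> K)"

definition internal_character :: "('om \<Rightarrow> 'mc) \<Rightarrow> 'om \<Rightarrow> 'mc" where
  "internal_character \<pi> K = itrace K \<cdot> \<pi> K"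

end

locale pivotal_module_category =
  pivotal_module_data C M + pivotal_finite_tensor_category C + exact_module_category C M
  for C :: "('oc, 'mc, 'k::field, 'z) pivotal_tensor_cat_scheme" (structure)
    and M :: "('om, 'mm, 'k, 'oc, 'mc, 'y) pivotal_module_cat_scheme" +
  assumes relative_serre_functor: is_relative_serre_functor
    and twisted_module_structure: is_twisted_module_structure
    and serre_compatible: serre_compatible
    and module_pivotal_structure: is_module_pivotal_structure

text \<open>\<open>CF(M)\<close>, where \<open>A\<close> is the end of \<open>K \<mapsto> [K, K]\<close>.\<close>

definition class_functions ::
  "('oc, 'mc, 'k, 'z) tensor_cat_scheme \<Rightarrow> 'oc \<Rightarrow> ('k, 'mc) module" where
  "class_functions C A = Hom C A \<I>\<^bsub>C\<^esub>"

definition complete_simples ::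
  "('o, 'm, 'k, 'z) lin_cat_scheme \<Rightarrow> nat \<Rightarrow> (nat \<Rightarrow> 'o) \<Rightarrow> bool" where
  "complete_simples M n L \<longleftrightarrow>
     (\<forall>i\<in>{1..n}. simple_object M (L i)) \<and>
     (\<forall>i\<in>{1..n}. \<forall>j\<in>{1..n}. isomorphic M (L i) (L j) \<longrightarrow> i = j) \<and>
     (\<forall>S. simple_object M S \<longrightarrow> (\<exists>i\<in>{1..n}. isomorphic M S (L i)))"

end

theory Submission
  imports Defs "Jordan_Normal_Form.Char_Poly"
begin

text \<open>
  An arrow \<open>h : X \<rightarrow> A\<close> into the end is the same thing as a natural transformation
  \<open>\<eta> : X \<rhd> - \<rightarrow> id\<close>: the composite \<open>\<pi>\<^sub>K h : X \<rightarrow> [K, K]\<close> corresponds to \<open>\<eta>\<^sub>K : X \<rhd> K \<rightarrow> K\<close>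
  (\<open>natural_imp_dinatural\<close>). Composing the internal characters with \<open>h\<close> therefore tests them on
  natural transformations. They are linearly independent as soon as, for every simple \<open>L\<^sub>j\<close>, some
  \<open>\<eta>\<close> vanishes at all other \<open>L\<^sub>i\<close> while the trace of \<open>L\<^sub>j\<close> does not kill the arrow
  \<open>X \<rightarrow> [L\<^sub>j, L\<^sub>j]\<close> that corresponds to the component of \<open>\<eta>\<close> at \<open>L\<^sub>j\<close>
  (\<open>characters_separated\<close>, \<open>lin_indpt_if_separated\<close>).

  The trace \<open>[L, L] \<rightarrow> \<I>\<close> of a nonzero object is nonzero. By definition it corresponds to the
  pivotal isomorphism of \<open>L\<close>, through a chain of bijections the only delicate one of which is
  transposition \<open>Hom(X, \<I>) \<rightarrow> Hom(\<I>, X\<^sup>\<or>)\<close> (\<open>itrace_props\<close>, \<open>ex1_functional\<close>). A projective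
  generator \<open>P\<close> of the tensor category then supplies \<open>g : P \<rightarrow> [L, L]\<close> with \<open>tr g \<noteq> 0\<close>, and what
  remains is to extend a single prescribed arrow \<open>t : P \<rhd> L \<rightarrow> L\<close>, together with zero at the other
  simple objects, to a natural transformation \<open>P \<rhd> - \<rightarrow> id\<close>.

  This is done by an explicit formula. The module category is equivalent to the category of
  finite-dimensional modules over an algebra \<open>B\<close>. Let \<open>R = B\<close> be the regular and \<open>I = B\<^sup>*\<close> the
  coregular module. Vectors \<open>x \<in> K\<close> are arrows \<open>R \<rightarrow> K\<close>, covectors \<open>\<phi> \<in> K\<^sup>*\<close> are arrows \<open>K \<rightarrow> I\<close>.
  For a linear endofunctor \<open>F\<close>, an arrow \<open>g : F I \<rightarrow> R\<close> and \<open>b \<in> B\<close>, the sum over a basis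
  \<open>\<eta>\<^sub>K = \<Sum>\<^sub>a (b e\<^sub>a) \<circ> g \<circ> F(e\<^sup>a)\<close> is natural in \<open>K\<close>, because it is a trace
  (\<open>trace_natural_transformation\<close>). By the density theorem some \<open>b\<close> annihilates the other simple
  modules and acts on \<open>L\<close> as a rank one operator \<open>x \<mapsto> \<phi>(x) y\<close> (\<open>rank_one_element\<close>). For this \<open>b\<close>
  the components at the other simple modules vanish, and \<open>\<eta>\<^sub>L = y \<circ> g \<circ> F(\<phi>)\<close>.

  It remains to solve \<open>y \<circ> g \<circ> F(\<phi>) = t\<close> for \<open>g\<close>, where \<open>F = P \<rhd> -\<close>, the arrow \<open>y : R \<rightarrow> L\<close> is an
  epimorphism and \<open>\<phi> : L \<rightarrow> I\<close> a monomorphism. Since the module category is exact, \<open>P \<rhd> L\<close> is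
  projective, so \<open>t\<close> lifts through \<open>y\<close>. And \<open>F(\<phi>)\<close> is a split monomorphism: \<open>P \<rhd> -\<close> preserves the
  cokernel of \<open>\<phi>\<close>, whose target becomes projective, and it preserves kernels, being right adjoint
  to \<open>P\<^sup>\<or> \<rhd> -\<close> (\<open>projective_action_splits_mono\<close>). Hence the lift extends along \<open>F(\<phi>)\<close>
  (\<open>prescribed_natural_transformation\<close>).
\<close>

section \<open>Matrices and subspaces\<close>

text \<open>To prove a linear statement about all vectors, add the coordinates one at a time; this replaces
  expansions in a basis.\<close>

lemma unit_vec_induct [consumes 1, case_names zero add]:
  fixes v :: "'k::field vec"
  assumes v: "v \<in> carrier_vec n"
    and zero: "P (0\<^sub>v n)"
    and add: "\<And>w c i. w \<in> carrier_vec n \<Longrightarrow> i < n \<Longrightarrow> P w \<Longrightarrow> P (w + c \<cdot>\<^sub>v unit_vec n i)"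
  shows "P v"
proof -
  define w where "w k = vec n (\<lambda>i. if i < k then v $ i else 0)" for k
  have "P (w k)" if "k \<le> n" for k
    using that
  proof (induction k)
    case 0
    have "w 0 = 0\<^sub>v n" by (auto simp: w_def)
    then show ?case using zero by simp
  next
    case (Suc k)
    have "w (Suc k) = w k + v $ k \<cdot>\<^sub>v unit_vec n k"
      using Suc.prems by (intro eq_vecI) (auto simp: w_def less_Suc_eq)
    with Suc add[of "w k" k "v $ k"] show ?case by (simp add: w_def)
  qed
  moreover have "w n = v" using v by (auto simp: w_def)
  ultimately show ?thesis by auto
qed

lemma mult_unit_vec:
  fixes A :: "'k::field mat"
  assumes "A \<in> carrier_mat m n" "i < n"
  shows "A *\<^sub>v unit_vec n i = col A i"
  using assms by (intro eq_vecI) (auto simp: scalar_prod_right_unit[of i n])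

lemma mult_mat_zero_vec [simp]:
  fixes A :: "'k::field mat"
  shows "A \<in> carrier_mat m n \<Longrightarrow> A *\<^sub>v 0\<^sub>v n = 0\<^sub>v m"
  by (intro eq_vecI) auto

lemma vec_eq_if_diff_zero:
  fixes x y :: "'k::field vec"
  assumes "x \<in> carrier_vec n" "y \<in> carrier_vec n" "x - y = 0\<^sub>v n"
  shows "x = y"
proof (rule eq_vecI)
  fix i assume "i < dim_vec y"
  then have "(x - y) $ i = 0" using assms by simp
  then show "x $ i = y $ i" using \<open>i < dim_vec y\<close> by simp
qed (use assms in auto)

lemma zero_mat_mult_vec [simp]:
  "x \<in> carrier_vec n \<Longrightarrow> 0\<^sub>m m n *\<^sub>v x = (0\<^sub>v m :: 'k::field vec)"
  by (intro eq_vecI) auto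

lemma zero_smult_vec: "x \<in> carrier_vec n \<Longrightarrow> 0 \<cdot>\<^sub>v x = (0\<^sub>v n :: 'k::field vec)"
  by (intro eq_vecI) auto

lemma vec_diff_eqI:
  "y \<in> carrier_vec n \<Longrightarrow> z \<in> carrier_vec n \<Longrightarrow> x = y + z \<Longrightarrow> z = x - (y :: 'k::field vec)"
  by (intro eq_vecI) auto

lemma smult_zero_vec [simp]: "c \<cdot>\<^sub>v 0\<^sub>v n = (0\<^sub>v n :: 'k::field vec)"
  by (intro eq_vecI) auto

lemma minus_smult_linear:
  fixes p q x y :: "'k::field vec"
  assumes "p \<in> carrier_vec n" "q \<in> carrier_vec n" "x \<in> carrier_vec n" "y \<in> carrier_vec n"
  shows "k \<cdot>\<^sub>v p - c \<cdot>\<^sub>v (k \<cdot>\<^sub>v x) = k \<cdot>\<^sub>v (p - c \<cdot>\<^sub>v x)"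
    and "(p + q) - c \<cdot>\<^sub>v (x + y) = (p - c \<cdot>\<^sub>v x) + (q - c \<cdot>\<^sub>v y)"
  using assms by (auto intro!: eq_vecI simp: algebra_simps)

lemma eq_mat_if_mult_vec:
  fixes A B :: "'k::field mat"
  assumes "A \<in> carrier_mat m n" "B \<in> carrier_mat m n"
    and "\<And>v. v \<in> carrier_vec n \<Longrightarrow> A *\<^sub>v v = B *\<^sub>v v"
  shows "A = B"
proof (rule mat_col_eqI)
  show "dim_row A = dim_row B" "dim_col A = dim_col B" using assms by auto
  fix i assume "i < dim_col B"
  then have i: "i < n" using assms by auto
  show "col A i = col B i"
    using assms(3)[of "unit_vec n i"] mult_unit_vec[OF assms(1) i] mult_unit_vec[OF assms(2) i] by simp
qed

lemma linear_map_matrix: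
  fixes f :: "'k::field vec \<Rightarrow> 'k vec"
  assumes closed: "\<And>v. v \<in> carrier_vec n \<Longrightarrow> f v \<in> carrier_vec m"
    and add: "\<And>v w. v \<in> carrier_vec n \<Longrightarrow> w \<in> carrier_vec n \<Longrightarrow> f (v + w) = f v + f w"
    and smult: "\<And>c v. v \<in> carrier_vec n \<Longrightarrow> f (c \<cdot>\<^sub>v v) = c \<cdot>\<^sub>v f v"
  obtains A where "A \<in> carrier_mat m n" "\<And>v. v \<in> carrier_vec n \<Longrightarrow> A *\<^sub>v v = f v"
proof -
  define A where "A = mat m n (\<lambda>(i, j). f (unit_vec n j) $ i)"
  have A: "A \<in> carrier_mat m n" by (simp add: A_def)
  have Au: "A *\<^sub>v unit_vec n j = f (unit_vec n j)" if "j < n" for j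
  proof -
    have "A *\<^sub>v unit_vec n j = col A j" using mult_unit_vec[OF A that] .
    also have "\<dots> = f (unit_vec n j)"
      using closed[of "unit_vec n j"] that by (intro eq_vecI) (auto simp: A_def)
    finally show ?thesis .
  qed
  have "A *\<^sub>v v = f v" if "v \<in> carrier_vec n" for v
    using that
  proof (induction v rule: unit_vec_induct)
    case zero
    have "(0 :: 'k) \<cdot>\<^sub>v 0\<^sub>v n = 0\<^sub>v n" by auto
    then have "f (0\<^sub>v n) = f (0 \<cdot>\<^sub>v 0\<^sub>v n)" by simp
    also have "\<dots> = 0 \<cdot>\<^sub>v f (0\<^sub>v n)" by (rule smult) simp
    also have "\<dots> = 0\<^sub>v m" using closed[of "0\<^sub>v n"] by auto
    finally show ?case using A by auto
  next
    case (add w c i)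
    then show ?case
      using A Au by (simp add: assms mult_add_distrib_mat_vec[of _ m n] mult_mat_vec[of _ m n])
  qed
  with A show ?thesis using that by blast
qed

definition vec_subspace :: "nat \<Rightarrow> 'k::field vec set \<Rightarrow> bool" where
  "vec_subspace n W \<longleftrightarrow> W \<subseteq> carrier_vec n \<and> 0\<^sub>v n \<in> W \<and>
     (\<forall>x\<in>W. \<forall>y\<in>W. x + y \<in> W) \<and> (\<forall>c. \<forall>x\<in>W. c \<cdot>\<^sub>v x \<in> W)"

text \<open>A basis of \<open>W\<close> is built by induction on the number \<open>k\<close> of coordinates that can be nonzero on
  \<open>W\<close>. If coordinate \<open>k\<close> is not identically zero on \<open>W\<close>, scale a vector of \<open>W\<close> to a \<open>w0\<close> whose coordinate \<open>k\<close>
  is \<open>1\<close>; then \<open>W\<close> is the direct sum of the line through \<open>w0\<close> and the subspace where that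
  coordinate vanishes.\<close>

lemma subspace_retraction:
  fixes W :: "'k::field vec set"
  assumes "vec_subspace n W"
  obtains r T T' where "T \<in> carrier_mat n r" "T' \<in> carrier_mat r n" "T' * T = 1\<^sub>m r"
    "\<And>z. z \<in> carrier_vec r \<Longrightarrow> T *\<^sub>v z \<in> W" "\<And>w. w \<in> W \<Longrightarrow> T *\<^sub>v (T' *\<^sub>v w) = w"
proof -
  have "\<exists>r T T'. T \<in> carrier_mat n r \<and> T' \<in> carrier_mat r n \<and> T' * T = 1\<^sub>m r \<and>
      (\<forall>z \<in> carrier_vec r. T *\<^sub>v z \<in> W) \<and> (\<forall>w \<in> W. T *\<^sub>v (T' *\<^sub>v w) = w)"
    if "k \<le> n" "vec_subspace n W" "\<And>w i. w \<in> W \<Longrightarrow> k \<le> i \<Longrightarrow> i < n \<Longrightarrow> w $ i = 0"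
    for k and W :: "'k vec set"
    using that
  proof (induction k arbitrary: W)
    case 0
    then have "w = 0\<^sub>v n" if "w \<in> W" for w
      using that by (intro eq_vecI) (auto simp: vec_subspace_def subset_iff)
    then have W: "W = {0\<^sub>v n}" using 0 by (auto simp: vec_subspace_def)
    show ?case
      by (rule exI[of _ 0], rule exI[of _ "0\<^sub>m n 0"], rule exI[of _ "0\<^sub>m 0 n"])
         (auto simp: W scalar_prod_def intro!: eq_vecI)
  next
    case (Suc k)
    note sub = Suc.prems(2)[unfolded vec_subspace_def]
    show ?case
    proof (cases "\<forall>w\<in>W. w $ k = 0")
      case True
      show ?thesis
        using Suc.prems True by (intro Suc.IH) (auto simp: le_Suc_eq Suc_le_eq dest: le_neq_implies_less)
    next
      case False
      then obtain w1 where w1: "w1 \<in> W" "w1 $ k \<noteq> 0" by auto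
      define w0 where "w0 = inverse (w1 $ k) \<cdot>\<^sub>v w1"
      have k: "k < n" using Suc.prems by simp
      have w0: "w0 \<in> W" "w0 \<in> carrier_vec n" "w0 $ k = 1" using w1 sub k by (auto simp: w0_def)
      define V where "V = {w\<in>W. w $ k = 0}"
      have V: "vec_subspace n V" using sub k by (auto simp: V_def vec_subspace_def)
      have "V \<subseteq> W" by (auto simp: V_def)
      have "w $ i = 0" if "w \<in> V" "k \<le> i" "i < n" for w i
        using Suc.prems(3)[of w i] that by (cases "i = k") (simp_all add: V_def)
      then obtain r T T' where T: "T \<in> carrier_mat n r" "T' \<in> carrier_mat r n" "T' * T = 1\<^sub>m r"
          and TV: "\<And>z. z \<in> carrier_vec r \<Longrightarrow> T *\<^sub>v z \<in> V" and TT: "\<And>w. w \<in> V \<Longrightarrow> T *\<^sub>v (T' *\<^sub>v w) = w"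
        using Suc.IH[OF _ V] Suc.prems(1) by auto
      \<comment> \<open>\<open>S\<close> appends the column \<open>w0\<close> to \<open>T\<close>, and \<open>S'\<close> below appends the \<open>k\<close>-th coordinate functional to \<open>T' \<circ> e\<close>.\<close>
      obtain S where S: "S \<in> carrier_mat n (Suc r)"
          "\<And>z. z \<in> carrier_vec (Suc r) \<Longrightarrow> S *\<^sub>v z = T *\<^sub>v vec_first z r + z $ r \<cdot>\<^sub>v w0"
      proof (rule linear_map_matrix[where f = "\<lambda>z. T *\<^sub>v vec_first z r + z $ r \<cdot>\<^sub>v w0" and n = "Suc r" and m = n])
        fix v w :: "'k vec" and c
        assume v: "v \<in> carrier_vec (Suc r)"
        show "T *\<^sub>v vec_first v r + v $ r \<cdot>\<^sub>v w0 \<in> carrier_vec n" using T w0 by auto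
        have "vec_first (c \<cdot>\<^sub>v v) r = c \<cdot>\<^sub>v vec_first v r" using v by (auto simp: vec_first_def)
        then show "T *\<^sub>v vec_first (c \<cdot>\<^sub>v v) r + (c \<cdot>\<^sub>v v) $ r \<cdot>\<^sub>v w0 = c \<cdot>\<^sub>v (T *\<^sub>v vec_first v r + v $ r \<cdot>\<^sub>v w0)"
          using T w0 v by (simp add: mult_mat_vec[of _ n r] smult_add_distrib_vec[of _ n] smult_smult_assoc)
        assume w: "w \<in> carrier_vec (Suc r)"
        have "vec_first (v + w) r = vec_first v r + vec_first w r" using v w by (auto simp: vec_first_def)
        then show "T *\<^sub>v vec_first (v + w) r + (v + w) $ r \<cdot>\<^sub>v w0
            = T *\<^sub>v vec_first v r + v $ r \<cdot>\<^sub>v w0 + (T *\<^sub>v vec_first w r + w $ r \<cdot>\<^sub>v w0)"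
          using T w0 v w
          by (simp add: mult_add_distrib_mat_vec[of _ n r] add_smult_distrib_vec[of _ n])
             (auto intro!: eq_vecI simp: algebra_simps)
      qed blast
      define e where "e x = x - x $ k \<cdot>\<^sub>v w0" for x :: "'k vec"
      have e: "e x \<in> carrier_vec n" if "x \<in> carrier_vec n" for x using that w0 by (auto simp: e_def)
      obtain S' where S': "S' \<in> carrier_mat (Suc r) n"
          "\<And>x. x \<in> carrier_vec n \<Longrightarrow> S' *\<^sub>v x = (T' *\<^sub>v e x) @\<^sub>v vec 1 (\<lambda>_. x $ k)"
      proof (rule linear_map_matrix[where f = "\<lambda>x. (T' *\<^sub>v e x) @\<^sub>v vec 1 (\<lambda>_. x $ k)" and n = n and m = "Suc r"])
        fix v w :: "'k vec" and c
        assume v: "v \<in> carrier_vec n"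
        show "(T' *\<^sub>v e v) @\<^sub>v vec 1 (\<lambda>_. v $ k) \<in> carrier_vec (Suc r)"
          using T(2) by (intro carrier_vecI) simp
        have "e (c \<cdot>\<^sub>v v) = c \<cdot>\<^sub>v e v"
          using v w0 k by (intro eq_vecI) (auto simp: e_def right_diff_distrib)
        then show "(T' *\<^sub>v e (c \<cdot>\<^sub>v v)) @\<^sub>v vec 1 (\<lambda>_. (c \<cdot>\<^sub>v v) $ k) = c \<cdot>\<^sub>v ((T' *\<^sub>v e v) @\<^sub>v vec 1 (\<lambda>_. v $ k))"
          using T w0 v e[OF v] k by (auto simp: mult_mat_vec[of _ r n])
        assume w: "w \<in> carrier_vec n"
        have "e (v + w) = e v + e w"
          using v w w0 k by (intro eq_vecI) (auto simp: e_def distrib_right)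
        then show "(T' *\<^sub>v e (v + w)) @\<^sub>v vec 1 (\<lambda>_. (v + w) $ k)
            = ((T' *\<^sub>v e v) @\<^sub>v vec 1 (\<lambda>_. v $ k)) + ((T' *\<^sub>v e w) @\<^sub>v vec 1 (\<lambda>_. w $ k))"
          using T w0 v w e[OF v] e[OF w] k by (auto simp: mult_add_distrib_mat_vec[of _ r n])
      qed blast
      have SW: "S *\<^sub>v z \<in> W" if z: "z \<in> carrier_vec (Suc r)" for z
        using TV[of "vec_first z r"] S(2)[OF z] \<open>V \<subseteq> W\<close> w0 sub by auto
      have "S *\<^sub>v (S' *\<^sub>v w) = w" if w: "w \<in> W" for w
      proof -
        have wc: "w \<in> carrier_vec n" using w sub by auto
        have "e w = w + (- w $ k) \<cdot>\<^sub>v w0" using wc w0 by (auto simp: e_def)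
        then have "e w \<in> W" using w w0 sub by auto
        moreover have "e w $ k = 0" using wc w0 k by (simp add: e_def)
        ultimately have "e w \<in> V" by (simp add: V_def)
        have c: "S' *\<^sub>v w \<in> carrier_vec (Suc r)" using S'(1) wc by simp
        have "vec_first (S' *\<^sub>v w) r = T' *\<^sub>v e w" "(S' *\<^sub>v w) $ r = w $ k"
          using T S'(2)[OF wc] by (auto simp: vec_first_def)
        then have "S *\<^sub>v (S' *\<^sub>v w) = e w + w $ k \<cdot>\<^sub>v w0" using S(2)[OF c] TT[OF \<open>e w \<in> V\<close>] by simp
        also have "\<dots> = w" using wc w0 by (auto simp: e_def)
        finally show ?thesis .
      qed
      moreover have "S' * S = 1\<^sub>m (Suc r)"
      proof (rule eq_mat_if_mult_vec[of _ "Suc r" "Suc r"])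
        fix z :: "'k vec"
        assume z: "z \<in> carrier_vec (Suc r)"
        define y where "y = T *\<^sub>v vec_first z r"
        have y: "y \<in> V" "y \<in> carrier_vec n" "y $ k = 0"
          using TV[of "vec_first z r"] T by (auto simp: y_def V_def)
        have Sz: "S *\<^sub>v z = y + z $ r \<cdot>\<^sub>v w0" "S *\<^sub>v z \<in> carrier_vec n"
          using S(2)[OF z, folded y_def] mult_mat_vec_carrier[OF S(1) z] by blast+
        then have "(S *\<^sub>v z) $ k = z $ r" using y w0 k by simp
        moreover from this have "e (S *\<^sub>v z) = y" unfolding e_def Sz(1) using y w0 by auto
        moreover have "T' *\<^sub>v y = vec_first z r" unfolding y_def using T
          by (metis assoc_mult_mat_vec one_mult_mat_vec vec_first_carrier)
        ultimately have "S' *\<^sub>v (S *\<^sub>v z) = vec_first z r @\<^sub>v vec 1 (\<lambda>_. z $ r)" using S'(2)[OF Sz(2)] by simp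
        also have "\<dots> = z" using z by (intro eq_vecI) (auto simp: vec_first_def less_Suc_eq)
        finally show "S' * S *\<^sub>v z = 1\<^sub>m (Suc r) *\<^sub>v z" using S S' z by simp
      qed (use S S' in auto)
      ultimately show ?thesis using S(1) S'(1) SW by blast
    qed
  qed
  from this[of n W] assms show ?thesis using that by auto
qed

text \<open>A subspace is a direct summand: \<open>T, T'\<close> are the inclusion of \<open>W\<close> and a projection, \<open>Q', Q\<close> those of a complement.
  The complement is the kernel of \<open>T'\<close>, and a retraction \<open>P\<close> of that kernel has to be composed with
  the projection \<open>1 - T T'\<close> in order to vanish on \<open>W\<close>.\<close>

lemma subspace_splitting:
  fixes W :: "'k::field vec set"
  assumes W: "vec_subspace n W"
  obtains r s T T' Q Q' where "T \<in> carrier_mat n r" "T' \<in> carrier_mat r n"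
    "Q \<in> carrier_mat s n" "Q' \<in> carrier_mat n s"
    "T' * T = 1\<^sub>m r" "Q * Q' = 1\<^sub>m s" "Q * T = 0\<^sub>m s r" "T * T' + Q' * Q = 1\<^sub>m n"
    "\<And>z. z \<in> carrier_vec r \<Longrightarrow> T *\<^sub>v z \<in> W" "\<And>w. w \<in> W \<Longrightarrow> T *\<^sub>v (T' *\<^sub>v w) = w"
    "\<And>x. x \<in> carrier_vec n \<Longrightarrow> x \<in> W \<longleftrightarrow> Q *\<^sub>v x = 0\<^sub>v s"
proof -
  obtain r T T' where T: "T \<in> carrier_mat n r" "T' \<in> carrier_mat r n" "T' * T = 1\<^sub>m r"
    and TW: "\<And>z. z \<in> carrier_vec r \<Longrightarrow> T *\<^sub>v z \<in> W" "\<And>w. w \<in> W \<Longrightarrow> T *\<^sub>v (T' *\<^sub>v w) = w"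
    using subspace_retraction[OF W] by metis
  have T'T: "T' *\<^sub>v (T *\<^sub>v z) = z" if "z \<in> carrier_vec r" for z
    using T that by (metis assoc_mult_mat_vec one_mult_mat_vec)
  define K where "K = {x\<in>carrier_vec n. T' *\<^sub>v x = 0\<^sub>v r}"
  have "vec_subspace n K"
    using T by (auto simp: K_def vec_subspace_def mult_add_distrib_mat_vec[of _ r n] mult_mat_vec[of _ r n])
  then obtain s Q' P where Q': "Q' \<in> carrier_mat n s" and P: "P \<in> carrier_mat s n" "P * Q' = 1\<^sub>m s"
    and QK: "\<And>z. z \<in> carrier_vec s \<Longrightarrow> Q' *\<^sub>v z \<in> K" "\<And>w. w \<in> K \<Longrightarrow> Q' *\<^sub>v (P *\<^sub>v w) = w"
    using subspace_retraction by metis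
  define Q where "Q = P * (1\<^sub>m n - T * T')"
  have TT': "T * T' \<in> carrier_mat n n" using T by auto
  have Q: "Q \<in> carrier_mat s n" unfolding Q_def by (rule mult_carrier_mat[OF P(1) minus_carrier_mat[OF TT']])
  have Qx: "Q *\<^sub>v x = P *\<^sub>v (x - T *\<^sub>v (T' *\<^sub>v x))" if "x \<in> carrier_vec n" for x
    using T minus_carrier_mat[OF TT', of "1\<^sub>m n"] P that
    by (simp add: Q_def assoc_mult_mat_vec[of _ s n _ n] minus_mult_distrib_mat_vec[of _ n n])
  have xK: "x - T *\<^sub>v (T' *\<^sub>v x) \<in> K" if "x \<in> carrier_vec n" for x
    using T that T'T[of "T' *\<^sub>v x"] by (simp add: K_def mult_minus_distrib_mat_vec[of _ r n])
  have Q'Q: "Q' *\<^sub>v (Q *\<^sub>v x) = x - T *\<^sub>v (T' *\<^sub>v x)" if "x \<in> carrier_vec n" for x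
    using QK(2)[OF xK[OF that]] Qx[OF that] by simp
  have 1: "Q * Q' = 1\<^sub>m s"
  proof (rule eq_mat_if_mult_vec[of _ s s])
    fix z :: "'k vec" assume z: "z \<in> carrier_vec s"
    have c: "Q' *\<^sub>v z \<in> carrier_vec n" "T' *\<^sub>v (Q' *\<^sub>v z) = 0\<^sub>v r" using QK(1)[OF z] by (auto simp: K_def)
    then have "Q *\<^sub>v (Q' *\<^sub>v z) = P *\<^sub>v (Q' *\<^sub>v z)" using Qx[OF c(1)] T by simp
    then show "Q * Q' *\<^sub>v z = 1\<^sub>m s *\<^sub>v z" using Q Q' P z by (metis assoc_mult_mat_vec)
  qed (use Q Q' in auto)
  have QT: "Q *\<^sub>v (T *\<^sub>v z) = 0\<^sub>v s" if "z \<in> carrier_vec r" for z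
  proof -
    have Tz: "T *\<^sub>v z \<in> carrier_vec n" by (rule mult_mat_vec_carrier[OF T(1) that])
    show ?thesis using Qx[OF Tz] T'T[OF that] minus_cancel_vec[OF Tz] P by simp
  qed
  have 2: "Q * T = 0\<^sub>m s r"
    by (rule eq_mat_if_mult_vec[of _ s r]) (use Q T QT in auto)
  have 3: "T * T' + Q' * Q = 1\<^sub>m n"
  proof (rule eq_mat_if_mult_vec[of _ n n])
    fix x :: "'k vec" assume x: "x \<in> carrier_vec n"
    have "(T * T' + Q' * Q) *\<^sub>v x = T *\<^sub>v (T' *\<^sub>v x) + Q' *\<^sub>v (Q *\<^sub>v x)"
      using T Q Q' x TT' by (simp add: add_mult_distrib_mat_vec[of _ n n])
    then show "(T * T' + Q' * Q) *\<^sub>v x = 1\<^sub>m n *\<^sub>v x" using Q'Q[OF x] T x by auto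
  qed (use T Q Q' in auto)
  have 4: "x \<in> W \<longleftrightarrow> Q *\<^sub>v x = 0\<^sub>v s" if x: "x \<in> carrier_vec n" for x
  proof
    assume "x \<in> W"
    then show "Q *\<^sub>v x = 0\<^sub>v s" using QT[of "T' *\<^sub>v x"] TW(2) T x by auto
  next
    assume "Q *\<^sub>v x = 0\<^sub>v s"
    then have "x - T *\<^sub>v (T' *\<^sub>v x) = 0\<^sub>v n" using Q'Q[OF x] mult_mat_zero_vec[OF Q'] by simp
    then have "x = T *\<^sub>v (T' *\<^sub>v x)"
      by (rule vec_eq_if_diff_zero[OF x mult_mat_vec_carrier[OF T(1) mult_mat_vec_carrier[OF T(2) x]]])
    then show "x \<in> W" using TW(1)[of "T' *\<^sub>v x"] T x by auto
  qed
  show ?thesis using that[OF T(1,2) Q Q' T(3) 1 2 3 TW 4] .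
qed

lemma eigenvector_exists:
  fixes A :: "'k::alg_closed_field mat"
  assumes A: "A \<in> carrier_mat n n" and "n > 0"
  obtains c v where "v \<in> carrier_vec n" "v \<noteq> 0\<^sub>v n" "A *\<^sub>v v = c \<cdot>\<^sub>v v"
proof -
  have "degree (char_poly A) > 0" using degree_monic_char_poly[OF A] \<open>n > 0\<close> by simp
  then obtain c where "poly (char_poly A) c = 0" using alg_closed_imp_poly_has_root by blast
  then have "eigenvalue A c" using eigenvalue_root_char_poly[OF A] by simp
  then show ?thesis using that A unfolding eigenvalue_def eigenvector_def by auto
qed

section \<open>Calculus of arrows in a linear category\<close>

lemma lin_mapsI:
  assumes "\<And>x. x \<in> carrier V \<Longrightarrow> h x \<in> carrier W"
    and "\<And>x y. x \<in> carrier V \<Longrightarrow> y \<in> carrier V \<Longrightarrow> h (x \<oplus>\<^bsub>V\<^esub> y) = h x \<oplus>\<^bsub>W\<^esub> h y"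
    and "\<And>c x. x \<in> carrier V \<Longrightarrow> h (c \<odot>\<^bsub>V\<^esub> x) = c \<odot>\<^bsub>W\<^esub> h x"
  shows "h \<in> lin_maps V W"
  using assms by (auto simp: LinearCombinations.module_hom_def)

lemma lin_mapsD:
  assumes "h \<in> lin_maps V W"
  shows "x \<in> carrier V \<Longrightarrow> h x \<in> carrier W"
    and "x \<in> carrier V \<Longrightarrow> y \<in> carrier V \<Longrightarrow> h (x \<oplus>\<^bsub>V\<^esub> y) = h x \<oplus>\<^bsub>W\<^esub> h y"
    and "x \<in> carrier V \<Longrightarrow> h (c \<odot>\<^bsub>V\<^esub> x) = c \<odot>\<^bsub>W\<^esub> h x"
  using assms by (auto simp: LinearCombinations.module_hom_def)

lemma lin_maps_comp:
  assumes "h \<in> lin_maps U V" "k \<in> lin_maps V W"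
  shows "(\<lambda>x. k (h x)) \<in> lin_maps U W"
  by (rule lin_mapsI) (simp_all add: lin_mapsD[OF assms(1)] lin_mapsD[OF assms(2)])

lemma lin_maps_mat:
  fixes A :: "'k::field mat"
  assumes "A \<in> carrier_mat m n"
  shows "(\<lambda>x. A *\<^sub>v x) \<in> lin_maps (module_vec TYPE('k) n) (module_vec TYPE('k) m)"
  using assms by (intro lin_mapsI)
    (auto simp: module_vec_simps mult_add_distrib_mat_vec[of _ m n] mult_mat_vec[of _ m n])

lemma lin_map_zero:
  assumes "vectorspace class_ring V" "vectorspace class_ring W" "h \<in> lin_maps V W"
  shows "h \<zero>\<^bsub>V\<^esub> = \<zero>\<^bsub>W\<^esub>"
proof -
  interpret V: vectorspace class_ring V by fact
  interpret W: vectorspace class_ring W by fact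
  interpret mod_hom class_ring V W h by unfold_locales fact
  show ?thesis by simp
qed

lemma lin_map_finsum:
  assumes "vectorspace class_ring V" "vectorspace class_ring W" "h \<in> lin_maps V W"
    and "finite I" "\<And>i. i \<in> I \<Longrightarrow> f i \<in> carrier V"
  shows "h (\<Oplus>\<^bsub>V\<^esub>i\<in>I. f i) = (\<Oplus>\<^bsub>W\<^esub>i\<in>I. h (f i))"
  using assms(4,5)
proof (induction I)
  interpret V: vectorspace class_ring V by fact
  interpret W: vectorspace class_ring W by fact
  interpret mod_hom class_ring V W h by unfold_locales fact
  {
    case empty
    show ?case by simp
  next
    case (insert i I)
    then show ?case by (simp add: Pi_def)
  }
qed

lemma finsum_swap:
  assumes "vectorspace class_ring V" "finite I" "finite J"
    and "\<And>i j. i \<in> I \<Longrightarrow> j \<in> J \<Longrightarrow> f i j \<in> carrier V"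
  shows "(\<Oplus>\<^bsub>V\<^esub>i\<in>I. \<Oplus>\<^bsub>V\<^esub>j\<in>J. f i j) = (\<Oplus>\<^bsub>V\<^esub>j\<in>J. \<Oplus>\<^bsub>V\<^esub>i\<in>I. f i j)"
  using assms(2,4)
proof (induction I)
  interpret V: vectorspace class_ring V by fact
  {
    case empty
    show ?case by simp
  next
    case (insert i I)
    then have "(\<Oplus>\<^bsub>V\<^esub>j\<in>J. \<Oplus>\<^bsub>V\<^esub>i\<in>insert i I. f i j) = (\<Oplus>\<^bsub>V\<^esub>j\<in>J. f i j \<oplus>\<^bsub>V\<^esub> (\<Oplus>\<^bsub>V\<^esub>i\<in>I. f i j))"
      by (intro V.finsum_cong') (auto simp: Pi_def)
    also have "\<dots> = (\<Oplus>\<^bsub>V\<^esub>j\<in>J. f i j) \<oplus>\<^bsub>V\<^esub> (\<Oplus>\<^bsub>V\<^esub>j\<in>J. \<Oplus>\<^bsub>V\<^esub>i\<in>I. f i j)"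
      using insert by (intro V.finsum_addf) (auto simp: Pi_def)
    finally show ?case using insert by (simp add: Pi_def)
  }
qed

context linear_category
begin

text \<open>Arrows determine their ends, so that typing conditions can be stated with the functions \<open>src\<close> and
  \<open>tgt\<close>. In this form the simplifier can check them: membership in a Hom space would leave the
  intermediate object of a composite to be guessed.\<close>

definition is_arr :: "'m \<Rightarrow> bool" where
  "is_arr f \<longleftrightarrow> (\<exists>X\<in>Ob C. \<exists>Y\<in>Ob C. f \<in> Arr C X Y)"

definition src :: "'m \<Rightarrow> 'o" where
  "src f = (THE X. X \<in> Ob C \<and> (\<exists>Y\<in>Ob C. f \<in> Arr C X Y))"

definition tgt :: "'m \<Rightarrow> 'o" where
  "tgt f = (THE Y. Y \<in> Ob C \<and> (\<exists>X\<in>Ob C. f \<in> Arr C X Y))"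

lemma arrD:
  assumes "f \<in> Arr C X Y" "X \<in> Ob C" "Y \<in> Ob C"
  shows "is_arr f" "src f = X" "tgt f = Y"
  using assms arr_unique unfolding is_arr_def src_def tgt_def by (blast | intro the_equality)+

lemma arr_cases:
  assumes "is_arr f"
  obtains X Y where "X \<in> Ob C" "Y \<in> Ob C" "f \<in> Arr C X Y" "src f = X" "tgt f = Y"
  using assms arrD unfolding is_arr_def by blast

lemma src_ob [simp]: "is_arr f \<Longrightarrow> src f \<in> Ob C"
  and tgt_ob [simp]: "is_arr f \<Longrightarrow> tgt f \<in> Ob C"
  and arr_hom: "is_arr f \<Longrightarrow> f \<in> Arr C (src f) (tgt f)"
  by (auto elim: arr_cases)

lemma arrI: "is_arr f \<Longrightarrow> src f = X \<Longrightarrow> tgt f = Y \<Longrightarrow> f \<in> Arr C X Y"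
  using arr_hom by auto

lemma hom_iff: "X \<in> Ob C \<Longrightarrow> Y \<in> Ob C \<Longrightarrow> f \<in> Arr C X Y \<longleftrightarrow> is_arr f \<and> src f = X \<and> tgt f = Y"
  using arrD arrI by blast

lemma comp_closed:
  "X \<in> Ob C \<Longrightarrow> Y \<in> Ob C \<Longrightarrow> Z \<in> Ob C \<Longrightarrow> f \<in> Arr C X Y \<Longrightarrow> g \<in> Arr C Y Z \<Longrightarrow> g \<cdot> f \<in> Arr C X Z"
  using comp_linear_right module_hom_closed by blast

lemma comp_arr [simp]:
  assumes "is_arr f" "is_arr g" "src g = tgt f"
  shows "is_arr (g \<cdot> f)" "src (g \<cdot> f) = src f" "tgt (g \<cdot> f) = tgt g"
  using arrD[OF comp_closed[of "src f" "tgt f" "tgt g" f g]] assms arr_hom[of f] arr_hom[of g] by auto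

lemma idn [simp]:
  assumes "X \<in> Ob C"
  shows "is_arr (\<iota> X)" "src (\<iota> X) = X" "tgt (\<iota> X) = X"
  using arrD[OF idn_arr] assms by auto

lemma assoc_comp [simp]:
  assumes "is_arr f" "is_arr g" "is_arr h" "src g = tgt f" "src h = tgt g"
  shows "(h \<cdot> g) \<cdot> f = h \<cdot> (g \<cdot> f)"
  using comp_assoc[of "src f" "tgt f" "tgt g" "tgt h" f g h] assms arr_hom[of f] arr_hom[of g] arr_hom[of h]
  by auto

lemma idn_comp [simp]: "is_arr f \<Longrightarrow> tgt f = Y \<Longrightarrow> \<iota> Y \<cdot> f = f"
  and comp_idn [simp]: "is_arr f \<Longrightarrow> src f = X \<Longrightarrow> f \<cdot> \<iota> X = f"
  using comp_idn_left comp_idn_right arr_hom src_ob tgt_ob by blast+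

text \<open>Composites are kept nested to the right; this is how an equation between composites is applied inside one.\<close>

lemma assoc_comp_eq:
  assumes "h \<cdot> g = k" "is_arr f" "is_arr g" "is_arr h" "src g = tgt f" "src h = tgt g"
  shows "h \<cdot> (g \<cdot> f) = k \<cdot> f"
  using assms assoc_comp by metis

abbreviation "zero_arr X Y \<equiv> \<zero>\<^bsub>Hom C X Y\<^esub>"

lemma zero_in_hom: "X \<in> Ob C \<Longrightarrow> Y \<in> Ob C \<Longrightarrow> zero_arr X Y \<in> Arr C X Y"
proof -
  assume "X \<in> Ob C" "Y \<in> Ob C"
  then interpret vectorspace class_ring "Hom C X Y" by (rule hom_space)
  show ?thesis by simp
qed

lemma zero_arr [simp]:
  assumes "X \<in> Ob C" "Y \<in> Ob C"
  shows "is_arr (zero_arr X Y)" "src (zero_arr X Y) = X" "tgt (zero_arr X Y) = Y"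
  using arrD[OF zero_in_hom] assms by auto

lemma comp_zero [simp]:
  assumes "is_arr g" "src g = Y" "X \<in> Ob C"
  shows "g \<cdot> zero_arr X Y = zero_arr X (tgt g)"
  using lin_map_zero[OF hom_space hom_space comp_linear_right[of X Y "tgt g" g]] assms arr_hom by auto

lemma zero_comp [simp]:
  assumes "is_arr f" "tgt f = Y" "Z \<in> Ob C"
  shows "zero_arr Y Z \<cdot> f = zero_arr (src f) Z"
  using lin_map_zero[OF hom_space hom_space comp_linear_left[of "src f" Y Z f]] assms arr_hom by auto

definition isom :: "'m \<Rightarrow> bool" where
  "isom f \<longleftrightarrow> is_arr f \<and> (\<exists>g. is_inverse C (src f) (tgt f) f g)"

definition inv_of :: "'m \<Rightarrow> 'm" where
  "inv_of f = inv_arr C (src f) (tgt f) f"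

lemma inverse_unique:
  assumes "X \<in> Ob C" "Y \<in> Ob C" "is_inverse C X Y f g" "is_inverse C X Y f h"
  shows "g = h"
proof -
  have T: "is_arr f" "src f = X" "tgt f = Y" "is_arr g" "src g = Y" "tgt g = X" "is_arr h" "src h = Y" "tgt h = X"
    and e: "g \<cdot> f = \<iota> X" "f \<cdot> h = \<iota> Y"
    using assms by (auto simp: is_inverse_def hom_iff)
  have "g = g \<cdot> (f \<cdot> h)" using T by (simp add: e)
  also have "\<dots> = (g \<cdot> f) \<cdot> h" using T by (simp del: e)
  also have "\<dots> = h" using T by (simp add: e del: assoc_comp)
  finally show ?thesis .
qed

lemma inv_arr_inverse:
  assumes "X \<in> Ob C" "Y \<in> Ob C" "iso_arr C X Y f"
  shows "is_inverse C X Y f (inv_arr C X Y f)"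
proof -
  obtain g where "is_inverse C X Y f g" using assms by (auto simp: iso_arr_def)
  then show ?thesis
    unfolding inv_arr_def
    using theI[of "is_inverse C X Y f" g] inverse_unique[OF assms(1,2)] by blast
qed

lemma isomD:
  assumes "iso_arr C X Y f" "X \<in> Ob C" "Y \<in> Ob C"
  shows "isom f" "is_arr f" "src f = X" "tgt f = Y" "inv_arr C X Y f = inv_of f"
  using assms by (auto simp: isom_def iso_arr_def is_inverse_def inv_of_def hom_iff)

lemma isom_iso_arr: "isom f \<Longrightarrow> iso_arr C (src f) (tgt f) f"
  by (auto simp: isom_def iso_arr_def)

lemma isom_is_arr [simp]: "isom f \<Longrightarrow> is_arr f"
  by (simp add: isom_def)

lemma inv_of [simp]:
  assumes "isom f"
  shows "is_arr (inv_of f)" "src (inv_of f) = tgt f" "tgt (inv_of f) = src f"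
    "inv_of f \<cdot> f = \<iota> (src f)" "f \<cdot> inv_of f = \<iota> (tgt f)"
  using inv_arr_inverse[OF _ _ isom_iso_arr[OF assms]] assms
  by (auto simp: inv_of_def is_inverse_def hom_iff)

lemma inv_of_comp [simp]:
  assumes "isom f" "is_arr g"
  shows "tgt g = src f \<Longrightarrow> inv_of f \<cdot> (f \<cdot> g) = g" "tgt g = tgt f \<Longrightarrow> f \<cdot> (inv_of f \<cdot> g) = g"
proof -
  assume "tgt g = src f"
  then have "inv_of f \<cdot> (f \<cdot> g) = (inv_of f \<cdot> f) \<cdot> g" using assms by (simp del: inv_of(4))
  then show "inv_of f \<cdot> (f \<cdot> g) = g" using assms \<open>tgt g = src f\<close> by (simp del: assoc_comp)
next
  assume "tgt g = tgt f"
  then have "f \<cdot> (inv_of f \<cdot> g) = (f \<cdot> inv_of f) \<cdot> g" using assms by (simp del: inv_of(5))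
  then show "f \<cdot> (inv_of f \<cdot> g) = g" using assms \<open>tgt g = tgt f\<close> by (simp del: assoc_comp)
qed

lemma isomI:
  assumes "is_arr f" "is_arr g" "src g = tgt f" "tgt g = src f" "g \<cdot> f = \<iota> (src f)" "f \<cdot> g = \<iota> (tgt f)"
  shows "isom f"
proof -
  have "is_inverse C (src f) (tgt f) f g" using assms by (simp add: is_inverse_def hom_iff)
  then show ?thesis using assms by (auto simp: isom_def)
qed

lemma isom_inv [simp]: "isom f \<Longrightarrow> isom (inv_of f)"
  by (rule isomI[of _ f]) auto

lemma isom_comp [simp]: "isom f \<Longrightarrow> isom g \<Longrightarrow> src g = tgt f \<Longrightarrow> isom (g \<cdot> f)"
  by (rule isomI[of _ "inv_of f \<cdot> inv_of g"]) auto

lemma isom_cancel_left: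
  assumes "f \<cdot> g = f \<cdot> h" "isom f" "is_arr g" "is_arr h" "tgt g = src f" "tgt h = src f"
  shows "g = h"
  using inv_of_comp(1)[of f g] inv_of_comp(1)[of f h] assms by metis

lemma isom_cancel_right:
  assumes "g \<cdot> f = h \<cdot> f" "isom f" "is_arr g" "is_arr h" "src g = tgt f" "src h = tgt f"
  shows "g = h"
proof -
  have "(g \<cdot> f) \<cdot> inv_of f = (h \<cdot> f) \<cdot> inv_of f" using assms(1) by simp
  then show ?thesis using assms(2-) by simp
qed

lemma isom_of_comp_left:
  assumes "isom (g \<cdot> f)" "isom f" "is_arr g" "src g = tgt f"
  shows "isom g"
proof -
  have "isom ((g \<cdot> f) \<cdot> inv_of f)" by (rule isom_comp) (use assms in simp_all)
  moreover have "(g \<cdot> f) \<cdot> inv_of f = g" using assms by simp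
  ultimately show ?thesis by (simp only:)
qed

lemma isom_idn [simp]: "X \<in> Ob C \<Longrightarrow> isom (\<iota> X)"
  by (rule isomI[of _ "\<iota> X"]) auto

lemma zero_object_hom:
  assumes "zero_object C (src f)" "is_arr f"
  shows "f = zero_arr (src f) (tgt f)"
  using assms arr_hom[of f] zero_in_hom[of "src f" "tgt f"] unfolding zero_object_def by (metis src_ob tgt_ob)

lemma idn_zero_imp_zero_object:
  assumes "X \<in> Ob C" "\<iota> X = zero_arr X X"
  shows "zero_object C X"
proof -
  have "f = zero_arr Y X" if "f \<in> Arr C Y X" "Y \<in> Ob C" for f Y
    using that idn_comp[of f X] zero_comp[of f X X] assms by (auto simp: hom_iff)
  moreover have "f = zero_arr X Y" if "f \<in> Arr C X Y" "Y \<in> Ob C" for f Y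
    using that comp_idn[of f X] comp_zero[of f X X] assms by (auto simp: hom_iff)
  ultimately show ?thesis
    using assms(1) zero_in_hom unfolding zero_object_def by metis
qed

lemma right_inverse_of_isom:
  assumes "q \<cdot> e = \<iota> X" "isom q" "is_arr e" "tgt e = src q" "tgt q = X"
  shows "isom e"
proof -
  have "e = inv_of q \<cdot> (q \<cdot> e)" using assms(2-4) by simp
  also have "\<dots> = inv_of q" using assms by simp
  finally show ?thesis using assms(2) by simp
qed

lemma inv_natural:
  assumes e: "b \<cdot> f = g \<cdot> a" and i: "isom a" "isom b" and f: "is_arr f" "is_arr g"
    and s: "src f = src a" "tgt f = src b" "src g = tgt a" "tgt g = tgt b"
  shows "inv_of b \<cdot> g = f \<cdot> inv_of a"
proof -
  have "inv_of b \<cdot> ((g \<cdot> a) \<cdot> inv_of a) = inv_of b \<cdot> ((b \<cdot> f) \<cdot> inv_of a)" using e by simp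
  then show ?thesis using i f s by simp
qed

lemma cokernel_imp_epi:
  assumes "is_cokernel C X Y Z f q" "X \<in> Ob C" "Y \<in> Ob C" "Z \<in> Ob C"
  shows "epi_arr C Y Z q"
proof -
  have f: "is_arr f" "src f = X" "tgt f = Y" and q: "is_arr q" "src q = Y" "tgt q = Z"
    and qf: "q \<cdot> f = zero_arr X Z"
    using assms by (auto simp: is_cokernel_def hom_iff)
  have "g = h" if W: "W \<in> Ob C" and "g \<in> Arr C Z W" "h \<in> Arr C Z W" and e: "g \<cdot> q = h \<cdot> q" for W g h
  proof -
    have gh: "is_arr g" "src g = Z" "tgt g = W" using that assms by (auto simp: hom_iff)
    have "(g \<cdot> q) \<cdot> f = zero_arr X W" using gh f q qf assms by simp
    moreover have "g \<cdot> q \<in> Arr C Y W" by (rule arrI) (use gh q in auto)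
    ultimately have "\<exists>!u. u \<in> Arr C Z W \<and> u \<cdot> q = g \<cdot> q" using assms(1) W unfolding is_cokernel_def by blast
    then show ?thesis using that by auto
  qed
  then show ?thesis using assms by (auto simp: epi_arr_def is_cokernel_def)
qed

text \<open>Only the existence of factorizations through \<open>v\<close> is demanded. Their uniqueness is the statement
  that \<open>v\<close> is a monomorphism.\<close>

definition weak_kernel :: "'m \<Rightarrow> 'm \<Rightarrow> bool" where
  "weak_kernel q v \<longleftrightarrow> is_arr q \<and> is_arr v \<and> src q = tgt v \<and>
     (\<forall>h. is_arr h \<longrightarrow> tgt h = tgt v \<longrightarrow> q \<cdot> h = zero_arr (src h) (tgt q) \<longrightarrow>
       (\<exists>h'. is_arr h' \<and> src h' = src h \<and> tgt h' = src v \<and> v \<cdot> h' = h))"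

lemma weak_kernelD:
  assumes "weak_kernel q v" "is_arr h" "tgt h = tgt v" "q \<cdot> h = zero_arr (src h) (tgt q)"
  shows "\<exists>h'. is_arr h' \<and> src h' = src h \<and> tgt h' = src v \<and> v \<cdot> h' = h"
  using assms by (simp add: weak_kernel_def)

lemma linear_functorD:
  assumes F: "linear_functor C C Fo Fm"
  shows "X \<in> Ob C \<Longrightarrow> Fo X \<in> Ob C"
    "is_arr f \<Longrightarrow> is_arr (Fm f)" "is_arr f \<Longrightarrow> src (Fm f) = Fo (src f)" "is_arr f \<Longrightarrow> tgt (Fm f) = Fo (tgt f)"
    "is_arr f \<Longrightarrow> is_arr g \<Longrightarrow> src g = tgt f \<Longrightarrow> Fm (g \<cdot> f) = Fm g \<cdot> Fm f"
    "X \<in> Ob C \<Longrightarrow> Y \<in> Ob C \<Longrightarrow> Fm \<in> lin_maps (Hom C X Y) (Hom C (Fo X) (Fo Y))"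
proof -
  have o: "Fo X \<in> Ob C" if "X \<in> Ob C" for X using F that by (auto simp: linear_functor_def is_functor_def)
  then show "X \<in> Ob C \<Longrightarrow> Fo X \<in> Ob C" .
  have "is_arr (Fm f) \<and> src (Fm f) = Fo (src f) \<and> tgt (Fm f) = Fo (tgt f)" if f: "is_arr f" for f
  proof -
    have "Fm f \<in> Arr C (Fo (src f)) (Fo (tgt f))"
      using F arr_hom[OF f] src_ob[OF f] tgt_ob[OF f] by (auto simp: linear_functor_def is_functor_def)
    then show ?thesis using arrD o f by simp
  qed
  then show "is_arr f \<Longrightarrow> is_arr (Fm f)" "is_arr f \<Longrightarrow> src (Fm f) = Fo (src f)" "is_arr f \<Longrightarrow> tgt (Fm f) = Fo (tgt f)"
    by auto
  show "Fm (g \<cdot> f) = Fm g \<cdot> Fm f" if f: "is_arr f" "is_arr g" "src g = tgt f"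
  proof -
    have "\<forall>X\<in>Ob C. \<forall>Y\<in>Ob C. \<forall>Z\<in>Ob C. \<forall>f\<in>Arr C X Y. \<forall>g\<in>Arr C Y Z. Fm (g \<cdot> f) = Fm g \<cdot> Fm f"
      using F by (simp add: linear_functor_def is_functor_def)
    from this[THEN bspec, OF src_ob[OF f(1)], THEN bspec, OF tgt_ob[OF f(1)], THEN bspec, OF tgt_ob[OF f(2)],
        THEN bspec, OF arr_hom[OF f(1)], THEN bspec, of g]
    show ?thesis using arr_hom[OF f(2)] f(3) by simp
  qed
  show "X \<in> Ob C \<Longrightarrow> Y \<in> Ob C \<Longrightarrow> Fm \<in> lin_maps (Hom C X Y) (Hom C (Fo X) (Fo Y))"
    using F by (auto simp: linear_functor_def)
qed

end

section \<open>Finite abelian categories in coordinates\<close>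

definition fd_rep :: "nat \<Rightarrow> ('k::field vec \<Rightarrow> 'k vec \<Rightarrow> 'k vec) \<Rightarrow> 'k vec \<Rightarrow> nat \<Rightarrow> ('k vec \<Rightarrow> 'k mat) \<Rightarrow> bool" where
  "fd_rep n mul u d \<rho> \<longleftrightarrow>
     (\<forall>a\<in>carrier_vec n. \<rho> a \<in> carrier_mat d d) \<and>
     (\<forall>a\<in>carrier_vec n. \<forall>b\<in>carrier_vec n. \<rho> (a + b) = \<rho> a + \<rho> b) \<and>
     (\<forall>c. \<forall>a\<in>carrier_vec n. \<rho> (c \<cdot>\<^sub>v a) = c \<cdot>\<^sub>m \<rho> a) \<and>
     \<rho> u = 1\<^sub>m d \<and>
     (\<forall>a\<in>carrier_vec n. \<forall>b\<in>carrier_vec n. \<rho> (mul a b) = \<rho> a * \<rho> b)"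

lemma fd_rep_iff: "(d, \<rho>) \<in> Ob (fd_modules n mul u) \<longleftrightarrow> fd_rep n mul u d \<rho>"
  by (auto simp: fd_modules_def fd_rep_def LinearCombinations.module_hom_def module_vec_simps module_mat_simps)

text \<open>A category that is equivalent to the modules over an algebra on \<open>k\<^sup>n\<close>, seen through a fully
  faithful and essentially surjective functor: the object \<open>X\<close> becomes \<open>k\<^sup>d\<close> for \<open>d = dm X\<close> with the
  algebra acting by the matrices \<open>act X a\<close>, the arrow \<open>f\<close> becomes the matrix \<open>mt f\<close>. Properties that are
  invariant under equivalence can thus be proved by linear algebra.\<close>

locale matrix_category = linear_category C
  for C :: "('o, 'm, 'k::field, 'z) lin_cat_scheme" (structure) +
  fixes n :: nat and mul :: "'k vec \<Rightarrow> 'k vec \<Rightarrow> 'k vec" and u :: "'k vec"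
    and dm :: "'o \<Rightarrow> nat" and act :: "'o \<Rightarrow> 'k vec \<Rightarrow> 'k mat" and mt :: "'m \<Rightarrow> 'k mat"
  assumes alg: "fd_algebra n mul u"
    and act_rep: "X \<in> Ob C \<Longrightarrow> fd_rep n mul u (dm X) (act X)"
    and mt_carrier: "X \<in> Ob C \<Longrightarrow> Y \<in> Ob C \<Longrightarrow> f \<in> Arr C X Y \<Longrightarrow> mt f \<in> carrier_mat (dm Y) (dm X)"
    and mt_act: "X \<in> Ob C \<Longrightarrow> Y \<in> Ob C \<Longrightarrow> f \<in> Arr C X Y \<Longrightarrow> a \<in> carrier_vec n \<Longrightarrow>
      mt f * act X a = act Y a * mt f"
    and mt_comp_hom: "X \<in> Ob C \<Longrightarrow> Y \<in> Ob C \<Longrightarrow> Z \<in> Ob C \<Longrightarrow> f \<in> Arr C X Y \<Longrightarrow> g \<in> Arr C Y Z \<Longrightarrow>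
      mt (g \<cdot> f) = mt g * mt f"
    and mt_idn: "X \<in> Ob C \<Longrightarrow> mt (\<iota> X) = 1\<^sub>m (dm X)"
    and mt_add: "X \<in> Ob C \<Longrightarrow> Y \<in> Ob C \<Longrightarrow> f \<in> Arr C X Y \<Longrightarrow> g \<in> Arr C X Y \<Longrightarrow>
      mt (f \<oplus>\<^bsub>Hom C X Y\<^esub> g) = mt f + mt g"
    and mt_smult: "X \<in> Ob C \<Longrightarrow> Y \<in> Ob C \<Longrightarrow> f \<in> Arr C X Y \<Longrightarrow>
      mt (c \<odot>\<^bsub>Hom C X Y\<^esub> f) = c \<cdot>\<^sub>m mt f"
    and mt_full: "X \<in> Ob C \<Longrightarrow> Y \<in> Ob C \<Longrightarrow> T \<in> carrier_mat (dm Y) (dm X) \<Longrightarrow>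
      (\<And>a. a \<in> carrier_vec n \<Longrightarrow> T * act X a = act Y a * T) \<Longrightarrow> \<exists>f\<in>Arr C X Y. mt f = T"
    and mt_faithful: "X \<in> Ob C \<Longrightarrow> Y \<in> Ob C \<Longrightarrow> f \<in> Arr C X Y \<Longrightarrow> g \<in> Arr C X Y \<Longrightarrow>
      mt f = mt g \<Longrightarrow> f = g"
    and realize: "fd_rep n mul u d \<rho> \<Longrightarrow> \<exists>X\<in>Ob C. \<exists>S S'. S \<in> carrier_mat d (dm X) \<and>
      S' \<in> carrier_mat (dm X) d \<and> S * S' = 1\<^sub>m d \<and> S' * S = 1\<^sub>m (dm X) \<and>
      (\<forall>a\<in>carrier_vec n. S * act X a = \<rho> a * S)"

text \<open>Let \<open>F\<close> and \<open>G\<close> be the two functors of the equivalence. The matrices are those of \<open>F\<close>. Naturality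
  of the counit makes \<open>G\<close> faithful. Then \<open>F\<close> is full: by naturality of the unit, the arrow
  \<open>\<eta>\<^sup>-\<^sup>1 \<circ> G(t) \<circ> \<eta>\<close> has the same image under \<open>G F\<close> as \<open>t\<close> has under \<open>G\<close>.\<close>

lemma (in finite_abelian_category) ex_matrix_category:
  "\<exists>n mul u dm act mt. matrix_category C n mul (u :: 'k vec) dm act mt"
proof -
  obtain n mul and u :: "'k vec" where alg: "fd_algebra n mul u" and "linear_equivalent C (fd_modules n mul u)"
    using equivalent_fd_modules by auto
  then obtain Fo Fm Go Gm \<eta> \<epsilon> where
    lF: "linear_functor C (fd_modules n mul u) Fo Fm" and lG: "linear_functor (fd_modules n mul u) C Go Gm" and
    \<eta>: "natural_iso C C (\<lambda>X. X) (\<lambda>f. f) (\<lambda>X. Go (Fo X)) (\<lambda>f. Gm (Fm f)) \<eta>" and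
    \<epsilon>: "natural_iso (fd_modules n mul u) (fd_modules n mul u) (\<lambda>X. Fo (Go X)) (\<lambda>f. Fm (Gm f)) (\<lambda>X. X) (\<lambda>f. f) \<epsilon>"
    unfolding linear_equivalent_def by blast
  define D where "D = fd_modules n mul u"
  note lF = lF[folded D_def] and lG = lG[folded D_def] and \<epsilon> = \<epsilon>[folded D_def]
  define dm where "dm X = fst (Fo X)" for X
  define act where "act X = snd (Fo X)" for X
  define mt where "mt f = fst (snd (Fm f))" for f
  have D_hom: "t \<in> Arr D P Q \<longleftrightarrow> (\<exists>T\<in>carrier_mat (fst Q) (fst P). t = (P, T, Q) \<and>
      (\<forall>a\<in>carrier_vec n. T * snd P a = snd Q a * T))" for t P Q
    by (auto simp: D_def fd_modules_def)
  have D_comp: "(Q', T, Z) \<cdot>\<^bsub>D\<^esub> (P, S, Q) = (P, T * S, Z)" for Q' T Z P S Q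
    by (simp add: D_def fd_modules_def)
  have D_idn: "\<iota>\<^bsub>D\<^esub> P = (P, 1\<^sub>m (fst P), P)" for P
    by (simp add: D_def fd_modules_def)
  have Fob: "Fo X \<in> Ob D" if "X \<in> Ob C" for X using lF that by (auto simp: linear_functor_def is_functor_def)
  have Gob: "Go P \<in> Ob C" if "P \<in> Ob D" for P using lG that by (auto simp: linear_functor_def is_functor_def)
  have Fhom: "Fm f \<in> Arr D (Fo X) (Fo Y)" if "X \<in> Ob C" "Y \<in> Ob C" "f \<in> Arr C X Y" for X Y f
    using lF that by (auto simp: linear_functor_def is_functor_def)
  have Ghom: "Gm f \<in> Arr C (Go X) (Go Y)" if "X \<in> Ob D" "Y \<in> Ob D" "f \<in> Arr D X Y" for X Y f
    using lG that by (auto simp: linear_functor_def is_functor_def)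
  have Fm: "Fm f = (Fo X, mt f, Fo Y)" "mt f \<in> carrier_mat (dm Y) (dm X)"
      "a \<in> carrier_vec n \<Longrightarrow> mt f * act X a = act Y a * mt f"
    if "X \<in> Ob C" "Y \<in> Ob C" "f \<in> Arr C X Y" for X Y f a
    using Fhom[OF that] by (auto simp: D_hom mt_def dm_def act_def)
  have Fcomp: "Fm (g \<cdot> f) = Fm g \<cdot>\<^bsub>D\<^esub> Fm f"
    if "X \<in> Ob C" "Y \<in> Ob C" "Z \<in> Ob C" "f \<in> Arr C X Y" "g \<in> Arr C Y Z" for X Y Z f g
    using lF that unfolding linear_functor_def is_functor_def by blast
  have Fidn: "Fm (\<iota> X) = \<iota>\<^bsub>D\<^esub> (Fo X)" if "X \<in> Ob C" for X
    using lF that by (auto simp: linear_functor_def is_functor_def)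
  have Flin: "Fm \<in> lin_maps (Hom C X Y) (Hom D (Fo X) (Fo Y))" if "X \<in> Ob C" "Y \<in> Ob C" for X Y
    using lF that by (auto simp: linear_functor_def)
  have \<eta>_iso: "iso_arr C X (Go (Fo X)) (\<eta> X)" if "X \<in> Ob C" for X
    using \<eta> that by (auto simp: natural_iso_def)
  have \<eta>_nat: "Gm (Fm f) \<cdot> \<eta> X = \<eta> Y \<cdot> f" if "X \<in> Ob C" "Y \<in> Ob C" "f \<in> Arr C X Y" for X Y f
    using \<eta> that by (auto simp: natural_iso_def)
  have \<epsilon>_iso: "iso_arr D (Fo (Go P)) P (\<epsilon> P)" if "P \<in> Ob D" for P
    using \<epsilon> that by (auto simp: natural_iso_def)
  have \<epsilon>_nat: "f \<cdot>\<^bsub>D\<^esub> \<epsilon> X = \<epsilon> Y \<cdot>\<^bsub>D\<^esub> Fm (Gm f)" if "X \<in> Ob D" "Y \<in> Ob D" "f \<in> Arr D X Y" for X Y f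
    using \<epsilon> that by (auto simp: natural_iso_def)
  have counit: "\<exists>E E'. \<epsilon> P = (Fo (Go P), E, P) \<and> E \<in> carrier_mat (fst P) (dm (Go P)) \<and>
      E' \<in> carrier_mat (dm (Go P)) (fst P) \<and> E * E' = 1\<^sub>m (fst P) \<and> E' * E = 1\<^sub>m (dm (Go P)) \<and>
      (\<forall>a\<in>carrier_vec n. E * act (Go P) a = snd P a * E)" if P: "P \<in> Ob D" for P
  proof -
    obtain e where e: "is_inverse D (Fo (Go P)) P (\<epsilon> P) e" using \<epsilon>_iso[OF P] by (auto simp: iso_arr_def)
    then obtain E E' where "\<epsilon> P = (Fo (Go P), E, P)" "e = (P, E', Fo (Go P))"
      "E \<in> carrier_mat (fst P) (dm (Go P))" "E' \<in> carrier_mat (dm (Go P)) (fst P)"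
      "\<forall>a\<in>carrier_vec n. E * act (Go P) a = snd P a * E"
      by (auto simp: is_inverse_def D_hom dm_def act_def)
    moreover from this e have "E * E' = 1\<^sub>m (fst P)" "E' * E = 1\<^sub>m (dm (Go P))"
      by (auto simp: is_inverse_def D_comp D_idn dm_def)
    ultimately show ?thesis by blast
  qed
  have G_faithful: "s = t" if P: "P \<in> Ob D" "Q \<in> Ob D" and st: "s \<in> Arr D P Q" "t \<in> Arr D P Q" "Gm s = Gm t" for P Q s t
  proof -
    obtain E E' where E: "\<epsilon> P = (Fo (Go P), E, P)" "E \<in> carrier_mat (fst P) (dm (Go P))"
      "E' \<in> carrier_mat (dm (Go P)) (fst P)" "E * E' = 1\<^sub>m (fst P)" using counit[OF P(1)] by blast
    obtain S T where S: "s = (P, S, Q)" "t = (P, T, Q)" "S \<in> carrier_mat (fst Q) (fst P)" "T \<in> carrier_mat (fst Q) (fst P)"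
      using st by (auto simp: D_hom)
    have "s \<cdot>\<^bsub>D\<^esub> \<epsilon> P = t \<cdot>\<^bsub>D\<^esub> \<epsilon> P" using \<epsilon>_nat[OF P st(1)] \<epsilon>_nat[OF P st(2)] st(3) by simp
    then have "S * E = T * E" by (simp add: S E(1) D_comp)
    then have "S * E * E' = T * E * E'" by simp
    then show ?thesis using S E by (simp add: assoc_mult_mat[of _ "fst Q" "fst P" _ "dm (Go P)" _ "fst P"])
  qed
  have "matrix_category C n mul u dm act mt"
  proof (unfold_locales, goal_cases)
    case 1 then show ?case by (rule alg)
  next
    case (2 X) then show ?case
      using Fob by (metis D_def act_def dm_def fd_rep_iff prod.collapse)
  next
    case (3 X Y f) then show ?case by (rule Fm(2))
  next
    case (4 X Y f a) then show ?case by (rule Fm(3))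
  next
    case (5 X Y Z f g)
    then have "Fm (g \<cdot> f) = (Fo X, mt g * mt f, Fo Z)"
      using Fm(1)[of X Y f] Fm(1)[of Y Z g] Fcomp by (simp add: D_comp)
    then show ?case by (simp add: mt_def)
  next
    case (6 X) then show ?case by (simp add: mt_def Fidn D_idn dm_def)
  next
    case (7 X Y f g)
    have "Fm (f \<oplus>\<^bsub>Hom C X Y\<^esub> g) = Fm f \<oplus>\<^bsub>Hom D (Fo X) (Fo Y)\<^esub> Fm g"
      using 7 by (intro LinearCombinations.module_hom_add[OF Flin]) auto
    then have "Fm (f \<oplus>\<^bsub>Hom C X Y\<^esub> g) = (Fo X, mt f + mt g, Fo Y)"
      using Fm(1)[OF 7(1,2,3)] Fm(1)[OF 7(1,2,4)] by (simp add: D_def fd_modules_def)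
    then show ?case by (simp add: mt_def)
  next
    case (8 X Y f c)
    have "Fm (c \<odot>\<^bsub>Hom C X Y\<^esub> f) = c \<odot>\<^bsub>Hom D (Fo X) (Fo Y)\<^esub> Fm f"
      using 8 by (intro LinearCombinations.module_hom_smult[OF Flin]) auto
    then have "Fm (c \<odot>\<^bsub>Hom C X Y\<^esub> f) = (Fo X, c \<cdot>\<^sub>m mt f, Fo Y)"
      using Fm(1)[OF 8(1,2,3)] by (simp add: D_def fd_modules_def)
    then show ?case by (simp add: mt_def)
  next
    case (9 X Y T)
    \<comment> \<open>The arrow \<open>f\<close> is the conjugate of \<open>G t\<close> by the unit; its image under \<open>F\<close> is seen to be \<open>t\<close> after applying \<open>G\<close>.\<close>
    define t where "t = (Fo X, T, Fo Y)"
    have t: "t \<in> Arr D (Fo X) (Fo Y)" using 9 by (auto simp: D_hom t_def dm_def act_def)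
    note \<eta>X = isomD[OF \<eta>_iso[OF 9(1)] 9(1) Gob[OF Fob[OF 9(1)]]]
    note \<eta>Y = isomD[OF \<eta>_iso[OF 9(2)] 9(2) Gob[OF Fob[OF 9(2)]]]
    note Gt = arrD[OF Ghom[OF Fob Fob t] Gob Gob, OF 9(1,2) Fob Fob, OF 9(1,2)]
    define f where "f = inv_of (\<eta> Y) \<cdot> (Gm t \<cdot> \<eta> X)"
    have f: "is_arr f" "src f = X" "tgt f = Y" using \<eta>X \<eta>Y Gt by (auto simp: f_def)
    then have fh: "f \<in> Arr C X Y" by (rule arrI)
    note GFf = arrD[OF Ghom[OF Fob Fob Fhom[OF 9(1,2) fh]] Gob Gob, OF 9(1,2) Fob Fob, OF 9(1,2)]
    have "Gm (Fm f) \<cdot> \<eta> X = Gm t \<cdot> \<eta> X"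
      using \<eta>_nat[OF 9(1,2) fh] \<eta>X \<eta>Y Gt by (simp add: f_def)
    then have "Gm (Fm f) = Gm t"
      by (rule isom_cancel_right) (use \<eta>X Gt GFf in auto)
    then have "Fm f = t" using G_faithful[OF Fob Fob Fhom t] 9 fh by blast
    then show ?case using fh by (intro bexI[of _ f]) (auto simp: mt_def t_def)
  next
    case (10 X Y f g)
    then have "Fm f = Fm g" using Fm(1)[of X Y f] Fm(1)[of X Y g] by simp
    then have "\<eta> Y \<cdot> f = \<eta> Y \<cdot> g" using \<eta>_nat[of X Y f] \<eta>_nat[of X Y g] 10 by simp
    then show ?case
      using isomD[OF \<eta>_iso[OF 10(2)] 10(2) Gob[OF Fob[OF 10(2)]]] 10 by (auto simp: hom_iff elim!: isom_cancel_left)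
  next
    case (11 d \<rho>)
    then have P: "(d, \<rho>) \<in> Ob D" by (simp add: D_def fd_rep_iff)
    from counit[OF P] show ?case by (intro bexI[OF _ Gob[OF P]]) auto
  qed
  then show ?thesis by blast
qed

context matrix_category
begin

lemma alg_facts:
  assumes "a \<in> carrier_vec n"
  shows "u \<in> carrier_vec n" "mul u a = a" "mul a u = a"
    and "b \<in> carrier_vec n \<Longrightarrow> mul a b \<in> carrier_vec n"
    and "b \<in> carrier_vec n \<Longrightarrow> c \<in> carrier_vec n \<Longrightarrow> mul a (b + c) = mul a b + mul a c"
    and "b \<in> carrier_vec n \<Longrightarrow> c \<in> carrier_vec n \<Longrightarrow> mul (b + c) a = mul b a + mul c a"
    and "b \<in> carrier_vec n \<Longrightarrow> mul a (k \<cdot>\<^sub>v b) = k \<cdot>\<^sub>v mul a b"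
    and "b \<in> carrier_vec n \<Longrightarrow> mul (k \<cdot>\<^sub>v b) a = k \<cdot>\<^sub>v mul b a"
    and "b \<in> carrier_vec n \<Longrightarrow> c \<in> carrier_vec n \<Longrightarrow> mul (mul a b) c = mul a (mul b c)"
proof -
  note A = alg[unfolded fd_algebra_def Let_def module_vec_simps]
  show "u \<in> carrier_vec n" "mul u a = a" "mul a u = a"
    "b \<in> carrier_vec n \<Longrightarrow> c \<in> carrier_vec n \<Longrightarrow> mul (mul a b) c = mul a (mul b c)"
    using A assms by blast+
  have 1: "mul a \<in> lin_maps (module_vec TYPE('k) n) (module_vec TYPE('k) n)"
    and 2: "(\<lambda>b. mul b a) \<in> lin_maps (module_vec TYPE('k) n) (module_vec TYPE('k) n)"
    using A assms by blast+
  show "b \<in> carrier_vec n \<Longrightarrow> mul a b \<in> carrier_vec n"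
    "b \<in> carrier_vec n \<Longrightarrow> c \<in> carrier_vec n \<Longrightarrow> mul a (b + c) = mul a b + mul a c"
    "b \<in> carrier_vec n \<Longrightarrow> mul a (k \<cdot>\<^sub>v b) = k \<cdot>\<^sub>v mul a b"
    using 1 by (auto simp: LinearCombinations.module_hom_def module_vec_simps)
  show "b \<in> carrier_vec n \<Longrightarrow> c \<in> carrier_vec n \<Longrightarrow> mul (b + c) a = mul b a + mul c a"
    "b \<in> carrier_vec n \<Longrightarrow> mul (k \<cdot>\<^sub>v b) a = k \<cdot>\<^sub>v mul b a"
    using 2 by (auto simp: LinearCombinations.module_hom_def module_vec_simps)
qed

lemma u_carrier [simp]: "u \<in> carrier_vec n"
  using alg by (simp add: fd_algebra_def Let_def module_vec_simps)

lemma act_facts: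
  assumes "X \<in> Ob C"
  shows "a \<in> carrier_vec n \<Longrightarrow> act X a \<in> carrier_mat (dm X) (dm X)"
    and "a \<in> carrier_vec n \<Longrightarrow> b \<in> carrier_vec n \<Longrightarrow> act X (a + b) = act X a + act X b"
    and "a \<in> carrier_vec n \<Longrightarrow> act X (k \<cdot>\<^sub>v a) = k \<cdot>\<^sub>m act X a"
    and "act X u = 1\<^sub>m (dm X)"
    and "a \<in> carrier_vec n \<Longrightarrow> b \<in> carrier_vec n \<Longrightarrow> act X (mul a b) = act X a * act X b"
  using act_rep[OF assms] by (auto simp: fd_rep_def)

declare act_facts(1,4) [simp]

lemma mt_mat [simp]: "is_arr f \<Longrightarrow> mt f \<in> carrier_mat (dm (tgt f)) (dm (src f))"
  using mt_carrier arr_hom by simp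

lemma mt_comp [simp]: "is_arr f \<Longrightarrow> is_arr g \<Longrightarrow> src g = tgt f \<Longrightarrow> mt (g \<cdot> f) = mt g * mt f"
  using mt_comp_hom[of "src f" "tgt f" "tgt g" f g] arr_hom[of f] arr_hom[of g] by simp

lemma mt_zero [simp]:
  assumes "X \<in> Ob C" "Y \<in> Ob C"
  shows "mt (zero_arr X Y) = 0\<^sub>m (dm Y) (dm X)"
proof -
  interpret vectorspace class_ring "Hom C X Y" using assms by (rule hom_space)
  let ?z = "zero_arr X Y"
  have "mt (0 \<odot>\<^bsub>Hom C X Y\<^esub> ?z) = 0 \<cdot>\<^sub>m mt ?z" using assms zero_in_hom by (intro mt_smult)
  moreover have "0 \<odot>\<^bsub>Hom C X Y\<^esub> ?z = ?z" using lmult_0[of ?z] assms by simp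
  moreover have "0 \<cdot>\<^sub>m mt ?z = 0\<^sub>m (dm Y) (dm X)"
    using mt_mat[of ?z] assms by (intro eq_matI) auto
  ultimately show ?thesis by simp
qed

lemma arr_eqI: "is_arr f \<Longrightarrow> is_arr g \<Longrightarrow> src f = src g \<Longrightarrow> tgt f = tgt g \<Longrightarrow> mt f = mt g \<Longrightarrow> f = g"
  using mt_faithful[of "src f" "tgt f" f g] arr_hom[of f] arr_hom[of g] by simp

lemma arr_eq_vecI:
  assumes "is_arr f" "is_arr g" "src f = src g" "tgt f = tgt g"
    "\<And>x. x \<in> carrier_vec (dm (src f)) \<Longrightarrow> mt f *\<^sub>v x = mt g *\<^sub>v x"
  shows "f = g"
  using assms mt_mat[of f] mt_mat[of g] by (intro arr_eqI eq_mat_if_mult_vec[of "mt f" "dm (tgt f)" "dm (src f)" "mt g"]) auto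

lemma mt_act_vec:
  assumes "is_arr f" "a \<in> carrier_vec n" "x \<in> carrier_vec (dm (src f))"
  shows "mt f *\<^sub>v (act (src f) a *\<^sub>v x) = act (tgt f) a *\<^sub>v (mt f *\<^sub>v x)"
proof -
  have "(mt f * act (src f) a) *\<^sub>v x = (act (tgt f) a * mt f) *\<^sub>v x"
    using mt_act[of "src f" "tgt f" f a] assms arr_hom[of f] by simp
  then show ?thesis
    using assms by (simp add: assoc_mult_mat_vec[OF mt_mat act_facts(1)] assoc_mult_mat_vec[OF act_facts(1) mt_mat])
qed

section \<open>Kernels, quotients and simple objects\<close>

abbreviation el :: "'o \<Rightarrow> 'k vec set" where
  "el X \<equiv> carrier_vec (dm X)"

definition inj_on_el :: "'m \<Rightarrow> bool" where
  "inj_on_el f \<longleftrightarrow> is_arr f \<and> (\<forall>x\<in>el (src f). mt f *\<^sub>v x = 0\<^sub>v (dm (tgt f)) \<longrightarrow> x = 0\<^sub>v (dm (src f)))"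

definition surj_on_el :: "'m \<Rightarrow> bool" where
  "surj_on_el f \<longleftrightarrow> is_arr f \<and> (\<forall>y\<in>el (tgt f). \<exists>x\<in>el (src f). mt f *\<^sub>v x = y)"

lemma mt_el: "is_arr f \<Longrightarrow> x \<in> el (src f) \<Longrightarrow> mt f *\<^sub>v x \<in> el (tgt f)"
  using mt_mat mult_mat_vec_carrier by blast

lemma mt_comp_vec:
  "is_arr f \<Longrightarrow> is_arr g \<Longrightarrow> src g = tgt f \<Longrightarrow> x \<in> el (src f) \<Longrightarrow> mt (g \<cdot> f) *\<^sub>v x = mt g *\<^sub>v (mt f *\<^sub>v x)"
  using mt_mat[of f] mt_mat[of g] by (simp add: assoc_mult_mat_vec[of "mt g" "dm (tgt g)" "dm (tgt f)" "mt f" "dm (src f)"])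

lemma mt_vec_add:
  "is_arr f \<Longrightarrow> x \<in> el (src f) \<Longrightarrow> y \<in> el (src f) \<Longrightarrow> mt f *\<^sub>v (x + y) = mt f *\<^sub>v x + mt f *\<^sub>v y"
  using mult_add_distrib_mat_vec[OF mt_mat] by blast

lemma mt_vec_diff:
  "is_arr f \<Longrightarrow> x \<in> el (src f) \<Longrightarrow> y \<in> el (src f) \<Longrightarrow> mt f *\<^sub>v (x - y) = mt f *\<^sub>v x - mt f *\<^sub>v y"
  using mult_minus_distrib_mat_vec[OF mt_mat] by blast

lemma mt_vec_smult: "is_arr f \<Longrightarrow> x \<in> el (src f) \<Longrightarrow> mt f *\<^sub>v (c \<cdot>\<^sub>v x) = c \<cdot>\<^sub>v (mt f *\<^sub>v x)"
  using mult_mat_vec[OF mt_mat] by blast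

lemma act_el: "X \<in> Ob C \<Longrightarrow> a \<in> carrier_vec n \<Longrightarrow> x \<in> el X \<Longrightarrow> act X a *\<^sub>v x \<in> el X"
  using act_facts(1) mult_mat_vec_carrier by blast

lemma act_mul_vec:
  "X \<in> Ob C \<Longrightarrow> a \<in> carrier_vec n \<Longrightarrow> b \<in> carrier_vec n \<Longrightarrow> x \<in> el X \<Longrightarrow>
   act X (mul a b) *\<^sub>v x = act X a *\<^sub>v (act X b *\<^sub>v x)"
  by (simp add: act_facts(5) assoc_mult_mat_vec[of "act X a" "dm X" "dm X" "act X b" "dm X"])

lemma act_vec_add: "X \<in> Ob C \<Longrightarrow> a \<in> carrier_vec n \<Longrightarrow> x \<in> el X \<Longrightarrow> y \<in> el X \<Longrightarrow>
    act X a *\<^sub>v (x + y) = act X a *\<^sub>v x + act X a *\<^sub>v y"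
  using mult_add_distrib_mat_vec[OF act_facts(1)] by blast

lemma act_vec_smult: "X \<in> Ob C \<Longrightarrow> a \<in> carrier_vec n \<Longrightarrow> x \<in> el X \<Longrightarrow>
    act X a *\<^sub>v (c \<cdot>\<^sub>v x) = c \<cdot>\<^sub>v (act X a *\<^sub>v x)"
  using mult_mat_vec[OF act_facts(1)] by blast

lemma act_add_vec: "X \<in> Ob C \<Longrightarrow> a \<in> carrier_vec n \<Longrightarrow> b \<in> carrier_vec n \<Longrightarrow> x \<in> el X \<Longrightarrow>
    act X (a + b) *\<^sub>v x = act X a *\<^sub>v x + act X b *\<^sub>v x"
  by (simp add: act_facts(2) add_mult_distrib_mat_vec[of "act X a" "dm X" "dm X"])

lemma act_smult_vec:
  assumes "X \<in> Ob C" "a \<in> carrier_vec n" "x \<in> el X"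
  shows "act X (c \<cdot>\<^sub>v a) *\<^sub>v x = c \<cdot>\<^sub>v (act X a *\<^sub>v x)"
proof -
  have "(c \<cdot>\<^sub>m act X a) *\<^sub>v x = c \<cdot>\<^sub>v (act X a *\<^sub>v x)"
    using act_facts(1)[OF assms(1,2)] assms(3) by (intro eq_vecI) auto
  then show ?thesis using assms by (simp add: act_facts(3))
qed

lemma arr_of_linear:
  assumes X: "X \<in> Ob C" and Y: "Y \<in> Ob C"
    and closed: "\<And>x. x \<in> el X \<Longrightarrow> h x \<in> el Y"
    and add: "\<And>x y. x \<in> el X \<Longrightarrow> y \<in> el X \<Longrightarrow> h (x + y) = h x + h y"
    and smult: "\<And>c x. x \<in> el X \<Longrightarrow> h (c \<cdot>\<^sub>v x) = c \<cdot>\<^sub>v h x"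
    and inter: "\<And>a x. a \<in> carrier_vec n \<Longrightarrow> x \<in> el X \<Longrightarrow> h (act X a *\<^sub>v x) = act Y a *\<^sub>v h x"
  obtains f where "is_arr f" "src f = X" "tgt f = Y" "\<And>x. x \<in> el X \<Longrightarrow> mt f *\<^sub>v x = h x"
proof -
  obtain T where T: "T \<in> carrier_mat (dm Y) (dm X)" "\<And>x. x \<in> el X \<Longrightarrow> T *\<^sub>v x = h x"
    using linear_map_matrix[of "dm X" h "dm Y"] closed add smult by metis
  have "T * act X a = act Y a * T" if a: "a \<in> carrier_vec n" for a
  proof (rule eq_mat_if_mult_vec[of _ "dm Y" "dm X"])
    fix x :: "'k vec" assume x: "x \<in> el X"
    have "T *\<^sub>v (act X a *\<^sub>v x) = act Y a *\<^sub>v (T *\<^sub>v x)"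
      using T(2)[OF x] T(2)[OF act_el[OF X a x]] inter[OF a x] by simp
    then show "T * act X a *\<^sub>v x = act Y a * T *\<^sub>v x"
      using T(1) act_facts(1)[OF X a] act_facts(1)[OF Y a] x
      by (simp add: assoc_mult_mat_vec[of _ "dm Y" "dm X" _ "dm X"] assoc_mult_mat_vec[of _ "dm Y" "dm Y" _ "dm X"])
  next
    show "T * act X a \<in> carrier_mat (dm Y) (dm X)" by (rule mult_carrier_mat[OF T(1) act_facts(1)[OF X a]])
    show "act Y a * T \<in> carrier_mat (dm Y) (dm X)" by (rule mult_carrier_mat[OF act_facts(1)[OF Y a] T(1)])
  qed
  then obtain f where "f \<in> Arr C X Y" "mt f = T" using mt_full[OF X Y T(1)] by blast
  then show ?thesis using that T(2) X Y by (auto simp: hom_iff)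
qed

lemma factor_through_surj:
  assumes q: "surj_on_el q" and h: "is_arr h" "src h = src q"
    and ker: "\<And>x. x \<in> el (src q) \<Longrightarrow> mt q *\<^sub>v x = 0\<^sub>v (dm (tgt q)) \<Longrightarrow> mt h *\<^sub>v x = 0\<^sub>v (dm (tgt h))"
  obtains h' where "is_arr h'" "src h' = tgt q" "tgt h' = tgt h" "h' \<cdot> q = h"
proof -
  have q': "is_arr q" using q by (simp add: surj_on_el_def)
  \<comment> \<open>The choice of preimages need not be linear, but two preimages have the same image under \<open>h\<close>.\<close>
  define s where "s y = (SOME x. x \<in> el (src q) \<and> mt q *\<^sub>v x = y)" for y
  have s: "s y \<in> el (src q)" "mt q *\<^sub>v s y = y" if "y \<in> el (tgt q)" for y
  proof -
    have "\<exists>x. x \<in> el (src q) \<and> mt q *\<^sub>v x = y" using q that by (auto simp: surj_on_el_def)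
    from someI_ex[OF this] show "s y \<in> el (src q)" "mt q *\<^sub>v s y = y" by (auto simp: s_def)
  qed
  have same: "mt h *\<^sub>v x = mt h *\<^sub>v x'" if x: "x \<in> el (src q)" "x' \<in> el (src q)" "mt q *\<^sub>v x = mt q *\<^sub>v x'" for x x'
  proof -
    have "mt q *\<^sub>v (x - x') = 0\<^sub>v (dm (tgt q))" using x q' mt_el[OF q' x(2)] by (simp add: mt_vec_diff)
    then have 0: "mt h *\<^sub>v x - mt h *\<^sub>v x' = 0\<^sub>v (dm (tgt h))"
      using ker[of "x - x'"] x h by (simp add: mt_vec_diff)
    have "mt h *\<^sub>v x \<in> el (tgt h)" "mt h *\<^sub>v x' \<in> el (tgt h)" using mt_el[OF h(1)] h(2) x by auto
    then show ?thesis using 0 by (rule vec_eq_if_diff_zero)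
  qed
  have hs: "mt h *\<^sub>v s (mt q *\<^sub>v x) = mt h *\<^sub>v x" if "x \<in> el (src q)" for x
    using same s[OF mt_el[OF q' that]] that by blast
  obtain h' where h': "is_arr h'" "src h' = tgt q" "tgt h' = tgt h"
    "\<And>y. y \<in> el (tgt q) \<Longrightarrow> mt h' *\<^sub>v y = mt h *\<^sub>v s y"
  proof (rule arr_of_linear[of "tgt q" "tgt h" "\<lambda>y. mt h *\<^sub>v s y"])
    fix y y' a :: "'k vec" and c :: 'k
    assume y: "y \<in> el (tgt q)"
    show "mt h *\<^sub>v s y \<in> el (tgt h)" using mt_el[OF h(1)] h s[OF y] by simp
    have "mt h *\<^sub>v s (c \<cdot>\<^sub>v y) = mt h *\<^sub>v (c \<cdot>\<^sub>v s y)"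
      using s[OF y] s[of "c \<cdot>\<^sub>v y"] y q' by - (rule same, auto simp: mt_vec_smult)
    then show "mt h *\<^sub>v s (c \<cdot>\<^sub>v y) = c \<cdot>\<^sub>v (mt h *\<^sub>v s y)" using s[OF y] h by (simp add: mt_vec_smult)
    {
      assume y': "y' \<in> el (tgt q)"
      have "mt h *\<^sub>v s (y + y') = mt h *\<^sub>v (s y + s y')"
        using s[OF y] s[OF y'] s[of "y + y'"] y y' q' by - (rule same, auto simp: mt_vec_add)
      then show "mt h *\<^sub>v s (y + y') = mt h *\<^sub>v s y + mt h *\<^sub>v s y'" using s[OF y] s[OF y'] h by (simp add: mt_vec_add)
    next
      assume a: "a \<in> carrier_vec n"
      have "mt h *\<^sub>v s (act (tgt q) a *\<^sub>v y) = mt h *\<^sub>v (act (src q) a *\<^sub>v s y)"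
        using s[OF y] s[OF act_el[OF tgt_ob[OF q'] a y]] act_el[OF src_ob[OF q'] a] q' mt_act_vec[OF q' a]
        by - (rule same, auto)
      then show "mt h *\<^sub>v s (act (tgt q) a *\<^sub>v y) = act (tgt h) a *\<^sub>v (mt h *\<^sub>v s y)"
        using mt_act_vec[OF h(1) a, of "s y"] h s[OF y] by simp
    }
  qed (use q' h in auto)
  have "h' \<cdot> q = h"
    using h h' q' hs mt_el[OF q'] by (intro arr_eq_vecI) (auto simp: mt_comp_vec simp del: mt_comp)
  then show ?thesis using that h' by blast
qed

lemma factor_through_inj:
  assumes i: "inj_on_el i" and h: "is_arr h" "tgt h = tgt i"
    and im: "\<And>z. z \<in> el (src h) \<Longrightarrow> \<exists>x\<in>el (src i). mt i *\<^sub>v x = mt h *\<^sub>v z"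
  obtains h' where "is_arr h'" "src h' = src h" "tgt h' = src i" "i \<cdot> h' = h"
proof -
  have i': "is_arr i" using i by (simp add: inj_on_el_def)
  have same: "x = x'" if x: "x \<in> el (src i)" "x' \<in> el (src i)" "mt i *\<^sub>v x = mt i *\<^sub>v x'" for x x'
  proof -
    have "mt i *\<^sub>v (x - x') = 0\<^sub>v (dm (tgt i))" using x i' mt_el[OF i' x(2)] by (simp add: mt_vec_diff)
    then have "x - x' = 0\<^sub>v (dm (src i))" using i x by (simp add: inj_on_el_def)
    then show ?thesis by (rule vec_eq_if_diff_zero[OF x(1,2)])
  qed
  define s where "s z = (SOME x. x \<in> el (src i) \<and> mt i *\<^sub>v x = mt h *\<^sub>v z)" for z
  have s: "s z \<in> el (src i)" "mt i *\<^sub>v s z = mt h *\<^sub>v z" if "z \<in> el (src h)" for z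
  proof -
    have "\<exists>x. x \<in> el (src i) \<and> mt i *\<^sub>v x = mt h *\<^sub>v z" using im[OF that] by auto
    from someI_ex[OF this] show "s z \<in> el (src i)" "mt i *\<^sub>v s z = mt h *\<^sub>v z" by (auto simp: s_def)
  qed
  obtain h' where h': "is_arr h'" "src h' = src h" "tgt h' = src i"
    "\<And>y. y \<in> el (src h) \<Longrightarrow> mt h' *\<^sub>v y = s y"
  proof (rule arr_of_linear[of "src h" "src i" s])
    fix y y' a :: "'k vec" and c :: 'k
    assume y: "y \<in> el (src h)"
    show "s y \<in> el (src i)" using s[OF y] by simp
    show "s (c \<cdot>\<^sub>v y) = c \<cdot>\<^sub>v s y"
      using s[OF y] s[of "c \<cdot>\<^sub>v y"] y h i' by - (rule same, auto simp: mt_vec_smult)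
    {
      assume y': "y' \<in> el (src h)"
      show "s (y + y') = s y + s y'"
        using s[OF y] s[OF y'] s[of "y + y'"] y y' h i' by - (rule same, auto simp: mt_vec_add)
    next
      assume a: "a \<in> carrier_vec n"
      show "s (act (src h) a *\<^sub>v y) = act (src i) a *\<^sub>v s y"
        using s[OF y] s[OF act_el[OF src_ob[OF h(1)] a y]] act_el[OF src_ob[OF i'] a] h
          mt_act_vec[OF i' a] mt_act_vec[OF h(1) a y]
        by - (rule same, auto)
    }
  qed (use i' h in auto)
  have "i \<cdot> h' = h"
    using h h' i' s by (intro arr_eq_vecI) (auto simp: mt_comp_vec simp del: mt_comp)
  then show ?thesis using that h' by blast
qed

text \<open>The compressions \<open>L a B\<close> of the operators \<open>a\<close> form a representation as soon as \<open>B L\<close> may be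
  cancelled between two of them. This happens both when the image of \<open>B\<close> is invariant, which gives
  submodules, and when the kernel of \<open>L\<close> is, which gives quotients.\<close>

lemma compression_realized:
  assumes X: "X \<in> Ob C" and L: "L \<in> carrier_mat r (dm X)" and B: "B \<in> carrier_mat (dm X) r" and LB: "L * B = 1\<^sub>m r"
    and mult: "\<And>a b z. a \<in> carrier_vec n \<Longrightarrow> b \<in> carrier_vec n \<Longrightarrow> z \<in> carrier_vec r \<Longrightarrow>
      L *\<^sub>v (act X a *\<^sub>v (B *\<^sub>v (L *\<^sub>v (act X b *\<^sub>v (B *\<^sub>v z))))) = L *\<^sub>v (act X a *\<^sub>v (act X b *\<^sub>v (B *\<^sub>v z)))"
  obtains Y S S' where "Y \<in> Ob C" "S \<in> carrier_mat r (dm Y)" "S' \<in> carrier_mat (dm Y) r"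
    "\<And>z. z \<in> carrier_vec r \<Longrightarrow> S *\<^sub>v (S' *\<^sub>v z) = z" "\<And>y. y \<in> el Y \<Longrightarrow> S' *\<^sub>v (S *\<^sub>v y) = y"
    "\<And>a y. a \<in> carrier_vec n \<Longrightarrow> y \<in> el Y \<Longrightarrow> S *\<^sub>v (act Y a *\<^sub>v y) = L *\<^sub>v (act X a *\<^sub>v (B *\<^sub>v (S *\<^sub>v y)))"
proof -
  define \<rho> where "\<rho> a = L * (act X a * B)" for a
  have A: "act X a * B \<in> carrier_mat (dm X) r" if "a \<in> carrier_vec n" for a
    by (rule mult_carrier_mat[OF act_facts(1)[OF X that] B])
  have \<rho>: "\<rho> a \<in> carrier_mat r r" if "a \<in> carrier_vec n" for a
    unfolding \<rho>_def by (rule mult_carrier_mat[OF L A[OF that]])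
  have \<rho>_vec: "\<rho> a *\<^sub>v z = L *\<^sub>v (act X a *\<^sub>v (B *\<^sub>v z))" if "a \<in> carrier_vec n" "z \<in> carrier_vec r" for a z
    using assoc_mult_mat_vec[OF L A[OF that(1)] that(2)] assoc_mult_mat_vec[OF act_facts(1)[OF X that(1)] B that(2)]
    by (simp add: \<rho>_def)
  have Bz: "B *\<^sub>v z \<in> el X" if "z \<in> carrier_vec r" for z by (rule mult_mat_vec_carrier[OF B that])
  have "fd_rep n mul u r \<rho>"
    unfolding fd_rep_def
  proof (intro conjI ballI allI)
    fix a b :: "'k vec" and c
    assume a: "a \<in> carrier_vec n"
    show "\<rho> a \<in> carrier_mat r r" by (rule \<rho>[OF a])
    show "\<rho> (c \<cdot>\<^sub>v a) = c \<cdot>\<^sub>m \<rho> a"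
      unfolding \<rho>_def using act_facts(3)[OF X a] mult_smult_distrib[OF L A[OF a]]
        mult_smult_assoc_mat[OF act_facts(1)[OF X a] B] by simp
    assume b: "b \<in> carrier_vec n"
    show "\<rho> (a + b) = \<rho> a + \<rho> b"
      unfolding \<rho>_def using act_facts(2)[OF X a b] mult_add_distrib_mat[OF L A[OF a] A[OF b]]
        add_mult_distrib_mat[OF act_facts(1)[OF X a] act_facts(1)[OF X b] B] by simp
    show "\<rho> (mul a b) = \<rho> a * \<rho> b"
    proof (rule eq_mat_if_mult_vec[of _ r r])
      fix z :: "'k vec" assume z: "z \<in> carrier_vec r"
      have bz: "\<rho> b *\<^sub>v z \<in> carrier_vec r" by (rule mult_mat_vec_carrier[OF \<rho>[OF b] z])
      show "\<rho> (mul a b) *\<^sub>v z = \<rho> a * \<rho> b *\<^sub>v z"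
        using mult[OF a b z] \<rho>_vec[OF alg_facts(4)[OF a b] z] \<rho>_vec[OF a bz] \<rho>_vec[OF b z]
          assoc_mult_mat_vec[OF \<rho>[OF a] \<rho>[OF b] z] act_mul_vec[OF X a b Bz[OF z]] by simp
    qed (use \<rho> a b alg_facts(4)[OF a b] mult_carrier_mat[OF \<rho>[OF a] \<rho>[OF b]] in auto)
  next
    show "\<rho> u = 1\<^sub>m r" unfolding \<rho>_def using X B LB by simp
  qed
  then obtain Y S S' where Y: "Y \<in> Ob C" and S: "S \<in> carrier_mat r (dm Y)" "S' \<in> carrier_mat (dm Y) r"
      "S * S' = 1\<^sub>m r" "S' * S = 1\<^sub>m (dm Y)" "\<And>a. a \<in> carrier_vec n \<Longrightarrow> S * act Y a = \<rho> a * S"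
    using realize by metis
  show ?thesis
  proof (rule that[OF Y S(1,2)])
    show "S *\<^sub>v (S' *\<^sub>v z) = z" if "z \<in> carrier_vec r" for z
      using assoc_mult_mat_vec[OF S(1,2) that] S(3) that by simp
    show "S' *\<^sub>v (S *\<^sub>v y) = y" if "y \<in> el Y" for y
      using assoc_mult_mat_vec[OF S(2,1) that] S(4) that by simp
    show "S *\<^sub>v (act Y a *\<^sub>v y) = L *\<^sub>v (act X a *\<^sub>v (B *\<^sub>v (S *\<^sub>v y)))" if "a \<in> carrier_vec n" "y \<in> el Y" for a y
    proof -
      have Sy: "S *\<^sub>v y \<in> carrier_vec r" by (rule mult_mat_vec_carrier[OF S(1) that(2)])
      show ?thesis
        using assoc_mult_mat_vec[OF S(1) act_facts(1)[OF Y that(1)] that(2)] S(5)[OF that(1)]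
          assoc_mult_mat_vec[OF \<rho>[OF that(1)] S(1) that(2)] \<rho>_vec[OF that(1) Sy] by simp
    qed
  qed
qed

text \<open>The submodule and the quotient module are the compressions of the action to the two summands of
  a splitting of \<open>k\<^sup>d\<close> along \<open>W\<close>.\<close>

lemma invariant_subspace:
  assumes X: "X \<in> Ob C" and W: "vec_subspace (dm X) W"
    and inv: "\<And>a w. a \<in> carrier_vec n \<Longrightarrow> w \<in> W \<Longrightarrow> act X a *\<^sub>v w \<in> W"
  obtains i q where "inj_on_el i" "tgt i = X" "surj_on_el q" "src q = X"
    "\<And>z. z \<in> el (src i) \<Longrightarrow> mt i *\<^sub>v z \<in> W" "\<And>w. w \<in> W \<Longrightarrow> \<exists>z\<in>el (src i). mt i *\<^sub>v z = w"
    "\<And>x. x \<in> el X \<Longrightarrow> x \<in> W \<longleftrightarrow> mt q *\<^sub>v x = 0\<^sub>v (dm (tgt q))"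
proof -
  obtain r s T T' Q Q' where T: "T \<in> carrier_mat (dm X) r" "T' \<in> carrier_mat r (dm X)"
    and Q: "Q \<in> carrier_mat s (dm X)" "Q' \<in> carrier_mat (dm X) s"
    and e: "T' * T = 1\<^sub>m r" "Q * Q' = 1\<^sub>m s" "Q * T = 0\<^sub>m s r" "T * T' + Q' * Q = 1\<^sub>m (dm X)"
    and TW: "\<And>z. z \<in> carrier_vec r \<Longrightarrow> T *\<^sub>v z \<in> W" "\<And>w. w \<in> W \<Longrightarrow> T *\<^sub>v (T' *\<^sub>v w) = w"
    and QW: "\<And>x. x \<in> el X \<Longrightarrow> x \<in> W \<longleftrightarrow> Q *\<^sub>v x = 0\<^sub>v s"
    using subspace_splitting[OF W] by metis
  have Wel: "w \<in> el X" if "w \<in> W" for w using W that by (auto simp: vec_subspace_def)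
  have Q'Q: "Q' *\<^sub>v (Q *\<^sub>v x) = x - T *\<^sub>v (T' *\<^sub>v x)" if x: "x \<in> el X" for x
  proof -
    have "(T * T' + Q' * Q) *\<^sub>v x = T *\<^sub>v (T' *\<^sub>v x) + Q' *\<^sub>v (Q *\<^sub>v x)"
      using add_mult_distrib_mat_vec[OF mult_carrier_mat[OF T] mult_carrier_mat[OF Q(2,1)] x]
        assoc_mult_mat_vec[OF T x] assoc_mult_mat_vec[OF Q(2,1) x] by simp
    then have "x = T *\<^sub>v (T' *\<^sub>v x) + Q' *\<^sub>v (Q *\<^sub>v x)" using e(4) x by simp
    then show ?thesis using T Q x by (intro vec_diff_eqI[of _ "dm X"]) auto
  qed
  have QTa: "Q *\<^sub>v (act X a *\<^sub>v (Q' *\<^sub>v (Q *\<^sub>v x))) = Q *\<^sub>v (act X a *\<^sub>v x)"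
    if a: "a \<in> carrier_vec n" and x: "x \<in> el X" for a x
  proof -
    have "T' *\<^sub>v x \<in> carrier_vec r" by (rule mult_mat_vec_carrier[OF T(2) x])
    then have w: "T *\<^sub>v (T' *\<^sub>v x) \<in> W" by (rule TW(1))
    note aw = inv[OF a w]
    have "act X a *\<^sub>v (Q' *\<^sub>v (Q *\<^sub>v x)) = act X a *\<^sub>v x - act X a *\<^sub>v (T *\<^sub>v (T' *\<^sub>v x))"
      using Q'Q[OF x] mult_minus_distrib_mat_vec[OF act_facts(1)[OF X a] x Wel[OF w]] by simp
    then have "Q *\<^sub>v (act X a *\<^sub>v (Q' *\<^sub>v (Q *\<^sub>v x))) = Q *\<^sub>v (act X a *\<^sub>v x) - 0\<^sub>v s"
      using mult_minus_distrib_mat_vec[OF Q(1) act_el[OF X a x] Wel[OF aw]] QW[OF Wel[OF aw]] aw by simp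
    moreover have "Q *\<^sub>v (act X a *\<^sub>v x) \<in> carrier_vec s" by (rule mult_mat_vec_carrier[OF Q(1) act_el[OF X a x]])
    ultimately show ?thesis by simp
  qed
  obtain Y S S' where Y: "Y \<in> Ob C" "S \<in> carrier_mat r (dm Y)" "S' \<in> carrier_mat (dm Y) r"
    and SS: "\<And>z. z \<in> carrier_vec r \<Longrightarrow> S *\<^sub>v (S' *\<^sub>v z) = z" "\<And>y. y \<in> el Y \<Longrightarrow> S' *\<^sub>v (S *\<^sub>v y) = y"
    and Sa: "\<And>a y. a \<in> carrier_vec n \<Longrightarrow> y \<in> el Y \<Longrightarrow> S *\<^sub>v (act Y a *\<^sub>v y) = T' *\<^sub>v (act X a *\<^sub>v (T *\<^sub>v (S *\<^sub>v y)))"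
  proof (rule compression_realized[OF X T(2,1) e(1)])
    fix a b z :: "'k vec" assume "a \<in> carrier_vec n" "b \<in> carrier_vec n" "z \<in> carrier_vec r"
    then show "T' *\<^sub>v (act X a *\<^sub>v (T *\<^sub>v (T' *\<^sub>v (act X b *\<^sub>v (T *\<^sub>v z))))) = T' *\<^sub>v (act X a *\<^sub>v (act X b *\<^sub>v (T *\<^sub>v z)))"
      using TW inv by simp
  qed blast
  have Sy: "S *\<^sub>v y \<in> carrier_vec r" if "y \<in> el Y" for y by (rule mult_mat_vec_carrier[OF Y(2) that])
  obtain i where i: "is_arr i" "src i = Y" "tgt i = X" "\<And>y. y \<in> el Y \<Longrightarrow> mt i *\<^sub>v y = T *\<^sub>v (S *\<^sub>v y)"
  proof (rule arr_of_linear[OF Y(1) X, of "\<lambda>y. T *\<^sub>v (S *\<^sub>v y)"])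
    fix y y' a :: "'k vec" and c :: 'k
    assume y: "y \<in> el Y"
    show "T *\<^sub>v (S *\<^sub>v y) \<in> el X" by (rule mult_mat_vec_carrier[OF T(1) Sy[OF y]])
    show "T *\<^sub>v (S *\<^sub>v (c \<cdot>\<^sub>v y)) = c \<cdot>\<^sub>v (T *\<^sub>v (S *\<^sub>v y))"
      using mult_mat_vec[OF Y(2) y] mult_mat_vec[OF T(1) Sy[OF y]] by simp
    {
      assume y': "y' \<in> el Y"
      show "T *\<^sub>v (S *\<^sub>v (y + y')) = T *\<^sub>v (S *\<^sub>v y) + T *\<^sub>v (S *\<^sub>v y')"
        using mult_add_distrib_mat_vec[OF Y(2) y y'] mult_add_distrib_mat_vec[OF T(1) Sy[OF y] Sy[OF y']] by simp
    next
      assume a: "a \<in> carrier_vec n"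
      show "T *\<^sub>v (S *\<^sub>v (act Y a *\<^sub>v y)) = act X a *\<^sub>v (T *\<^sub>v (S *\<^sub>v y))"
        using Sa[OF a y] TW(2)[OF inv[OF a TW(1)[OF Sy[OF y]]]] by simp
    }
  qed blast
  obtain Z P P' where Z: "Z \<in> Ob C" "P \<in> carrier_mat s (dm Z)" "P' \<in> carrier_mat (dm Z) s"
    and PP: "\<And>z. z \<in> carrier_vec s \<Longrightarrow> P *\<^sub>v (P' *\<^sub>v z) = z" "\<And>y. y \<in> el Z \<Longrightarrow> P' *\<^sub>v (P *\<^sub>v y) = y"
    and Pa: "\<And>a y. a \<in> carrier_vec n \<Longrightarrow> y \<in> el Z \<Longrightarrow> P *\<^sub>v (act Z a *\<^sub>v y) = Q *\<^sub>v (act X a *\<^sub>v (Q' *\<^sub>v (P *\<^sub>v y)))"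
  proof (rule compression_realized[OF X Q(1,2) e(2)])
    fix a b z :: "'k vec" assume a: "a \<in> carrier_vec n" and b: "b \<in> carrier_vec n" and z: "z \<in> carrier_vec s"
    show "Q *\<^sub>v (act X a *\<^sub>v (Q' *\<^sub>v (Q *\<^sub>v (act X b *\<^sub>v (Q' *\<^sub>v z))))) = Q *\<^sub>v (act X a *\<^sub>v (act X b *\<^sub>v (Q' *\<^sub>v z)))"
      by (rule QTa[OF a act_el[OF X b mult_mat_vec_carrier[OF Q(2) z]]])
  qed blast
  have Qx: "Q *\<^sub>v x \<in> carrier_vec s" if "x \<in> el X" for x by (rule mult_mat_vec_carrier[OF Q(1) that])
  have P'z: "P' *\<^sub>v z \<in> el Z" if "z \<in> carrier_vec s" for z by (rule mult_mat_vec_carrier[OF Z(3) that])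
  obtain q where q: "is_arr q" "src q = X" "tgt q = Z" "\<And>x. x \<in> el X \<Longrightarrow> mt q *\<^sub>v x = P' *\<^sub>v (Q *\<^sub>v x)"
  proof (rule arr_of_linear[OF X Z(1), of "\<lambda>x. P' *\<^sub>v (Q *\<^sub>v x)"])
    fix y y' a :: "'k vec" and c :: 'k
    assume y: "y \<in> el X"
    show "P' *\<^sub>v (Q *\<^sub>v y) \<in> el Z" by (rule P'z[OF Qx[OF y]])
    show "P' *\<^sub>v (Q *\<^sub>v (c \<cdot>\<^sub>v y)) = c \<cdot>\<^sub>v (P' *\<^sub>v (Q *\<^sub>v y))"
      using mult_mat_vec[OF Q(1) y] mult_mat_vec[OF Z(3) Qx[OF y]] by simp
    {
      assume y': "y' \<in> el X"
      show "P' *\<^sub>v (Q *\<^sub>v (y + y')) = P' *\<^sub>v (Q *\<^sub>v y) + P' *\<^sub>v (Q *\<^sub>v y')"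
        using mult_add_distrib_mat_vec[OF Q(1) y y'] mult_add_distrib_mat_vec[OF Z(3) Qx[OF y] Qx[OF y']] by simp
    next
      assume a: "a \<in> carrier_vec n"
      have "P *\<^sub>v (act Z a *\<^sub>v (P' *\<^sub>v (Q *\<^sub>v y))) = Q *\<^sub>v (act X a *\<^sub>v y)"
        using Pa[OF a P'z[OF Qx[OF y]]] PP(1)[OF Qx[OF y]] QTa[OF a y] by simp
      then show "P' *\<^sub>v (Q *\<^sub>v (act X a *\<^sub>v y)) = act Z a *\<^sub>v (P' *\<^sub>v (Q *\<^sub>v y))"
        using PP(2)[OF act_el[OF Z(1) a P'z[OF Qx[OF y]]]] by simp
    }
  qed blast
  show ?thesis
  proof
    show "inj_on_el i"
      unfolding inj_on_el_def
    proof (intro conjI ballI impI)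
      fix y assume "y \<in> el (src i)" and 0: "mt i *\<^sub>v y = 0\<^sub>v (dm (tgt i))"
      then have y: "y \<in> el Y" using i by simp
      have "S *\<^sub>v y = T' *\<^sub>v (T *\<^sub>v (S *\<^sub>v y))"
        using assoc_mult_mat_vec[OF T(2,1) Sy[OF y]] e(1) Sy[OF y] by simp
      also have "T *\<^sub>v (S *\<^sub>v y) = 0\<^sub>v (dm X)" using 0 i y by simp
      also have "T' *\<^sub>v 0\<^sub>v (dm X) = 0\<^sub>v r" by (rule mult_mat_zero_vec[OF T(2)])
      finally have "y = S' *\<^sub>v 0\<^sub>v r" using SS(2)[OF y] by simp
      then show "y = 0\<^sub>v (dm (src i))" using mult_mat_zero_vec[OF Y(3)] i by simp
    qed (rule i)
    show "surj_on_el q"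
      unfolding surj_on_el_def
    proof (intro conjI ballI)
      fix y assume "y \<in> el (tgt q)"
      then have y: "y \<in> el Z" using q by simp
      have Py: "P *\<^sub>v y \<in> carrier_vec s" by (rule mult_mat_vec_carrier[OF Z(2) y])
      have x: "Q' *\<^sub>v (P *\<^sub>v y) \<in> el X" by (rule mult_mat_vec_carrier[OF Q(2) Py])
      have "Q *\<^sub>v (Q' *\<^sub>v (P *\<^sub>v y)) = P *\<^sub>v y"
        using assoc_mult_mat_vec[OF Q Py] e(2) Py by simp
      then have "mt q *\<^sub>v (Q' *\<^sub>v (P *\<^sub>v y)) = y" using q(4)[OF x] PP(2)[OF y] by simp
      then show "\<exists>x\<in>el (src q). mt q *\<^sub>v x = y" using x q by auto
    qed (rule q)
    show "mt i *\<^sub>v z \<in> W" if "z \<in> el (src i)" for z using that i Sy TW(1) by simp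
    show "\<exists>z\<in>el (src i). mt i *\<^sub>v z = w" if w: "w \<in> W" for w
    proof
      have c: "T' *\<^sub>v w \<in> carrier_vec r" by (rule mult_mat_vec_carrier[OF T(2) Wel[OF w]])
      show "S' *\<^sub>v (T' *\<^sub>v w) \<in> el (src i)" using mult_mat_vec_carrier[OF Y(3) c] i by simp
      then show "mt i *\<^sub>v (S' *\<^sub>v (T' *\<^sub>v w)) = w" using i SS(1)[OF c] TW(2)[OF w] by simp
    qed
    show "x \<in> W \<longleftrightarrow> mt q *\<^sub>v x = 0\<^sub>v (dm (tgt q))" if x: "x \<in> el X" for x
    proof
      assume "x \<in> W"
      then show "mt q *\<^sub>v x = 0\<^sub>v (dm (tgt q))" using QW[OF x] q x mult_mat_zero_vec[OF Z(3)] by simp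
    next
      assume "mt q *\<^sub>v x = 0\<^sub>v (dm (tgt q))"
      then have "P' *\<^sub>v (Q *\<^sub>v x) = 0\<^sub>v (dm Z)" using q x by simp
      then have "Q *\<^sub>v x = 0\<^sub>v s" using PP(1)[OF Qx[OF x]] mult_mat_zero_vec[OF Z(2)] by simp
      then show "x \<in> W" using QW[OF x] by simp
    qed
  qed (use i q in auto)
qed

lemma kernel_subspace:
  assumes "is_arr f"
  shows "vec_subspace (dm (src f)) {x \<in> el (src f). mt f *\<^sub>v x = 0\<^sub>v (dm (tgt f))}"
  using assms mult_mat_zero_vec[OF mt_mat[OF assms]]
  by (auto simp: vec_subspace_def mt_vec_add mt_vec_smult)

lemma image_subspace:
  assumes f: "is_arr f"
  shows "vec_subspace (dm (tgt f)) {mt f *\<^sub>v x | x. x \<in> el (src f)}"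
proof -
  have "0\<^sub>v (dm (tgt f)) = mt f *\<^sub>v 0\<^sub>v (dm (src f))" using mult_mat_zero_vec[OF mt_mat[OF f]] by simp
  moreover have "\<exists>z. mt f *\<^sub>v x + mt f *\<^sub>v y = mt f *\<^sub>v z \<and> z \<in> el (src f)" if "x \<in> el (src f)" "y \<in> el (src f)" for x y
    using mt_vec_add[OF f that] that by (metis add_carrier_vec)
  moreover have "\<exists>z. c \<cdot>\<^sub>v (mt f *\<^sub>v x) = mt f *\<^sub>v z \<and> z \<in> el (src f)" if "x \<in> el (src f)" for x c
    using mt_vec_smult[OF f that, of c] that by (metis smult_carrier_vec)
  ultimately show ?thesis
    using mt_el[OF f] unfolding vec_subspace_def by (auto intro: exI[of _ "0\<^sub>v (dm (src f))"])
qed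

lemma inj_imp_cancel:
  assumes f: "inj_on_el f" and g: "is_arr g" "is_arr h" "tgt g = src f" "tgt h = src f" "src g = src h" and e: "f \<cdot> g = f \<cdot> h"
  shows "g = h"
proof (rule arr_eq_vecI)
  fix x assume x: "x \<in> el (src g)"
  have f': "is_arr f" using f by (simp add: inj_on_el_def)
  have c: "mt g *\<^sub>v x \<in> el (src f)" "mt h *\<^sub>v x \<in> el (src f)" using mt_el[OF g(1) x] mt_el[OF g(2), of x] x g by auto
  have "mt f *\<^sub>v (mt g *\<^sub>v x) = mt f *\<^sub>v (mt h *\<^sub>v x)"
    using mt_comp_vec[of g f x] mt_comp_vec[of h f x] e f' g x by simp
  then have "mt f *\<^sub>v (mt g *\<^sub>v x - mt h *\<^sub>v x) = 0\<^sub>v (dm (tgt f))"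
    using mt_vec_diff[OF f' c] mt_el[OF f' c(2)] by simp
  then have "mt g *\<^sub>v x - mt h *\<^sub>v x = 0\<^sub>v (dm (src f))" using f c by (simp add: inj_on_el_def)
  then show "mt g *\<^sub>v x = mt h *\<^sub>v x" by (rule vec_eq_if_diff_zero[OF c])
qed (use g in auto)

lemma surj_imp_cancel:
  assumes f: "surj_on_el f" and g: "is_arr g" "is_arr h" "src g = tgt f" "src h = tgt f" "tgt g = tgt h" and e: "g \<cdot> f = h \<cdot> f"
  shows "g = h"
proof (rule arr_eq_vecI)
  fix y assume "y \<in> el (src g)"
  then obtain x where x: "x \<in> el (src f)" "mt f *\<^sub>v x = y" using f g by (auto simp: surj_on_el_def)
  then show "mt g *\<^sub>v y = mt h *\<^sub>v y"
    using mt_comp_vec[of f g x] mt_comp_vec[of f h x] e f g by (simp add: surj_on_el_def)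
qed (use g in auto)

lemma inj_imp_mono: "inj_on_el f \<Longrightarrow> mono_arr C (src f) (tgt f) f"
  using inj_imp_cancel[of f] by (auto simp: mono_arr_def hom_iff inj_on_el_def)

text \<open>The projection to the quotient by the image of \<open>f\<close> has the same composite with \<open>f\<close> as zero.\<close>

lemma epi_imp_surj:
  assumes e: "epi_arr C X Y f" and XY: "X \<in> Ob C" "Y \<in> Ob C"
  shows "surj_on_el f"
proof -
  have f: "is_arr f" "src f = X" "tgt f = Y" using e XY by (auto simp: epi_arr_def hom_iff)
  let ?W = "{mt f *\<^sub>v x | x. x \<in> el (src f)}"
  obtain q where q: "surj_on_el q" "src q = tgt f"
    "\<And>x. x \<in> el (tgt f) \<Longrightarrow> x \<in> ?W \<longleftrightarrow> mt q *\<^sub>v x = 0\<^sub>v (dm (tgt q))"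
  proof (rule invariant_subspace[OF tgt_ob[OF f(1)] image_subspace[OF f(1)]])
    fix a w :: "'k vec" assume "a \<in> carrier_vec n" "w \<in> ?W"
    then show "act (tgt f) a *\<^sub>v w \<in> ?W"
      using mt_act_vec[OF f(1)] act_el[OF src_ob[OF f(1)]] by auto metis
  qed blast
  have q': "is_arr q" using q(1) by (simp add: surj_on_el_def)
  have "q \<cdot> f = zero_arr Y (tgt q) \<cdot> f"
  proof (rule arr_eq_vecI)
    fix x assume "x \<in> el (src (q \<cdot> f))"
    then have x: "x \<in> el (src f)" using f q q' by simp
    have "mt q *\<^sub>v (mt f *\<^sub>v x) = 0\<^sub>v (dm (tgt q))" using q(3)[OF mt_el[OF f(1) x]] x by blast
    then show "mt (q \<cdot> f) *\<^sub>v x = mt (zero_arr Y (tgt q) \<cdot> f) *\<^sub>v x"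
      using mt_comp_vec[of f q x] x f q q' by (simp add: XY)
  qed (use f q q' XY in auto)
  then have "q = zero_arr Y (tgt q)"
    using e f q q' XY unfolding epi_arr_def by (metis (no_types, lifting) arr_hom tgt_ob zero_in_hom)
  then have "mt q = 0\<^sub>m (dm (tgt q)) (dm Y)" using mt_zero[OF XY(2) tgt_ob[OF q']] by simp
  then have "y \<in> ?W" if "y \<in> el Y" for y using q(3)[of y] that f by simp
  then show ?thesis using f by (auto simp: surj_on_el_def)
qed

text \<open>The arrow \<open>q\<close> is the projection to the quotient by the image of \<open>v\<close>.\<close>

lemma inj_is_kernel_of_cokernel:
  assumes v: "inj_on_el v"
  obtains q where "is_arr q" "src q = tgt v" "is_cokernel C (src v) (tgt v) (tgt q) v q"
    "\<And>h. is_arr h \<Longrightarrow> tgt h = tgt v \<Longrightarrow> q \<cdot> h = zero_arr (src h) (tgt q) \<Longrightarrow>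
      \<exists>h'. is_arr h' \<and> src h' = src h \<and> tgt h' = src v \<and> v \<cdot> h' = h"
proof -
  have v': "is_arr v" using v by (simp add: inj_on_el_def)
  let ?W = "{mt v *\<^sub>v x | x. x \<in> el (src v)}"
  obtain q where q: "surj_on_el q" "src q = tgt v"
    and qW: "\<And>x. x \<in> el (tgt v) \<Longrightarrow> x \<in> ?W \<longleftrightarrow> mt q *\<^sub>v x = 0\<^sub>v (dm (tgt q))"
  proof (rule invariant_subspace[OF tgt_ob[OF v'] image_subspace[OF v']])
    fix a w :: "'k vec" assume "a \<in> carrier_vec n" "w \<in> ?W"
    then show "act (tgt v) a *\<^sub>v w \<in> ?W"
      using mt_act_vec[OF v'] act_el[OF src_ob[OF v']] by auto metis
  qed blast
  have q': "is_arr q" using q(1) by (simp add: surj_on_el_def)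
  have qv: "q \<cdot> v = zero_arr (src v) (tgt q)"
  proof (rule arr_eq_vecI)
    fix x assume "x \<in> el (src (q \<cdot> v))"
    then have x: "x \<in> el (src v)" using v' q q' by simp
    have "mt q *\<^sub>v (mt v *\<^sub>v x) = 0\<^sub>v (dm (tgt q))" using qW[OF mt_el[OF v' x]] x by blast
    then show "mt (q \<cdot> v) *\<^sub>v x = mt (zero_arr (src v) (tgt q)) *\<^sub>v x"
      using mt_comp_vec[of v q x] x v' q q' by simp
  qed (use v' q q' in auto)
  have cok: "\<exists>!h'. h' \<in> Arr C (tgt q) Z \<and> h' \<cdot> q = h"
    if Z: "Z \<in> Ob C" and "h \<in> Arr C (tgt v) Z" and hv: "h \<cdot> v = zero_arr (src v) Z" for Z h
  proof -
    have h: "is_arr h" "src h = tgt v" "tgt h = Z" using that v' by (auto simp: hom_iff)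
    obtain h' where h': "is_arr h'" "src h' = tgt q" "tgt h' = tgt h" "h' \<cdot> q = h"
    proof (rule factor_through_surj[OF q(1) h(1)])
      fix x assume x: "x \<in> el (src q)" and "mt q *\<^sub>v x = 0\<^sub>v (dm (tgt q))"
      then obtain y where y: "y \<in> el (src v)" "x = mt v *\<^sub>v y" using qW[of x] q by auto
      then have "mt h *\<^sub>v x = mt (h \<cdot> v) *\<^sub>v y" using mt_comp_vec[of v h y] v' h by simp
      then show "mt h *\<^sub>v x = 0\<^sub>v (dm (tgt h))" using hv v' Z y h by simp
    qed (use h q in auto)
    show ?thesis
    proof (rule ex1I[of _ h'])
      show "h' \<in> Arr C (tgt q) Z \<and> h' \<cdot> q = h" using h' h by (auto intro: arrI)
      show "k = h'" if "k \<in> Arr C (tgt q) Z \<and> k \<cdot> q = h" for k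
        by (rule surj_imp_cancel[OF q(1)]) (use that h' h q' Z in \<open>auto simp: hom_iff\<close>)
    qed
  qed
  have "is_cokernel C (src v) (tgt v) (tgt q) v q"
    unfolding is_cokernel_def
    using qv cok arr_hom[OF v'] arr_hom[OF q'] q(2) by auto
  moreover have "\<exists>h'. is_arr h' \<and> src h' = src h \<and> tgt h' = src v \<and> v \<cdot> h' = h"
    if h: "is_arr h" "tgt h = tgt v" and qh: "q \<cdot> h = zero_arr (src h) (tgt q)" for h
  proof -
    have im: "\<exists>x\<in>el (src v). mt v *\<^sub>v x = mt h *\<^sub>v z" if z: "z \<in> el (src h)" for z
    proof -
      have "mt q *\<^sub>v (mt h *\<^sub>v z) = mt (q \<cdot> h) *\<^sub>v z" using mt_comp_vec[of h q z] h q q' z by simp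
      also have "\<dots> = 0\<^sub>v (dm (tgt q))" using qh h q' z by simp
      finally show ?thesis using qW[of "mt h *\<^sub>v z"] mt_el[OF h(1) z] h by auto
    qed
    show ?thesis using factor_through_inj[OF v h im] by metis
  qed
  ultimately show ?thesis using that q q' by blast
qed

text \<open>The inclusion \<open>i\<close> of the kernel is a monomorphism into \<open>L\<close>. If it were an isomorphism,
  \<open>f i = 0\<close> would give \<open>f = 0\<close>.\<close>

lemma simple_nonzero_imp_inj:
  assumes L: "simple_object C L" and f: "is_arr f" "src f = L" "f \<noteq> zero_arr L (tgt f)"
  shows "inj_on_el f"
proof -
  let ?W = "{x \<in> el (src f). mt f *\<^sub>v x = 0\<^sub>v (dm (tgt f))}"
  obtain i where i: "inj_on_el i" "tgt i = src f"
    and iW: "\<And>z. z \<in> el (src i) \<Longrightarrow> mt i *\<^sub>v z \<in> ?W" "\<And>w. w \<in> ?W \<Longrightarrow> \<exists>z\<in>el (src i). mt i *\<^sub>v z = w"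
  proof (rule invariant_subspace[OF src_ob[OF f(1)] kernel_subspace[OF f(1)]])
    fix a w :: "'k vec" assume a: "a \<in> carrier_vec n" and "w \<in> ?W"
    then show "act (src f) a *\<^sub>v w \<in> ?W"
      using mt_act_vec[OF f(1) a] act_el[OF src_ob[OF f(1)] a] mult_mat_zero_vec[OF act_facts(1)[OF tgt_ob[OF f(1)] a]]
      by auto
  qed blast
  have i': "is_arr i" using i by (simp add: inj_on_el_def)
  have fi: "f \<cdot> i = zero_arr (src i) (tgt f)"
    using iW(1) f i i' mt_el[OF i'] by (intro arr_eq_vecI) (auto simp: mt_comp_vec simp del: mt_comp)
  have "zero_object C (src i) \<or> iso_arr C (src i) L i"
    using L inj_imp_mono[OF i(1)] i i' f unfolding simple_object_def by (metis src_ob)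
  then show ?thesis
  proof
    assume "zero_object C (src i)"
    then have "i = zero_arr (src i) (tgt i)" using zero_object_hom i' by blast
    then have 0: "mt i = 0\<^sub>m (dm (tgt i)) (dm (src i))" using mt_zero i' by (metis src_ob tgt_ob)
    have "x = 0\<^sub>v (dm (src f))" if "x \<in> ?W" for x
    proof -
      obtain z where "z \<in> el (src i)" "mt i *\<^sub>v z = x" using iW(2)[OF \<open>x \<in> ?W\<close>] by blast
      then show ?thesis using 0 i by simp
    qed
    then show ?thesis using f by (auto simp: inj_on_el_def)
  next
    assume "iso_arr C (src i) L i"
    then have iso: "isom i" using isomD i i' f by (metis src_ob)
    have "(f \<cdot> i) \<cdot> inv_of i = zero_arr (src i) (tgt f) \<cdot> inv_of i" using fi by simp
    then have "f = zero_arr L (tgt f)" using iso i i' f by simp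
    then show ?thesis using f by simp
  qed
qed

text \<open>The orbit of \<open>y\<close> is a submodule, and it contains \<open>y\<close> because the algebra has a unit.\<close>

lemma simple_orbit:
  assumes L: "simple_object C L" and y: "y \<in> el L" "y \<noteq> 0\<^sub>v (dm L)" and x: "x \<in> el L"
  shows "\<exists>a\<in>carrier_vec n. act L a *\<^sub>v y = x"
proof -
  have Lo: "L \<in> Ob C" using L by (simp add: simple_object_def)
  let ?W = "{act L a *\<^sub>v y | a. a \<in> carrier_vec n}"
  have sub: "vec_subspace (dm L) ?W"
    unfolding vec_subspace_def
  proof (intro conjI ballI allI)
    show "?W \<subseteq> el L" using act_el[OF Lo] y by auto
    have "act L (0 \<cdot>\<^sub>v u) *\<^sub>v y = 0\<^sub>v (dm L)" using act_smult_vec[OF Lo u_carrier y(1), of 0] zero_smult_vec[OF act_el[OF Lo u_carrier y(1)]] by (simp only:)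
    then show "0\<^sub>v (dm L) \<in> ?W" by (auto intro!: exI[of _ "0 \<cdot>\<^sub>v u"])
  next
    fix x z assume "x \<in> ?W" "z \<in> ?W"
    then obtain a b where ab: "a \<in> carrier_vec n" "b \<in> carrier_vec n" "x = act L a *\<^sub>v y" "z = act L b *\<^sub>v y" by auto
    then have "x + z = act L (a + b) *\<^sub>v y" using act_add_vec[OF Lo ab(1,2) y(1)] by simp
    then show "x + z \<in> ?W" using ab by (auto intro!: exI[of _ "a + b"])
  next
    fix x and c :: 'k assume "x \<in> ?W"
    then obtain a where a: "a \<in> carrier_vec n" "x = act L a *\<^sub>v y" by auto
    then have "c \<cdot>\<^sub>v x = act L (c \<cdot>\<^sub>v a) *\<^sub>v y" using act_smult_vec[OF Lo a(1) y(1)] by simp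
    then show "c \<cdot>\<^sub>v x \<in> ?W" using a by (auto intro!: exI[of _ "c \<cdot>\<^sub>v a"])
  qed
  obtain i where i: "inj_on_el i" "tgt i = L"
    and iW: "\<And>z. z \<in> el (src i) \<Longrightarrow> mt i *\<^sub>v z \<in> ?W" "\<And>w. w \<in> ?W \<Longrightarrow> \<exists>z\<in>el (src i). mt i *\<^sub>v z = w"
  proof (rule invariant_subspace[OF Lo sub])
    fix a w :: "'k vec" assume a: "a \<in> carrier_vec n" and "w \<in> ?W"
    then obtain b where "b \<in> carrier_vec n" "w = act L b *\<^sub>v y" by auto
    then show "act L a *\<^sub>v w \<in> ?W" using act_mul_vec[OF Lo a _ y(1)] alg_facts(4)[OF a] by auto metis
  qed blast
  have i': "is_arr i" using i by (simp add: inj_on_el_def)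
  have "zero_object C (src i) \<or> iso_arr C (src i) L i"
    using L inj_imp_mono[OF i(1)] i i' unfolding simple_object_def by (metis src_ob)
  then have iso: "isom i"
  proof
    assume "zero_object C (src i)"
    then have "i = zero_arr (src i) (tgt i)" using zero_object_hom i' by blast
    then have 0: "mt i = 0\<^sub>m (dm (tgt i)) (dm (src i))" using mt_zero i' by (metis src_ob tgt_ob)
    have "act L u *\<^sub>v y = y" using Lo y by simp
    then have "y \<in> ?W" by (auto intro!: exI[of _ u])
    then obtain z where "z \<in> el (src i)" "mt i *\<^sub>v z = y" using iW(2) by blast
    then show ?thesis using 0 i y by simp
  next
    assume "iso_arr C (src i) L i"
    then show ?thesis using isomD i i' by (metis src_ob tgt_ob)
  qed
  have "mt i *\<^sub>v (mt (inv_of i) *\<^sub>v x) = x"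
    using mt_comp_vec[of "inv_of i" i x] iso i i' x mt_idn[OF Lo] by (simp del: mt_comp)
  moreover have "mt (inv_of i) *\<^sub>v x \<in> el (src i)" using mt_el[of "inv_of i" x] iso i x by simp
  ultimately show ?thesis using iW(1) by force
qed

section \<open>Density\<close>

lemma simple_ob: "simple_object C L \<Longrightarrow> L \<in> Ob C"
  by (simp add: simple_object_def)

lemma simple_dm_pos:
  assumes L: "simple_object C L"
  shows "dm L > 0"
proof (rule ccontr)
  assume "\<not> dm L > 0"
  then have "\<iota> L = zero_arr L L"
    using mt_zero[of L L] mt_idn[of L] simple_ob[OF L] by (intro arr_eqI) auto
  then show False using idn_zero_imp_zero_object L by (auto simp: simple_object_def)
qed

lemma inj_surj_imp_isom:
  assumes i: "inj_on_el f" and s: "surj_on_el f"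
  shows "isom f"
proof -
  have f: "is_arr f" using i by (simp add: inj_on_el_def)
  obtain g where g: "is_arr g" "src g = tgt f" "tgt g = src f" "g \<cdot> f = \<iota> (src f)"
  proof (rule factor_through_surj[OF s, of "\<iota> (src f)"])
    fix x assume "x \<in> el (src f)" "mt f *\<^sub>v x = 0\<^sub>v (dm (tgt f))"
    then show "mt (\<iota> (src f)) *\<^sub>v x = 0\<^sub>v (dm (tgt (\<iota> (src f))))"
      using i f by (simp add: inj_on_el_def mt_idn)
  qed (use f in auto)
  have "f \<cdot> g = \<iota> (tgt f)"
    by (rule surj_imp_cancel[OF s]) (use f g in auto)
  then show ?thesis using f g by (intro isomI[of f g]) auto
qed

definition left_ideal :: "'k vec set \<Rightarrow> bool" where
  "left_ideal J \<longleftrightarrow> J \<subseteq> carrier_vec n \<and> (\<forall>a\<in>J. \<forall>b\<in>J. a - b \<in> J) \<and> (\<forall>a\<in>J. \<forall>b\<in>J. a + b \<in> J) \<and>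
     (\<forall>c. \<forall>a\<in>J. c \<cdot>\<^sub>v a \<in> J) \<and> (\<forall>b\<in>carrier_vec n. \<forall>a\<in>J. mul b a \<in> J)"

lemma act_diff_vec:
  assumes "X \<in> Ob C" "a \<in> carrier_vec n" "b \<in> carrier_vec n" "x \<in> el X"
  shows "act X (a - b) *\<^sub>v x = act X a *\<^sub>v x - act X b *\<^sub>v x"
proof -
  have "a - b = a + (- 1) \<cdot>\<^sub>v b" using assms by (intro eq_vecI) auto
  then have "act X (a - b) *\<^sub>v x = act X a *\<^sub>v x + (- 1) \<cdot>\<^sub>v (act X b *\<^sub>v x)"
    using act_add_vec[OF assms(1,2), of "(- 1) \<cdot>\<^sub>v b" x] act_smult_vec[OF assms(1,3,4), of "- 1"] assms by simp
  then show ?thesis using act_el[OF assms(1,2,4)] act_el[OF assms(1,3,4)] by (intro eq_vecI) auto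
qed

lemma left_ideal_orbit:
  assumes K: "simple_object C K" and J: "left_ideal J" and v: "v \<in> el K"
    and "a \<in> J" "act K a *\<^sub>v v \<noteq> 0\<^sub>v (dm K)" and x: "x \<in> el K"
  shows "\<exists>b\<in>J. act K b *\<^sub>v v = x"
proof -
  have Ko: "K \<in> Ob C" by (rule simple_ob[OF K])
  have a: "a \<in> carrier_vec n" using assms by (auto simp: left_ideal_def)
  obtain b where b: "b \<in> carrier_vec n" "act K b *\<^sub>v (act K a *\<^sub>v v) = x"
    using simple_orbit[OF K act_el[OF Ko a v] assms(5) x] by blast
  then have "act K (mul b a) *\<^sub>v v = x" using act_mul_vec[OF Ko b(1) a v] by simp
  then show ?thesis using J b assms(4) by (auto simp: left_ideal_def)
qed

text \<open>Since \<open>J v\<close> is all of the simple module \<open>K\<close>, the assignment \<open>a v \<mapsto> a y\<close> for \<open>a \<in> J\<close> is defined on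
  \<open>K\<close>. Both halves of the density theorem rest on this homomorphism: for simple \<open>L\<close> it is zero or
  shows \<open>K\<close> and \<open>L\<close> to be isomorphic, and for \<open>L = K\<close> it is a scalar.\<close>

lemma left_ideal_hom:
  assumes K: "simple_object C K" and Lo: "L \<in> Ob C" and J: "left_ideal J"
    and v: "v \<in> el K" and y: "y \<in> el L"
    and nz: "\<exists>a\<in>J. act K a *\<^sub>v v \<noteq> 0\<^sub>v (dm K)"
    and ker: "\<And>a. a \<in> J \<Longrightarrow> act K a *\<^sub>v v = 0\<^sub>v (dm K) \<Longrightarrow> act L a *\<^sub>v y = 0\<^sub>v (dm L)"
  obtains f where "is_arr f" "src f = K" "tgt f = L" "\<And>a. a \<in> J \<Longrightarrow> mt f *\<^sub>v (act K a *\<^sub>v v) = act L a *\<^sub>v y"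
proof -
  have Ko: "K \<in> Ob C" by (rule simple_ob[OF K])
  have Jn: "a \<in> carrier_vec n" if "a \<in> J" for a using J that by (auto simp: left_ideal_def)
  define s where "s x = (SOME a. a \<in> J \<and> act K a *\<^sub>v v = x)" for x
  have s: "s x \<in> J" "act K (s x) *\<^sub>v v = x" "s x \<in> carrier_vec n" if "x \<in> el K" for x
  proof -
    have "\<exists>a. a \<in> J \<and> act K a *\<^sub>v v = x" using left_ideal_orbit[OF K J v _ _ that] nz by blast
    from someI_ex[OF this] show "s x \<in> J" "act K (s x) *\<^sub>v v = x" by (auto simp: s_def)
    then show "s x \<in> carrier_vec n" using Jn by blast
  qed
  have same: "act L a *\<^sub>v y = act L b *\<^sub>v y" if ab: "a \<in> J" "b \<in> J" "act K a *\<^sub>v v = act K b *\<^sub>v v" for a b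
  proof -
    have "a - b \<in> J" using ab J by (auto simp: left_ideal_def)
    moreover have "act K (a - b) *\<^sub>v v = 0\<^sub>v (dm K)"
      using act_diff_vec[OF Ko Jn[OF ab(1)] Jn[OF ab(2)] v] ab act_el[OF Ko Jn[OF ab(2)] v] by simp
    ultimately have "act L a *\<^sub>v y - act L b *\<^sub>v y = 0\<^sub>v (dm L)"
      using ker act_diff_vec[OF Lo Jn[OF ab(1)] Jn[OF ab(2)] y] by simp
    then show ?thesis by (rule vec_eq_if_diff_zero[OF act_el[OF Lo Jn[OF ab(1)] y] act_el[OF Lo Jn[OF ab(2)] y]])
  qed
  obtain f where f: "is_arr f" "src f = K" "tgt f = L" "\<And>x. x \<in> el K \<Longrightarrow> mt f *\<^sub>v x = act L (s x) *\<^sub>v y"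
  proof (rule arr_of_linear[OF Ko Lo, of "\<lambda>x. act L (s x) *\<^sub>v y"])
    fix x z a :: "'k vec" and c :: 'k
    assume x: "x \<in> el K"
    note sx = s[OF x]
    show "act L (s x) *\<^sub>v y \<in> el L" by (rule act_el[OF Lo sx(3) y])
    have cx: "c \<cdot>\<^sub>v x \<in> el K" using x by simp
    have "act L (s (c \<cdot>\<^sub>v x)) *\<^sub>v y = act L (c \<cdot>\<^sub>v s x) *\<^sub>v y"
    proof (rule same)
      show "c \<cdot>\<^sub>v s x \<in> J" using sx J by (auto simp: left_ideal_def)
      show "act K (s (c \<cdot>\<^sub>v x)) *\<^sub>v v = act K (c \<cdot>\<^sub>v s x) *\<^sub>v v"
        using act_smult_vec[OF Ko sx(3) v, of c] sx s[OF cx] by simp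
    qed (rule s[OF cx])
    then show "act L (s (c \<cdot>\<^sub>v x)) *\<^sub>v y = c \<cdot>\<^sub>v (act L (s x) *\<^sub>v y)"
      using act_smult_vec[OF Lo sx(3) y, of c] by simp
    {
      assume z: "z \<in> el K"
      note sz = s[OF z]
      have xz: "x + z \<in> el K" using x z by simp
      have "act L (s (x + z)) *\<^sub>v y = act L (s x + s z) *\<^sub>v y"
      proof (rule same)
        show "s x + s z \<in> J" using sx sz J by (auto simp: left_ideal_def)
        show "act K (s (x + z)) *\<^sub>v v = act K (s x + s z) *\<^sub>v v"
          using act_add_vec[OF Ko sx(3) sz(3) v] sx sz s[OF xz] by simp
      qed (rule s[OF xz])
      then show "act L (s (x + z)) *\<^sub>v y = act L (s x) *\<^sub>v y + act L (s z) *\<^sub>v y"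
        using act_add_vec[OF Lo sx(3) sz(3) y] by simp
    next
      assume a: "a \<in> carrier_vec n"
      have ax: "act K a *\<^sub>v x \<in> el K" by (rule act_el[OF Ko a x])
      have "act L (s (act K a *\<^sub>v x)) *\<^sub>v y = act L (mul a (s x)) *\<^sub>v y"
      proof (rule same)
        show "mul a (s x) \<in> J" using sx a J by (auto simp: left_ideal_def)
        show "act K (s (act K a *\<^sub>v x)) *\<^sub>v v = act K (mul a (s x)) *\<^sub>v v"
          using act_mul_vec[OF Ko a sx(3) v] sx s[OF ax] by simp
      qed (rule s[OF ax])
      then show "act L (s (act K a *\<^sub>v x)) *\<^sub>v y = act L a *\<^sub>v (act L (s x) *\<^sub>v y)"
        using act_mul_vec[OF Lo a sx(3) y] by simp
    }
  qed blast
  have "mt f *\<^sub>v (act K a *\<^sub>v v) = act L a *\<^sub>v y" if a: "a \<in> J" for a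
    using f(4)[OF act_el[OF Ko Jn[OF a] v]] s[OF act_el[OF Ko Jn[OF a] v]] same a by metis
  then show ?thesis using that f by blast
qed

text \<open>Elements that kill the modules in \<open>S\<close> and the first \<open>i\<close> basis vectors of \<open>L\<close>; the density theorem
  is an induction on \<open>i\<close>.\<close>

definition annihilator :: "'o set \<Rightarrow> 'o \<Rightarrow> nat \<Rightarrow> 'k vec set" where
  "annihilator S L i = {a \<in> carrier_vec n. (\<forall>K\<in>S. \<forall>x\<in>el K. act K a *\<^sub>v x = 0\<^sub>v (dm K)) \<and>
     (\<forall>j<i. act L a *\<^sub>v unit_vec (dm L) j = 0\<^sub>v (dm L))}"

lemma left_ideal_annihilator:
  assumes S: "S \<subseteq> Ob C" and L: "L \<in> Ob C"
  shows "left_ideal (annihilator S L i)"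
proof -
  have Ko: "K \<in> Ob C" if "K \<in> S" for K using S that by auto
  have z: "act K b *\<^sub>v 0\<^sub>v (dm K) = 0\<^sub>v (dm K)" if "K \<in> Ob C" "b \<in> carrier_vec n" for K b
    using mult_mat_zero_vec[OF act_facts(1)[OF that]] .
  show ?thesis
    unfolding left_ideal_def annihilator_def using L Ko
    by (auto simp: act_add_vec act_diff_vec act_smult_vec act_mul_vec z alg_facts(4))
qed

text \<open>Suppose that everything that kills \<open>K\<close> kills \<open>L\<close>, and let \<open>y \<in> L\<close> be nonzero. The elements that kill
  the first \<open>m\<close> basis vectors of \<open>K\<close> kill \<open>y\<close> for \<open>m = dm K\<close>, but not for \<open>m = 0\<close>. At the step where this
  changes, \<open>a e\<^sub>m \<mapsto> a y\<close> is a well defined nonzero homomorphism \<open>K \<rightarrow> L\<close>, that is, an isomorphism.\<close>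

lemma annihilators_differ:
  assumes K: "simple_object C K" and L: "simple_object C L" and ni: "\<not> isomorphic C K L"
  shows "\<exists>a\<in>annihilator {K} L 0. \<exists>y\<in>el L. act L a *\<^sub>v y \<noteq> 0\<^sub>v (dm L)"
proof (rule ccontr)
  assume "\<not> ?thesis"
  then have A: "act L a *\<^sub>v y = 0\<^sub>v (dm L)"
    if "a \<in> carrier_vec n" "\<And>x. x \<in> el K \<Longrightarrow> act K a *\<^sub>v x = 0\<^sub>v (dm K)" "y \<in> el L" for a y
    using that by (auto simp: annihilator_def)
  have Ko: "K \<in> Ob C" and Lo: "L \<in> Ob C" using K L simple_ob by auto
  define y where "y = (unit_vec (dm L) 0 :: 'k vec)"
  have y: "y \<in> el L" "y \<noteq> 0\<^sub>v (dm L)" using simple_dm_pos[OF L] by (auto simp: y_def)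
  define J where "J m = annihilator {} K m" for m
  have J: "left_ideal (J m)" for m unfolding J_def by (rule left_ideal_annihilator) (use Ko in auto)
  have Jn: "a \<in> carrier_vec n" if "a \<in> J m" for a m using that by (simp add: J_def annihilator_def)
  define kills where "kills m \<longleftrightarrow> (\<forall>a\<in>J m. act L a *\<^sub>v y = 0\<^sub>v (dm L))" for m
  have "kills (dm K)"
    unfolding kills_def
  proof
    fix a assume a: "a \<in> J (dm K)"
    have "act K a *\<^sub>v x = 0\<^sub>v (dm K)" if "x \<in> el K" for x
      using that
    proof (induction x rule: unit_vec_induct)
      case zero
      then show ?case by (rule mult_mat_zero_vec[OF act_facts(1)[OF Ko Jn[OF a]]])
    next
      case (add w c i)
      then show ?case using a act_vec_add[OF Ko Jn[OF a], of w "c \<cdot>\<^sub>v unit_vec (dm K) i"]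
          act_vec_smult[OF Ko Jn[OF a], of "unit_vec (dm K) i" c]
        by (simp add: J_def annihilator_def)
    qed
    then show "act L a *\<^sub>v y = 0\<^sub>v (dm L)" using A[OF Jn[OF a]] y by blast
  qed
  moreover have k0: "\<not> kills 0"
  proof -
    have "u \<in> J 0" by (simp add: J_def annihilator_def)
    moreover have "act L u *\<^sub>v y \<noteq> 0\<^sub>v (dm L)" using Lo y by simp
    ultimately show ?thesis by (auto simp: kills_def)
  qed
  moreover have "\<not> kills m" if "\<And>m. \<not> kills m \<Longrightarrow> \<not> kills (Suc m)" for m
    by (induction m) (use that k0 in auto)
  ultimately obtain m where m: "\<not> kills m" "kills (Suc m)" by blast
  define v where "v = (unit_vec (dm K) m :: 'k vec)"
  have v: "v \<in> el K" by (simp add: v_def)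
  have JS: "a \<in> J (Suc m)" if "a \<in> J m" "act K a *\<^sub>v v = 0\<^sub>v (dm K)" for a
    using that by (auto simp: J_def annihilator_def v_def less_Suc_eq)
  obtain a0 where a0: "a0 \<in> J m" "act L a0 *\<^sub>v y \<noteq> 0\<^sub>v (dm L)" using m by (auto simp: kills_def)
  obtain f where f: "is_arr f" "src f = K" "tgt f = L"
    and fa: "\<And>a. a \<in> J m \<Longrightarrow> mt f *\<^sub>v (act K a *\<^sub>v v) = act L a *\<^sub>v y"
  proof (rule left_ideal_hom[OF K Lo J[of m] v y(1)])
    show "\<exists>a\<in>J m. act K a *\<^sub>v v \<noteq> 0\<^sub>v (dm K)" using a0 JS m by (auto simp: kills_def)
    show "act L a *\<^sub>v y = 0\<^sub>v (dm L)" if "a \<in> J m" "act K a *\<^sub>v v = 0\<^sub>v (dm K)" for a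
      using JS[OF that] m by (auto simp: kills_def)
  qed blast
  have av: "act K a0 *\<^sub>v v \<in> el K" by (rule act_el[OF Ko Jn[OF a0(1)] v])
  have "f \<noteq> zero_arr K L" using fa[OF a0(1)] a0(2) av Ko Lo by auto
  then have "inj_on_el f" using simple_nonzero_imp_inj[OF K f(1,2)] f by simp
  moreover have "surj_on_el f"
    unfolding surj_on_el_def
  proof (intro conjI ballI)
    fix x assume "x \<in> el (tgt f)"
    then obtain b where b: "b \<in> carrier_vec n" "act L b *\<^sub>v (act L a0 *\<^sub>v y) = x"
      using simple_orbit[OF L act_el[OF Lo Jn[OF a0(1)] y(1)] a0(2)] f by auto
    have "mt f *\<^sub>v (act K b *\<^sub>v (act K a0 *\<^sub>v v)) = x"
      using mt_act_vec[OF f(1) b(1), of "act K a0 *\<^sub>v v"] f av b fa[OF a0(1)] by simp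
    then show "\<exists>z\<in>el (src f). mt f *\<^sub>v z = x" using act_el[OF Ko b(1) av] f by auto
  qed (rule f)
  ultimately have "isom f" by (rule inj_surj_imp_isom)
  then show False using ni isom_iso_arr f by (auto simp: isomorphic_def)
qed

text \<open>If \<open>b\<close> kills \<open>S\<close> and \<open>a\<close> kills \<open>K\<close>, then every \<open>a c b\<close> kills both; and \<open>c\<close> can be chosen to
  move a nonzero vector of the image of \<open>b\<close> on \<open>L\<close> to one that \<open>a\<close> does not kill.\<close>

lemma annihilator_acts:
  assumes L: "simple_object C L" and "finite S" "\<And>K. K \<in> S \<Longrightarrow> simple_object C K \<and> \<not> isomorphic C K L"
  shows "\<exists>a\<in>annihilator S L 0. \<exists>y\<in>el L. act L a *\<^sub>v y \<noteq> 0\<^sub>v (dm L)"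
  using assms(2,3)
proof (induction S)
  have Lo: "L \<in> Ob C" by (rule simple_ob[OF L])
  case empty
  have "unit_vec (dm L) 0 \<noteq> (0\<^sub>v (dm L) :: 'k vec)" using simple_dm_pos[OF L] by simp
  then have "act L u *\<^sub>v unit_vec (dm L) 0 \<noteq> 0\<^sub>v (dm L)" using Lo by simp
  moreover have "u \<in> annihilator {} L 0" by (simp add: annihilator_def)
  ultimately show ?case by (meson unit_vec_carrier)
next
  have Lo: "L \<in> Ob C" by (rule simple_ob[OF L])
  case (insert K S)
  have Ko: "K \<in> Ob C" using insert simple_ob by auto
  obtain b z where b: "b \<in> annihilator S L 0" "z \<in> el L" "act L b *\<^sub>v z \<noteq> 0\<^sub>v (dm L)" using insert by blast
  obtain a y where a: "a \<in> annihilator {K} L 0" "y \<in> el L" "act L a *\<^sub>v y \<noteq> 0\<^sub>v (dm L)"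
    using annihilators_differ[of K L] insert L by auto
  have ab: "a \<in> carrier_vec n" "b \<in> carrier_vec n" using a b by (auto simp: annihilator_def)
  obtain c where c: "c \<in> carrier_vec n" "act L c *\<^sub>v (act L b *\<^sub>v z) = y"
    using simple_orbit[OF L act_el[OF Lo ab(2) b(2)] b(3) a(2)] by blast
  define d where "d = mul a (mul c b)"
  have cb: "mul c b \<in> carrier_vec n" by (rule alg_facts(4)[OF c(1) ab(2)])
  have d: "d \<in> carrier_vec n" unfolding d_def by (rule alg_facts(4)[OF ab(1) cb])
  have dx: "act X d *\<^sub>v x = act X a *\<^sub>v (act X c *\<^sub>v (act X b *\<^sub>v x))" if "X \<in> Ob C" "x \<in> el X" for X x
    unfolding d_def using act_mul_vec[OF that(1) ab(1) cb that(2)] act_mul_vec[OF that(1) c(1) ab(2) that(2)] by simp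
  have "act X d *\<^sub>v x = 0\<^sub>v (dm X)" if X: "X \<in> insert K S" and x: "x \<in> el X" for X x
  proof (cases "X = K")
    case True
    then show ?thesis
      using dx[OF Ko] x a(1) act_el[OF Ko c(1) act_el[OF Ko ab(2)]] by (simp add: annihilator_def)
  next
    case False
    then have "X \<in> S" and Xo: "X \<in> Ob C" using X insert simple_ob by auto
    then show ?thesis
      using dx[OF Xo x] x b(1) mult_mat_zero_vec[OF act_facts(1)[OF Xo c(1)]] mult_mat_zero_vec[OF act_facts(1)[OF Xo ab(1)]]
      by (simp add: annihilator_def)
  qed
  then have "d \<in> annihilator (insert K S) L 0" using d by (simp add: annihilator_def)
  moreover have "act L d *\<^sub>v z \<noteq> 0\<^sub>v (dm L)" using dx[OF Lo b(2)] c a by simp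
  ultimately show ?case using b by blast
qed

end

locale alg_closed_matrix_category = matrix_category C n mul u dm act mt
  for C :: "('o, 'm, 'k::alg_closed_field, 'z) lin_cat_scheme" (structure)
    and n mul u dm act mt
begin

text \<open>The matrix of \<open>f\<close> has an eigenvector \<open>v\<close>, say for \<open>c\<close>, and \<open>f - c\<close> is an endomorphism that is not
  injective.\<close>

lemma schur:
  assumes L: "simple_object C L" and f: "is_arr f" "src f = L" "tgt f = L"
  shows "\<exists>c. \<forall>x\<in>el L. mt f *\<^sub>v x = c \<cdot>\<^sub>v x"
proof -
  obtain c v where v: "v \<in> el L" "v \<noteq> 0\<^sub>v (dm L)" "mt f *\<^sub>v v = c \<cdot>\<^sub>v v"
    using eigenvector_exists[of "mt f" "dm L"] mt_mat[OF f(1)] f simple_dm_pos[OF L] by metis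
  have Lo: "L \<in> Ob C" by (rule simple_ob[OF L])
  have fe: "mt f *\<^sub>v x \<in> el L" if "x \<in> el L" for x using mt_el[OF f(1)] f that by simp
  obtain g where g: "is_arr g" "src g = L" "tgt g = L" "\<And>x. x \<in> el L \<Longrightarrow> mt g *\<^sub>v x = mt f *\<^sub>v x - c \<cdot>\<^sub>v x"
  proof (rule arr_of_linear[OF Lo Lo, of "\<lambda>x. mt f *\<^sub>v x - c \<cdot>\<^sub>v x"])
    fix x y a :: "'k vec" and k :: 'k
    assume x: "x \<in> el L"
    show "mt f *\<^sub>v x - c \<cdot>\<^sub>v x \<in> el L" using x fe by simp
    show "mt f *\<^sub>v (k \<cdot>\<^sub>v x) - c \<cdot>\<^sub>v (k \<cdot>\<^sub>v x) = k \<cdot>\<^sub>v (mt f *\<^sub>v x - c \<cdot>\<^sub>v x)"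
      using mt_vec_smult[OF f(1), of x k] x f minus_smult_linear(1)[OF fe[OF x] fe[OF x] x x] by simp
    {
      assume y: "y \<in> el L"
      show "mt f *\<^sub>v (x + y) - c \<cdot>\<^sub>v (x + y) = mt f *\<^sub>v x - c \<cdot>\<^sub>v x + (mt f *\<^sub>v y - c \<cdot>\<^sub>v y)"
        using mt_vec_add[OF f(1), of x y] x y f minus_smult_linear(2)[OF fe[OF x] fe[OF y] x y] by simp
    next
      assume a: "a \<in> carrier_vec n"
      show "mt f *\<^sub>v (act L a *\<^sub>v x) - c \<cdot>\<^sub>v (act L a *\<^sub>v x) = act L a *\<^sub>v (mt f *\<^sub>v x - c \<cdot>\<^sub>v x)"
        using mt_act_vec[OF f(1) a, of x] f x act_vec_smult[OF Lo a x, of c]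
          mult_minus_distrib_mat_vec[OF act_facts(1)[OF Lo a] fe[OF x], of "c \<cdot>\<^sub>v x"] by simp
    }
  qed blast
  have "mt g *\<^sub>v v = 0\<^sub>v (dm L)" using g(4)[OF v(1)] v by simp
  then have "\<not> inj_on_el g" using g(2,3) v unfolding inj_on_el_def by auto
  then have "g = zero_arr L L" using simple_nonzero_imp_inj[OF L g(1,2)] g by auto
  then have 0: "mt g = 0\<^sub>m (dm L) (dm L)" using Lo by simp
  have "mt f *\<^sub>v x = c \<cdot>\<^sub>v x" if x: "x \<in> el L" for x
    by (rule vec_eq_if_diff_zero[OF fe[OF x]]) (use g(4)[OF x] 0 x in auto)
  then show ?thesis by blast
qed

text \<open>A vector \<open>y\<close> that is killed by all elements killing \<open>S\<close> and \<open>e\<^sub>0, \<dots>, e\<^sub>i\<^sub>-\<^sub>1\<close> lies in the span of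
  these basis vectors. For the step, \<open>a e\<^sub>i \<mapsto> a y\<close> (for \<open>a\<close> killing \<open>S\<close> and
  \<open>e\<^sub>0, \<dots>, e\<^sub>i\<^sub>-\<^sub>1\<close>) is an endomorphism of \<open>L\<close>, hence a scalar \<open>c\<close>, and \<open>y - c e\<^sub>i\<close> falls under the
  induction hypothesis.\<close>

lemma annihilated_by_annihilator:
  assumes L: "simple_object C L" and S: "finite S" "\<And>K. K \<in> S \<Longrightarrow> simple_object C K \<and> \<not> isomorphic C K L"
    and "i \<le> dm L" "y \<in> el L" "\<And>a. a \<in> annihilator S L i \<Longrightarrow> act L a *\<^sub>v y = 0\<^sub>v (dm L)" "i \<le> j" "j < dm L"
  shows "y $ j = 0"
  using assms(4-8)
proof (induction i arbitrary: y j)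
  have Lo: "L \<in> Ob C" by (rule simple_ob[OF L])
  have So: "S \<subseteq> Ob C" using S simple_ob by blast
  note J = left_ideal_annihilator[OF So Lo]
  {
    case 0
    obtain a z where a: "a \<in> annihilator S L 0" "z \<in> el L" "act L a *\<^sub>v z \<noteq> 0\<^sub>v (dm L)"
      using annihilator_acts[OF L S] by blast
    have "y = 0\<^sub>v (dm L)"
    proof (rule ccontr)
      assume "y \<noteq> 0\<^sub>v (dm L)"
      then obtain b where b: "b \<in> carrier_vec n" "act L b *\<^sub>v y = z" using simple_orbit[OF L 0(2) _ a(2)] by blast
      have an: "a \<in> carrier_vec n" using a by (simp add: annihilator_def)
      have ab: "mul a b \<in> carrier_vec n" by (rule alg_facts(4)[OF an b(1)])
      have "mul a b \<in> annihilator S L 0"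
        using a(1) ab act_mul_vec[OF _ an b(1)] act_el[OF _ b(1)] So by (auto simp: annihilator_def)
      then have "act L (mul a b) *\<^sub>v y = 0\<^sub>v (dm L)" by (rule 0)
      then show False using act_mul_vec[OF Lo an b(1) 0(2)] b a by simp
    qed
    then show ?case using 0 by simp
  next
    case (Suc i)
    define v where "v = (unit_vec (dm L) i :: 'k vec)"
    have i: "i < dm L" and v: "v \<in> el L" using Suc.prems by (auto simp: v_def)
    have nz: "\<exists>a\<in>annihilator S L i. act L a *\<^sub>v v \<noteq> 0\<^sub>v (dm L)"
    proof (rule ccontr)
      assume "\<not> ?thesis"
      then have "v $ i = 0" using i v by (intro Suc.IH) auto
      then show False using i by (simp add: v_def)
    qed
    have aS: "act L a *\<^sub>v y = 0\<^sub>v (dm L)" if "a \<in> annihilator S L i" "act L a *\<^sub>v v = 0\<^sub>v (dm L)" for a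
      by (rule Suc.prems(3)) (use that in \<open>auto simp: annihilator_def v_def less_Suc_eq\<close>)
    obtain f where f: "is_arr f" "src f = L" "tgt f = L"
      and fa: "\<And>a. a \<in> annihilator S L i \<Longrightarrow> mt f *\<^sub>v (act L a *\<^sub>v v) = act L a *\<^sub>v y"
      using left_ideal_hom[OF L Lo J v Suc.prems(2) nz aS] by metis
    obtain c where c: "\<And>x. x \<in> el L \<Longrightarrow> mt f *\<^sub>v x = c \<cdot>\<^sub>v x" using schur[OF L f] by blast
    have "(y - c \<cdot>\<^sub>v v) $ j = 0"
    proof (rule Suc.IH)
      fix a assume a: "a \<in> annihilator S L i"
      then have an: "a \<in> carrier_vec n" by (simp add: annihilator_def)
      have "act L a *\<^sub>v (y - c \<cdot>\<^sub>v v) = act L a *\<^sub>v y - c \<cdot>\<^sub>v (act L a *\<^sub>v v)"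
        using mult_minus_distrib_mat_vec[OF act_facts(1)[OF Lo an] Suc.prems(2), of "c \<cdot>\<^sub>v v"]
          act_vec_smult[OF Lo an v, of c] v by simp
      then show "act L a *\<^sub>v (y - c \<cdot>\<^sub>v v) = 0\<^sub>v (dm L)"
        using fa[OF a] c[OF act_el[OF Lo an v]] act_el[OF Lo an Suc.prems(2)] by simp
    qed (use Suc.prems v in auto)
    then show ?case using Suc.prems v by (simp add: v_def)
  }
qed

text \<open>The last basis vector of \<open>L\<close> is not in the span of the others. So something kills \<open>S\<close> and all
  the other basis vectors, but not the last one.\<close>

lemma rank_one_element:
  assumes L: "simple_object C L" and S: "finite S" "\<And>K. K \<in> S \<Longrightarrow> simple_object C K \<and> \<not> isomorphic C K L"
  obtains b y j where "b \<in> carrier_vec n" "\<And>K x. K \<in> S \<Longrightarrow> x \<in> el K \<Longrightarrow> act K b *\<^sub>v x = 0\<^sub>v (dm K)"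
    "j < dm L" "y \<in> el L" "y \<noteq> 0\<^sub>v (dm L)" "\<And>x. x \<in> el L \<Longrightarrow> act L b *\<^sub>v x = x $ j \<cdot>\<^sub>v y"
proof -
  have Lo: "L \<in> Ob C" by (rule simple_ob[OF L])
  define j where "j = dm L - 1"
  have j: "j < dm L" "Suc j = dm L" using simple_dm_pos[OF L] by (auto simp: j_def)
  define y where "y b = act L b *\<^sub>v unit_vec (dm L) j" for b
  obtain b where b: "b \<in> annihilator S L j" "y b \<noteq> 0\<^sub>v (dm L)"
  proof (rule ccontr)
    assume "\<not> thesis"
    then have "unit_vec (dm L) j $ j = (0::'k)"
      using that j by (intro annihilated_by_annihilator[OF L S, of j]) (auto simp: y_def)
    then show False using j by simp
  qed
  have bn: "b \<in> carrier_vec n" using b by (simp add: annihilator_def)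
  have yb: "y b \<in> el L" unfolding y_def by (rule act_el[OF Lo bn]) simp
  have "act L b *\<^sub>v x = x $ j \<cdot>\<^sub>v y b" if "x \<in> el L" for x
    using that
  proof (induction x rule: unit_vec_induct)
    case zero
    show ?case using mult_mat_zero_vec[OF act_facts(1)[OF Lo bn]] zero_smult_vec[OF yb] j by simp
  next
    case (add w c i)
    have "act L b *\<^sub>v unit_vec (dm L) i = (if i = j then y b else 0\<^sub>v (dm L))"
      using b(1) add j by (auto simp: annihilator_def y_def)
    then show ?case
      using add act_vec_add[OF Lo bn, of w "c \<cdot>\<^sub>v unit_vec (dm L) i"]
        act_vec_smult[OF Lo bn, of "unit_vec (dm L) i" c] yb j
      by (auto simp: add_smult_distrib_vec)
  qed
  then show ?thesis using that[OF bn _ j(1) yb b(2)] b(1) by (auto simp: annihilator_def)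
qed

end

section \<open>The regular and the coregular module\<close>

lemma lin_map_vec_zero:
  fixes h :: "'k::field vec \<Rightarrow> 'v"
  assumes "vectorspace class_ring V" "h \<in> lin_maps (module_vec TYPE('k) d) V"
  shows "h (0\<^sub>v d) = \<zero>\<^bsub>V\<^esub>"
proof -
  interpret V: vectorspace class_ring V by fact
  note h = lin_mapsD[OF assms(2), unfolded module_vec_simps]
  have "h (0 \<cdot>\<^sub>v 0\<^sub>v d) = 0 \<odot>\<^bsub>V\<^esub> h (0\<^sub>v d)" by (rule h(3)) simp
  then show ?thesis using V.lmult_0[of "h (0\<^sub>v d)"] h(1)[of "0\<^sub>v d"] by simp
qed

lemma lin_map_vec_expand:
  fixes h :: "'k::field vec \<Rightarrow> 'v"
  assumes V: "vectorspace class_ring V" and h: "h \<in> lin_maps (module_vec TYPE('k) d) V" and v: "v \<in> carrier_vec d"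
  shows "h v = (\<Oplus>\<^bsub>V\<^esub>i\<in>{..<d}. v $ i \<odot>\<^bsub>V\<^esub> h (unit_vec d i))"
proof -
  interpret V: vectorspace class_ring V by fact
  note h' = lin_mapsD[OF h, unfolded module_vec_simps]
  have e: "h (unit_vec d i) \<in> carrier V" for i by (rule h'(1)) simp
  have l0: "0 \<odot>\<^bsub>V\<^esub> x = \<zero>\<^bsub>V\<^esub>" if "x \<in> carrier V" for x using V.lmult_0[OF that] by simp
  have sm: "c \<odot>\<^bsub>V\<^esub> x \<in> carrier V" if "x \<in> carrier V" for c x using V.smult_closed[of c x] that by simp
  have ld: "(a + b) \<odot>\<^bsub>V\<^esub> x = a \<odot>\<^bsub>V\<^esub> x \<oplus>\<^bsub>V\<^esub> b \<odot>\<^bsub>V\<^esub> x" if "x \<in> carrier V" for a b x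
    using V.smult_l_distr[of a b x] that by simp
  show ?thesis
    using v
  proof (induction v rule: unit_vec_induct)
    case zero
    have "(\<Oplus>\<^bsub>V\<^esub>i\<in>{..<d}. 0\<^sub>v d $ i \<odot>\<^bsub>V\<^esub> h (unit_vec d i)) = (\<Oplus>\<^bsub>V\<^esub>i\<in>{..<d}. \<zero>\<^bsub>V\<^esub>)"
      by (rule V.finsum_cong') (auto simp: l0 e)
    then show ?case using lin_map_vec_zero[OF V h] by simp
  next
    case (add w c k)
    have "(\<Oplus>\<^bsub>V\<^esub>i\<in>{..<d}. (w + c \<cdot>\<^sub>v unit_vec d k) $ i \<odot>\<^bsub>V\<^esub> h (unit_vec d i))
        = (\<Oplus>\<^bsub>V\<^esub>i\<in>{..<d}. w $ i \<odot>\<^bsub>V\<^esub> h (unit_vec d i) \<oplus>\<^bsub>V\<^esub> (if k = i then c \<odot>\<^bsub>V\<^esub> h (unit_vec d i) else \<zero>\<^bsub>V\<^esub>))"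
      by (rule V.finsum_cong') (use add in \<open>auto simp: ld l0 e sm\<close>)
    also have "\<dots> = (\<Oplus>\<^bsub>V\<^esub>i\<in>{..<d}. w $ i \<odot>\<^bsub>V\<^esub> h (unit_vec d i)) \<oplus>\<^bsub>V\<^esub>
        (\<Oplus>\<^bsub>V\<^esub>i\<in>{..<d}. if k = i then c \<odot>\<^bsub>V\<^esub> h (unit_vec d i) else \<zero>\<^bsub>V\<^esub>)"
      by (rule V.finsum_addf) (auto simp: e sm)
    also have "(\<Oplus>\<^bsub>V\<^esub>i\<in>{..<d}. if k = i then c \<odot>\<^bsub>V\<^esub> h (unit_vec d i) else \<zero>\<^bsub>V\<^esub>) = c \<odot>\<^bsub>V\<^esub> h (unit_vec d k)"
      by (rule V.finsum_singleton) (use add in \<open>auto simp: e sm\<close>)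
    finally show ?case using add h'(2)[of w "c \<cdot>\<^sub>v unit_vec d k"] h'(3)[of "unit_vec d k" c] by simp
  qed
qed

text \<open>Both sides are the sum of \<open>U\<^sub>b\<^sub>a \<gamma>(e\<^sub>b, e\<^sub>a)\<close> over all \<open>a\<close> and \<open>b\<close>: under a trace an operator may be
  moved from one argument to the other.\<close>

lemma bilinear_trace:
  fixes \<gamma> :: "'k::field vec \<Rightarrow> 'k vec \<Rightarrow> 'v"
  assumes V: "vectorspace class_ring V"
    and l: "\<And>\<phi>. \<phi> \<in> carrier_vec d \<Longrightarrow> (\<lambda>x. \<gamma> x \<phi>) \<in> lin_maps (module_vec TYPE('k) d') V"
    and r: "\<And>x. x \<in> carrier_vec d' \<Longrightarrow> \<gamma> x \<in> lin_maps (module_vec TYPE('k) d) V"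
    and U: "U \<in> carrier_mat d' d"
  shows "(\<Oplus>\<^bsub>V\<^esub>a\<in>{..<d}. \<gamma> (U *\<^sub>v unit_vec d a) (unit_vec d a)) =
    (\<Oplus>\<^bsub>V\<^esub>b\<in>{..<d'}. \<gamma> (unit_vec d' b) (transpose_mat U *\<^sub>v unit_vec d' b))"
proof -
  interpret V: vectorspace class_ring V by fact
  have U': "transpose_mat U \<in> carrier_mat d d'" using U by simp
  have \<gamma>: "\<gamma> x y \<in> carrier V" if "x \<in> carrier_vec d'" "y \<in> carrier_vec d" for x y
    using lin_mapsD(1)[OF r[OF that(1)]] that by (simp add: module_vec_simps)
  have sm: "c \<odot>\<^bsub>V\<^esub> x \<in> carrier V" if "x \<in> carrier V" for c x using V.smult_closed[of c x] that by simp
  have "(\<Oplus>\<^bsub>V\<^esub>a\<in>{..<d}. \<gamma> (U *\<^sub>v unit_vec d a) (unit_vec d a))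
      = (\<Oplus>\<^bsub>V\<^esub>a\<in>{..<d}. \<Oplus>\<^bsub>V\<^esub>b\<in>{..<d'}. U $$ (b, a) \<odot>\<^bsub>V\<^esub> \<gamma> (unit_vec d' b) (unit_vec d a))"
  proof (rule V.finsum_cong')
    show "(\<lambda>a. \<Oplus>\<^bsub>V\<^esub>b\<in>{..<d'}. U $$ (b, a) \<odot>\<^bsub>V\<^esub> \<gamma> (unit_vec d' b) (unit_vec d a)) \<in> {..<d} \<rightarrow> carrier V"
      by (auto intro!: V.finsum_closed sm \<gamma>)
    fix a assume "a \<in> {..<d}"
    then have a: "a < d" by simp
    have "\<gamma> (U *\<^sub>v unit_vec d a) (unit_vec d a) = (\<Oplus>\<^bsub>V\<^esub>b\<in>{..<d'}. (U *\<^sub>v unit_vec d a) $ b \<odot>\<^bsub>V\<^esub> \<gamma> (unit_vec d' b) (unit_vec d a))"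
      using U by (intro lin_map_vec_expand[OF V l]) auto
    also have "\<dots> = (\<Oplus>\<^bsub>V\<^esub>b\<in>{..<d'}. U $$ (b, a) \<odot>\<^bsub>V\<^esub> \<gamma> (unit_vec d' b) (unit_vec d a))"
      using U a by (intro V.finsum_cong') (auto simp: mult_unit_vec[OF U a] intro!: sm \<gamma>)
    finally show "\<gamma> (U *\<^sub>v unit_vec d a) (unit_vec d a) = (\<Oplus>\<^bsub>V\<^esub>b\<in>{..<d'}. U $$ (b, a) \<odot>\<^bsub>V\<^esub> \<gamma> (unit_vec d' b) (unit_vec d a))" .
  qed simp
  also have "\<dots> = (\<Oplus>\<^bsub>V\<^esub>b\<in>{..<d'}. \<Oplus>\<^bsub>V\<^esub>a\<in>{..<d}. U $$ (b, a) \<odot>\<^bsub>V\<^esub> \<gamma> (unit_vec d' b) (unit_vec d a))"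
    by (rule finsum_swap[OF V]) (auto intro!: sm \<gamma>)
  also have "\<dots> = (\<Oplus>\<^bsub>V\<^esub>b\<in>{..<d'}. \<gamma> (unit_vec d' b) (transpose_mat U *\<^sub>v unit_vec d' b))"
  proof (rule V.finsum_cong')
    show "(\<lambda>b. \<gamma> (unit_vec d' b) (transpose_mat U *\<^sub>v unit_vec d' b)) \<in> {..<d'} \<rightarrow> carrier V"
      using mult_mat_vec_carrier[OF U'] by (auto intro!: \<gamma>)
    fix b assume "b \<in> {..<d'}"
    then have b: "b < d'" by simp
    have "\<gamma> (unit_vec d' b) (transpose_mat U *\<^sub>v unit_vec d' b)
        = (\<Oplus>\<^bsub>V\<^esub>a\<in>{..<d}. (transpose_mat U *\<^sub>v unit_vec d' b) $ a \<odot>\<^bsub>V\<^esub> \<gamma> (unit_vec d' b) (unit_vec d a))"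
      using U' by (intro lin_map_vec_expand[OF V r]) auto
    also have "\<dots> = (\<Oplus>\<^bsub>V\<^esub>a\<in>{..<d}. U $$ (b, a) \<odot>\<^bsub>V\<^esub> \<gamma> (unit_vec d' b) (unit_vec d a))"
      using U b by (intro V.finsum_cong') (auto simp: mult_unit_vec[OF U' b] intro!: sm \<gamma>)
    finally show "(\<Oplus>\<^bsub>V\<^esub>a\<in>{..<d}. U $$ (b, a) \<odot>\<^bsub>V\<^esub> \<gamma> (unit_vec d' b) (unit_vec d a))
        = \<gamma> (unit_vec d' b) (transpose_mat U *\<^sub>v unit_vec d' b)" by simp
  qed simp
  finally show ?thesis .
qed

lemma scalar_prod_ext:
  fixes v w :: "'k::field vec"
  assumes "v \<in> carrier_vec d" "w \<in> carrier_vec d" "\<And>c. c \<in> carrier_vec d \<Longrightarrow> c \<bullet> v = c \<bullet> w"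
  shows "v = w"
proof (rule eq_vecI)
  fix i assume "i < dim_vec w"
  then show "v $ i = w $ i" using assms(3)[of "unit_vec d i"] assms(1,2) by (simp add: scalar_prod_left_unit[of _ d])
qed (use assms in auto)

context matrix_category
begin

lemma lin_maps_into_hom:
  fixes p :: "'k vec \<Rightarrow> 'm"
  assumes XY: "X \<in> Ob C" "Y \<in> Ob C"
    and p: "\<And>x. x \<in> carrier_vec d \<Longrightarrow> is_arr (p x) \<and> src (p x) = X \<and> tgt (p x) = Y"
    and add: "\<And>x y z. x \<in> carrier_vec d \<Longrightarrow> y \<in> carrier_vec d \<Longrightarrow> z \<in> el X \<Longrightarrow>
      mt (p (x + y)) *\<^sub>v z = mt (p x) *\<^sub>v z + mt (p y) *\<^sub>v z"
    and smult: "\<And>c x z. x \<in> carrier_vec d \<Longrightarrow> z \<in> el X \<Longrightarrow> mt (p (c \<cdot>\<^sub>v x)) *\<^sub>v z = c \<cdot>\<^sub>v (mt (p x) *\<^sub>v z)"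
  shows "p \<in> lin_maps (module_vec TYPE('k) d) (Hom C X Y)"
proof (rule lin_mapsI, unfold module_vec_simps)
  interpret V: vectorspace class_ring "Hom C X Y" using XY by (rule hom_space)
  fix x :: "'k vec" assume x: "x \<in> carrier_vec d"
  show px: "p x \<in> Arr C X Y" using p[OF x] by (auto intro: arrI)
  have mx: "mt (p x) \<in> carrier_mat (dm Y) (dm X)" using mt_mat[of "p x"] p[OF x] by simp
  {
    fix y :: "'k vec" assume y: "y \<in> carrier_vec d"
    have py: "p y \<in> Arr C X Y" using p[OF y] by (auto intro: arrI)
    have my: "mt (p y) \<in> carrier_mat (dm Y) (dm X)" using mt_mat[of "p y"] p[OF y] by simp
    have xy: "x + y \<in> carrier_vec d" using x y by simp
    have s: "p x \<oplus>\<^bsub>Hom C X Y\<^esub> p y \<in> Arr C X Y" using px py by simp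
    show "p (x + y) = p x \<oplus>\<^bsub>Hom C X Y\<^esub> p y"
    proof (rule arr_eq_vecI)
      fix z assume "z \<in> el (src (p (x + y)))"
      then have z: "z \<in> el X" using p[OF xy] by simp
      show "mt (p (x + y)) *\<^sub>v z = mt (p x \<oplus>\<^bsub>Hom C X Y\<^esub> p y) *\<^sub>v z"
        using mt_add[OF XY px py] add[OF x y z] add_mult_distrib_mat_vec[OF mx my z] by simp
    qed (use p[OF xy] arrD[OF s XY] in auto)
  next
    fix c :: 'k
    have cx: "c \<cdot>\<^sub>v x \<in> carrier_vec d" using x by simp
    have s: "c \<odot>\<^bsub>Hom C X Y\<^esub> p x \<in> Arr C X Y" using V.smult_closed[of c "p x"] px by simp
    show "p (c \<cdot>\<^sub>v x) = c \<odot>\<^bsub>Hom C X Y\<^esub> p x"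
    proof (rule arr_eq_vecI)
      fix z assume "z \<in> el (src (p (c \<cdot>\<^sub>v x)))"
      then have z: "z \<in> el X" using p[OF cx] by simp
      have "(c \<cdot>\<^sub>m mt (p x)) *\<^sub>v z = c \<cdot>\<^sub>v (mt (p x) *\<^sub>v z)" using mx z by (intro eq_vecI) auto
      then show "mt (p (c \<cdot>\<^sub>v x)) *\<^sub>v z = mt (c \<odot>\<^bsub>Hom C X Y\<^esub> p x) *\<^sub>v z"
        using mt_smult[OF XY px] smult[OF x z] by simp
    qed (use p[OF cx] arrD[OF s XY] in auto)
  }
qed

lemma algebra_rep:
  assumes h: "\<And>a v. a \<in> carrier_vec n \<Longrightarrow> v \<in> carrier_vec n \<Longrightarrow> \<rho> a *\<^sub>v v = h a v"
    and \<rho>: "\<And>a. a \<in> carrier_vec n \<Longrightarrow> \<rho> a \<in> carrier_mat n n"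
    and add: "\<And>a b v. a \<in> carrier_vec n \<Longrightarrow> b \<in> carrier_vec n \<Longrightarrow> v \<in> carrier_vec n \<Longrightarrow> h (a + b) v = h a v + h b v"
    and smult: "\<And>a c v. a \<in> carrier_vec n \<Longrightarrow> v \<in> carrier_vec n \<Longrightarrow> h (c \<cdot>\<^sub>v a) v = c \<cdot>\<^sub>v h a v"
    and unit: "\<And>v. v \<in> carrier_vec n \<Longrightarrow> h u v = v"
    and mult: "\<And>a b v. a \<in> carrier_vec n \<Longrightarrow> b \<in> carrier_vec n \<Longrightarrow> v \<in> carrier_vec n \<Longrightarrow> h (mul a b) v = h a (h b v)"
  shows "fd_rep n mul u n \<rho>"
  unfolding fd_rep_def
proof (intro conjI ballI allI)
  fix a b :: "'k vec" and c assume a: "a \<in> carrier_vec n"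
  show "\<rho> a \<in> carrier_mat n n" by (rule \<rho>[OF a])
  have ca: "c \<cdot>\<^sub>v a \<in> carrier_vec n" using a by simp
  show "\<rho> (c \<cdot>\<^sub>v a) = c \<cdot>\<^sub>m \<rho> a"
  proof (rule eq_mat_if_mult_vec[OF \<rho>[OF ca]])
    show "c \<cdot>\<^sub>m \<rho> a \<in> carrier_mat n n" using \<rho>[OF a] by simp
    fix v :: "'k vec" assume v: "v \<in> carrier_vec n"
    have "(c \<cdot>\<^sub>m \<rho> a) *\<^sub>v v = c \<cdot>\<^sub>v (\<rho> a *\<^sub>v v)" using \<rho>[OF a] v by (intro eq_vecI) auto
    then show "\<rho> (c \<cdot>\<^sub>v a) *\<^sub>v v = c \<cdot>\<^sub>m \<rho> a *\<^sub>v v" using smult[OF a v] h[OF a v] h[OF ca v] by simp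
  qed
  assume b: "b \<in> carrier_vec n"
  have ab: "a + b \<in> carrier_vec n" using a b by simp
  show "\<rho> (a + b) = \<rho> a + \<rho> b"
  proof (rule eq_mat_if_mult_vec[OF \<rho>[OF ab]])
    show "\<rho> a + \<rho> b \<in> carrier_mat n n" using \<rho>[OF b] by simp
    fix v :: "'k vec" assume v: "v \<in> carrier_vec n"
    show "\<rho> (a + b) *\<^sub>v v = (\<rho> a + \<rho> b) *\<^sub>v v"
      using add[OF a b v] h[OF ab v] h[OF a v] h[OF b v] add_mult_distrib_mat_vec[OF \<rho>[OF a] \<rho>[OF b] v] by simp
  qed
  show "\<rho> (mul a b) = \<rho> a * \<rho> b"
  proof (rule eq_mat_if_mult_vec[OF \<rho>[OF alg_facts(4)[OF a b]] mult_carrier_mat[OF \<rho>[OF a] \<rho>[OF b]]])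
    fix v :: "'k vec" assume v: "v \<in> carrier_vec n"
    have "h b v \<in> carrier_vec n" using h[OF b v] mult_mat_vec_carrier[OF \<rho>[OF b] v] by simp
    then show "\<rho> (mul a b) *\<^sub>v v = \<rho> a * \<rho> b *\<^sub>v v"
      using mult[OF a b v] h[OF alg_facts(4)[OF a b] v] h[OF b v] h[OF a]
        assoc_mult_mat_vec[OF \<rho>[OF a] \<rho>[OF b] v] by simp
  qed
next
  show "\<rho> u = 1\<^sub>m n"
    by (rule eq_mat_if_mult_vec[OF \<rho>[OF u_carrier]]) (auto simp: h unit)
qed

lemma realize_vec:
  assumes "fd_rep n mul u n \<rho>"
  obtains X S S' where "X \<in> Ob C" "S \<in> carrier_mat n (dm X)" "S' \<in> carrier_mat (dm X) n"
    "\<And>v. v \<in> carrier_vec n \<Longrightarrow> S *\<^sub>v (S' *\<^sub>v v) = v" "\<And>x. x \<in> el X \<Longrightarrow> S' *\<^sub>v (S *\<^sub>v x) = x"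
    "\<And>a x. a \<in> carrier_vec n \<Longrightarrow> x \<in> el X \<Longrightarrow> S *\<^sub>v (act X a *\<^sub>v x) = \<rho> a *\<^sub>v (S *\<^sub>v x)"
proof -
  obtain X S S' where X: "X \<in> Ob C" and S: "S \<in> carrier_mat n (dm X)" "S' \<in> carrier_mat (dm X) n"
    and e: "S * S' = 1\<^sub>m n" "S' * S = 1\<^sub>m (dm X)" and a: "\<And>a. a \<in> carrier_vec n \<Longrightarrow> S * act X a = \<rho> a * S"
    using realize[OF assms] by metis
  have \<rho>: "\<rho> a \<in> carrier_mat n n" if "a \<in> carrier_vec n" for a using assms that by (simp add: fd_rep_def)
  show ?thesis
  proof (rule that[OF X S])
    show "S *\<^sub>v (S' *\<^sub>v v) = v" if "v \<in> carrier_vec n" for v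
      using assoc_mult_mat_vec[OF S that] e that by simp
    show "S' *\<^sub>v (S *\<^sub>v x) = x" if "x \<in> el X" for x
      using assoc_mult_mat_vec[OF S(2,1) that] e that by simp
    show "S *\<^sub>v (act X a *\<^sub>v x) = \<rho> a *\<^sub>v (S *\<^sub>v x)" if "a \<in> carrier_vec n" "x \<in> el X" for a x
      using assoc_mult_mat_vec[OF S(1) act_facts(1)[OF X that(1)] that(2)] a[OF that(1)]
        assoc_mult_mat_vec[OF \<rho>[OF that(1)] S(1) that(2)] by simp
  qed
qed

text \<open>The regular module \<open>R\<close> represents the underlying space: \<open>pt X x : R \<rightarrow> X\<close> sends the unit of the
  algebra to \<open>x\<close>, hence \<open>a\<close> to \<open>a x\<close>.\<close>

definition point_family :: "'o \<Rightarrow> ('o \<Rightarrow> 'k vec \<Rightarrow> 'm) \<Rightarrow> bool" where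
  "point_family R pt \<longleftrightarrow> R \<in> Ob C \<and>
     (\<forall>X\<in>Ob C. \<forall>x\<in>el X. is_arr (pt X x) \<and> src (pt X x) = R \<and> tgt (pt X x) = X) \<and>
     (\<forall>X\<in>Ob C. pt X \<in> lin_maps (module_vec TYPE('k) (dm X)) (Hom C R X)) \<and>
     (\<forall>f. is_arr f \<longrightarrow> (\<forall>x\<in>el (src f). f \<cdot> pt (src f) x = pt (tgt f) (mt f *\<^sub>v x))) \<and>
     (\<forall>f. is_arr f \<longrightarrow> src f = R \<longrightarrow> (\<exists>x\<in>el (tgt f). f = pt (tgt f) x)) \<and>
     (\<forall>X\<in>Ob C. \<forall>x\<in>el X. pt X x = zero_arr R X \<longrightarrow> x = 0\<^sub>v (dm X)) \<and>
     (\<forall>X\<in>Ob C. \<forall>x\<in>el X. (\<forall>y\<in>el X. \<exists>a\<in>carrier_vec n. act X a *\<^sub>v x = y) \<longrightarrow> surj_on_el (pt X x))"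

lemma point_familyD:
  assumes "point_family R pt"
  shows "R \<in> Ob C"
    "X \<in> Ob C \<Longrightarrow> x \<in> el X \<Longrightarrow> is_arr (pt X x)"
    "X \<in> Ob C \<Longrightarrow> x \<in> el X \<Longrightarrow> src (pt X x) = R"
    "X \<in> Ob C \<Longrightarrow> x \<in> el X \<Longrightarrow> tgt (pt X x) = X"
    "X \<in> Ob C \<Longrightarrow> pt X \<in> lin_maps (module_vec TYPE('k) (dm X)) (Hom C R X)"
    "is_arr f \<Longrightarrow> x \<in> el (src f) \<Longrightarrow> f \<cdot> pt (src f) x = pt (tgt f) (mt f *\<^sub>v x)"
    "is_arr f \<Longrightarrow> src f = R \<Longrightarrow> \<exists>x\<in>el (tgt f). f = pt (tgt f) x"
    "X \<in> Ob C \<Longrightarrow> x \<in> el X \<Longrightarrow> pt X x = zero_arr R X \<Longrightarrow> x = 0\<^sub>v (dm X)"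
    "X \<in> Ob C \<Longrightarrow> x \<in> el X \<Longrightarrow> \<forall>y\<in>el X. \<exists>a\<in>carrier_vec n. act X a *\<^sub>v x = y \<Longrightarrow> surj_on_el (pt X x)"
  using assms unfolding point_family_def by blast+

text \<open>The isomorphism \<open>S\<close> identifies \<open>R\<close> with the algebra. As it is available only up to this
  isomorphism, \<open>pt X x\<close> sends \<open>r\<close> to \<open>(S r) x\<close>, and \<open>r1\<close> plays the part of the unit.\<close>

lemma regular_object:
  obtains R pt where "point_family R pt"
proof -
  have "\<exists>A. A \<in> carrier_mat n n \<and> (\<forall>v\<in>carrier_vec n. A *\<^sub>v v = mul a v)" if a: "a \<in> carrier_vec n" for a
    by (rule linear_map_matrix[where f = "mul a" and n = n and m = n]) (use a alg_facts in auto)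
  then obtain \<rho> where \<rho>: "\<And>a. a \<in> carrier_vec n \<Longrightarrow> \<rho> a \<in> carrier_mat n n"
      "\<And>a v. a \<in> carrier_vec n \<Longrightarrow> v \<in> carrier_vec n \<Longrightarrow> \<rho> a *\<^sub>v v = mul a v"
    by metis
  have "fd_rep n mul u n \<rho>"
    by (rule algebra_rep[where h = mul]) (use \<rho> in \<open>auto simp: alg_facts\<close>)
  then obtain R S S' where R: "R \<in> Ob C" and S: "S \<in> carrier_mat n (dm R)" "S' \<in> carrier_mat (dm R) n"
    and SS: "\<And>v. v \<in> carrier_vec n \<Longrightarrow> S *\<^sub>v (S' *\<^sub>v v) = v" "\<And>x. x \<in> el R \<Longrightarrow> S' *\<^sub>v (S *\<^sub>v x) = x"
    and Sa: "\<And>a x. a \<in> carrier_vec n \<Longrightarrow> x \<in> el R \<Longrightarrow> S *\<^sub>v (act R a *\<^sub>v x) = \<rho> a *\<^sub>v (S *\<^sub>v x)"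
    using realize_vec by metis
  have Sn: "S *\<^sub>v r \<in> carrier_vec n" if "r \<in> el R" for r by (rule mult_mat_vec_carrier[OF S(1) that])
  have S'n: "S' *\<^sub>v v \<in> el R" if "v \<in> carrier_vec n" for v by (rule mult_mat_vec_carrier[OF S(2) that])
  define r1 where "r1 = S' *\<^sub>v u"
  have r1: "r1 \<in> el R" "S *\<^sub>v r1 = u" using S'n[of u] SS(1)[of u] by (auto simp: r1_def)
  have Sa': "S *\<^sub>v (act R a *\<^sub>v x) = mul a (S *\<^sub>v x)" if "a \<in> carrier_vec n" "x \<in> el R" for a x
    using Sa[OF that] \<rho>(2)[OF that(1) Sn[OF that(2)]] by simp
  have gen: "r = act R (S *\<^sub>v r) *\<^sub>v r1" if r: "r \<in> el R" for r
  proof -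
    have "S *\<^sub>v (act R (S *\<^sub>v r) *\<^sub>v r1) = S *\<^sub>v r" using Sa'[OF Sn[OF r] r1(1)] r1 alg_facts(3)[OF Sn[OF r]] by simp
    then show ?thesis using SS(2)[OF r] SS(2)[OF act_el[OF R Sn[OF r] r1(1)]] by simp
  qed
  define pt where "pt X x = (SOME f. is_arr f \<and> src f = R \<and> tgt f = X \<and> (\<forall>r\<in>el R. mt f *\<^sub>v r = act X (S *\<^sub>v r) *\<^sub>v x))" for X x
  have pt: "is_arr (pt X x) \<and> src (pt X x) = R \<and> tgt (pt X x) = X \<and> (\<forall>r\<in>el R. mt (pt X x) *\<^sub>v r = act X (S *\<^sub>v r) *\<^sub>v x)"
    if X: "X \<in> Ob C" and x: "x \<in> el X" for X x
  proof -
    have "\<exists>f. is_arr f \<and> src f = R \<and> tgt f = X \<and> (\<forall>r\<in>el R. mt f *\<^sub>v r = act X (S *\<^sub>v r) *\<^sub>v x)"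
    proof (rule arr_of_linear[OF R X, of "\<lambda>r. act X (S *\<^sub>v r) *\<^sub>v x"])
      fix r r' a :: "'k vec" and c :: 'k
      assume r: "r \<in> el R"
      show "act X (S *\<^sub>v r) *\<^sub>v x \<in> el X" by (rule act_el[OF X Sn[OF r] x])
      show "act X (S *\<^sub>v (c \<cdot>\<^sub>v r)) *\<^sub>v x = c \<cdot>\<^sub>v (act X (S *\<^sub>v r) *\<^sub>v x)"
        using mult_mat_vec[OF S(1) r] act_smult_vec[OF X Sn[OF r] x] by simp
      {
        assume r': "r' \<in> el R"
        show "act X (S *\<^sub>v (r + r')) *\<^sub>v x = act X (S *\<^sub>v r) *\<^sub>v x + act X (S *\<^sub>v r') *\<^sub>v x"
          using mult_add_distrib_mat_vec[OF S(1) r r'] act_add_vec[OF X Sn[OF r] Sn[OF r'] x] by simp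
      next
        assume a: "a \<in> carrier_vec n"
        show "act X (S *\<^sub>v (act R a *\<^sub>v r)) *\<^sub>v x = act X a *\<^sub>v (act X (S *\<^sub>v r) *\<^sub>v x)"
          using Sa'[OF a r] act_mul_vec[OF X a Sn[OF r] x] by simp
      }
    qed blast
    from someI_ex[OF this] show ?thesis unfolding pt_def .
  qed
  have pt_r1: "mt (pt X x) *\<^sub>v r1 = x" if "X \<in> Ob C" "x \<in> el X" for X x
    using pt[OF that] r1 that by simp
  show ?thesis
  proof (rule that, unfold point_family_def, intro conjI ballI allI impI)
    show "R \<in> Ob C" by (rule R)
    show "is_arr (pt X x)" "src (pt X x) = R" "tgt (pt X x) = X" if "X \<in> Ob C" "x \<in> el X" for X x
      using pt[OF that] by blast+
    show "pt X \<in> lin_maps (module_vec TYPE('k) (dm X)) (Hom C R X)" if X: "X \<in> Ob C" for X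
    proof (rule lin_maps_into_hom[OF R X])
      fix x y z :: "'k vec" and c :: 'k assume x: "x \<in> el X"
      show "is_arr (pt X x) \<and> src (pt X x) = R \<and> tgt (pt X x) = X" using pt[OF X x] by blast
      assume z: "z \<in> el R"
      have cx: "c \<cdot>\<^sub>v x \<in> el X" using x by simp
      show "mt (pt X (c \<cdot>\<^sub>v x)) *\<^sub>v z = c \<cdot>\<^sub>v (mt (pt X x) *\<^sub>v z)"
        using pt[OF X x] pt[OF X cx] z act_vec_smult[OF X Sn[OF z] x] by simp
      assume y: "y \<in> el X"
      have xy: "x + y \<in> el X" using x y by simp
      show "mt (pt X (x + y)) *\<^sub>v z = mt (pt X x) *\<^sub>v z + mt (pt X y) *\<^sub>v z"
        using pt[OF X x] pt[OF X y] pt[OF X xy] z act_vec_add[OF X Sn[OF z] x y] by simp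
    qed
    show "f \<cdot> pt (src f) x = pt (tgt f) (mt f *\<^sub>v x)" if f: "is_arr f" and x: "x \<in> el (src f)" for f x
    proof (rule arr_eq_vecI)
      note p = pt[OF src_ob[OF f] x] and p' = pt[OF tgt_ob[OF f] mt_el[OF f x]]
      show "is_arr (f \<cdot> pt (src f) x)" "is_arr (pt (tgt f) (mt f *\<^sub>v x))" "src (f \<cdot> pt (src f) x) = src (pt (tgt f) (mt f *\<^sub>v x))"
        "tgt (f \<cdot> pt (src f) x) = tgt (pt (tgt f) (mt f *\<^sub>v x))"
        using p p' f by auto
      fix r assume "r \<in> el (src (f \<cdot> pt (src f) x))"
      then have r: "r \<in> el R" using p f by simp
      have "mt (f \<cdot> pt (src f) x) *\<^sub>v r = mt f *\<^sub>v (act (src f) (S *\<^sub>v r) *\<^sub>v x)"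
        using mt_comp_vec[of "pt (src f) x" f r] p f r by simp
      also have "\<dots> = act (tgt f) (S *\<^sub>v r) *\<^sub>v (mt f *\<^sub>v x)" by (rule mt_act_vec[OF f Sn[OF r] x])
      finally show "mt (f \<cdot> pt (src f) x) *\<^sub>v r = mt (pt (tgt f) (mt f *\<^sub>v x)) *\<^sub>v r" using p' r by simp
    qed
    show "\<exists>x\<in>el (tgt f). f = pt (tgt f) x" if f: "is_arr f" "src f = R" for f
    proof
      show x: "mt f *\<^sub>v r1 \<in> el (tgt f)" using mt_el[OF f(1)] r1 f by simp
      note p = pt[OF tgt_ob[OF f(1)] x]
      show "f = pt (tgt f) (mt f *\<^sub>v r1)"
      proof (rule arr_eq_vecI)
        fix r assume "r \<in> el (src f)"
        then have r: "r \<in> el R" using f by simp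
        show "mt f *\<^sub>v r = mt (pt (tgt f) (mt f *\<^sub>v r1)) *\<^sub>v r"
          using gen[OF r] mt_act_vec[OF f(1) Sn[OF r], of r1] r1 p f r by simp
      qed (use f p in auto)
    qed
    show "x = 0\<^sub>v (dm X)" if X: "X \<in> Ob C" "x \<in> el X" and "pt X x = zero_arr R X" for X x
      using pt_r1[OF X] that(3) R X r1 by simp
    show "surj_on_el (pt X x)"
      if X: "X \<in> Ob C" "x \<in> el X" and s: "\<forall>y\<in>el X. \<exists>a\<in>carrier_vec n. act X a *\<^sub>v x = y" for X x
      unfolding surj_on_el_def
    proof (intro conjI ballI)
      show "is_arr (pt X x)" using pt[OF X] by blast
      fix y assume "y \<in> el (tgt (pt X x))"
      then obtain a where a: "a \<in> carrier_vec n" "act X a *\<^sub>v x = y" using s pt[OF X] by auto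
      then have "mt (pt X x) *\<^sub>v (S' *\<^sub>v a) = y" using pt[OF X] S'n[OF a(1)] SS(1)[OF a(1)] by simp
      then show "\<exists>r\<in>el (src (pt X x)). mt (pt X x) *\<^sub>v r = y" using S'n[OF a(1)] pt[OF X] by auto
    qed
  qed
qed

lemma scalar_prod_transpose:
  fixes A :: "'k mat"
  assumes "A \<in> carrier_mat m d" "c \<in> carrier_vec d" "v \<in> carrier_vec m"
  shows "c \<bullet> (transpose_mat A *\<^sub>v v) = (A *\<^sub>v c) \<bullet> v"
  using transpose_vec_mult_scalar[OF assms(1,2,3)] comm_scalar_prod[of c d] assms
    comm_scalar_prod[OF mult_mat_vec_carrier[OF assms(1,2)] assms(3)] by simp

text \<open>The coregular module \<open>I\<close>, the dual space of the algebra, represents the dual of the underlying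
  space: \<open>cpt X \<phi> : X \<rightarrow> I\<close> sends \<open>x\<close> to the functional \<open>c \<mapsto> \<phi>(c x)\<close>.\<close>

definition copoint_family :: "'o \<Rightarrow> ('o \<Rightarrow> 'k vec \<Rightarrow> 'm) \<Rightarrow> bool" where
  "copoint_family I cpt \<longleftrightarrow> I \<in> Ob C \<and>
     (\<forall>X\<in>Ob C. \<forall>\<phi>\<in>el X. is_arr (cpt X \<phi>) \<and> src (cpt X \<phi>) = X \<and> tgt (cpt X \<phi>) = I) \<and>
     (\<forall>X\<in>Ob C. cpt X \<in> lin_maps (module_vec TYPE('k) (dm X)) (Hom C X I)) \<and>
     (\<forall>f. is_arr f \<longrightarrow> (\<forall>\<phi>\<in>el (tgt f). cpt (tgt f) \<phi> \<cdot> f = cpt (src f) (transpose_mat (mt f) *\<^sub>v \<phi>))) \<and>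
     (\<forall>X\<in>Ob C. \<forall>\<phi>\<in>el X. cpt X \<phi> = zero_arr X I \<longrightarrow> \<phi> = 0\<^sub>v (dm X))"

lemma copoint_familyD:
  assumes "copoint_family I cpt"
  shows "I \<in> Ob C"
    "X \<in> Ob C \<Longrightarrow> \<phi> \<in> el X \<Longrightarrow> is_arr (cpt X \<phi>)"
    "X \<in> Ob C \<Longrightarrow> \<phi> \<in> el X \<Longrightarrow> src (cpt X \<phi>) = X"
    "X \<in> Ob C \<Longrightarrow> \<phi> \<in> el X \<Longrightarrow> tgt (cpt X \<phi>) = I"
    "X \<in> Ob C \<Longrightarrow> cpt X \<in> lin_maps (module_vec TYPE('k) (dm X)) (Hom C X I)"
    "is_arr f \<Longrightarrow> \<phi> \<in> el (tgt f) \<Longrightarrow> cpt (tgt f) \<phi> \<cdot> f = cpt (src f) (transpose_mat (mt f) *\<^sub>v \<phi>)"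
    "X \<in> Ob C \<Longrightarrow> \<phi> \<in> el X \<Longrightarrow> cpt X \<phi> = zero_arr X I \<Longrightarrow> \<phi> = 0\<^sub>v (dm X)"
  using assms unfolding copoint_family_def by blast+

text \<open>The algebra acts on its dual by the transposes of right multiplications. All identities in \<open>I\<close> are
  checked by pairing with the elements of the algebra.\<close>

lemma coregular_object:
  obtains I cpt where "copoint_family I cpt"
proof -
  have "\<exists>A. A \<in> carrier_mat n n \<and> (\<forall>v\<in>carrier_vec n. A *\<^sub>v v = mul v a)" if a: "a \<in> carrier_vec n" for a
    by (rule linear_map_matrix[where f = "\<lambda>v. mul v a" and n = n and m = n]) (use a alg_facts in auto)
  then obtain r where r: "\<And>a. a \<in> carrier_vec n \<Longrightarrow> r a \<in> carrier_mat n n"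
      "\<And>a v. a \<in> carrier_vec n \<Longrightarrow> v \<in> carrier_vec n \<Longrightarrow> r a *\<^sub>v v = mul v a"
    by metis
  define \<rho> where "\<rho> a = transpose_mat (r a)" for a
  have \<rho>: "\<rho> a \<in> carrier_mat n n" if "a \<in> carrier_vec n" for a using r(1)[OF that] by (simp add: \<rho>_def)
  have \<rho>v: "\<rho> a *\<^sub>v v \<in> carrier_vec n" if "a \<in> carrier_vec n" "v \<in> carrier_vec n" for a v
    by (rule mult_mat_vec_carrier[OF \<rho>[OF that(1)] that(2)])
  have \<rho>_pair: "c \<bullet> (\<rho> a *\<^sub>v v) = mul c a \<bullet> v" if "a \<in> carrier_vec n" "c \<in> carrier_vec n" "v \<in> carrier_vec n" for a c v
    unfolding \<rho>_def using scalar_prod_transpose[OF r(1)[OF that(1)] that(2,3)] r(2)[OF that(1,2)] by simp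
  have "fd_rep n mul u n \<rho>"
  proof (rule algebra_rep[where h = "\<lambda>a v. \<rho> a *\<^sub>v v"])
    fix a b v :: "'k vec" and k :: 'k
    assume a: "a \<in> carrier_vec n" and v: "v \<in> carrier_vec n"
    show "\<rho> (k \<cdot>\<^sub>v a) *\<^sub>v v = k \<cdot>\<^sub>v (\<rho> a *\<^sub>v v)"
    proof (rule scalar_prod_ext[of _ n])
      fix c :: "'k vec" assume c: "c \<in> carrier_vec n"
      show "c \<bullet> (\<rho> (k \<cdot>\<^sub>v a) *\<^sub>v v) = c \<bullet> (k \<cdot>\<^sub>v (\<rho> a *\<^sub>v v))"
        using \<rho>_pair[of "k \<cdot>\<^sub>v a" c v] \<rho>_pair[of a c v] a c v \<rho>v[OF a v] alg_facts(7)[OF c a] alg_facts(4)[OF c a] by simp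
    qed (use a v \<rho>v in auto)
    assume b: "b \<in> carrier_vec n"
    show "\<rho> (a + b) *\<^sub>v v = \<rho> a *\<^sub>v v + \<rho> b *\<^sub>v v"
    proof (rule scalar_prod_ext[of _ n])
      fix c :: "'k vec" assume c: "c \<in> carrier_vec n"
      show "c \<bullet> (\<rho> (a + b) *\<^sub>v v) = c \<bullet> (\<rho> a *\<^sub>v v + \<rho> b *\<^sub>v v)"
        using \<rho>_pair[of "a + b" c v] \<rho>_pair[of a c v] \<rho>_pair[of b c v] a b c v \<rho>v[OF a v] \<rho>v[OF b v]
          alg_facts(5)[OF c a b] alg_facts(4)[OF c a] alg_facts(4)[OF c b]
        by (simp add: scalar_prod_add_distrib[of _ n] add_scalar_prod_distrib[of _ n])
    qed (use a b v \<rho>v in auto)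
    show "\<rho> (mul a b) *\<^sub>v v = \<rho> a *\<^sub>v (\<rho> b *\<^sub>v v)"
    proof (rule scalar_prod_ext[of _ n])
      fix c :: "'k vec" assume c: "c \<in> carrier_vec n"
      show "c \<bullet> (\<rho> (mul a b) *\<^sub>v v) = c \<bullet> (\<rho> a *\<^sub>v (\<rho> b *\<^sub>v v))"
        using \<rho>_pair[of "mul a b" c v] \<rho>_pair[of a c "\<rho> b *\<^sub>v v"] \<rho>_pair[of b "mul c a" v] a b c v \<rho>v[OF b v]
          alg_facts(9)[OF c a b] alg_facts(4)[OF c a] alg_facts(4)[OF a b] by simp
    qed (use a b v \<rho>v alg_facts(4) in auto)
  next
    fix v :: "'k vec" assume v: "v \<in> carrier_vec n"
    show "\<rho> u *\<^sub>v v = v"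
    proof (rule scalar_prod_ext[of _ n])
      fix c :: "'k vec" assume c: "c \<in> carrier_vec n"
      show "c \<bullet> (\<rho> u *\<^sub>v v) = c \<bullet> v" using \<rho>_pair[of u c v] c v alg_facts(3)[OF c] by simp
    qed (use v \<rho>v in auto)
  qed (use \<rho> in auto)
  then obtain I S S' where I: "I \<in> Ob C" and S: "S \<in> carrier_mat n (dm I)" "S' \<in> carrier_mat (dm I) n"
    and SS: "\<And>v. v \<in> carrier_vec n \<Longrightarrow> S *\<^sub>v (S' *\<^sub>v v) = v" "\<And>x. x \<in> el I \<Longrightarrow> S' *\<^sub>v (S *\<^sub>v x) = x"
    and Sa: "\<And>a x. a \<in> carrier_vec n \<Longrightarrow> x \<in> el I \<Longrightarrow> S *\<^sub>v (act I a *\<^sub>v x) = \<rho> a *\<^sub>v (S *\<^sub>v x)"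
    using realize_vec by metis
  have Sn: "S *\<^sub>v y \<in> carrier_vec n" if "y \<in> el I" for y by (rule mult_mat_vec_carrier[OF S(1) that])
  have S'n: "S' *\<^sub>v v \<in> el I" if "v \<in> carrier_vec n" for v by (rule mult_mat_vec_carrier[OF S(2) that])
  have ext: "y = y'" if y: "y \<in> el I" "y' \<in> el I" and "\<And>c. c \<in> carrier_vec n \<Longrightarrow> c \<bullet> (S *\<^sub>v y) = c \<bullet> (S *\<^sub>v y')" for y y'
    using scalar_prod_ext[OF Sn[OF y(1)] Sn[OF y(2)] that(3)] SS(2)[OF y(1)] SS(2)[OF y(2)] by metis
  define w where "w X \<phi> x = vec n (\<lambda>i. \<phi> \<bullet> (act X (unit_vec n i) *\<^sub>v x))" for X \<phi> x
  have w: "c \<bullet> w X \<phi> x = \<phi> \<bullet> (act X c *\<^sub>v x)" if X: "X \<in> Ob C" "\<phi> \<in> el X" "x \<in> el X" and c: "c \<in> carrier_vec n" for X \<phi> x c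
    using c
  proof (induction c rule: unit_vec_induct)
    case zero
    have "act X (0 \<cdot>\<^sub>v u) *\<^sub>v x = 0\<^sub>v (dm X)"
      using act_smult_vec[OF X(1) u_carrier X(3), of 0] zero_smult_vec[OF act_el[OF X(1) u_carrier X(3)]] by (simp only:)
    then show ?case using X zero_smult_vec[OF u_carrier] by (simp add: w_def)
  next
    case (add c k i)
    have "unit_vec n i \<bullet> w X \<phi> x = \<phi> \<bullet> (act X (unit_vec n i) *\<^sub>v x)"
      using add by (simp add: w_def scalar_prod_left_unit[of _ n])
    then show ?case
      using add X act_add_vec[OF X(1) add(1) _ X(3), of "k \<cdot>\<^sub>v unit_vec n i"] act_smult_vec[OF X(1) _ X(3), of "unit_vec n i" k]
        act_el[OF X(1) add(1) X(3)] act_el[OF X(1) _ X(3), of "unit_vec n i"]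
      by (simp add: add_scalar_prod_distrib[of _ n] scalar_prod_add_distrib[of _ "dm X"] w_def)
  qed
  have wn: "w X \<phi> x \<in> carrier_vec n" for X \<phi> x by (simp add: w_def)
  have Sw: "c \<bullet> (S *\<^sub>v (S' *\<^sub>v w X \<phi> x)) = \<phi> \<bullet> (act X c *\<^sub>v x)"
    if "X \<in> Ob C" "\<phi> \<in> el X" "x \<in> el X" "c \<in> carrier_vec n" for X \<phi> x c
    using w[OF that] SS(1)[OF wn] by simp
  define cpt where "cpt X \<phi> = (SOME f. is_arr f \<and> src f = X \<and> tgt f = I \<and> (\<forall>x\<in>el X. mt f *\<^sub>v x = S' *\<^sub>v w X \<phi> x))" for X \<phi>
  have cpt0: "is_arr (cpt X \<phi>) \<and> src (cpt X \<phi>) = X \<and> tgt (cpt X \<phi>) = I \<and> (\<forall>x\<in>el X. mt (cpt X \<phi>) *\<^sub>v x = S' *\<^sub>v w X \<phi> x)"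
    if X: "X \<in> Ob C" and \<phi>: "\<phi> \<in> el X" for X \<phi>
  proof -
    have "\<exists>f. is_arr f \<and> src f = X \<and> tgt f = I \<and> (\<forall>x\<in>el X. mt f *\<^sub>v x = S' *\<^sub>v w X \<phi> x)"
    proof (rule arr_of_linear[OF X I, of "\<lambda>x. S' *\<^sub>v w X \<phi> x"])
      fix x y a :: "'k vec" and k :: 'k
      assume x: "x \<in> el X"
      have Sx: "S' *\<^sub>v w X \<phi> x \<in> el I" by (rule S'n[OF wn])
      then show "S' *\<^sub>v w X \<phi> x \<in> el I" .
      show "S' *\<^sub>v w X \<phi> (k \<cdot>\<^sub>v x) = k \<cdot>\<^sub>v (S' *\<^sub>v w X \<phi> x)"
      proof (rule ext)
        fix c :: "'k vec" assume c: "c \<in> carrier_vec n"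
        show "c \<bullet> (S *\<^sub>v (S' *\<^sub>v w X \<phi> (k \<cdot>\<^sub>v x))) = c \<bullet> (S *\<^sub>v (k \<cdot>\<^sub>v (S' *\<^sub>v w X \<phi> x)))"
          using Sw[OF X \<phi> x c] Sw[OF X \<phi> _ c, of "k \<cdot>\<^sub>v x"] x c \<phi> mult_mat_vec[OF S(1) Sx] Sn[OF Sx]
            act_vec_smult[OF X c x] act_el[OF X c x] by simp
      qed (use Sx S'n[OF wn] in auto)
      {
        assume y: "y \<in> el X"
        have Sy: "S' *\<^sub>v w X \<phi> y \<in> el I" by (rule S'n[OF wn])
        show "S' *\<^sub>v w X \<phi> (x + y) = S' *\<^sub>v w X \<phi> x + S' *\<^sub>v w X \<phi> y"
        proof (rule ext)
          fix c :: "'k vec" assume c: "c \<in> carrier_vec n"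
          show "c \<bullet> (S *\<^sub>v (S' *\<^sub>v w X \<phi> (x + y))) = c \<bullet> (S *\<^sub>v (S' *\<^sub>v w X \<phi> x + S' *\<^sub>v w X \<phi> y))"
            using Sw[OF X \<phi> x c] Sw[OF X \<phi> y c] Sw[OF X \<phi> _ c, of "x + y"] x y c \<phi>
              mult_add_distrib_mat_vec[OF S(1) Sx Sy] Sn[OF Sx] Sn[OF Sy]
              act_vec_add[OF X c x y] act_el[OF X c x] act_el[OF X c y]
            by (simp add: scalar_prod_add_distrib[of _ n] scalar_prod_add_distrib[of _ "dm X"])
        qed (use Sx Sy S'n[OF wn] in auto)
      next
        assume a: "a \<in> carrier_vec n"
        show "S' *\<^sub>v w X \<phi> (act X a *\<^sub>v x) = act I a *\<^sub>v (S' *\<^sub>v w X \<phi> x)"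
        proof (rule ext)
          fix c :: "'k vec" assume c: "c \<in> carrier_vec n"
          show "c \<bullet> (S *\<^sub>v (S' *\<^sub>v w X \<phi> (act X a *\<^sub>v x))) = c \<bullet> (S *\<^sub>v (act I a *\<^sub>v (S' *\<^sub>v w X \<phi> x)))"
            using Sw[OF X \<phi> act_el[OF X a x] c] Sw[OF X \<phi> x alg_facts(4)[OF c a]] Sa[OF a Sx]
              \<rho>_pair[OF a c Sn[OF Sx]] act_mul_vec[OF X c a x] by simp
        qed (use S'n[OF wn] act_el[OF I a Sx] in auto)
      }
    qed blast
    from someI_ex[OF this] show ?thesis unfolding cpt_def .
  qed
  have cpt_arr: "is_arr (cpt X \<phi>) \<and> src (cpt X \<phi>) = X \<and> tgt (cpt X \<phi>) = I" if "X \<in> Ob C" "\<phi> \<in> el X" for X \<phi>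
    using cpt0[OF that] by blast
  have cpt_pair: "c \<bullet> (S *\<^sub>v (mt (cpt X \<phi>) *\<^sub>v x)) = \<phi> \<bullet> (act X c *\<^sub>v x)"
    if "X \<in> Ob C" "\<phi> \<in> el X" "x \<in> el X" "c \<in> carrier_vec n" for X \<phi> x c
    using cpt0[OF that(1,2)] Sw[OF that] that(3) by simp
  have cpt_el: "mt (cpt X \<phi>) *\<^sub>v x \<in> el I" if "X \<in> Ob C" "\<phi> \<in> el X" "x \<in> el X" for X \<phi> x
    using mt_el[of "cpt X \<phi>" x] cpt_arr[OF that(1,2)] that by simp
  show ?thesis
  proof (rule that, unfold copoint_family_def, intro conjI ballI allI impI)
    show "I \<in> Ob C" by (rule I)
    show "is_arr (cpt X \<phi>)" "src (cpt X \<phi>) = X" "tgt (cpt X \<phi>) = I" if "X \<in> Ob C" "\<phi> \<in> el X" for X \<phi>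
      using cpt_arr[OF that] by blast+
    show "cpt X \<in> lin_maps (module_vec TYPE('k) (dm X)) (Hom C X I)" if X: "X \<in> Ob C" for X
    proof (rule lin_maps_into_hom[OF X I cpt_arr[OF X]])
      fix x y z :: "'k vec" and k :: 'k assume x: "x \<in> el X" and z: "z \<in> el X"
      have kx: "k \<cdot>\<^sub>v x \<in> el X" using x by simp
      note xz = cpt_el[OF X x z]
      show "mt (cpt X (k \<cdot>\<^sub>v x)) *\<^sub>v z = k \<cdot>\<^sub>v (mt (cpt X x) *\<^sub>v z)"
      proof (rule ext)
        fix c :: "'k vec" assume c: "c \<in> carrier_vec n"
        show "c \<bullet> (S *\<^sub>v (mt (cpt X (k \<cdot>\<^sub>v x)) *\<^sub>v z)) = c \<bullet> (S *\<^sub>v (k \<cdot>\<^sub>v (mt (cpt X x) *\<^sub>v z)))"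
          using cpt_pair[OF X x z c] cpt_pair[OF X kx z c] mult_mat_vec[OF S(1) xz] Sn[OF xz] c x act_el[OF X c z] by simp
      qed (use xz cpt_el[OF X kx z] in auto)
      assume y: "y \<in> el X"
      have xy: "x + y \<in> el X" using x y by simp
      note yz = cpt_el[OF X y z]
      show "mt (cpt X (x + y)) *\<^sub>v z = mt (cpt X x) *\<^sub>v z + mt (cpt X y) *\<^sub>v z"
      proof (rule ext)
        fix c :: "'k vec" assume c: "c \<in> carrier_vec n"
        show "c \<bullet> (S *\<^sub>v (mt (cpt X (x + y)) *\<^sub>v z)) = c \<bullet> (S *\<^sub>v (mt (cpt X x) *\<^sub>v z + mt (cpt X y) *\<^sub>v z))"
          using cpt_pair[OF X x z c] cpt_pair[OF X y z c] cpt_pair[OF X xy z c] mult_add_distrib_mat_vec[OF S(1) xz yz]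
            Sn[OF xz] Sn[OF yz] c x y act_el[OF X c z]
          by (simp add: scalar_prod_add_distrib[of _ n] add_scalar_prod_distrib[of _ "dm X"])
      qed (use xz yz cpt_el[OF X xy z] in auto)
    qed
    show "cpt (tgt f) \<phi> \<cdot> f = cpt (src f) (transpose_mat (mt f) *\<^sub>v \<phi>)" if f: "is_arr f" and \<phi>: "\<phi> \<in> el (tgt f)" for f \<phi>
    proof -
      let ?\<psi> = "transpose_mat (mt f) *\<^sub>v \<phi>"
      have \<psi>: "?\<psi> \<in> el (src f)" using mt_mat[OF f] \<phi> by (intro mult_mat_vec_carrier[of _ _ "dm (tgt f)"]) auto
      note p = cpt_arr[OF tgt_ob[OF f] \<phi>] and p' = cpt_arr[OF src_ob[OF f] \<psi>]
      show ?thesis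
      proof (rule arr_eq_vecI)
        fix x assume "x \<in> el (src (cpt (tgt f) \<phi> \<cdot> f))"
        then have x: "x \<in> el (src f)" using f p by simp
        have "mt (cpt (tgt f) \<phi>) *\<^sub>v (mt f *\<^sub>v x) = mt (cpt (src f) ?\<psi>) *\<^sub>v x"
        proof (rule ext[OF cpt_el[OF tgt_ob[OF f] \<phi> mt_el[OF f x]] cpt_el[OF src_ob[OF f] \<psi> x]])
          fix c :: "'k vec" assume c: "c \<in> carrier_vec n"
          note cx = act_el[OF src_ob[OF f] c x]
          have "?\<psi> \<bullet> (act (src f) c *\<^sub>v x) = \<phi> \<bullet> (mt f *\<^sub>v (act (src f) c *\<^sub>v x))"
            using scalar_prod_transpose[OF mt_mat[OF f] cx \<phi>] comm_scalar_prod[OF \<psi> cx]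
              comm_scalar_prod[OF \<phi> mult_mat_vec_carrier[OF mt_mat[OF f] cx]] by simp
          then show "c \<bullet> (S *\<^sub>v (mt (cpt (tgt f) \<phi>) *\<^sub>v (mt f *\<^sub>v x))) = c \<bullet> (S *\<^sub>v (mt (cpt (src f) ?\<psi>) *\<^sub>v x))"
            using cpt_pair[OF tgt_ob[OF f] \<phi> mt_el[OF f x] c] cpt_pair[OF src_ob[OF f] \<psi> x c] mt_act_vec[OF f c x] by simp
        qed
        then show "mt (cpt (tgt f) \<phi> \<cdot> f) *\<^sub>v x = mt (cpt (src f) ?\<psi>) *\<^sub>v x"
          using mt_comp_vec[of f "cpt (tgt f) \<phi>" x] f p x by simp
      qed (use f p p' in auto)
    qed
    show "\<phi> = 0\<^sub>v (dm X)" if X: "X \<in> Ob C" "\<phi> \<in> el X" and z: "cpt X \<phi> = zero_arr X I" for X \<phi>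
    proof (rule scalar_prod_ext[OF X(2)])
      fix x :: "'k vec" assume x: "x \<in> el X"
      have "mt (cpt X \<phi>) *\<^sub>v x = 0\<^sub>v (dm I)" using z X I x by simp
      then have "u \<bullet> (S *\<^sub>v 0\<^sub>v (dm I)) = \<phi> \<bullet> (act X u *\<^sub>v x)" using cpt_pair[OF X x u_carrier] by simp
      then have "\<phi> \<bullet> x = 0" using mult_mat_zero_vec[OF S(1)] X x by simp
      then show "x \<bullet> \<phi> = x \<bullet> 0\<^sub>v (dm X)" using comm_scalar_prod[OF x X(2)] x by simp
    qed simp
  qed
qed

text \<open>The regular module: arrows from it are vectors, and epimorphisms are surjective on vectors.\<close>

lemma projective_generator:
  "\<exists>P. projective_object C P \<and>
     (\<forall>f. is_arr f \<longrightarrow> f \<noteq> zero_arr (src f) (tgt f) \<longrightarrow>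
        (\<exists>g. is_arr g \<and> src g = P \<and> tgt g = src f \<and> f \<cdot> g \<noteq> zero_arr P (tgt f)))"
proof -
  obtain R pt where P: "point_family R pt" by (rule regular_object)
  note R = point_familyD(1)[OF P] and pt = point_familyD(2-4)[OF P] and f_pt = point_familyD(6)[OF P]
    and all_pt = point_familyD(7)[OF P] and pt_zero = point_familyD(8)[OF P]
  have "projective_object C R"
    unfolding projective_object_def
  proof (intro conjI ballI allI impI)
    fix X Y e f
    assume X: "X \<in> Ob C" and Y: "Y \<in> Ob C" and e: "epi_arr C X Y e" and "f \<in> Arr C R Y"
    then have f: "is_arr f" "src f = R" "tgt f = Y" using R by (auto simp: hom_iff)
    have e': "is_arr e" "src e = X" "tgt e = Y" using e X Y by (auto simp: epi_arr_def hom_iff)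
    obtain y where y: "y \<in> el Y" "f = pt Y y" using all_pt[OF f(1,2)] f by auto
    obtain x where x: "x \<in> el X" "mt e *\<^sub>v x = y" using epi_imp_surj[OF e X Y] y e' by (auto simp: surj_on_el_def)
    then have "e \<cdot> pt X x = f" using f_pt[of e x] e' y by simp
    then show "\<exists>g\<in>Arr C R X. e \<cdot> g = f" using arrI[OF pt[OF X x(1)]] by blast
  qed (rule R)
  moreover have "\<exists>g. is_arr g \<and> src g = R \<and> tgt g = src f \<and> f \<cdot> g \<noteq> zero_arr R (tgt f)"
    if f: "is_arr f" and nz: "f \<noteq> zero_arr (src f) (tgt f)" for f
  proof (rule ccontr)
    assume "\<not> ?thesis"
    then have z: "f \<cdot> pt (src f) x = zero_arr R (tgt f)" if "x \<in> el (src f)" for x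
      using pt[OF src_ob[OF f] that] that by blast
    have "mt f *\<^sub>v x = 0\<^sub>v (dm (tgt f))" if "x \<in> el (src f)" for x
      using pt_zero[OF tgt_ob[OF f] mt_el[OF f that]] z[OF that] f_pt[OF f that] by simp
    then have "f = zero_arr (src f) (tgt f)" by - (rule arr_eq_vecI, use f in simp_all)
    then show False using nz by simp
  qed
  ultimately show ?thesis by blast
qed

end

section \<open>Natural transformations out of an endofunctor\<close>

context matrix_category
begin

text \<open>For \<open>f : K \<rightarrow> N\<close> with matrix \<open>U\<close>, both composites are traces of the bilinear map
  \<open>\<gamma>(x, \<phi>) = pt (b x) \<circ> g \<circ> F (cpt \<phi>)\<close>. On one side \<open>U\<close> is applied to the vector \<open>x\<close>, on the other its
  transpose is applied to the covector \<open>\<phi>\<close>.\<close>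

lemma trace_natural_transformation:
  assumes F: "linear_functor C C Fo Fm" and P: "point_family R pt" and Q: "copoint_family I cpt"
    and g: "is_arr g" "src g = Fo I" "tgt g = R" and b: "b \<in> carrier_vec n"
  defines "\<eta> \<equiv> \<lambda>K. \<Oplus>\<^bsub>Hom C (Fo K) K\<^esub>a\<in>{..<dm K}.
      pt K (act K b *\<^sub>v unit_vec (dm K) a) \<cdot> (g \<cdot> Fm (cpt K (unit_vec (dm K) a)))"
  shows "K \<in> Ob C \<Longrightarrow> \<eta> K \<in> Arr C (Fo K) K"
    and "is_arr f \<Longrightarrow> f \<cdot> \<eta> (src f) = \<eta> (tgt f) \<cdot> Fm f"
proof -
  note F = linear_functorD[OF F] and P = point_familyD[OF P] and Q = copoint_familyD[OF Q]
  have gcl: "g \<cdot> Fm (cpt K \<phi>) \<in> Arr C (Fo K) R" if "K \<in> Ob C" "\<phi> \<in> el K" for K \<phi>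
    by (rule arrI) (use that g F Q in auto)
  have term_hom: "pt N x \<cdot> (g \<cdot> Fm (cpt K \<phi>)) \<in> Arr C (Fo K) N"
    if "N \<in> Ob C" "K \<in> Ob C" "x \<in> el N" "\<phi> \<in> el K" for N K x \<phi>
    by (rule arrI) (use that g F P Q in auto)
  have lin_l: "(\<lambda>x. pt N (act N b *\<^sub>v x) \<cdot> (g \<cdot> Fm (cpt K \<phi>))) \<in> lin_maps (module_vec TYPE('k) (dm N)) (Hom C (Fo K) N)"
    if "N \<in> Ob C" "K \<in> Ob C" "\<phi> \<in> el K" for N K \<phi>
    using lin_maps_comp[OF lin_maps_comp[OF lin_maps_mat[OF act_facts(1)[OF that(1) b]] P(5)[OF that(1)]]
        comp_linear_left[OF F(1)[OF that(2)] P(1) that(1) gcl[OF that(2,3)]]] .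
  have lin_r: "(\<lambda>\<phi>. pt N (act N b *\<^sub>v x) \<cdot> (g \<cdot> Fm (cpt K \<phi>))) \<in> lin_maps (module_vec TYPE('k) (dm K)) (Hom C (Fo K) N)"
    if "N \<in> Ob C" "K \<in> Ob C" "x \<in> el N" for N K x
  proof -
    have ax: "act N b *\<^sub>v x \<in> el N" by (rule act_el[OF that(1) b that(3)])
    have p: "pt N (act N b *\<^sub>v x) \<in> Arr C R N" by (rule arrI) (use P(2-4)[OF that(1) ax] in auto)
    have gh: "g \<in> Arr C (Fo I) R" by (rule arrI) (use g in auto)
    show ?thesis
      using lin_maps_comp[OF lin_maps_comp[OF lin_maps_comp[OF Q(5)[OF that(2)] F(6)[OF that(2) Q(1)]]
          comp_linear_right[OF F(1)[OF that(2)] F(1)[OF Q(1)] P(1) gh]]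
          comp_linear_right[OF F(1)[OF that(2)] P(1) that(1) p]] .
  qed
  have \<eta>: "\<eta> K \<in> Arr C (Fo K) K" if K: "K \<in> Ob C" for K
  proof -
    interpret V: vectorspace class_ring "Hom C (Fo K) K" by (rule hom_space[OF F(1)[OF K] K])
    show ?thesis unfolding \<eta>_def
      by (rule V.finsum_closed) (auto intro!: term_hom[OF K K] act_el[OF K b])
  qed
  then show "K \<in> Ob C \<Longrightarrow> \<eta> K \<in> Arr C (Fo K) K" .
  assume f: "is_arr f"
  define K N where "K = src f" and "N = tgt f"
  have KN: "K \<in> Ob C" "N \<in> Ob C" using f by (auto simp: K_def N_def)
  define U where "U = mt f"
  have U: "U \<in> carrier_mat (dm N) (dm K)" using f by (simp add: U_def K_def N_def)
  define \<gamma> where "\<gamma> x \<phi> = pt N (act N b *\<^sub>v x) \<cdot> (g \<cdot> Fm (cpt K \<phi>))" for x \<phi>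
  let ?V = "Hom C (Fo K) N"
  have V: "vectorspace class_ring ?V" by (rule hom_space[OF F(1)[OF KN(1)] KN(2)])
  interpret V: vectorspace class_ring ?V by (rule V)
  have fh: "f \<in> Arr C K N" using arr_hom[OF f] by (simp add: K_def N_def)
  have Ffh: "Fm f \<in> Arr C (Fo K) (Fo N)" by (rule arrI) (use f F in \<open>auto simp: K_def N_def\<close>)
  have "f \<cdot> \<eta> K = (\<Oplus>\<^bsub>?V\<^esub>a\<in>{..<dm K}. f \<cdot> (pt K (act K b *\<^sub>v unit_vec (dm K) a) \<cdot> (g \<cdot> Fm (cpt K (unit_vec (dm K) a)))))"
    unfolding \<eta>_def
    by (rule lin_map_finsum[OF hom_space[OF F(1)[OF KN(1)] KN(1)] V comp_linear_right[OF F(1)[OF KN(1)] KN fh]])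
      (auto intro!: term_hom[OF KN(1,1)] act_el[OF KN(1) b])
  also have "\<dots> = (\<Oplus>\<^bsub>?V\<^esub>a\<in>{..<dm K}. \<gamma> (U *\<^sub>v unit_vec (dm K) a) (unit_vec (dm K) a))"
  proof (rule V.finsum_cong')
    show "(\<lambda>a. \<gamma> (U *\<^sub>v unit_vec (dm K) a) (unit_vec (dm K) a)) \<in> {..<dm K} \<rightarrow> Arr C (Fo K) N"
      unfolding \<gamma>_def using mult_mat_vec_carrier[OF U] by (auto intro!: term_hom[OF KN(2,1)] act_el[OF KN(2) b])
    fix a assume "a \<in> {..<dm K}"
    define e where "e = (unit_vec (dm K) a :: 'k vec)"
    have e: "e \<in> el K" by (simp add: e_def)
    have x: "act K b *\<^sub>v e \<in> el K" by (rule act_el[OF KN(1) b e])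
    have "f \<cdot> (pt K (act K b *\<^sub>v e) \<cdot> (g \<cdot> Fm (cpt K e))) = (f \<cdot> pt K (act K b *\<^sub>v e)) \<cdot> (g \<cdot> Fm (cpt K e))"
      using f KN P(2-4)[OF KN(1) x] g F Q(1) Q(2-4)[OF KN(1) e] by (simp add: K_def)
    also have "f \<cdot> pt K (act K b *\<^sub>v e) = pt N (U *\<^sub>v (act K b *\<^sub>v e))"
      using P(6)[OF f, of "act K b *\<^sub>v e"] x by (simp add: K_def N_def U_def)
    also have "U *\<^sub>v (act K b *\<^sub>v e) = act N b *\<^sub>v (U *\<^sub>v e)"
      using mt_act_vec[OF f b, of e] e by (simp add: K_def N_def U_def)
    finally show "f \<cdot> (pt K (act K b *\<^sub>v unit_vec (dm K) a) \<cdot> (g \<cdot> Fm (cpt K (unit_vec (dm K) a))))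
        = \<gamma> (U *\<^sub>v unit_vec (dm K) a) (unit_vec (dm K) a)" by (simp add: e_def \<gamma>_def)
  qed simp
  also have "\<dots> = (\<Oplus>\<^bsub>?V\<^esub>c\<in>{..<dm N}. \<gamma> (unit_vec (dm N) c) (transpose_mat U *\<^sub>v unit_vec (dm N) c))"
    by (rule bilinear_trace[OF V _ _ U]) (unfold \<gamma>_def, rule lin_l[OF KN(2,1)], assumption, rule lin_r[OF KN(2,1)])
  also have "\<dots> = (\<Oplus>\<^bsub>?V\<^esub>c\<in>{..<dm N}. (pt N (act N b *\<^sub>v unit_vec (dm N) c) \<cdot> (g \<cdot> Fm (cpt N (unit_vec (dm N) c)))) \<cdot> Fm f)"
  proof (rule V.finsum_cong')
    show "(\<lambda>c. (pt N (act N b *\<^sub>v unit_vec (dm N) c) \<cdot> (g \<cdot> Fm (cpt N (unit_vec (dm N) c)))) \<cdot> Fm f) \<in> {..<dm N} \<rightarrow> Arr C (Fo K) N"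
      by (auto intro!: comp_closed[OF F(1)[OF KN(1)] F(1)[OF KN(2)] KN(2) Ffh] term_hom[OF KN(2,2)] act_el[OF KN(2) b])
    fix c assume "c \<in> {..<dm N}"
    define e where "e = (unit_vec (dm N) c :: 'k vec)"
    have e: "e \<in> el N" by (simp add: e_def)
    have x: "act N b *\<^sub>v e \<in> el N" by (rule act_el[OF KN(2) b e])
    have "cpt N e \<cdot> f = cpt K (transpose_mat U *\<^sub>v e)" using Q(6)[OF f, of e] e by (simp add: K_def N_def U_def)
    then have "\<gamma> e (transpose_mat U *\<^sub>v e) = pt N (act N b *\<^sub>v e) \<cdot> (g \<cdot> (Fm (cpt N e) \<cdot> Fm f))"
      using F(5)[OF f Q(2)[OF KN(2) e]] Q(3)[OF KN(2) e] by (simp add: \<gamma>_def N_def)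
    also have "\<dots> = (pt N (act N b *\<^sub>v e) \<cdot> (g \<cdot> Fm (cpt N e))) \<cdot> Fm f"
      using f KN P(2-4)[OF KN(2) x] g F Q(1) Q(2-4)[OF KN(2) e] by (simp add: N_def)
    finally show "\<gamma> (unit_vec (dm N) c) (transpose_mat U *\<^sub>v unit_vec (dm N) c)
        = (pt N (act N b *\<^sub>v unit_vec (dm N) c) \<cdot> (g \<cdot> Fm (cpt N (unit_vec (dm N) c)))) \<cdot> Fm f" by (simp add: e_def)
  qed simp
  also have "\<dots> = \<eta> N \<cdot> Fm f"
    unfolding \<eta>_def
    by (rule lin_map_finsum[OF hom_space[OF F(1)[OF KN(2)] KN(2)] V comp_linear_left[OF F(1)[OF KN(1)] F(1)[OF KN(2)] KN(2) Ffh], symmetric])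
      (auto intro!: term_hom[OF KN(2,2)] act_el[OF KN(2) b])
  finally show "f \<cdot> \<eta> (src f) = \<eta> (tgt f) \<cdot> Fm f" by (simp add: K_def N_def)
qed

lemma surj_imp_epi: "surj_on_el f \<Longrightarrow> epi_arr C (src f) (tgt f) f"
  using surj_imp_cancel[of f] by (auto simp: epi_arr_def hom_iff surj_on_el_def)

end

text \<open>Take \<open>b\<close> to be of rank one on \<open>L\<close>, say \<open>x \<mapsto> \<phi>(x) y\<close>, and zero on \<open>S\<close>. The component at \<open>L\<close> of
  the natural transformation given by \<open>b\<close> and \<open>g\<close> is \<open>pt y \<circ> g \<circ> F (cpt \<phi>)\<close>. First \<open>t\<close> is lifted
  through the epimorphism \<open>pt y\<close>, and the lift is then extended along \<open>F (cpt \<phi>)\<close>, which has a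
  retraction because \<open>cpt \<phi>\<close> is a monomorphism with a cokernel.\<close>

lemma (in alg_closed_matrix_category) prescribed_natural_transformation:
  assumes F: "linear_functor C C Fo Fm"
    and L: "simple_object C L" and S: "finite S" "\<And>K. K \<in> S \<Longrightarrow> simple_object C K \<and> \<not> isomorphic C K L"
    and proj: "projective_object C (Fo L)"
    and split: "\<And>v q. mono_arr C L (tgt v) v \<Longrightarrow> is_cokernel C L (tgt v) (tgt q) v q \<Longrightarrow> weak_kernel q v \<Longrightarrow>
      \<exists>r. is_arr r \<and> src r = Fo (tgt v) \<and> tgt r = Fo L \<and> r \<cdot> Fm v = \<iota> (Fo L)"
    and t: "t \<in> Arr C (Fo L) L"
  shows "\<exists>\<eta>. (\<forall>K\<in>Ob C. \<eta> K \<in> Arr C (Fo K) K) \<and> (\<forall>f. is_arr f \<longrightarrow> f \<cdot> \<eta> (src f) = \<eta> (tgt f) \<cdot> Fm f) \<and>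
    \<eta> L = t \<and> (\<forall>K\<in>S. \<eta> K = zero_arr (Fo K) K)"
proof -
  note F' = linear_functorD[OF F]
  have Lo: "L \<in> Ob C" by (rule simple_ob[OF L])
  obtain R pt where P0: "point_family R pt" by (rule regular_object)
  note P = point_familyD[OF P0]
  obtain I cpt where Q0: "copoint_family I cpt" by (rule coregular_object)
  note Q = copoint_familyD[OF Q0]
  obtain b y j where b: "b \<in> carrier_vec n" and bS: "\<And>K x. K \<in> S \<Longrightarrow> x \<in> el K \<Longrightarrow> act K b *\<^sub>v x = 0\<^sub>v (dm K)"
    and j: "j < dm L" and y: "y \<in> el L" "y \<noteq> 0\<^sub>v (dm L)" and bL: "\<And>x. x \<in> el L \<Longrightarrow> act L b *\<^sub>v x = x $ j \<cdot>\<^sub>v y"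
    by (rule rank_one_element[OF L S], assumption) (rule that; blast)
  have "surj_on_el (pt L y)" by (rule P(9)[OF Lo y(1)]) (use simple_orbit[OF L y] in blast)
  then have "epi_arr C R L (pt L y)" using surj_imp_epi P(3,4)[OF Lo y(1)] by metis
  then obtain t' where t': "t' \<in> Arr C (Fo L) R" "pt L y \<cdot> t' = t"
    using proj t P(1) Lo unfolding projective_object_def by blast
  note t'_arr = arrD[OF t'(1) F'(1)[OF Lo] P(1)]
  \<comment> \<open>The operator \<open>x \<mapsto> x\<^sub>j y\<close> pairs \<open>y\<close> with the covector \<open>e\<^sub>j\<close>.\<close>
  define \<phi> where "\<phi> = (unit_vec (dm L) j :: 'k vec)"
  have \<phi>: "\<phi> \<in> el L" "\<phi> \<noteq> 0\<^sub>v (dm L)" using j by (auto simp: \<phi>_def)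
  define v where "v = cpt L \<phi>"
  have v: "is_arr v" "src v = L" "tgt v = I" using Q(2-4)[OF Lo \<phi>(1)] by (auto simp: v_def)
  have "v \<noteq> zero_arr L (tgt v)" using Q(7)[OF Lo \<phi>(1)] \<phi>(2) v by (auto simp: v_def)
  then have inj: "inj_on_el v" by (rule simple_nonzero_imp_inj[OF L v(1,2)])
  then obtain q where "is_arr q" "src q = tgt v" "is_cokernel C (src v) (tgt v) (tgt q) v q" "weak_kernel q v"
    using v by (rule_tac inj_is_kernel_of_cokernel) (auto simp: weak_kernel_def)
  then obtain r where r: "is_arr r" "src r = Fo I" "tgt r = Fo L" "r \<cdot> Fm v = \<iota> (Fo L)"
    using split[of v q] inj_imp_mono[OF inj] v by auto
  define g where "g = t' \<cdot> r"
  have g: "is_arr g" "src g = Fo I" "tgt g = R" using t'_arr r by (auto simp: g_def)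
  have gv: "g \<cdot> Fm v = t'" using t'_arr r v F' by (simp add: g_def)
  define \<tau> where "\<tau> K a = pt K (act K b *\<^sub>v unit_vec (dm K) a) \<cdot> (g \<cdot> Fm (cpt K (unit_vec (dm K) a)))" for K a
  define \<eta> where "\<eta> K = (\<Oplus>\<^bsub>Hom C (Fo K) K\<^esub>a\<in>{..<dm K}. \<tau> K a)" for K
  note nat = trace_natural_transformation[OF F P0 Q0 g b, folded \<tau>_def, folded \<eta>_def]
  have pt0: "pt K (0\<^sub>v (dm K)) = zero_arr R K" if "K \<in> Ob C" for K
    by (rule lin_map_vec_zero[OF hom_space[OF P(1) that] P(5)[OF that]])
  have gc: "is_arr (g \<cdot> Fm (cpt K (unit_vec (dm K) a)))" "src (g \<cdot> Fm (cpt K (unit_vec (dm K) a))) = Fo K"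
      "tgt (g \<cdot> Fm (cpt K (unit_vec (dm K) a))) = R" if "K \<in> Ob C" for K a
    using that g F' Q by auto
  have "\<eta> K = zero_arr (Fo K) K" if K: "K \<in> S" for K
  proof -
    have Ko: "K \<in> Ob C" using S K simple_ob by blast
    interpret V: vectorspace class_ring "Hom C (Fo K) K" by (rule hom_space[OF F'(1)[OF Ko] Ko])
    have "\<tau> K a = zero_arr (Fo K) K" for a
      using bS[OF K, of "unit_vec (dm K) a"] pt0[OF Ko] gc[OF Ko] Ko by (simp add: \<tau>_def del: comp_arr)
    then show ?thesis by (simp add: \<eta>_def)
  qed
  moreover have "\<eta> L = t"
  proof -
    interpret V: vectorspace class_ring "Hom C (Fo L) L" by (rule hom_space[OF F'(1)[OF Lo] Lo])
    have "\<tau> L a = (if j = a then t else zero_arr (Fo L) L)" if "a < dm L" for a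
    proof (cases "j = a")
      case True
      have "(1::'k) \<cdot>\<^sub>v y = y" by simp
      then have "\<tau> L a = pt L y \<cdot> (g \<cdot> Fm v)" using bL[of "unit_vec (dm L) a"] that True by (simp add: \<tau>_def v_def \<phi>_def)
      then show ?thesis using True gv t'(2) by simp
    next
      case False
      have "act L b *\<^sub>v unit_vec (dm L) a = 0\<^sub>v (dm L)"
        using bL[of "unit_vec (dm L) a"] that j False zero_smult_vec[OF y(1)] by simp
      then show ?thesis using False pt0[OF Lo] gc[OF Lo] Lo by (simp add: \<tau>_def del: comp_arr)
    qed
    then have "\<eta> L = (\<Oplus>\<^bsub>Hom C (Fo L) L\<^esub>a\<in>{..<dm L}. if j = a then t else zero_arr (Fo L) L)"
      unfolding \<eta>_def using t by (intro V.finsum_cong') auto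
    also have "\<dots> = t" by (rule V.finsum_singleton) (use j t in auto)
    finally show ?thesis .
  qed
  ultimately show ?thesis using nat by blast
qed

section \<open>Duality in a finite tensor category\<close>

context finite_tensor_category
begin

declare tens_ob [simp] unit_ob [simp] tens_idn [simp]

lemma tens_arr [simp]:
  assumes "is_arr f" "is_arr g"
  shows "is_arr (f \<boxtimes>\<^sub>m g)" "src (f \<boxtimes>\<^sub>m g) = src f \<boxtimes> src g" "tgt (f \<boxtimes>\<^sub>m g) = tgt f \<boxtimes> tgt g"
proof -
  have "f \<boxtimes>\<^sub>m g \<in> Arr C (src f \<boxtimes> src g) (tgt f \<boxtimes> tgt g)"
    using lin_mapsD(1)[OF tens_linear_right[of "src f" "tgt f" "src g" "tgt g" f]] assms arr_hom by simp
  then show "is_arr (f \<boxtimes>\<^sub>m g)" "src (f \<boxtimes>\<^sub>m g) = src f \<boxtimes> src g" "tgt (f \<boxtimes>\<^sub>m g) = tgt f \<boxtimes> tgt g"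
    using arrD assms tens_ob by simp_all
qed

lemma interchange:
  assumes "is_arr f" "is_arr g" "is_arr f'" "is_arr g'" "src g = tgt f" "src g' = tgt f'"
  shows "(g \<boxtimes>\<^sub>m g') \<cdot> (f \<boxtimes>\<^sub>m f') = (g \<cdot> f) \<boxtimes>\<^sub>m (g' \<cdot> f')"
  using tens_comp[of "src f" "tgt f" "tgt g" "src f'" "tgt f'" "tgt g'" f g f' g'] assms
    arr_hom[of f] arr_hom[of g] arr_hom[of f'] arr_hom[of g'] by simp

lemma tens_comp_left:
  assumes "is_arr f" "is_arr g" "src g = tgt f" "X \<in> Ob C"
  shows "(g \<cdot> f) \<boxtimes>\<^sub>m \<iota> X = (g \<boxtimes>\<^sub>m \<iota> X) \<cdot> (f \<boxtimes>\<^sub>m \<iota> X)"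
  using interchange[of f g "\<iota> X" "\<iota> X"] assms by simp

lemma tens_comp_right:
  assumes "is_arr f" "is_arr g" "src g = tgt f" "X \<in> Ob C"
  shows "\<iota> X \<boxtimes>\<^sub>m (g \<cdot> f) = (\<iota> X \<boxtimes>\<^sub>m g) \<cdot> (\<iota> X \<boxtimes>\<^sub>m f)"
  using interchange[of "\<iota> X" "\<iota> X" f g] assms by simp

lemma isom_tens [simp]: "isom f \<Longrightarrow> isom g \<Longrightarrow> isom (f \<boxtimes>\<^sub>m g)"
  by (rule isomI[of _ "inv_of f \<boxtimes>\<^sub>m inv_of g"]) (auto simp: interchange)

lemma assoc_arr [simp]:
  assumes "X \<in> Ob C" "Y \<in> Ob C" "Z \<in> Ob C"
  shows "isom (assoc X Y Z)" "src (assoc X Y Z) = (X \<boxtimes> Y) \<boxtimes> Z" "tgt (assoc X Y Z) = X \<boxtimes> (Y \<boxtimes> Z)"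
    "assoc_inv X Y Z = inv_of (assoc X Y Z)"
  using isomD[OF assoc_iso[OF assms]] assms by (simp_all add: assoc_inv_def)

lemma lunit_arr [simp]:
  assumes "X \<in> Ob C"
  shows "isom (lunit X)" "src (lunit X) = \<I> \<boxtimes> X" "tgt (lunit X) = X"
  using isomD[OF lunit_iso[OF assms]] assms by simp_all

lemma runit_arr [simp]:
  assumes "X \<in> Ob C"
  shows "isom (runit X)" "src (runit X) = X \<boxtimes> \<I>" "tgt (runit X) = X" "runit_inv X = inv_of (runit X)"
  using isomD[OF runit_iso[OF assms]] assms by (simp_all add: runit_inv_def)

lemma dual_arrows [simp]:
  assumes "X \<in> Ob C"
  shows "X\<^sup>\<or> \<in> Ob C" "is_arr (ev X)" "src (ev X) = X\<^sup>\<or> \<boxtimes> X" "tgt (ev X) = \<I>"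
    "is_arr (coev X)" "src (coev X) = \<I>" "tgt (coev X) = X \<boxtimes> X\<^sup>\<or>"
  using left_dual[OF assms] assms by (auto simp: is_left_dual_def hom_iff)

lemma assoc_nat:
  assumes "is_arr f" "is_arr g" "is_arr h"
  shows "assoc (tgt f) (tgt g) (tgt h) \<cdot> ((f \<boxtimes>\<^sub>m g) \<boxtimes>\<^sub>m h) = (f \<boxtimes>\<^sub>m (g \<boxtimes>\<^sub>m h)) \<cdot> assoc (src f) (src g) (src h)"
  using assoc_natural[of "src f" "src g" "src h" "tgt f" "tgt g" "tgt h" f g h] assms
    arr_hom[of f] arr_hom[of g] arr_hom[of h] by simp

lemma assoc_inv_nat:
  assumes "is_arr f" "is_arr g" "is_arr h"
  shows "inv_of (assoc (tgt f) (tgt g) (tgt h)) \<cdot> (f \<boxtimes>\<^sub>m (g \<boxtimes>\<^sub>m h)) = ((f \<boxtimes>\<^sub>m g) \<boxtimes>\<^sub>m h) \<cdot> inv_of (assoc (src f) (src g) (src h))"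
  by (rule inv_natural[OF assoc_nat[OF assms]]) (use assms in auto)

lemma runit_nat: "is_arr f \<Longrightarrow> runit (tgt f) \<cdot> (f \<boxtimes>\<^sub>m \<iota> \<I>) = f \<cdot> runit (src f)"
  using runit_natural[of "src f" "tgt f" f] arr_hom[of f] by simp

lemma lunit_nat: "is_arr f \<Longrightarrow> lunit (tgt f) \<cdot> (\<iota> \<I> \<boxtimes>\<^sub>m f) = f \<cdot> lunit (src f)"
  using lunit_natural[of "src f" "tgt f" f] arr_hom[of f] by simp

lemma runit_inv_nat: "is_arr f \<Longrightarrow> inv_of (runit (tgt f)) \<cdot> f = (f \<boxtimes>\<^sub>m \<iota> \<I>) \<cdot> inv_of (runit (src f))"
  by (rule inv_natural[OF runit_nat]) auto

text \<open>By naturality of \<open>lunit\<close>, tensoring with the unit object is conjugation by an isomorphism.\<close>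

lemma unit_tens_faithful:
  assumes "\<iota> \<I> \<boxtimes>\<^sub>m f = \<iota> \<I> \<boxtimes>\<^sub>m g" "is_arr f" "is_arr g" "src f = src g" "tgt f = tgt g"
  shows "f = g"
proof -
  have "f \<cdot> lunit (src f) = g \<cdot> lunit (src f)"
    using lunit_nat[of f] lunit_nat[of g] assms by simp
  then show ?thesis by (rule isom_cancel_right) (use assms in auto)
qed

text \<open>Tensored with \<open>\<I>\<close> from the left, this follows from the pentagon for \<open>\<I>, \<I>, A, B\<close> and two
  triangles.\<close>

lemma lunit_tens:
  assumes A: "A \<in> Ob C" and B: "B \<in> Ob C"
  shows "lunit (A \<boxtimes> B) \<cdot> assoc \<I> A B = lunit A \<boxtimes>\<^sub>m \<iota> B"
proof (rule unit_tens_faithful)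
  let ?J = "\<iota> \<I>"
  have tri: "(?J \<boxtimes>\<^sub>m lunit Y) \<cdot> assoc \<I> \<I> Y = runit \<I> \<boxtimes>\<^sub>m \<iota> Y" if "Y \<in> Ob C" for Y
    by (rule triangle[OF unit_ob that])
  have "(?J \<boxtimes>\<^sub>m lunit (A \<boxtimes> B)) \<cdot> ((?J \<boxtimes>\<^sub>m assoc \<I> A B) \<cdot> (assoc \<I> (\<I> \<boxtimes> A) B \<cdot> (assoc \<I> \<I> A \<boxtimes>\<^sub>m \<iota> B)))
      = (?J \<boxtimes>\<^sub>m lunit (A \<boxtimes> B)) \<cdot> (assoc \<I> \<I> (A \<boxtimes> B) \<cdot> assoc (\<I> \<boxtimes> \<I>) A B)"
    using pentagon[OF unit_ob unit_ob A B] by simp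
  also have "\<dots> = (runit \<I> \<boxtimes>\<^sub>m \<iota> (A \<boxtimes> B)) \<cdot> assoc (\<I> \<boxtimes> \<I>) A B"
    by (rule assoc_comp_eq[OF tri]) (use A B in auto)
  also have "\<dots> = assoc \<I> A B \<cdot> ((runit \<I> \<boxtimes>\<^sub>m \<iota> A) \<boxtimes>\<^sub>m \<iota> B)"
    using assoc_nat[of "runit \<I>" "\<iota> A" "\<iota> B"] A B by simp
  also have "\<dots> = assoc \<I> A B \<cdot> (((?J \<boxtimes>\<^sub>m lunit A) \<boxtimes>\<^sub>m \<iota> B) \<cdot> (assoc \<I> \<I> A \<boxtimes>\<^sub>m \<iota> B))"
    using A B by (simp add: tri[symmetric] tens_comp_left)
  also have "\<dots> = (?J \<boxtimes>\<^sub>m (lunit A \<boxtimes>\<^sub>m \<iota> B)) \<cdot> (assoc \<I> (\<I> \<boxtimes> A) B \<cdot> (assoc \<I> \<I> A \<boxtimes>\<^sub>m \<iota> B))"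
    using assoc_comp_eq[OF assoc_nat[of ?J "lunit A" "\<iota> B"], of "assoc \<I> \<I> A \<boxtimes>\<^sub>m \<iota> B"] A B by simp
  finally have e: "((?J \<boxtimes>\<^sub>m lunit (A \<boxtimes> B)) \<cdot> (?J \<boxtimes>\<^sub>m assoc \<I> A B)) \<cdot> (assoc \<I> (\<I> \<boxtimes> A) B \<cdot> (assoc \<I> \<I> A \<boxtimes>\<^sub>m \<iota> B))
      = (?J \<boxtimes>\<^sub>m (lunit A \<boxtimes>\<^sub>m \<iota> B)) \<cdot> (assoc \<I> (\<I> \<boxtimes> A) B \<cdot> (assoc \<I> \<I> A \<boxtimes>\<^sub>m \<iota> B))"
    using A B by simp
  have "(?J \<boxtimes>\<^sub>m lunit (A \<boxtimes> B)) \<cdot> (?J \<boxtimes>\<^sub>m assoc \<I> A B) = ?J \<boxtimes>\<^sub>m (lunit A \<boxtimes>\<^sub>m \<iota> B)"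
    by (rule isom_cancel_right[OF e]) (use A B in auto)
  then show "?J \<boxtimes>\<^sub>m (lunit (A \<boxtimes> B) \<cdot> assoc \<I> A B) = ?J \<boxtimes>\<^sub>m (lunit A \<boxtimes>\<^sub>m \<iota> B)"
    using A B by (simp add: tens_comp_right)
qed (use A B in auto)

text \<open>Arrows \<open>w : Z \<rightarrow> X\<^sup>\<or>\<close> correspond to arrows \<open>s : Z \<boxtimes> X \<rightarrow> \<I>\<close>, by \<open>pair_of X\<close> and its inverse
  \<open>mate_of Z X\<close>.\<close>

definition pair_of :: "'o \<Rightarrow> 'm \<Rightarrow> 'm" where
  "pair_of X w = ev X \<cdot> (w \<boxtimes>\<^sub>m \<iota> X)"

definition mate_of :: "'o \<Rightarrow> 'o \<Rightarrow> 'm \<Rightarrow> 'm" where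
  "mate_of Z X s = lunit (X\<^sup>\<or>) \<cdot> ((s \<boxtimes>\<^sub>m \<iota> (X\<^sup>\<or>)) \<cdot> (inv_of (assoc Z X (X\<^sup>\<or>)) \<cdot> ((\<iota> Z \<boxtimes>\<^sub>m coev X) \<cdot> inv_of (runit Z))))"

lemma pair_of_arr [simp]:
  assumes "is_arr w" "X \<in> Ob C" "tgt w = X\<^sup>\<or>"
  shows "is_arr (pair_of X w)" "src (pair_of X w) = src w \<boxtimes> X" "tgt (pair_of X w) = \<I>"
  using assms by (auto simp: pair_of_def)

lemma mate_of_arr [simp]:
  assumes "is_arr s" "Z \<in> Ob C" "X \<in> Ob C" "src s = Z \<boxtimes> X" "tgt s = \<I>"
  shows "is_arr (mate_of Z X s)" "src (mate_of Z X s) = Z" "tgt (mate_of Z X s) = X\<^sup>\<or>"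
  using assms by (auto simp: mate_of_def)

lemma zigzag_dual:
  assumes X: "X \<in> Ob C"
  shows "lunit (X\<^sup>\<or>) \<cdot> ((ev X \<boxtimes>\<^sub>m \<iota> (X\<^sup>\<or>)) \<cdot> (inv_of (assoc (X\<^sup>\<or>) X (X\<^sup>\<or>)) \<cdot> (\<iota> (X\<^sup>\<or>) \<boxtimes>\<^sub>m coev X))) = runit (X\<^sup>\<or>)"
    and "runit X \<cdot> ((\<iota> X \<boxtimes>\<^sub>m ev X) \<cdot> (assoc X (X\<^sup>\<or>) X \<cdot> (coev X \<boxtimes>\<^sub>m \<iota> X))) = lunit X"
  using left_dual[OF X] X by (simp_all add: is_left_dual_def)

text \<open>Naturality moves \<open>w\<close> to the right end, and what remains on the left is the second zigzag identity.\<close>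

lemma mate_pair:
  assumes w: "is_arr w" "tgt w = X\<^sup>\<or>" and X: "X \<in> Ob C"
  shows "mate_of (src w) X (pair_of X w) = w"
proof -
  let ?D = "X\<^sup>\<or>" and ?Z = "src w"
  have 1: "pair_of X w \<boxtimes>\<^sub>m \<iota> ?D = (ev X \<boxtimes>\<^sub>m \<iota> ?D) \<cdot> ((w \<boxtimes>\<^sub>m \<iota> X) \<boxtimes>\<^sub>m \<iota> ?D)"
    using w X by (simp add: pair_of_def tens_comp_left)
  have 2: "((w \<boxtimes>\<^sub>m \<iota> X) \<boxtimes>\<^sub>m \<iota> ?D) \<cdot> inv_of (assoc ?Z X ?D) = inv_of (assoc ?D X ?D) \<cdot> (w \<boxtimes>\<^sub>m \<iota> (X \<boxtimes> ?D))"
    using assoc_inv_nat[of w "\<iota> X" "\<iota> ?D"] w X by simp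
  have 3: "(w \<boxtimes>\<^sub>m \<iota> (X \<boxtimes> ?D)) \<cdot> (\<iota> ?Z \<boxtimes>\<^sub>m coev X) = (\<iota> ?D \<boxtimes>\<^sub>m coev X) \<cdot> (w \<boxtimes>\<^sub>m \<iota> \<I>)"
    using w X by (simp add: interchange)
  have 4: "(w \<boxtimes>\<^sub>m \<iota> \<I>) \<cdot> inv_of (runit ?Z) = inv_of (runit ?D) \<cdot> w"
    using runit_inv_nat[of w] w by simp
  let ?r = "inv_of (runit ?Z)"
  have "mate_of ?Z X (pair_of X w) = lunit ?D \<cdot> ((ev X \<boxtimes>\<^sub>m \<iota> ?D) \<cdot> (((w \<boxtimes>\<^sub>m \<iota> X) \<boxtimes>\<^sub>m \<iota> ?D) \<cdot>
      (inv_of (assoc ?Z X ?D) \<cdot> ((\<iota> ?Z \<boxtimes>\<^sub>m coev X) \<cdot> ?r))))"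
    using w X by (simp add: mate_of_def 1)
  also have "\<dots> = lunit ?D \<cdot> ((ev X \<boxtimes>\<^sub>m \<iota> ?D) \<cdot> (inv_of (assoc ?D X ?D) \<cdot>
      ((w \<boxtimes>\<^sub>m \<iota> (X \<boxtimes> ?D)) \<cdot> ((\<iota> ?Z \<boxtimes>\<^sub>m coev X) \<cdot> ?r))))"
    using assoc_comp_eq[OF 2, of "(\<iota> ?Z \<boxtimes>\<^sub>m coev X) \<cdot> ?r"] w X by simp
  also have "\<dots> = lunit ?D \<cdot> ((ev X \<boxtimes>\<^sub>m \<iota> ?D) \<cdot> (inv_of (assoc ?D X ?D) \<cdot>
      ((\<iota> ?D \<boxtimes>\<^sub>m coev X) \<cdot> ((w \<boxtimes>\<^sub>m \<iota> \<I>) \<cdot> ?r))))"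
    using assoc_comp_eq[OF 3, of ?r] w X by simp
  also have "\<dots> = (lunit ?D \<cdot> ((ev X \<boxtimes>\<^sub>m \<iota> ?D) \<cdot> (inv_of (assoc ?D X ?D) \<cdot> (\<iota> ?D \<boxtimes>\<^sub>m coev X)))) \<cdot> (inv_of (runit ?D) \<cdot> w)"
    using w X by (simp add: 4)
  also have "\<dots> = w" using w X by (simp only: zigzag_dual(1)[OF X]) simp
  finally show ?thesis .
qed

text \<open>The first zigzag identity shows that the composite of \<open>mate_of\<close> and \<open>pair_of\<close> in this order is the
  identity up to the automorphism \<open>c\<close> of \<open>\<I>\<close>, which compares \<open>lunit\<close> with \<open>runit\<close>, and the automorphism \<open>e\<close>,
  which compares \<open>runit (Z \<boxtimes> X)\<close> with \<open>\<iota> Z \<boxtimes> runit X\<close>. That \<open>c\<close> and \<open>e\<close> are identities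
  would require more coherence; that they do not depend on \<open>s\<close> is enough for \<open>pair_mate\<close>.\<close>

lemma pair_mate_twisted:
  assumes Z: "Z \<in> Ob C" and X: "X \<in> Ob C"
  obtains c e where "isom c" "src c = \<I>" "tgt c = \<I>" "isom e" "src e = Z \<boxtimes> X" "tgt e = Z \<boxtimes> X"
    "\<And>s. is_arr s \<Longrightarrow> src s = Z \<boxtimes> X \<Longrightarrow> tgt s = \<I> \<Longrightarrow> pair_of X (mate_of Z X s) = c \<cdot> (s \<cdot> e)"
proof -
  let ?D = "X\<^sup>\<or>" and ?ZX = "Z \<boxtimes> X"
  let ?cr = "((\<iota> Z \<boxtimes>\<^sub>m coev X) \<boxtimes>\<^sub>m \<iota> X) \<cdot> (inv_of (runit Z) \<boxtimes>\<^sub>m \<iota> X)"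
  define E where "E = (\<iota> ?ZX \<boxtimes>\<^sub>m ev X) \<cdot> (assoc ?ZX ?D X \<cdot> ((inv_of (assoc Z X ?D) \<boxtimes>\<^sub>m \<iota> X) \<cdot> ?cr))"
  have E: "is_arr E" "src E = ?ZX" "tgt E = ?ZX \<boxtimes> \<I>" using Z X by (auto simp: E_def)
  let ?q = "(\<iota> Z \<boxtimes>\<^sub>m runit X) \<cdot> assoc Z X \<I>"
  have "?q \<cdot> E = \<iota> ?ZX"
  proof -
    have 1: "assoc Z X \<I> \<cdot> (\<iota> ?ZX \<boxtimes>\<^sub>m ev X) = (\<iota> Z \<boxtimes>\<^sub>m (\<iota> X \<boxtimes>\<^sub>m ev X)) \<cdot> assoc Z X (?D \<boxtimes> X)"
      using assoc_nat[of "\<iota> Z" "\<iota> X" "ev X"] Z X by simp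
    have 2: "assoc Z X (?D \<boxtimes> X) \<cdot> (assoc ?ZX ?D X \<cdot> ((inv_of (assoc Z X ?D) \<boxtimes>\<^sub>m \<iota> X) \<cdot> k))
        = (\<iota> Z \<boxtimes>\<^sub>m assoc X ?D X) \<cdot> (assoc Z (X \<boxtimes> ?D) X \<cdot> k)"
      if k: "is_arr k" "tgt k = (Z \<boxtimes> (X \<boxtimes> ?D)) \<boxtimes> X" for k
    proof -
      have "assoc Z X (?D \<boxtimes> X) \<cdot> (assoc ?ZX ?D X \<cdot> ((inv_of (assoc Z X ?D) \<boxtimes>\<^sub>m \<iota> X) \<cdot> k))
          = (assoc Z X (?D \<boxtimes> X) \<cdot> assoc ?ZX ?D X) \<cdot> ((inv_of (assoc Z X ?D) \<boxtimes>\<^sub>m \<iota> X) \<cdot> k)"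
        using Z X k by simp
      also have "\<dots> = (\<iota> Z \<boxtimes>\<^sub>m assoc X ?D X) \<cdot> (assoc Z (X \<boxtimes> ?D) X \<cdot> (((assoc Z X ?D \<boxtimes>\<^sub>m \<iota> X) \<cdot> (inv_of (assoc Z X ?D) \<boxtimes>\<^sub>m \<iota> X)) \<cdot> k))"
        unfolding pentagon[OF Z X dual_arrows(1)[OF X] X] using Z X k by simp
      also have "(assoc Z X ?D \<boxtimes>\<^sub>m \<iota> X) \<cdot> (inv_of (assoc Z X ?D) \<boxtimes>\<^sub>m \<iota> X) = \<iota> ((Z \<boxtimes> (X \<boxtimes> ?D)) \<boxtimes> X)"
        using Z X by (simp add: interchange)
      finally show ?thesis using Z X k by simp
    qed
    have 3: "assoc Z (X \<boxtimes> ?D) X \<cdot> ((\<iota> Z \<boxtimes>\<^sub>m coev X) \<boxtimes>\<^sub>m \<iota> X) = (\<iota> Z \<boxtimes>\<^sub>m (coev X \<boxtimes>\<^sub>m \<iota> X)) \<cdot> assoc Z \<I> X"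
      using assoc_nat[of "\<iota> Z" "coev X" "\<iota> X"] Z X by simp
    let ?ri = "inv_of (runit Z) \<boxtimes>\<^sub>m \<iota> X"
    have "?q \<cdot> E = (\<iota> Z \<boxtimes>\<^sub>m runit X) \<cdot> ((assoc Z X \<I> \<cdot> (\<iota> ?ZX \<boxtimes>\<^sub>m ev X)) \<cdot> (assoc ?ZX ?D X \<cdot> ((inv_of (assoc Z X ?D) \<boxtimes>\<^sub>m \<iota> X) \<cdot> ?cr)))"
      using Z X by (simp add: E_def)
    also have "\<dots> = (\<iota> Z \<boxtimes>\<^sub>m runit X) \<cdot> ((\<iota> Z \<boxtimes>\<^sub>m (\<iota> X \<boxtimes>\<^sub>m ev X)) \<cdot> (assoc Z X (?D \<boxtimes> X) \<cdot> (assoc ?ZX ?D X \<cdot> ((inv_of (assoc Z X ?D) \<boxtimes>\<^sub>m \<iota> X) \<cdot> ?cr))))"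
      unfolding 1 using Z X by simp
    also have "\<dots> = (\<iota> Z \<boxtimes>\<^sub>m runit X) \<cdot> ((\<iota> Z \<boxtimes>\<^sub>m (\<iota> X \<boxtimes>\<^sub>m ev X)) \<cdot> ((\<iota> Z \<boxtimes>\<^sub>m assoc X ?D X) \<cdot> (assoc Z (X \<boxtimes> ?D) X \<cdot> ?cr)))"
      using Z X by (subst 2) auto
    also have "assoc Z (X \<boxtimes> ?D) X \<cdot> ?cr = (\<iota> Z \<boxtimes>\<^sub>m (coev X \<boxtimes>\<^sub>m \<iota> X)) \<cdot> (assoc Z \<I> X \<cdot> ?ri)"
      using assoc_comp_eq[OF 3, of ?ri] Z X by simp
    also have "(\<iota> Z \<boxtimes>\<^sub>m runit X) \<cdot> ((\<iota> Z \<boxtimes>\<^sub>m (\<iota> X \<boxtimes>\<^sub>m ev X)) \<cdot> ((\<iota> Z \<boxtimes>\<^sub>m assoc X ?D X) \<cdot>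
        ((\<iota> Z \<boxtimes>\<^sub>m (coev X \<boxtimes>\<^sub>m \<iota> X)) \<cdot> (assoc Z \<I> X \<cdot> ?ri))))
        = (\<iota> Z \<boxtimes>\<^sub>m (runit X \<cdot> ((\<iota> X \<boxtimes>\<^sub>m ev X) \<cdot> (assoc X ?D X \<cdot> (coev X \<boxtimes>\<^sub>m \<iota> X))))) \<cdot> (assoc Z \<I> X \<cdot> ?ri)"
      using Z X by (simp add: tens_comp_right)
    also have "\<dots> = ((\<iota> Z \<boxtimes>\<^sub>m lunit X) \<cdot> assoc Z \<I> X) \<cdot> ?ri"
      unfolding zigzag_dual(2)[OF X] using Z X by simp
    also have "\<dots> = \<iota> ?ZX" unfolding triangle[OF Z X] using Z X by (simp add: interchange)
    finally show ?thesis .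
  qed
  then have "isom E" by (rule right_inverse_of_isom) (use E Z X in auto)
  define c where "c = lunit \<I> \<cdot> inv_of (runit \<I>)"
  define e where "e = runit ?ZX \<cdot> E"
  have c: "isom c" "src c = \<I>" "tgt c = \<I>" by (auto simp: c_def)
  have e: "isom e" "src e = ?ZX" "tgt e = ?ZX" using \<open>isom E\<close> E Z X by (auto simp: e_def)
  have "pair_of X (mate_of Z X s) = c \<cdot> (s \<cdot> e)" if s: "is_arr s" "src s = ?ZX" "tgt s = \<I>" for s
  proof -
    let ?k = "(inv_of (assoc Z X ?D) \<boxtimes>\<^sub>m \<iota> X) \<cdot> ?cr"
    have 1: "ev X \<cdot> (lunit ?D \<boxtimes>\<^sub>m \<iota> X) = lunit \<I> \<cdot> ((\<iota> \<I> \<boxtimes>\<^sub>m ev X) \<cdot> assoc \<I> ?D X)"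
    proof -
      have "ev X \<cdot> (lunit ?D \<boxtimes>\<^sub>m \<iota> X) = (ev X \<cdot> lunit (?D \<boxtimes> X)) \<cdot> assoc \<I> ?D X"
        using lunit_tens[of ?D X, symmetric] X by simp
      also have "ev X \<cdot> lunit (?D \<boxtimes> X) = lunit \<I> \<cdot> (\<iota> \<I> \<boxtimes>\<^sub>m ev X)" using lunit_nat[of "ev X"] X by simp
      finally show ?thesis using X by simp
    qed
    have 2: "assoc \<I> ?D X \<cdot> ((s \<boxtimes>\<^sub>m \<iota> ?D) \<boxtimes>\<^sub>m \<iota> X) = (s \<boxtimes>\<^sub>m \<iota> (?D \<boxtimes> X)) \<cdot> assoc ?ZX ?D X"
      using assoc_nat[of s "\<iota> ?D" "\<iota> X"] s X by simp
    have 3: "(\<iota> \<I> \<boxtimes>\<^sub>m ev X) \<cdot> (s \<boxtimes>\<^sub>m \<iota> (?D \<boxtimes> X)) = (s \<boxtimes>\<^sub>m \<iota> \<I>) \<cdot> (\<iota> ?ZX \<boxtimes>\<^sub>m ev X)"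
      using s X Z by (simp add: interchange)
    have 4: "s \<boxtimes>\<^sub>m \<iota> \<I> = inv_of (runit \<I>) \<cdot> (s \<cdot> runit ?ZX)"
    proof -
      have "inv_of (runit \<I>) \<cdot> (runit \<I> \<cdot> (s \<boxtimes>\<^sub>m \<iota> \<I>)) = inv_of (runit \<I>) \<cdot> (s \<cdot> runit ?ZX)"
        using runit_nat[of s] s by simp
      then show ?thesis using s Z X by simp
    qed
    have "pair_of X (mate_of Z X s) = (ev X \<cdot> (lunit ?D \<boxtimes>\<^sub>m \<iota> X)) \<cdot> (((s \<boxtimes>\<^sub>m \<iota> ?D) \<boxtimes>\<^sub>m \<iota> X) \<cdot> ?k)"
      using s Z X by (simp add: pair_of_def mate_of_def tens_comp_left)
    also have "\<dots> = lunit \<I> \<cdot> ((\<iota> \<I> \<boxtimes>\<^sub>m ev X) \<cdot> ((assoc \<I> ?D X \<cdot> ((s \<boxtimes>\<^sub>m \<iota> ?D) \<boxtimes>\<^sub>m \<iota> X)) \<cdot> ?k))"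
      unfolding 1 using s Z X by simp
    also have "\<dots> = lunit \<I> \<cdot> (((\<iota> \<I> \<boxtimes>\<^sub>m ev X) \<cdot> (s \<boxtimes>\<^sub>m \<iota> (?D \<boxtimes> X))) \<cdot> (assoc ?ZX ?D X \<cdot> ?k))"
      unfolding 2 using s Z X by simp
    also have "\<dots> = lunit \<I> \<cdot> ((s \<boxtimes>\<^sub>m \<iota> \<I>) \<cdot> E)"
      unfolding 3 E_def using s Z X by simp
    also have "\<dots> = c \<cdot> (s \<cdot> e)"
      unfolding 4 c_def e_def using s Z X E by simp
    finally show ?thesis .
  qed
  then show ?thesis using that c e by blast
qed

text \<open>By \<open>mate_pair\<close> both sides have the same mate, and \<open>mate_of\<close> is injective because
  \<open>pair_mate_twisted\<close> writes its composite with \<open>pair_of\<close> as \<open>s \<mapsto> c s e\<close> with \<open>c\<close> and \<open>e\<close>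
  invertible.\<close>

lemma pair_mate:
  assumes s: "is_arr s" "src s = Z \<boxtimes> X" "tgt s = \<I>" and Z: "Z \<in> Ob C" and X: "X \<in> Ob C"
  shows "pair_of X (mate_of Z X s) = s"
proof -
  obtain c e where c: "isom c" "src c = \<I>" "tgt c = \<I>" and e: "isom e" "src e = Z \<boxtimes> X" "tgt e = Z \<boxtimes> X"
    and pm: "\<And>s. is_arr s \<Longrightarrow> src s = Z \<boxtimes> X \<Longrightarrow> tgt s = \<I> \<Longrightarrow> pair_of X (mate_of Z X s) = c \<cdot> (s \<cdot> e)"
    by (rule pair_mate_twisted[OF Z X]) blast
  let ?t = "pair_of X (mate_of Z X s)"
  have t: "is_arr ?t" "src ?t = Z \<boxtimes> X" "tgt ?t = \<I>" using s Z X by auto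
  have "mate_of Z X ?t = mate_of Z X s" using mate_pair[of "mate_of Z X s" X] s Z X by simp
  then have "c \<cdot> (?t \<cdot> e) = c \<cdot> (s \<cdot> e)" using pm[OF t] pm[OF s] by simp
  then have "?t \<cdot> e = s \<cdot> e" by (rule isom_cancel_left) (use s t c e in auto)
  then show "?t = s" by (rule isom_cancel_right) (use s t c e in auto)
qed

lemma dual_arr_mate:
  assumes f: "is_arr f"
  shows "dual_arr (src f) (tgt f) f = mate_of ((tgt f)\<^sup>\<or>) (src f) (ev (tgt f) \<cdot> (\<iota> ((tgt f)\<^sup>\<or>) \<boxtimes>\<^sub>m f))"
proof -
  let ?X = "src f" and ?Y = "tgt f"
  let ?k = "(\<iota> (?Y\<^sup>\<or>) \<boxtimes>\<^sub>m coev ?X) \<cdot> inv_of (runit (?Y\<^sup>\<or>))"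
  have "inv_of (assoc (?Y\<^sup>\<or>) ?Y (?X\<^sup>\<or>)) \<cdot> (\<iota> (?Y\<^sup>\<or>) \<boxtimes>\<^sub>m (f \<boxtimes>\<^sub>m \<iota> (?X\<^sup>\<or>)))
      = ((\<iota> (?Y\<^sup>\<or>) \<boxtimes>\<^sub>m f) \<boxtimes>\<^sub>m \<iota> (?X\<^sup>\<or>)) \<cdot> inv_of (assoc (?Y\<^sup>\<or>) ?X (?X\<^sup>\<or>))"
    using assoc_inv_nat[of "\<iota> (?Y\<^sup>\<or>)" f "\<iota> (?X\<^sup>\<or>)"] f by simp
  from assoc_comp_eq[OF this, of ?k] f show ?thesis
    by (simp add: dual_arr_def mate_of_def tens_comp_left)
qed

lemma dual_arr_arr [simp]:
  assumes f: "is_arr f"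
  shows "is_arr (dual_arr (src f) (tgt f) f)" "src (dual_arr (src f) (tgt f) f) = (tgt f)\<^sup>\<or>"
    "tgt (dual_arr (src f) (tgt f) f) = (src f)\<^sup>\<or>"
  using f by (simp_all add: dual_arr_mate)

lemma pair_dual_arr:
  assumes f: "is_arr f"
  shows "pair_of (src f) (dual_arr (src f) (tgt f) f) = ev (tgt f) \<cdot> (\<iota> ((tgt f)\<^sup>\<or>) \<boxtimes>\<^sub>m f)"
  unfolding dual_arr_mate[OF f] by (rule pair_mate) (use f in auto)

lemma dual_unit_arr:
  shows "is_arr dual_unit" "src dual_unit = \<I>" "tgt dual_unit = \<I>\<^sup>\<or>" "pair_of \<I> dual_unit = lunit \<I>"
proof -
  let ?P = "\<lambda>g. g \<in> Arr C \<I> (\<I>\<^sup>\<or>) \<and> ev \<I> \<cdot> (g \<boxtimes>\<^sub>m \<iota> \<I>) = lunit \<I>"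
  define g where "g = mate_of \<I> \<I> (lunit \<I>)"
  have g: "is_arr g" "src g = \<I>" "tgt g = \<I>\<^sup>\<or>" by (auto simp: g_def)
  have "?P g" using g pair_mate[of "lunit \<I>" \<I> \<I>] arrI[OF g] by (simp add: g_def pair_of_def)
  moreover have "h = g" if "?P h" for h
    using that mate_pair[of h \<I>] by (auto simp: hom_iff pair_of_def g_def)
  ultimately have "?P dual_unit" unfolding dual_unit_def by (rule theI)
  then show "is_arr dual_unit" "src dual_unit = \<I>" "tgt dual_unit = \<I>\<^sup>\<or>" "pair_of \<I> dual_unit = lunit \<I>"
    by (auto simp: hom_iff pair_of_def)
qed

lemma pair_of_comp:
  assumes "is_arr w" "is_arr v" "src w = tgt v" "tgt w = X\<^sup>\<or>" "X \<in> Ob C"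
  shows "pair_of X (w \<cdot> v) = pair_of X w \<cdot> (v \<boxtimes>\<^sub>m \<iota> X)"
  using assms by (simp add: pair_of_def tens_comp_left)

text \<open>Under the correspondence with arrows \<open>\<I> \<boxtimes> X \<rightarrow> \<I>\<close>, transposition becomes composition with \<open>lunit\<close>,
  which is visibly bijective.\<close>

lemma pair_of_functional:
  assumes t: "is_arr t" "tgt t = \<I>"
  shows "pair_of (src t) (dual_arr (src t) \<I> t \<cdot> dual_unit) = t \<cdot> lunit (src t)"
proof -
  let ?X = "src t"
  note d = dual_arr_arr[OF t(1), unfolded t(2)] and u = dual_unit_arr
  have "pair_of ?X (dual_arr ?X \<I> t \<cdot> dual_unit) = (ev \<I> \<cdot> (\<iota> (\<I>\<^sup>\<or>) \<boxtimes>\<^sub>m t)) \<cdot> (dual_unit \<boxtimes>\<^sub>m \<iota> ?X)"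
    using pair_of_comp[of "dual_arr ?X \<I> t" dual_unit ?X] pair_dual_arr[OF t(1)] t d u by simp
  also have "\<dots> = (ev \<I> \<cdot> (dual_unit \<boxtimes>\<^sub>m \<iota> \<I>)) \<cdot> (\<iota> \<I> \<boxtimes>\<^sub>m t)"
    using t u by (simp add: interchange)
  also have "\<dots> = lunit \<I> \<cdot> (\<iota> \<I> \<boxtimes>\<^sub>m t)" using u(4) by (simp add: pair_of_def)
  also have "\<dots> = t \<cdot> lunit ?X" using lunit_nat[of t] t by simp
  finally show ?thesis .
qed

lemma ex1_functional:
  assumes r: "is_arr r" "src r = \<I>" "tgt r = X\<^sup>\<or>" and X: "X \<in> Ob C"
  shows "\<exists>!t. t \<in> Arr C X \<I> \<and> dual_arr X \<I> t \<cdot> dual_unit = r"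
proof (rule ex1I)
  define t where "t = pair_of X r \<cdot> inv_of (lunit X)"
  have t: "is_arr t" "src t = X" "tgt t = \<I>" using r X by (auto simp: t_def)
  note d = dual_arr_arr[OF t(1), unfolded t(2,3)] and u = dual_unit_arr
  have "pair_of X (dual_arr X \<I> t \<cdot> dual_unit) = pair_of X r"
    using pair_of_functional[OF t(1,3)] t r X by (simp add: t_def)
  then have "dual_arr X \<I> t \<cdot> dual_unit = r"
    using mate_pair[of "dual_arr X \<I> t \<cdot> dual_unit" X] mate_pair[OF r(1,3) X] d u r X by simp
  then show "t \<in> Arr C X \<I> \<and> dual_arr X \<I> t \<cdot> dual_unit = r" using arrI[OF t] by blast
  fix s assume "s \<in> Arr C X \<I> \<and> dual_arr X \<I> s \<cdot> dual_unit = r"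
  then have s: "is_arr s" "src s = X" "tgt s = \<I>" and e: "dual_arr X \<I> s \<cdot> dual_unit = r" using X by (auto simp: hom_iff)
  have "s \<cdot> lunit X = pair_of X r" using pair_of_functional[OF s(1,3)] s e by simp
  then have "(s \<cdot> lunit X) \<cdot> inv_of (lunit X) = t" by (simp add: t_def)
  then show "s = t" using s X by simp
qed

lemma functional_zero:
  assumes X: "X \<in> Ob C"
  shows "dual_arr X \<I> (zero_arr X \<I>) \<cdot> dual_unit = zero_arr \<I> (X\<^sup>\<or>)"
proof -
  let ?z = "zero_arr X \<I>"
  have z: "is_arr ?z" "src ?z = X" "tgt ?z = \<I>" using X by auto
  note d = dual_arr_arr[OF z(1), unfolded z(2,3)] and u = dual_unit_arr
  have zt: "zero_arr \<I> (X\<^sup>\<or>) \<boxtimes>\<^sub>m \<iota> X = zero_arr (\<I> \<boxtimes> X) (X\<^sup>\<or> \<boxtimes> X)"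
    by (rule lin_map_zero[OF hom_space hom_space tens_linear_left]) (use X idn_arr in auto)
  have "pair_of X (dual_arr X \<I> ?z \<cdot> dual_unit) = pair_of X (zero_arr \<I> (X\<^sup>\<or>))"
    using pair_of_functional[OF z(1,3)] z X zt by (simp add: pair_of_def)
  then show ?thesis
    using mate_pair[of "dual_arr X \<I> ?z \<cdot> dual_unit" X] mate_pair[of "zero_arr \<I> (X\<^sup>\<or>)" X] d u X by simp
qed

end

section \<open>The action of an object on an exact module category\<close>

lemma (in finite_abelian_category) ex_projective_generator:
  "\<exists>P. projective_object C P \<and>
     (\<forall>f. is_arr f \<longrightarrow> f \<noteq> zero_arr (src f) (tgt f) \<longrightarrow>
        (\<exists>g. is_arr g \<and> src g = P \<and> tgt g = src f \<and> f \<cdot> g \<noteq> zero_arr P (tgt f)))"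
  using ex_matrix_category matrix_category.projective_generator by blast

sublocale finite_module_category \<subseteq> Mod: finite_abelian_category M
  by (rule finite_abelian)

context finite_module_category
begin

declare act_ob_closed [simp]

lemma action_arr [simp]:
  assumes "is_arr f" "Mod.is_arr w"
  shows "Mod.is_arr (f \<rhd>\<^sub>m w)" "Mod.src (f \<rhd>\<^sub>m w) = src f \<rhd> Mod.src w" "Mod.tgt (f \<rhd>\<^sub>m w) = tgt f \<rhd> Mod.tgt w"
proof -
  have "f \<rhd>\<^sub>m w \<in> Arr M (src f \<rhd> Mod.src w) (tgt f \<rhd> Mod.tgt w)"
    using act_arr_closed[of "src f" "tgt f" "Mod.src w" "Mod.tgt w" f w] assms arr_hom Mod.arr_hom by simp
  then show "Mod.is_arr (f \<rhd>\<^sub>m w)" "Mod.src (f \<rhd>\<^sub>m w) = src f \<rhd> Mod.src w" "Mod.tgt (f \<rhd>\<^sub>m w) = tgt f \<rhd> Mod.tgt w"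
    using Mod.arrD assms by simp_all
qed

lemma action_idn [simp]: "X \<in> Ob C \<Longrightarrow> K \<in> Ob M \<Longrightarrow> \<iota> X \<rhd>\<^sub>m \<iota>\<^bsub>M\<^esub> K = \<iota>\<^bsub>M\<^esub> (X \<rhd> K)"
  using act_right_exact_right[of X] by (simp add: right_exact_functor_def linear_functor_def is_functor_def)

lemma action_interchange:
  assumes "is_arr f" "is_arr g" "Mod.is_arr w" "Mod.is_arr v" "src g = tgt f" "Mod.src v = Mod.tgt w"
  shows "(g \<rhd>\<^sub>m v) \<cdot>\<^bsub>M\<^esub> (f \<rhd>\<^sub>m w) = (g \<cdot> f) \<rhd>\<^sub>m (v \<cdot>\<^bsub>M\<^esub> w)"
  using act_comp[of "src f" "tgt f" "tgt g" "Mod.src w" "Mod.tgt w" "Mod.tgt v" f g w v] assms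
    arr_hom[of f] arr_hom[of g] Mod.arr_hom[of w] Mod.arr_hom[of v] by simp

lemma action_comp_right:
  assumes "X \<in> Ob C" "Mod.is_arr w" "Mod.is_arr v" "Mod.src v = Mod.tgt w"
  shows "\<iota> X \<rhd>\<^sub>m (v \<cdot>\<^bsub>M\<^esub> w) = (\<iota> X \<rhd>\<^sub>m v) \<cdot>\<^bsub>M\<^esub> (\<iota> X \<rhd>\<^sub>m w)"
  using action_interchange[of "\<iota> X" "\<iota> X" w v] assms by simp

lemma action_comp_left:
  assumes "K \<in> Ob M" "is_arr f" "is_arr g" "src g = tgt f"
  shows "(g \<cdot> f) \<rhd>\<^sub>m \<iota>\<^bsub>M\<^esub> K = (g \<rhd>\<^sub>m \<iota>\<^bsub>M\<^esub> K) \<cdot>\<^bsub>M\<^esub> (f \<rhd>\<^sub>m \<iota>\<^bsub>M\<^esub> K)"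
  using action_interchange[of f g "\<iota>\<^bsub>M\<^esub> K" "\<iota>\<^bsub>M\<^esub> K"] assms by simp

lemma action_linear: "X \<in> Ob C \<Longrightarrow> linear_functor M M (\<lambda>K. X \<rhd> K) (\<lambda>g. \<iota> X \<rhd>\<^sub>m g)"
  using act_right_exact_right by (simp add: right_exact_functor_def)

lemma action_zero_right: "X \<in> Ob C \<Longrightarrow> K \<in> Ob M \<Longrightarrow> N \<in> Ob M \<Longrightarrow> \<iota> X \<rhd>\<^sub>m Mod.zero_arr K N = Mod.zero_arr (X \<rhd> K) (X \<rhd> N)"
  by (rule lin_map_zero[OF Mod.hom_space Mod.hom_space Mod.linear_functorD(6)[OF action_linear]]) auto

lemma action_zero_left:
  assumes "X \<in> Ob C" "Y \<in> Ob C" "K \<in> Ob M"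
  shows "zero_arr X Y \<rhd>\<^sub>m \<iota>\<^bsub>M\<^esub> K = Mod.zero_arr (X \<rhd> K) (Y \<rhd> K)"
proof -
  have "(\<lambda>f. f \<rhd>\<^sub>m \<iota>\<^bsub>M\<^esub> K) \<in> lin_maps (Hom C X Y) (Hom M (X \<rhd> K) (Y \<rhd> K))"
    using act_right_exact_left[OF assms(3)] assms by (simp add: right_exact_functor_def linear_functor_def)
  from lin_map_zero[OF hom_space Mod.hom_space this] show ?thesis using assms by simp
qed

lemma massoc_arr [simp]:
  assumes "X \<in> Ob C" "Y \<in> Ob C" "K \<in> Ob M"
  shows "Mod.isom (massoc X Y K)" "Mod.src (massoc X Y K) = (X \<boxtimes> Y) \<rhd> K" "Mod.tgt (massoc X Y K) = X \<rhd> (Y \<rhd> K)"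
  using Mod.isomD[OF massoc_iso[OF assms]] assms by simp_all

lemma munit_arr [simp]:
  assumes "K \<in> Ob M"
  shows "Mod.isom (munit K)" "Mod.src (munit K) = \<I> \<rhd> K" "Mod.tgt (munit K) = K"
  using Mod.isomD[OF munit_iso[OF assms]] assms by simp_all

lemma massoc_nat:
  assumes "is_arr f" "is_arr g" "Mod.is_arr w"
  shows "massoc (tgt f) (tgt g) (Mod.tgt w) \<cdot>\<^bsub>M\<^esub> ((f \<boxtimes>\<^sub>m g) \<rhd>\<^sub>m w) = (f \<rhd>\<^sub>m (g \<rhd>\<^sub>m w)) \<cdot>\<^bsub>M\<^esub> massoc (src f) (src g) (Mod.src w)"
  using massoc_natural[of "src f" "tgt f" "src g" "tgt g" "Mod.src w" "Mod.tgt w" f g w] assms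
    arr_hom[of f] arr_hom[of g] Mod.arr_hom[of w] by simp

lemma munit_nat: "Mod.is_arr w \<Longrightarrow> munit (Mod.tgt w) \<cdot>\<^bsub>M\<^esub> (\<iota> \<I> \<rhd>\<^sub>m w) = w \<cdot>\<^bsub>M\<^esub> munit (Mod.src w)"
  using munit_natural[of "Mod.src w" "Mod.tgt w" w] Mod.arr_hom[of w] by simp

lemma isom_action [simp]: "isom f \<Longrightarrow> Mod.isom w \<Longrightarrow> Mod.isom (f \<rhd>\<^sub>m w)"
  by (rule Mod.isomI[of _ "inv_of f \<rhd>\<^sub>m Mod.inv_of w"]) (auto simp: action_interchange)

text \<open>Unit and counit of the adjunction between \<open>P\<^sup>\<or> \<rhd> -\<close> and \<open>P \<rhd> -\<close>, and the composite of the two on \<open>P \<rhd> K\<close>.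
  This composite is the identity by coherence, but the transposition of arrows needs it only to be a natural
  isomorphism, and this follows at once from the axioms: \<open>zigzag_lunit\<close> expresses it by
  structural isomorphisms.\<close>

definition adj_unit :: "'oc \<Rightarrow> 'om \<Rightarrow> 'mm" where
  "adj_unit P K = massoc P (P\<^sup>\<or>) K \<cdot>\<^bsub>M\<^esub> (coev P \<rhd>\<^sub>m \<iota>\<^bsub>M\<^esub> K) \<cdot>\<^bsub>M\<^esub> Mod.inv_of (munit K)"

definition adj_counit :: "'oc \<Rightarrow> 'om \<Rightarrow> 'mm" where
  "adj_counit P K = munit K \<cdot>\<^bsub>M\<^esub> (ev P \<rhd>\<^sub>m \<iota>\<^bsub>M\<^esub> K) \<cdot>\<^bsub>M\<^esub> Mod.inv_of (massoc (P\<^sup>\<or>) P K)"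

definition zigzag :: "'oc \<Rightarrow> 'om \<Rightarrow> 'mm" where
  "zigzag P K = (\<iota> P \<rhd>\<^sub>m adj_counit P K) \<cdot>\<^bsub>M\<^esub> adj_unit P (P \<rhd> K)"

lemma adj_unit_arr [simp]:
  assumes "P \<in> Ob C" "K \<in> Ob M"
  shows "Mod.is_arr (adj_unit P K)" "Mod.src (adj_unit P K) = K" "Mod.tgt (adj_unit P K) = P \<rhd> (P\<^sup>\<or> \<rhd> K)"
  using assms by (auto simp: adj_unit_def)

lemma adj_counit_arr [simp]:
  assumes "P \<in> Ob C" "K \<in> Ob M"
  shows "Mod.is_arr (adj_counit P K)" "Mod.src (adj_counit P K) = P\<^sup>\<or> \<rhd> (P \<rhd> K)" "Mod.tgt (adj_counit P K) = K"
  using assms by (auto simp: adj_counit_def)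

lemma zigzag_arr [simp]:
  assumes "P \<in> Ob C" "K \<in> Ob M"
  shows "Mod.is_arr (zigzag P K)" "Mod.src (zigzag P K) = P \<rhd> K" "Mod.tgt (zigzag P K) = P \<rhd> K"
  using assms by (auto simp: zigzag_def)

lemma adj_unit_nat:
  assumes P: "P \<in> Ob C" and w: "Mod.is_arr w"
  shows "adj_unit P (Mod.tgt w) \<cdot>\<^bsub>M\<^esub> w = (\<iota> P \<rhd>\<^sub>m (\<iota> (P\<^sup>\<or>) \<rhd>\<^sub>m w)) \<cdot>\<^bsub>M\<^esub> adj_unit P (Mod.src w)"
proof -
  let ?K = "Mod.src w" and ?N = "Mod.tgt w" and ?D = "P\<^sup>\<or>"
  have 1: "Mod.inv_of (munit ?N) \<cdot>\<^bsub>M\<^esub> w = (\<iota> \<I> \<rhd>\<^sub>m w) \<cdot>\<^bsub>M\<^esub> Mod.inv_of (munit ?K)"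
    by (rule Mod.inv_natural[OF munit_nat[OF w]]) (use w in auto)
  have 2: "(coev P \<rhd>\<^sub>m \<iota>\<^bsub>M\<^esub> ?N) \<cdot>\<^bsub>M\<^esub> (\<iota> \<I> \<rhd>\<^sub>m w) = (\<iota> (P \<boxtimes> ?D) \<rhd>\<^sub>m w) \<cdot>\<^bsub>M\<^esub> (coev P \<rhd>\<^sub>m \<iota>\<^bsub>M\<^esub> ?K)"
    using P w by (simp add: action_interchange)
  have 3: "massoc P ?D ?N \<cdot>\<^bsub>M\<^esub> (\<iota> (P \<boxtimes> ?D) \<rhd>\<^sub>m w) = (\<iota> P \<rhd>\<^sub>m (\<iota> ?D \<rhd>\<^sub>m w)) \<cdot>\<^bsub>M\<^esub> massoc P ?D ?K"
    using massoc_nat[of "\<iota> P" "\<iota> ?D" w] P w by simp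
  let ?m = "Mod.inv_of (munit ?K)"
  have "adj_unit P ?N \<cdot>\<^bsub>M\<^esub> w = massoc P ?D ?N \<cdot>\<^bsub>M\<^esub> ((coev P \<rhd>\<^sub>m \<iota>\<^bsub>M\<^esub> ?N) \<cdot>\<^bsub>M\<^esub> ((\<iota> \<I> \<rhd>\<^sub>m w) \<cdot>\<^bsub>M\<^esub> ?m))"
    using P w by (simp add: adj_unit_def 1)
  also have "\<dots> = massoc P ?D ?N \<cdot>\<^bsub>M\<^esub> ((\<iota> (P \<boxtimes> ?D) \<rhd>\<^sub>m w) \<cdot>\<^bsub>M\<^esub> ((coev P \<rhd>\<^sub>m \<iota>\<^bsub>M\<^esub> ?K) \<cdot>\<^bsub>M\<^esub> ?m))"
    using Mod.assoc_comp_eq[OF 2, of ?m] P w by simp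
  also have "\<dots> = (\<iota> P \<rhd>\<^sub>m (\<iota> ?D \<rhd>\<^sub>m w)) \<cdot>\<^bsub>M\<^esub> adj_unit P ?K"
    using Mod.assoc_comp_eq[OF 3, of "(coev P \<rhd>\<^sub>m \<iota>\<^bsub>M\<^esub> ?K) \<cdot>\<^bsub>M\<^esub> ?m"] P w by (simp add: adj_unit_def)
  finally show ?thesis .
qed

lemma adj_counit_nat:
  assumes P: "P \<in> Ob C" and w: "Mod.is_arr w"
  shows "adj_counit P (Mod.tgt w) \<cdot>\<^bsub>M\<^esub> (\<iota> (P\<^sup>\<or>) \<rhd>\<^sub>m (\<iota> P \<rhd>\<^sub>m w)) = w \<cdot>\<^bsub>M\<^esub> adj_counit P (Mod.src w)"
proof -
  let ?K = "Mod.src w" and ?N = "Mod.tgt w" and ?D = "P\<^sup>\<or>"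
  have "massoc ?D P ?N \<cdot>\<^bsub>M\<^esub> (\<iota> (?D \<boxtimes> P) \<rhd>\<^sub>m w) = (\<iota> ?D \<rhd>\<^sub>m (\<iota> P \<rhd>\<^sub>m w)) \<cdot>\<^bsub>M\<^esub> massoc ?D P ?K"
    using massoc_nat[of "\<iota> ?D" "\<iota> P" w] P w by simp
  from Mod.inv_natural[OF this]
  have 1: "Mod.inv_of (massoc ?D P ?N) \<cdot>\<^bsub>M\<^esub> (\<iota> ?D \<rhd>\<^sub>m (\<iota> P \<rhd>\<^sub>m w)) = (\<iota> (?D \<boxtimes> P) \<rhd>\<^sub>m w) \<cdot>\<^bsub>M\<^esub> Mod.inv_of (massoc ?D P ?K)"
    using P w by simp
  have 2: "(ev P \<rhd>\<^sub>m \<iota>\<^bsub>M\<^esub> ?N) \<cdot>\<^bsub>M\<^esub> (\<iota> (?D \<boxtimes> P) \<rhd>\<^sub>m w) = (\<iota> \<I> \<rhd>\<^sub>m w) \<cdot>\<^bsub>M\<^esub> (ev P \<rhd>\<^sub>m \<iota>\<^bsub>M\<^esub> ?K)"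
    using P w by (simp add: action_interchange)
  let ?m = "Mod.inv_of (massoc ?D P ?K)"
  have "adj_counit P ?N \<cdot>\<^bsub>M\<^esub> (\<iota> ?D \<rhd>\<^sub>m (\<iota> P \<rhd>\<^sub>m w))
      = munit ?N \<cdot>\<^bsub>M\<^esub> ((ev P \<rhd>\<^sub>m \<iota>\<^bsub>M\<^esub> ?N) \<cdot>\<^bsub>M\<^esub> ((\<iota> (?D \<boxtimes> P) \<rhd>\<^sub>m w) \<cdot>\<^bsub>M\<^esub> ?m))"
    using P w by (simp add: adj_counit_def 1)
  also have "\<dots> = munit ?N \<cdot>\<^bsub>M\<^esub> ((\<iota> \<I> \<rhd>\<^sub>m w) \<cdot>\<^bsub>M\<^esub> ((ev P \<rhd>\<^sub>m \<iota>\<^bsub>M\<^esub> ?K) \<cdot>\<^bsub>M\<^esub> ?m))"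
    using Mod.assoc_comp_eq[OF 2, of ?m] P w by simp
  also have "\<dots> = w \<cdot>\<^bsub>M\<^esub> adj_counit P ?K"
    using Mod.assoc_comp_eq[OF munit_nat[OF w], of "(ev P \<rhd>\<^sub>m \<iota>\<^bsub>M\<^esub> ?K) \<cdot>\<^bsub>M\<^esub> ?m"] P w by (simp add: adj_counit_def)
  finally show ?thesis .
qed

text \<open>The pentagon collects the action of \<open>P\<close>, \<open>P\<^sup>\<or>\<close> and \<open>P\<close> into the action of the zigzag of
  \<open>P\<close> in the tensor category, which is \<open>lunit P\<close>.\<close>

lemma zigzag_lunit:
  assumes P: "P \<in> Ob C" and K: "K \<in> Ob M"
  shows "zigzag P K \<cdot>\<^bsub>M\<^esub> (munit (P \<rhd> K) \<cdot>\<^bsub>M\<^esub> massoc \<I> P K) = lunit P \<rhd>\<^sub>m \<iota>\<^bsub>M\<^esub> K"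
proof -
  let ?D = "P\<^sup>\<or>"
  let ?i = "\<iota> P \<rhd>\<^sub>m Mod.inv_of (massoc ?D P K)"
  let ?h = "(\<iota> P \<rhd>\<^sub>m munit K) \<cdot>\<^bsub>M\<^esub> (\<iota> P \<rhd>\<^sub>m (ev P \<rhd>\<^sub>m \<iota>\<^bsub>M\<^esub> K))"
  have 1: "(coev P \<rhd>\<^sub>m \<iota>\<^bsub>M\<^esub> (P \<rhd> K)) \<cdot>\<^bsub>M\<^esub> massoc \<I> P K = massoc (P \<boxtimes> ?D) P K \<cdot>\<^bsub>M\<^esub> ((coev P \<boxtimes>\<^sub>m \<iota> P) \<rhd>\<^sub>m \<iota>\<^bsub>M\<^esub> K)"
    using massoc_nat[of "coev P" "\<iota> P" "\<iota>\<^bsub>M\<^esub> K"] P K by simp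
  have 2: "?i \<cdot>\<^bsub>M\<^esub> (massoc P ?D (P \<rhd> K) \<cdot>\<^bsub>M\<^esub> massoc (P \<boxtimes> ?D) P K) = massoc P (?D \<boxtimes> P) K \<cdot>\<^bsub>M\<^esub> (assoc P ?D P \<rhd>\<^sub>m \<iota>\<^bsub>M\<^esub> K)"
  proof -
    have "?i \<cdot>\<^bsub>M\<^esub> (massoc P ?D (P \<rhd> K) \<cdot>\<^bsub>M\<^esub> massoc (P \<boxtimes> ?D) P K)
        = (?i \<cdot>\<^bsub>M\<^esub> (\<iota> P \<rhd>\<^sub>m massoc ?D P K)) \<cdot>\<^bsub>M\<^esub> (massoc P (?D \<boxtimes> P) K \<cdot>\<^bsub>M\<^esub> (assoc P ?D P \<rhd>\<^sub>m \<iota>\<^bsub>M\<^esub> K))"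
      unfolding act_pentagon[OF P dual_arrows(1)[OF P] P K] using P K by simp
    also have "?i \<cdot>\<^bsub>M\<^esub> (\<iota> P \<rhd>\<^sub>m massoc ?D P K) = \<iota>\<^bsub>M\<^esub> (P \<rhd> ((?D \<boxtimes> P) \<rhd> K))"
      using P K by (simp add: action_interchange)
    finally show ?thesis using P K by simp
  qed
  have 3: "(\<iota> P \<rhd>\<^sub>m (ev P \<rhd>\<^sub>m \<iota>\<^bsub>M\<^esub> K)) \<cdot>\<^bsub>M\<^esub> massoc P (?D \<boxtimes> P) K = massoc P \<I> K \<cdot>\<^bsub>M\<^esub> ((\<iota> P \<boxtimes>\<^sub>m ev P) \<rhd>\<^sub>m \<iota>\<^bsub>M\<^esub> K)"
    using massoc_nat[of "\<iota> P" "ev P" "\<iota>\<^bsub>M\<^esub> K"] P K by simp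
  let ?a = "(assoc P ?D P \<rhd>\<^sub>m \<iota>\<^bsub>M\<^esub> K) \<cdot>\<^bsub>M\<^esub> ((coev P \<boxtimes>\<^sub>m \<iota> P) \<rhd>\<^sub>m \<iota>\<^bsub>M\<^esub> K)"
  have "zigzag P K \<cdot>\<^bsub>M\<^esub> (munit (P \<rhd> K) \<cdot>\<^bsub>M\<^esub> massoc \<I> P K)
      = ?h \<cdot>\<^bsub>M\<^esub> (?i \<cdot>\<^bsub>M\<^esub> (massoc P ?D (P \<rhd> K) \<cdot>\<^bsub>M\<^esub> ((coev P \<rhd>\<^sub>m \<iota>\<^bsub>M\<^esub> (P \<rhd> K)) \<cdot>\<^bsub>M\<^esub> massoc \<I> P K)))"
    using P K by (simp add: zigzag_def adj_unit_def adj_counit_def action_comp_right)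
  also have "\<dots> = ?h \<cdot>\<^bsub>M\<^esub> ((?i \<cdot>\<^bsub>M\<^esub> (massoc P ?D (P \<rhd> K) \<cdot>\<^bsub>M\<^esub> massoc (P \<boxtimes> ?D) P K)) \<cdot>\<^bsub>M\<^esub> ((coev P \<boxtimes>\<^sub>m \<iota> P) \<rhd>\<^sub>m \<iota>\<^bsub>M\<^esub> K))"
    unfolding 1 using P K by simp
  also have "\<dots> = (\<iota> P \<rhd>\<^sub>m munit K) \<cdot>\<^bsub>M\<^esub> (((\<iota> P \<rhd>\<^sub>m (ev P \<rhd>\<^sub>m \<iota>\<^bsub>M\<^esub> K)) \<cdot>\<^bsub>M\<^esub> massoc P (?D \<boxtimes> P) K) \<cdot>\<^bsub>M\<^esub> ?a)"
    unfolding 2 using P K by simp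
  also have "\<dots> = ((\<iota> P \<rhd>\<^sub>m munit K) \<cdot>\<^bsub>M\<^esub> massoc P \<I> K) \<cdot>\<^bsub>M\<^esub> (((\<iota> P \<boxtimes>\<^sub>m ev P) \<rhd>\<^sub>m \<iota>\<^bsub>M\<^esub> K) \<cdot>\<^bsub>M\<^esub> ?a)"
    unfolding 3 using P K by simp
  also have "\<dots> = (runit P \<cdot> ((\<iota> P \<boxtimes>\<^sub>m ev P) \<cdot> (assoc P ?D P \<cdot> (coev P \<boxtimes>\<^sub>m \<iota> P)))) \<rhd>\<^sub>m \<iota>\<^bsub>M\<^esub> K"
    unfolding act_triangle[OF P K] using P K by (simp add: action_comp_left)
  finally show ?thesis unfolding zigzag_dual(2)[OF P] .
qed

lemma isom_zigzag [simp]: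
  assumes P: "P \<in> Ob C" and K: "K \<in> Ob M"
  shows "Mod.isom (zigzag P K)"
proof (rule Mod.isom_of_comp_left)
  show "Mod.isom (zigzag P K \<cdot>\<^bsub>M\<^esub> (munit (P \<rhd> K) \<cdot>\<^bsub>M\<^esub> massoc \<I> P K))"
    unfolding zigzag_lunit[OF P K] using P K by simp
qed (use P K in auto)

lemma zigzag_nat:
  assumes P: "P \<in> Ob C" and w: "Mod.is_arr w"
  shows "zigzag P (Mod.tgt w) \<cdot>\<^bsub>M\<^esub> (\<iota> P \<rhd>\<^sub>m w) = (\<iota> P \<rhd>\<^sub>m w) \<cdot>\<^bsub>M\<^esub> zigzag P (Mod.src w)"
proof -
  let ?K = "Mod.src w" and ?N = "Mod.tgt w"
  have "zigzag P ?N \<cdot>\<^bsub>M\<^esub> (\<iota> P \<rhd>\<^sub>m w)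
      = (\<iota> P \<rhd>\<^sub>m adj_counit P ?N) \<cdot>\<^bsub>M\<^esub> ((\<iota> P \<rhd>\<^sub>m (\<iota> (P\<^sup>\<or>) \<rhd>\<^sub>m (\<iota> P \<rhd>\<^sub>m w))) \<cdot>\<^bsub>M\<^esub> adj_unit P (P \<rhd> ?K))"
    using adj_unit_nat[OF P, of "\<iota> P \<rhd>\<^sub>m w"] P w by (simp add: zigzag_def)
  also have "\<dots> = (\<iota> P \<rhd>\<^sub>m (adj_counit P ?N \<cdot>\<^bsub>M\<^esub> (\<iota> (P\<^sup>\<or>) \<rhd>\<^sub>m (\<iota> P \<rhd>\<^sub>m w)))) \<cdot>\<^bsub>M\<^esub> adj_unit P (P \<rhd> ?K)"
    using P w by (simp add: action_comp_right)
  also have "\<dots> = (\<iota> P \<rhd>\<^sub>m w) \<cdot>\<^bsub>M\<^esub> zigzag P ?K"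
    unfolding adj_counit_nat[OF P w] using P w by (simp add: action_comp_right zigzag_def)
  finally show ?thesis .
qed

text \<open>The arrow \<open>P\<^sup>\<or> \<rhd> K \<rightarrow> N\<close> adjoint to \<open>w : K \<rightarrow> P \<rhd> N\<close>.\<close>

definition transpose_of :: "'oc \<Rightarrow> 'om \<Rightarrow> 'mm \<Rightarrow> 'mm" where
  "transpose_of P N w = adj_counit P N \<cdot>\<^bsub>M\<^esub> (\<iota> (P\<^sup>\<or>) \<rhd>\<^sub>m w)"

lemma transpose_of_arr [simp]:
  assumes "P \<in> Ob C" "N \<in> Ob M" "Mod.is_arr w" "Mod.tgt w = P \<rhd> N"
  shows "Mod.is_arr (transpose_of P N w)" "Mod.src (transpose_of P N w) = P\<^sup>\<or> \<rhd> Mod.src w" "Mod.tgt (transpose_of P N w) = N"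
  using assms by (auto simp: transpose_of_def)

lemma transpose_of_comp:
  assumes P: "P \<in> Ob C" and w: "Mod.is_arr w" "Mod.tgt w = P \<rhd> Mod.src q" and q: "Mod.is_arr q"
  shows "transpose_of P (Mod.tgt q) ((\<iota> P \<rhd>\<^sub>m q) \<cdot>\<^bsub>M\<^esub> w) = q \<cdot>\<^bsub>M\<^esub> transpose_of P (Mod.src q) w"
proof -
  have "transpose_of P (Mod.tgt q) ((\<iota> P \<rhd>\<^sub>m q) \<cdot>\<^bsub>M\<^esub> w)
      = (adj_counit P (Mod.tgt q) \<cdot>\<^bsub>M\<^esub> (\<iota> (P\<^sup>\<or>) \<rhd>\<^sub>m (\<iota> P \<rhd>\<^sub>m q))) \<cdot>\<^bsub>M\<^esub> (\<iota> (P\<^sup>\<or>) \<rhd>\<^sub>m w)"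
    using P w q by (simp add: transpose_of_def action_comp_right)
  then show ?thesis unfolding adj_counit_nat[OF P q] using P w q by (simp add: transpose_of_def)
qed

lemma transpose_of_back:
  assumes P: "P \<in> Ob C" and N: "N \<in> Ob M" and w: "Mod.is_arr w" "Mod.tgt w = P \<rhd> N"
  shows "(\<iota> P \<rhd>\<^sub>m transpose_of P N w) \<cdot>\<^bsub>M\<^esub> adj_unit P (Mod.src w) = zigzag P N \<cdot>\<^bsub>M\<^esub> w"
proof -
  have "(\<iota> P \<rhd>\<^sub>m transpose_of P N w) \<cdot>\<^bsub>M\<^esub> adj_unit P (Mod.src w)
      = (\<iota> P \<rhd>\<^sub>m adj_counit P N) \<cdot>\<^bsub>M\<^esub> ((\<iota> P \<rhd>\<^sub>m (\<iota> (P\<^sup>\<or>) \<rhd>\<^sub>m w)) \<cdot>\<^bsub>M\<^esub> adj_unit P (Mod.src w))"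
    using P N w by (simp add: transpose_of_def action_comp_right)
  also have "\<dots> = (\<iota> P \<rhd>\<^sub>m adj_counit P N) \<cdot>\<^bsub>M\<^esub> (adj_unit P (P \<rhd> N) \<cdot>\<^bsub>M\<^esub> w)"
    using adj_unit_nat[OF P w(1)] w by simp
  finally show ?thesis using P N w by (simp add: zigzag_def)
qed

lemma action_cancel_mono:
  assumes P: "P \<in> Ob C" and v: "Mod.is_arr v" "mono_arr M (Mod.src v) (Mod.tgt v) v"
    and a: "Mod.is_arr a" "Mod.tgt a = P \<rhd> Mod.src v" and b: "Mod.is_arr b" "Mod.tgt b = P \<rhd> Mod.src v" "Mod.src b = Mod.src a"
    and e: "(\<iota> P \<rhd>\<^sub>m v) \<cdot>\<^bsub>M\<^esub> a = (\<iota> P \<rhd>\<^sub>m v) \<cdot>\<^bsub>M\<^esub> b"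
  shows "a = b"
proof -
  let ?L = "Mod.src v"
  have L: "?L \<in> Ob M" using v by simp
  have "v \<cdot>\<^bsub>M\<^esub> transpose_of P ?L a = v \<cdot>\<^bsub>M\<^esub> transpose_of P ?L b"
    using transpose_of_comp[OF P a v(1)] transpose_of_comp[OF P b(1,2) v(1)] e by simp
  moreover have "transpose_of P ?L a \<in> Arr M (P\<^sup>\<or> \<rhd> Mod.src a) ?L" "transpose_of P ?L b \<in> Arr M (P\<^sup>\<or> \<rhd> Mod.src a) ?L"
    using P L a b by (auto intro!: Mod.arrI)
  moreover have "P\<^sup>\<or> \<rhd> Mod.src a \<in> Ob M" using P a by simp
  ultimately have "transpose_of P ?L a = transpose_of P ?L b" using v(2) unfolding mono_arr_def by blast
  then have "zigzag P ?L \<cdot>\<^bsub>M\<^esub> a = zigzag P ?L \<cdot>\<^bsub>M\<^esub> b"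
    using transpose_of_back[OF P L a] transpose_of_back[OF P L b(1,2)] b by simp
  then show ?thesis by (rule Mod.isom_cancel_left) (use P L a b in auto)
qed

text \<open>If \<open>P \<rhd> q\<close> kills \<open>w\<close>, then \<open>q\<close> kills the transpose of \<open>w\<close>, which therefore factors through
  \<open>v\<close>. Transposing back gives a factorization of \<open>w\<close> up to the natural isomorphism \<open>zigzag\<close>.\<close>

lemma action_preserves_weak_kernel:
  assumes P: "P \<in> Ob C" and k: "Mod.weak_kernel q v"
  shows "Mod.weak_kernel (\<iota> P \<rhd>\<^sub>m q) (\<iota> P \<rhd>\<^sub>m v)"
proof -
  have q: "Mod.is_arr q" and v: "Mod.is_arr v" and qv: "Mod.src q = Mod.tgt v"
    and ker: "\<And>h. Mod.is_arr h \<Longrightarrow> Mod.tgt h = Mod.tgt v \<Longrightarrow> q \<cdot>\<^bsub>M\<^esub> h = Mod.zero_arr (Mod.src h) (Mod.tgt q) \<Longrightarrow>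
      \<exists>h'. Mod.is_arr h' \<and> Mod.src h' = Mod.src h \<and> Mod.tgt h' = Mod.src v \<and> v \<cdot>\<^bsub>M\<^esub> h' = h"
    using k by (auto simp: Mod.weak_kernel_def)
  let ?L = "Mod.src v" and ?N = "Mod.tgt v"
  have "\<exists>w'. Mod.is_arr w' \<and> Mod.src w' = Mod.src w \<and> Mod.tgt w' = P \<rhd> ?L \<and> (\<iota> P \<rhd>\<^sub>m v) \<cdot>\<^bsub>M\<^esub> w' = w"
    if w: "Mod.is_arr w" "Mod.tgt w = P \<rhd> ?N" and z: "(\<iota> P \<rhd>\<^sub>m q) \<cdot>\<^bsub>M\<^esub> w = Mod.zero_arr (Mod.src w) (P \<rhd> Mod.tgt q)" for w
  proof -
    let ?t = "transpose_of P ?N w"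
    have t: "Mod.is_arr ?t" "Mod.src ?t = P\<^sup>\<or> \<rhd> Mod.src w" "Mod.tgt ?t = ?N" using P v w by auto
    have "q \<cdot>\<^bsub>M\<^esub> ?t = transpose_of P (Mod.tgt q) (Mod.zero_arr (Mod.src w) (P \<rhd> Mod.tgt q))"
      using transpose_of_comp[OF P w(1) _ q] w qv z by simp
    also have "\<dots> = Mod.zero_arr (P\<^sup>\<or> \<rhd> Mod.src w) (Mod.tgt q)"
      using P w q by (simp add: transpose_of_def action_zero_right)
    finally obtain y where y: "Mod.is_arr y" "Mod.src y = P\<^sup>\<or> \<rhd> Mod.src w" "Mod.tgt y = ?L" "v \<cdot>\<^bsub>M\<^esub> y = ?t"
      using ker[OF t(1,3)] t by auto
    let ?y = "(\<iota> P \<rhd>\<^sub>m y) \<cdot>\<^bsub>M\<^esub> adj_unit P (Mod.src w)"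
    have y': "Mod.is_arr ?y" "Mod.src ?y = Mod.src w" "Mod.tgt ?y = P \<rhd> ?L" using P w y by auto
    have e: "(\<iota> P \<rhd>\<^sub>m v) \<cdot>\<^bsub>M\<^esub> ?y = zigzag P ?N \<cdot>\<^bsub>M\<^esub> w"
    proof -
      have "(\<iota> P \<rhd>\<^sub>m v) \<cdot>\<^bsub>M\<^esub> ?y = (\<iota> P \<rhd>\<^sub>m (v \<cdot>\<^bsub>M\<^esub> y)) \<cdot>\<^bsub>M\<^esub> adj_unit P (Mod.src w)"
        using P v w y(1-3) by (simp add: action_comp_right)
      then show ?thesis using transpose_of_back[OF P _ w] v y(4) by simp
    qed
    let ?w' = "Mod.inv_of (zigzag P ?L) \<cdot>\<^bsub>M\<^esub> ?y"
    have zn: "Mod.inv_of (zigzag P ?N) \<cdot>\<^bsub>M\<^esub> (\<iota> P \<rhd>\<^sub>m v) = (\<iota> P \<rhd>\<^sub>m v) \<cdot>\<^bsub>M\<^esub> Mod.inv_of (zigzag P ?L)"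
      by (rule Mod.inv_natural[OF zigzag_nat[OF P v]]) (use P v in auto)
    have "(\<iota> P \<rhd>\<^sub>m v) \<cdot>\<^bsub>M\<^esub> ?w' = Mod.inv_of (zigzag P ?N) \<cdot>\<^bsub>M\<^esub> ((\<iota> P \<rhd>\<^sub>m v) \<cdot>\<^bsub>M\<^esub> ?y)"
      using Mod.assoc_comp_eq[OF zn, of ?y] P v y' by (simp del: Mod.comp_arr add: Mod.comp_arr(1))
    also have "\<dots> = w" unfolding e using P v w by simp
    finally have "(\<iota> P \<rhd>\<^sub>m v) \<cdot>\<^bsub>M\<^esub> ?w' = w" .
    moreover have "Mod.is_arr ?w'" "Mod.src ?w' = Mod.src w" "Mod.tgt ?w' = P \<rhd> ?L" using P v y' by auto
    ultimately show ?thesis by blast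
  qed
  then show ?thesis using P q v qv by (auto simp: Mod.weak_kernel_def)
qed

end

text \<open>Let \<open>F = P \<rhd> -\<close>. Right exactness keeps \<open>F q\<close> an epimorphism, and its target is projective, so it
  has a section \<open>s\<close>. Then \<open>d = 1 - s \<circ> F q\<close> is killed by \<open>F q\<close> and factors as \<open>F v \<circ> r\<close>, because \<open>F\<close> preserves
  kernels. Finally \<open>F v \<circ> r \<circ> F v = F v\<close>, and \<open>F v\<close> is a monomorphism.\<close>

lemma (in exact_module_category) projective_action_splits_mono:
  assumes P: "projective_object C P" and v: "mono_arr M L (Mod.tgt v) v" and L: "L \<in> Ob M"
    and cok: "is_cokernel M L (Mod.tgt v) (Mod.tgt q) v q" and ker: "Mod.weak_kernel q v"
  shows "\<exists>r. Mod.is_arr r \<and> Mod.src r = P \<rhd> Mod.tgt v \<and> Mod.tgt r = P \<rhd> L \<and> r \<cdot>\<^bsub>M\<^esub> (\<iota> P \<rhd>\<^sub>m v) = \<iota>\<^bsub>M\<^esub> (P \<rhd> L)"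
proof -
  have Po: "P \<in> Ob C" using P by (simp add: projective_object_def)
  have v': "Mod.is_arr v" "Mod.is_arr q" "Mod.src q = Mod.tgt v" using ker by (auto simp: Mod.weak_kernel_def)
  have sv: "Mod.src v = L" using v v' L by (auto simp: mono_arr_def Mod.hom_iff)
  let ?N = "Mod.tgt v" and ?Q = "Mod.tgt q" and ?v = "\<iota> P \<rhd>\<^sub>m v" and ?q = "\<iota> P \<rhd>\<^sub>m q"
  have ob: "?N \<in> Ob M" "?Q \<in> Ob M" using v' by auto
  have va: "Mod.is_arr ?v" "Mod.src ?v = P \<rhd> L" "Mod.tgt ?v = P \<rhd> ?N"
    and qa: "Mod.is_arr ?q" "Mod.src ?q = P \<rhd> ?N" "Mod.tgt ?q = P \<rhd> ?Q" using v' sv Po by auto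
  have ck: "is_cokernel M (P \<rhd> L) (P \<rhd> ?N) (P \<rhd> ?Q) ?v ?q"
    using act_right_exact_right[OF Po] cok L ob unfolding right_exact_functor_def by blast
  then have epi: "epi_arr M (P \<rhd> ?N) (P \<rhd> ?Q) ?q" by (rule Mod.cokernel_imp_epi) (use Po L ob in auto)
  have "projective_object M (P \<rhd> ?Q)" by (rule exact[OF P ob(2)])
  moreover have "\<iota>\<^bsub>M\<^esub> (P \<rhd> ?Q) \<in> Arr M (P \<rhd> ?Q) (P \<rhd> ?Q)" by (rule Mod.idn_arr) (use Po ob in auto)
  ultimately obtain s where "s \<in> Arr M (P \<rhd> ?Q) (P \<rhd> ?N)" and qs: "?q \<cdot>\<^bsub>M\<^esub> s = \<iota>\<^bsub>M\<^esub> (P \<rhd> ?Q)"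
    using epi Po ob unfolding projective_object_def by (metis act_ob_closed)
  then have s: "Mod.is_arr s" "Mod.src s = P \<rhd> ?Q" "Mod.tgt s = P \<rhd> ?N" using Po ob by (auto simp: Mod.hom_iff)
  let ?V = "Hom M (P \<rhd> ?N) (P \<rhd> ?N)"
  interpret V: vectorspace class_ring ?V by (rule Mod.hom_space) (use Po ob in auto)
  have i: "\<iota>\<^bsub>M\<^esub> (P \<rhd> ?N) \<in> carrier ?V" by (rule Mod.idn_arr) (use Po ob in auto)
  have sq: "s \<cdot>\<^bsub>M\<^esub> ?q \<in> carrier ?V" by (rule Mod.arrI) (use s qa in auto)
  define d where "d = \<iota>\<^bsub>M\<^esub> (P \<rhd> ?N) \<ominus>\<^bsub>?V\<^esub> (s \<cdot>\<^bsub>M\<^esub> ?q)"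
  have d: "d \<in> carrier ?V" using i sq by (simp add: d_def)
  then have da: "Mod.is_arr d" "Mod.src d = P \<rhd> ?N" "Mod.tgt d = P \<rhd> ?N" using Mod.hom_iff Po ob by auto
  have "?q \<cdot>\<^bsub>M\<^esub> d = Mod.zero_arr (P \<rhd> ?N) (P \<rhd> ?Q)"
  proof -
    interpret W: vectorspace class_ring "Hom M (P \<rhd> ?N) (P \<rhd> ?Q)" by (rule Mod.hom_space) (use Po ob in auto)
    interpret h: mod_hom class_ring ?V "Hom M (P \<rhd> ?N) (P \<rhd> ?Q)" "\<lambda>f. ?q \<cdot>\<^bsub>M\<^esub> f"
      by unfold_locales (rule Mod.comp_linear_right, use Po ob in auto, rule Mod.arrI, use qa in auto)
    have "?q \<cdot>\<^bsub>M\<^esub> d = (?q \<cdot>\<^bsub>M\<^esub> \<iota>\<^bsub>M\<^esub> (P \<rhd> ?N)) \<ominus>\<^bsub>Hom M (P \<rhd> ?N) (P \<rhd> ?Q)\<^esub> (?q \<cdot>\<^bsub>M\<^esub> (s \<cdot>\<^bsub>M\<^esub> ?q))"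
      unfolding d_def by (rule h.f_minus[OF i sq])
    also have "?q \<cdot>\<^bsub>M\<^esub> (s \<cdot>\<^bsub>M\<^esub> ?q) = ?q" using Mod.assoc_comp_eq[OF qs qa(1) s(1) qa(1)] s qa by simp
    also have "?q \<cdot>\<^bsub>M\<^esub> \<iota>\<^bsub>M\<^esub> (P \<rhd> ?N) = ?q" using qa by simp
    finally show ?thesis using Mod.arrI[OF qa] by (simp add: W.r_neg a_minus_def)
  qed
  then obtain r where r: "Mod.is_arr r" "Mod.src r = P \<rhd> ?N" "Mod.tgt r = P \<rhd> L" and vr: "?v \<cdot>\<^bsub>M\<^esub> r = d"
    using Mod.weak_kernelD[OF action_preserves_weak_kernel[OF Po ker] da(1), unfolded va da qa] by auto
  \<comment> \<open>\<open>F q \<circ> F v\<close> is zero, so \<open>d\<close> acts on \<open>F v\<close> as the identity.\<close>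
  have dv: "d \<cdot>\<^bsub>M\<^esub> ?v = ?v"
  proof -
    let ?U = "Hom M (P \<rhd> L) (P \<rhd> ?N)"
    interpret W: vectorspace class_ring ?U by (rule Mod.hom_space) (use Po ob L in auto)
    interpret h: mod_hom class_ring ?V ?U "\<lambda>f. f \<cdot>\<^bsub>M\<^esub> ?v"
      by unfold_locales (rule Mod.comp_linear_left, use Po ob L in auto, rule Mod.arrI, use va in auto)
    have "d \<cdot>\<^bsub>M\<^esub> ?v = (\<iota>\<^bsub>M\<^esub> (P \<rhd> ?N) \<cdot>\<^bsub>M\<^esub> ?v) \<ominus>\<^bsub>?U\<^esub> ((s \<cdot>\<^bsub>M\<^esub> ?q) \<cdot>\<^bsub>M\<^esub> ?v)"
      unfolding d_def by (rule h.f_minus[OF i sq])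
    also have "(s \<cdot>\<^bsub>M\<^esub> ?q) \<cdot>\<^bsub>M\<^esub> ?v = s \<cdot>\<^bsub>M\<^esub> (?q \<cdot>\<^bsub>M\<^esub> ?v)" using s qa va by simp
    also have "?q \<cdot>\<^bsub>M\<^esub> ?v = Mod.zero_arr (P \<rhd> L) (P \<rhd> ?Q)" using ck by (simp add: is_cokernel_def)
    also have "s \<cdot>\<^bsub>M\<^esub> Mod.zero_arr (P \<rhd> L) (P \<rhd> ?Q) = Mod.zero_arr (P \<rhd> L) (P \<rhd> ?N)" using s Po L by simp
    also have "\<iota>\<^bsub>M\<^esub> (P \<rhd> ?N) \<cdot>\<^bsub>M\<^esub> ?v = ?v" using va by simp
    finally show ?thesis using Mod.arrI[OF va] by (simp add: a_minus_def)
  qed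
  have "r \<cdot>\<^bsub>M\<^esub> ?v = \<iota>\<^bsub>M\<^esub> (P \<rhd> L)"
  proof (rule action_cancel_mono[OF Po v'(1)])
    show "mono_arr M (Mod.src v) (Mod.tgt v) v" using v sv by simp
    show "?v \<cdot>\<^bsub>M\<^esub> (r \<cdot>\<^bsub>M\<^esub> ?v) = ?v \<cdot>\<^bsub>M\<^esub> \<iota>\<^bsub>M\<^esub> (P \<rhd> L)"
      using Mod.assoc_comp_eq[OF vr, of ?v] r va dv by simp
  qed (use r va sv Po L in auto)
  then show ?thesis using r by blast
qed

section \<open>Internal Homs, the end and the trace\<close>

context exact_module_category
begin

declare ihom_ob [simp]

lemma iev_arr' [simp]:
  assumes "K \<in> Ob M" "N \<in> Ob M"
  shows "Mod.is_arr (iev K N)" "Mod.src (iev K N) = ihom K N \<rhd> K" "Mod.tgt (iev K N) = N"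
  using Mod.arrD[OF iev_arr[OF assms]] assms by simp_all

lemma adjunct:
  assumes "X \<in> Ob C" "K \<in> Ob M" "Mod.is_arr w" "Mod.src w = X \<rhd> K" "Mod.tgt w = N"
  shows "is_arr (adjunct X K N w)" "src (adjunct X K N w) = X" "tgt (adjunct X K N w) = ihom K N"
    "iev K N \<cdot>\<^bsub>M\<^esub> (adjunct X K N w \<rhd>\<^sub>m \<iota>\<^bsub>M\<^esub> K) = w"
proof -
  have N: "N \<in> Ob M" using assms by auto
  have "\<exists>!g. g \<in> Arr C X (ihom K N) \<and> iev K N \<cdot>\<^bsub>M\<^esub> (g \<rhd>\<^sub>m \<iota>\<^bsub>M\<^esub> K) = w"
    by (rule ihom_universal[OF assms(1,2) N]) (rule Mod.arrI[OF assms(3-5)])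
  from theI'[OF this] have a: "adjunct X K N w \<in> Arr C X (ihom K N)"
    and e: "iev K N \<cdot>\<^bsub>M\<^esub> (adjunct X K N w \<rhd>\<^sub>m \<iota>\<^bsub>M\<^esub> K) = w"
    by (auto simp: adjunct_def)
  show "is_arr (adjunct X K N w)" "src (adjunct X K N w) = X" "tgt (adjunct X K N w) = ihom K N"
    using arrD[OF a] assms(1,2) N by auto
  show "iev K N \<cdot>\<^bsub>M\<^esub> (adjunct X K N w \<rhd>\<^sub>m \<iota>\<^bsub>M\<^esub> K) = w" by (rule e)
qed

lemma adjunct_unique:
  assumes "iev K N \<cdot>\<^bsub>M\<^esub> (g \<rhd>\<^sub>m \<iota>\<^bsub>M\<^esub> K) = iev K N \<cdot>\<^bsub>M\<^esub> (h \<rhd>\<^sub>m \<iota>\<^bsub>M\<^esub> K)"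
    and "is_arr g" "tgt g = ihom K N" "is_arr h" "src h = src g" "tgt h = ihom K N" "K \<in> Ob M" "N \<in> Ob M"
  shows "g = h"
proof -
  let ?w = "iev K N \<cdot>\<^bsub>M\<^esub> (g \<rhd>\<^sub>m \<iota>\<^bsub>M\<^esub> K)"
  have "?w \<in> Arr M (src g \<rhd> K) N" by (rule Mod.arrI) (use assms in auto)
  then have "\<exists>!k. k \<in> Arr C (src g) (ihom K N) \<and> iev K N \<cdot>\<^bsub>M\<^esub> (k \<rhd>\<^sub>m \<iota>\<^bsub>M\<^esub> K) = ?w"
    using assms by (intro ihom_universal) auto
  moreover have "g \<in> Arr C (src g) (ihom K N)" "h \<in> Arr C (src g) (ihom K N)" using assms by (auto intro: arrI)
  ultimately show ?thesis using assms(1) by metis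
qed

lemma ihom_post:
  assumes "K \<in> Ob M" "Mod.is_arr f"
  shows "is_arr (ihom_post K (Mod.src f) (Mod.tgt f) f)" "src (ihom_post K (Mod.src f) (Mod.tgt f) f) = ihom K (Mod.src f)"
    "tgt (ihom_post K (Mod.src f) (Mod.tgt f) f) = ihom K (Mod.tgt f)"
    "iev K (Mod.tgt f) \<cdot>\<^bsub>M\<^esub> (ihom_post K (Mod.src f) (Mod.tgt f) f \<rhd>\<^sub>m \<iota>\<^bsub>M\<^esub> K) = f \<cdot>\<^bsub>M\<^esub> iev K (Mod.src f)"
  unfolding ihom_post_def
  using adjunct[of "ihom K (Mod.src f)" K "f \<cdot>\<^bsub>M\<^esub> iev K (Mod.src f)" "Mod.tgt f"] assms by auto

lemma ihom_pre:
  assumes "N \<in> Ob M" "Mod.is_arr f"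
  shows "is_arr (ihom_pre (Mod.src f) (Mod.tgt f) N f)" "src (ihom_pre (Mod.src f) (Mod.tgt f) N f) = ihom (Mod.tgt f) N"
    "tgt (ihom_pre (Mod.src f) (Mod.tgt f) N f) = ihom (Mod.src f) N"
    "iev (Mod.src f) N \<cdot>\<^bsub>M\<^esub> (ihom_pre (Mod.src f) (Mod.tgt f) N f \<rhd>\<^sub>m \<iota>\<^bsub>M\<^esub> (Mod.src f)) =
      iev (Mod.tgt f) N \<cdot>\<^bsub>M\<^esub> (\<iota> (ihom (Mod.tgt f) N) \<rhd>\<^sub>m f)"
  unfolding ihom_pre_def
  using adjunct[of "ihom (Mod.tgt f) N" "Mod.src f" "iev (Mod.tgt f) N \<cdot>\<^bsub>M\<^esub> (\<iota> (ihom (Mod.tgt f) N) \<rhd>\<^sub>m f)" N] assms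
  by auto

lemma iev_post:
  assumes K: "K \<in> Ob M" and f: "Mod.is_arr f" and w: "is_arr w" "tgt w = ihom K (Mod.src f)"
  shows "iev K (Mod.tgt f) \<cdot>\<^bsub>M\<^esub> ((ihom_post K (Mod.src f) (Mod.tgt f) f \<cdot> w) \<rhd>\<^sub>m \<iota>\<^bsub>M\<^esub> K) =
    f \<cdot>\<^bsub>M\<^esub> (iev K (Mod.src f) \<cdot>\<^bsub>M\<^esub> (w \<rhd>\<^sub>m \<iota>\<^bsub>M\<^esub> K))"
  using Mod.assoc_comp_eq[OF ihom_post(4)[OF K f], of "w \<rhd>\<^sub>m \<iota>\<^bsub>M\<^esub> K"] ihom_post(1-3)[OF K f] K f w
  by (simp add: action_comp_left)

text \<open>Under the adjunction both sides of the dinaturality condition for \<open>f : K \<rightarrow> N\<close> become the arrow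
  \<open>f \<circ> \<eta>\<^sub>K = \<eta>\<^sub>N \<circ> (X \<rhd> f)\<close>.\<close>

lemma natural_imp_dinatural:
  assumes X: "X \<in> Ob C"
    and \<eta>: "\<And>K. K \<in> Ob M \<Longrightarrow> \<eta> K \<in> Arr M (X \<rhd> K) K"
    and nat: "\<And>f. Mod.is_arr f \<Longrightarrow> f \<cdot>\<^bsub>M\<^esub> \<eta> (Mod.src f) = \<eta> (Mod.tgt f) \<cdot>\<^bsub>M\<^esub> (\<iota> X \<rhd>\<^sub>m f)"
  shows "dinatural X (\<lambda>K. adjunct X K K (\<eta> K))"
proof -
  define p where "p K = adjunct X K K (\<eta> K)" for K
  have \<eta>': "Mod.is_arr (\<eta> K)" "Mod.src (\<eta> K) = X \<rhd> K" "Mod.tgt (\<eta> K) = K" if "K \<in> Ob M" for K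
    using Mod.arrD[OF \<eta>[OF that]] that X by auto
  have p: "is_arr (p K)" "src (p K) = X" "tgt (p K) = ihom K K" "iev K K \<cdot>\<^bsub>M\<^esub> (p K \<rhd>\<^sub>m \<iota>\<^bsub>M\<^esub> K) = \<eta> K" if "K \<in> Ob M" for K
    using adjunct[OF X that \<eta>'[OF that]] by (auto simp: p_def)
  have "ihom_post K K N f \<cdot> p K = ihom_pre K N N f \<cdot> p N" if K: "K \<in> Ob M" and N: "N \<in> Ob M" and "f \<in> Arr M K N" for K N f
  proof (rule adjunct_unique)
    have f: "Mod.is_arr f" "Mod.src f = K" "Mod.tgt f = N" using that by (auto simp: Mod.hom_iff)
    note post = ihom_post[OF K f(1), unfolded f(2,3)] and pre = ihom_pre[OF N f(1), unfolded f(2,3)]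
    let ?i = "p N \<rhd>\<^sub>m \<iota>\<^bsub>M\<^esub> K"
    have 1: "(\<iota> (ihom N N) \<rhd>\<^sub>m f) \<cdot>\<^bsub>M\<^esub> ?i = (p N \<rhd>\<^sub>m \<iota>\<^bsub>M\<^esub> N) \<cdot>\<^bsub>M\<^esub> (\<iota> X \<rhd>\<^sub>m f)"
      using p[OF N] K N X f by (simp add: action_interchange)
    have "iev K N \<cdot>\<^bsub>M\<^esub> ((ihom_pre K N N f \<cdot> p N) \<rhd>\<^sub>m \<iota>\<^bsub>M\<^esub> K) = iev N N \<cdot>\<^bsub>M\<^esub> ((\<iota> (ihom N N) \<rhd>\<^sub>m f) \<cdot>\<^bsub>M\<^esub> ?i)"
      using Mod.assoc_comp_eq[OF pre(4), of ?i] pre p[OF N] K N f by (simp add: action_comp_left)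
    also have "\<dots> = \<eta> N \<cdot>\<^bsub>M\<^esub> (\<iota> X \<rhd>\<^sub>m f)"
      unfolding 1 using Mod.assoc_comp_eq[OF p(4)[OF N], of "\<iota> X \<rhd>\<^sub>m f"] p[OF N] N X f by simp
    also have "\<dots> = f \<cdot>\<^bsub>M\<^esub> \<eta> K" using nat[OF f(1)] f by simp
    also have "\<dots> = iev K N \<cdot>\<^bsub>M\<^esub> ((ihom_post K K N f \<cdot> p K) \<rhd>\<^sub>m \<iota>\<^bsub>M\<^esub> K)"
      using iev_post[OF K f(1), of "p K"] p[OF K] f by simp
    finally show "iev K N \<cdot>\<^bsub>M\<^esub> ((ihom_post K K N f \<cdot> p K) \<rhd>\<^sub>m \<iota>\<^bsub>M\<^esub> K) = iev K N \<cdot>\<^bsub>M\<^esub> ((ihom_pre K N N f \<cdot> p N) \<rhd>\<^sub>m \<iota>\<^bsub>M\<^esub> K)" by simp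
    show "is_arr (ihom_post K K N f \<cdot> p K)" "tgt (ihom_post K K N f \<cdot> p K) = ihom K N" "is_arr (ihom_pre K N N f \<cdot> p N)"
      "src (ihom_pre K N N f \<cdot> p N) = src (ihom_post K K N f \<cdot> p K)" "tgt (ihom_pre K N N f \<cdot> p N) = ihom K N"
      using post pre p[OF K] p[OF N] by auto
  qed (use that in auto)
  then show ?thesis using p by (auto simp: dinatural_def p_def[symmetric] intro: arrI)
qed

end

context pivotal_module_category
begin

text \<open>The defining equation prescribes the transpose of the trace: it is the arrow \<open>r : \<I> \<rightarrow> [K, K]\<^sup>\<or>\<close>
  that the isomorphism \<open>ser_d\<close> maps to \<open>\<rho>\<close>. By \<open>ex1_functional\<close> exactly one arrow has this transpose,
  and it is zero only if \<open>\<rho>\<close> is. But \<open>\<rho>\<close> corresponds to the isomorphism \<open>\<I> \<rhd> K \<rightarrow> SerO K\<close> composed of the unit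
  constraint and the pivotal structure.\<close>

lemma itrace_props:
  assumes K: "K \<in> Ob M"
  shows "itrace K \<in> Arr C (ihom K K) \<I>"
    and "\<not> zero_object M K \<Longrightarrow> itrace K \<noteq> zero_arr (ihom K K) \<I>"
proof -
  let ?S = "ser_o K" and ?H = "ihom K K"
  have S: "?S \<in> Ob M" using relative_serre_functor K by (simp add: is_relative_serre_functor_def is_functor_def)
  have "iso_arr M K ?S (PivM M K)" using module_pivotal_structure K by (simp add: is_module_pivotal_structure_def natural_iso_def)
  note j = Mod.isomD[OF this K S]
  have "iso_arr C (?H\<^sup>\<or>) (ihom K ?S) (ser_d K K)" using relative_serre_functor K by (simp add: is_relative_serre_functor_def)
  note d = isomD[OF this dual_arrows(1)[OF ihom_ob[OF K K]] ihom_ob[OF K S]]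
  define w where "w = ihom_post K (\<I> \<rhd> K) K (munit K) \<cdot> icoev \<I> K"
  define \<rho> where "\<rho> = ihom_post K K ?S (PivM M K) \<cdot> w"
  note c = adjunct[of \<I> K "\<iota>\<^bsub>M\<^esub> (\<I> \<rhd> K)" "\<I> \<rhd> K", folded icoev_def]
  note m = ihom_post[OF K Mod.isom_is_arr[OF munit_arr(1)[OF K]], unfolded munit_arr[OF K]]
  note p = ihom_post[OF K j(2), unfolded j(3,4)]
  have w: "is_arr w" "src w = \<I>" "tgt w = ihom K K" using c m K by (auto simp: w_def)
  have \<rho>: "is_arr \<rho>" "src \<rho> = \<I>" "tgt \<rho> = ihom K ?S" using w p by (auto simp: \<rho>_def)
  have ev_w: "iev K K \<cdot>\<^bsub>M\<^esub> (w \<rhd>\<^sub>m \<iota>\<^bsub>M\<^esub> K) = munit K"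
    using iev_post[OF K Mod.isom_is_arr[OF munit_arr(1)[OF K]], of "icoev \<I> K"] c K by (simp add: w_def)
  have ev_\<rho>: "iev K ?S \<cdot>\<^bsub>M\<^esub> (\<rho> \<rhd>\<^sub>m \<iota>\<^bsub>M\<^esub> K) = PivM M K \<cdot>\<^bsub>M\<^esub> munit K"
    using iev_post[OF K j(2), of w] w j ev_w by (simp add: \<rho>_def)
  define r where "r = inv_of (ser_d K K) \<cdot> \<rho>"
  have r: "is_arr r" "src r = \<I>" "tgt r = ?H\<^sup>\<or>" using d \<rho> by (auto simp: r_def)
  have iff: "ser_d K K \<cdot> (dual_arr ?H \<I> t \<cdot> dual_unit) = \<rho> \<longleftrightarrow> dual_arr ?H \<I> t \<cdot> dual_unit = r"
    if t: "t \<in> Arr C ?H \<I>" for t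
  proof -
    have ta: "is_arr t" "src t = ?H" "tgt t = \<I>" using t K by (auto simp: hom_iff)
    note dt = dual_arr_arr[OF ta(1), unfolded ta(2,3)] and u = dual_unit_arr
    let ?x = "dual_arr ?H \<I> t \<cdot> dual_unit"
    have x: "is_arr ?x" "tgt ?x = ?H\<^sup>\<or>" using dt u by auto
    have "ser_d K K \<cdot> r = \<rho>" using d \<rho> by (simp add: r_def)
    moreover have "?x = r" if "ser_d K K \<cdot> ?x = \<rho>"
      using inv_of_comp(1)[OF d(1) x(1)] d x that by (simp add: r_def)
    ultimately show ?thesis by auto
  qed
  have "\<exists>!t. t \<in> Arr C ?H \<I> \<and> dual_arr ?H \<I> t \<cdot> dual_unit = r"
    by (rule ex1_functional[OF r]) (use K in auto)
  then have "\<exists>!t. t \<in> Arr C ?H \<I> \<and> ser_d K K \<cdot> (dual_arr ?H \<I> t \<cdot> dual_unit) = \<rho>"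
    using iff by metis
  from theI'[OF this] have t: "itrace K \<in> Arr C ?H \<I>" "ser_d K K \<cdot> (dual_arr ?H \<I> (itrace K) \<cdot> dual_unit) = \<rho>"
    by (simp_all add: itrace_def \<rho>_def w_def)
  show "itrace K \<in> Arr C ?H \<I>" by (rule t)
  assume nz: "\<not> zero_object M K"
  show "itrace K \<noteq> zero_arr ?H \<I>"
  proof
    assume "itrace K = zero_arr ?H \<I>"
    then have "\<rho> = ser_d K K \<cdot> zero_arr \<I> (?H\<^sup>\<or>)" using t(2) functional_zero[OF ihom_ob[OF K K]] by simp
    then have "\<rho> = zero_arr \<I> (ihom K ?S)" using d by simp
    then have "PivM M K \<cdot>\<^bsub>M\<^esub> munit K = Mod.zero_arr (\<I> \<rhd> K) ?S"
      using ev_\<rho> K S by (simp add: action_zero_left)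
    then have "PivM M K \<cdot>\<^bsub>M\<^esub> munit K = Mod.zero_arr K ?S \<cdot>\<^bsub>M\<^esub> munit K" using K S by simp
    then have "PivM M K = Mod.zero_arr K ?S"
      by (rule Mod.isom_cancel_right) (use K S j in auto)
    then have "\<iota>\<^bsub>M\<^esub> K = Mod.inv_of (PivM M K) \<cdot>\<^bsub>M\<^esub> Mod.zero_arr K ?S" using Mod.inv_of(4)[OF j(1)] j by simp
    also have "\<dots> = Mod.zero_arr K K" using j K by simp
    finally show False using Mod.idn_zero_imp_zero_object[OF K] nz by blast
  qed
qed

end

section \<open>Separating the characters of simple objects\<close>

text \<open>Choose a projective \<open>P\<close> and \<open>g : P \<rightarrow> [L, L]\<close> not killed by the trace of \<open>L\<close>. The arrow \<open>P \<rhd> L \<rightarrow> L\<close>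
  that corresponds to \<open>g\<close>, and zero on \<open>S\<close>, extend to a natural transformation \<open>P \<rhd> - \<rightarrow> id\<close>, and \<open>h\<close> is the arrow
  into the end that it induces.\<close>

lemma characters_separated:
  fixes C :: "('oc, 'mc, 'k::alg_closed_field, 'z) pivotal_tensor_cat_scheme"
    and M :: "('om, 'mm, 'k, 'oc, 'mc, 'y) pivotal_module_cat_scheme"
  assumes "pivotal_module_category C M" and "module_data.is_end C M A \<pi>"
    and L: "simple_object M L"
    and S: "finite S" "\<And>K. K \<in> S \<Longrightarrow> simple_object M K \<and> \<not> isomorphic M K L"
  shows "\<exists>P\<in>Ob C. \<exists>h\<in>Arr C P A.
    pivotal_module_data.internal_character C M \<pi> L \<cdot>\<^bsub>C\<^esub> h \<noteq> \<zero>\<^bsub>Hom C P \<I>\<^bsub>C\<^esub>\<^esub> \<and>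
    (\<forall>K\<in>S. pivotal_module_data.internal_character C M \<pi> K \<cdot>\<^bsub>C\<^esub> h = \<zero>\<^bsub>Hom C P \<I>\<^bsub>C\<^esub>\<^esub>)"
proof -
  interpret pivotal_module_category C M by fact
  obtain n mul u dm act mt where "matrix_category M n mul (u :: 'k vec) dm act mt"
    using Mod.ex_matrix_category by blast
  then interpret MC: alg_closed_matrix_category M n mul u dm act mt
    by (rule alg_closed_matrix_category.intro)
  have Lo: "L \<in> Ob M" using L by (simp add: simple_object_def)
  have end_A: "A \<in> Ob C" "dinatural A \<pi>"
    and univ: "\<And>X p. X \<in> Ob C \<Longrightarrow> dinatural X p \<Longrightarrow> \<exists>!g. g \<in> Arr C X A \<and> (\<forall>K\<in>Ob M. \<pi> K \<cdot>\<^bsub>C\<^esub> g = p K)"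
    using assms(2) by (auto simp: is_end_def)
  have \<pi>: "is_arr (\<pi> K)" "src (\<pi> K) = A" "tgt (\<pi> K) = ihom K K" if "K \<in> Ob M" for K
    using end_A that arrD[of "\<pi> K" A "ihom K K"] by (auto simp: dinatural_def)
  have tr: "is_arr (itrace K)" "src (itrace K) = ihom K K" "tgt (itrace K) = \<I>\<^bsub>C\<^esub>" if "K \<in> Ob M" for K
    using arrD[OF itrace_props(1)[OF that]] that by auto
  have "itrace L \<noteq> zero_arr (ihom L L) \<I>\<^bsub>C\<^esub>"
    using itrace_props(2)[OF Lo] L by (simp add: simple_object_def)
  then obtain P g where P: "projective_object C P"
    and g: "is_arr g" "src g = P" "tgt g = ihom L L" "itrace L \<cdot>\<^bsub>C\<^esub> g \<noteq> zero_arr P \<I>\<^bsub>C\<^esub>"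
    using ex_projective_generator tr[OF Lo] by metis
  have Po: "P \<in> Ob C" using P by (simp add: projective_object_def)
  define t where "t = iev L L \<cdot>\<^bsub>M\<^esub> (g \<rhd>\<^sub>m \<iota>\<^bsub>M\<^esub> L)"
  have t: "t \<in> Arr M (P \<rhd> L) L" unfolding t_def by (rule Mod.arrI) (use g Lo in auto)
  have "\<exists>\<eta>. (\<forall>K\<in>Ob M. \<eta> K \<in> Arr M (P \<rhd> K) K) \<and>
      (\<forall>f. Mod.is_arr f \<longrightarrow> f \<cdot>\<^bsub>M\<^esub> \<eta> (Mod.src f) = \<eta> (Mod.tgt f) \<cdot>\<^bsub>M\<^esub> (\<iota>\<^bsub>C\<^esub> P \<rhd>\<^sub>m f)) \<and>
      \<eta> L = t \<and> (\<forall>K\<in>S. \<eta> K = Mod.zero_arr (P \<rhd> K) K)"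
  proof (rule MC.prescribed_natural_transformation[OF action_linear[OF Po] L S(1) _ exact[OF P Lo] _ t])
    fix v q
    assume "mono_arr M L (Mod.tgt v) v" "is_cokernel M L (Mod.tgt v) (Mod.tgt q) v q" "Mod.weak_kernel q v"
    then show "\<exists>r. Mod.is_arr r \<and> Mod.src r = P \<rhd> Mod.tgt v \<and> Mod.tgt r = P \<rhd> L \<and> r \<cdot>\<^bsub>M\<^esub> (\<iota>\<^bsub>C\<^esub> P \<rhd>\<^sub>m v) = \<iota>\<^bsub>M\<^esub> (P \<rhd> L)"
      by (intro projective_action_splits_mono[OF P _ Lo])
  qed (rule S(2))
  then obtain \<eta> where \<eta>: "\<And>K. K \<in> Ob M \<Longrightarrow> \<eta> K \<in> Arr M (P \<rhd> K) K"
    and nat: "\<And>f. Mod.is_arr f \<Longrightarrow> f \<cdot>\<^bsub>M\<^esub> \<eta> (Mod.src f) = \<eta> (Mod.tgt f) \<cdot>\<^bsub>M\<^esub> (\<iota>\<^bsub>C\<^esub> P \<rhd>\<^sub>m f)"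
    and \<eta>L: "\<eta> L = t" and \<eta>S: "\<And>K. K \<in> S \<Longrightarrow> \<eta> K = Mod.zero_arr (P \<rhd> K) K"
    by blast
  obtain h where h: "h \<in> Arr C P A" and \<pi>h: "\<And>K. K \<in> Ob M \<Longrightarrow> \<pi> K \<cdot>\<^bsub>C\<^esub> h = adjunct P K K (\<eta> K)"
    using univ[OF Po natural_imp_dinatural[OF Po \<eta> nat]] by blast
  have ha: "is_arr h" "src h = P" "tgt h = A" using arrD[OF h Po end_A(1)] by auto
  have ch: "internal_character \<pi> K \<cdot>\<^bsub>C\<^esub> h = itrace K \<cdot>\<^bsub>C\<^esub> adjunct P K K (\<eta> K)" if "K \<in> Ob M" for K
    using tr[OF that] \<pi>[OF that] ha \<pi>h[OF that] by (simp add: internal_character_def)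
  have adj: "is_arr (adjunct P K K (\<eta> K))" "src (adjunct P K K (\<eta> K)) = P" "tgt (adjunct P K K (\<eta> K)) = ihom K K"
      "iev K K \<cdot>\<^bsub>M\<^esub> (adjunct P K K (\<eta> K) \<rhd>\<^sub>m \<iota>\<^bsub>M\<^esub> K) = \<eta> K" if K: "K \<in> Ob M" for K
    using adjunct[OF Po K Mod.arrD[OF \<eta>[OF K]]] Po K by auto
  have "adjunct P L L (\<eta> L) = g"
  proof (rule adjunct_unique)
    show "iev L L \<cdot>\<^bsub>M\<^esub> (adjunct P L L (\<eta> L) \<rhd>\<^sub>m \<iota>\<^bsub>M\<^esub> L) = iev L L \<cdot>\<^bsub>M\<^esub> (g \<rhd>\<^sub>m \<iota>\<^bsub>M\<^esub> L)"
      using adj(4)[OF Lo] \<eta>L by (simp add: t_def)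
  qed (use adj[OF Lo] g Lo in auto)
  then have 1: "internal_character \<pi> L \<cdot>\<^bsub>C\<^esub> h \<noteq> zero_arr P \<I>\<^bsub>C\<^esub>" using ch[OF Lo] g by simp
  have 2: "internal_character \<pi> K \<cdot>\<^bsub>C\<^esub> h = zero_arr P \<I>\<^bsub>C\<^esub>" if K: "K \<in> S" for K
  proof -
    have Ko: "K \<in> Ob M" using S(2)[OF K] by (simp add: simple_object_def)
    have "adjunct P K K (\<eta> K) = zero_arr P (ihom K K)"
    proof (rule adjunct_unique)
      show "iev K K \<cdot>\<^bsub>M\<^esub> (adjunct P K K (\<eta> K) \<rhd>\<^sub>m \<iota>\<^bsub>M\<^esub> K) = iev K K \<cdot>\<^bsub>M\<^esub> (zero_arr P (ihom K K) \<rhd>\<^sub>m \<iota>\<^bsub>M\<^esub> K)"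
        using adj(4)[OF Ko] \<eta>S[OF K] Ko Po by (simp add: action_zero_left)
    qed (use adj[OF Ko] Po Ko in auto)
    then show ?thesis using ch[OF Ko] tr[OF Ko] Po by simp
  qed
  show ?thesis using Po h 1 2 by blast
qed

text \<open>A linear map that kills all vectors of the family except \<open>f i\<close> turns a linear relation into
  one that says that the coefficient of \<open>f i\<close> vanishes.\<close>

lemma lin_indpt_if_separated:
  fixes V :: "('k::field, 'v) module" and f :: "nat \<Rightarrow> 'v"
  assumes V: "vectorspace class_ring V" and f: "\<And>i. i \<in> I \<Longrightarrow> f i \<in> carrier V"
    and sep: "\<And>i. i \<in> I \<Longrightarrow> \<exists>(W :: ('k, 'v) module) H. vectorspace class_ring W \<and> H \<in> lin_maps V W \<and>
      H (f i) \<noteq> \<zero>\<^bsub>W\<^esub> \<and> (\<forall>j\<in>I - {i}. H (f j) = \<zero>\<^bsub>W\<^esub>)"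
  shows "inj_on f I" and "\<not> LinearCombinations.module.lin_dep class_ring V (f ` I)"
proof -
  show "inj_on f I"
  proof (rule inj_onI, rule ccontr)
    fix i j assume "i \<in> I" "j \<in> I" "f i = f j" "i \<noteq> j"
    then show False using sep[of i] by force
  qed
  interpret V: vectorspace class_ring V by (rule V)
  show "\<not> LinearCombinations.module.lin_dep class_ring V (f ` I)"
  proof
    assume "V.lin_dep (f ` I)"
    then obtain B a v where B: "finite B" "B \<subseteq> f ` I" and z: "V.lincomb a B = \<zero>\<^bsub>V\<^esub>" and v: "v \<in> B" and av: "a v \<noteq> 0"
      unfolding V.lin_dep_def by auto
    obtain i where i: "i \<in> I" "v = f i" using B v by auto
    obtain W :: "('k, 'v) module" and H where W: "vectorspace class_ring W" and H: "H \<in> lin_maps V W"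
      and Hi: "H (f i) \<noteq> \<zero>\<^bsub>W\<^esub>" and Hj: "\<And>j. j \<in> I \<Longrightarrow> j \<noteq> i \<Longrightarrow> H (f j) = \<zero>\<^bsub>W\<^esub>"
      using sep[OF i(1)] by blast
    interpret W: vectorspace class_ring W by (rule W)
    have Bc: "w \<in> carrier V" if "w \<in> B" for w using B f that by auto
    have Hc: "H w \<in> carrier W" if "w \<in> B" for w using lin_mapsD(1)[OF H Bc[OF that]] .
    have sm: "c \<odot>\<^bsub>W\<^esub> x \<in> carrier W" if "x \<in> carrier W" for c x using W.smult_closed[of c x] that by simp
    have r0: "c \<odot>\<^bsub>W\<^esub> \<zero>\<^bsub>W\<^esub> = \<zero>\<^bsub>W\<^esub>" for c using W.rmult_0[of c] by simp
    have "\<zero>\<^bsub>W\<^esub> = H (V.lincomb a B)" unfolding z by (rule lin_map_zero[OF V W H, symmetric])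
    also have "\<dots> = (\<Oplus>\<^bsub>W\<^esub>w\<in>B. H (a w \<odot>\<^bsub>V\<^esub> w))"
      unfolding V.lincomb_def
    proof (rule lin_map_finsum[OF V W H B(1)])
      show "a w \<odot>\<^bsub>V\<^esub> w \<in> carrier V" if "w \<in> B" for w using V.smult_closed[of "a w" w] Bc[OF that] by simp
    qed
    also have "\<dots> = (\<Oplus>\<^bsub>W\<^esub>w\<in>B. if v = w then a w \<odot>\<^bsub>W\<^esub> H w else \<zero>\<^bsub>W\<^esub>)"
    proof (rule W.finsum_cong')
      fix w assume w: "w \<in> B"
      then obtain j where j: "j \<in> I" "w = f j" using B by auto
      show "H (a w \<odot>\<^bsub>V\<^esub> w) = (if v = w then a w \<odot>\<^bsub>W\<^esub> H w else \<zero>\<^bsub>W\<^esub>)"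
      proof (cases "v = w")
        case False
        then have "j \<noteq> i" using i j by auto
        then show ?thesis using lin_mapsD(3)[OF H Bc[OF w]] Hj[OF j(1)] j False by (simp add: r0)
      qed (use lin_mapsD(3)[OF H Bc[OF w]] in simp)
    qed (auto intro!: sm Hc)
    also have "\<dots> = a v \<odot>\<^bsub>W\<^esub> H v" by (rule W.finsum_singleton[OF v B(1)]) (auto intro!: sm Hc)
    finally have e: "\<zero>\<^bsub>W\<^esub> = a v \<odot>\<^bsub>W\<^esub> H v" .
    have "inverse (a v) \<odot>\<^bsub>W\<^esub> (a v \<odot>\<^bsub>W\<^esub> H v) = \<zero>\<^bsub>W\<^esub>" unfolding e[symmetric] by (rule r0)
    moreover have "inverse (a v) \<odot>\<^bsub>W\<^esub> (a v \<odot>\<^bsub>W\<^esub> H v) = H v"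
      using W.smult_assoc1[of "inverse (a v)" "a v" "H v"] W.smult_one[of "H v"] Hc[OF v] av by simp
    ultimately show False using Hi i by simp
  qed
qed

theorem theorem5p11:
  fixes C :: "('oc, 'mc, 'k::alg_closed_field) pivotal_tensor_cat"
    and M :: "('om, 'mm, 'k, 'oc, 'mc) pivotal_module_cat"
    and A :: 'oc and \<pi> :: "'om \<Rightarrow> 'mc" and n :: nat and L :: "nat \<Rightarrow> 'om"
  defines "ch \<equiv> pivotal_module_data.internal_character C M \<pi>"
  assumes "pivotal_finite_tensor_category C"
    and "pivotal_module_category C M"
    and "module_data.is_end C M A \<pi>"
    and "complete_simples M n L"
  shows "(\<forall>i\<in>{1..n}. ch (L i) \<in> carrier (class_functions C A)) \<and>
    inj_on (\<lambda>i. ch (L i)) {1..n} \<and>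
    \<not> LinearCombinations.module.lin_dep class_ring (class_functions C A)
        ((\<lambda>i. ch (L i)) ` {1..n})"
proof -
  interpret pivotal_module_category C M by fact
  have A: "A \<in> Ob C" "dinatural A \<pi>" using assms(4) by (auto simp: is_end_def)
  have simple: "simple_object M (L i)" if "i \<in> {1..n}" for i
    using assms(5) that unfolding complete_simples_def by blast
  have noniso: "\<not> isomorphic M (L i) (L j)" if "i \<in> {1..n}" "j \<in> {1..n}" "i \<noteq> j" for i j
    using assms(5) that unfolding complete_simples_def by blast
  let ?V = "class_functions C A"
  have V: "vectorspace class_ring ?V" unfolding class_functions_def by (rule hom_space) (use A in auto)
  have carrier: "ch (L i) \<in> carrier ?V" if i: "i \<in> {1..n}" for i
  proof -
    have Li: "L i \<in> Ob M" using simple[OF i] by (simp add: simple_object_def)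
    have "\<pi> (L i) \<in> Arr C A (ihom (L i) (L i))" using A Li by (simp add: dinatural_def)
    then show ?thesis
      unfolding ch_def class_functions_def internal_character_def
      by (rule comp_closed[rotated 3]) (use A Li itrace_props(1)[OF Li] in auto)
  qed
  have sep: "\<exists>(W :: ('k, 'mc) module) H. vectorspace class_ring W \<and> H \<in> lin_maps ?V W \<and>
      H (ch (L i)) \<noteq> \<zero>\<^bsub>W\<^esub> \<and> (\<forall>j\<in>{1..n} - {i}. H (ch (L j)) = \<zero>\<^bsub>W\<^esub>)" if i: "i \<in> {1..n}" for i
  proof -
    have S: "finite (L ` ({1..n} - {i}))" by simp
    have "simple_object M K \<and> \<not> isomorphic M K (L i)" if "K \<in> L ` ({1..n} - {i})" for K
      using that simple noniso i by auto
    from characters_separated[OF assms(3,4) simple[OF i] S this]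
    obtain P h where P: "P \<in> Ob C" and h: "h \<in> Arr C P A"
      and n0: "ch (L i) \<cdot>\<^bsub>C\<^esub> h \<noteq> zero_arr P \<I>\<^bsub>C\<^esub>"
      and z: "\<And>j. j \<in> {1..n} - {i} \<Longrightarrow> ch (L j) \<cdot>\<^bsub>C\<^esub> h = zero_arr P \<I>\<^bsub>C\<^esub>"
      unfolding ch_def by blast
    have "(\<lambda>f. f \<cdot>\<^bsub>C\<^esub> h) \<in> lin_maps ?V (Hom C P \<I>\<^bsub>C\<^esub>)"
      unfolding class_functions_def by (rule comp_linear_left) (use P A h in auto)
    then show ?thesis
      using n0 z hom_space[OF P unit_ob] by (intro exI[of _ "Hom C P \<I>\<^bsub>C\<^esub>"] exI[of _ "\<lambda>f. f \<cdot>\<^bsub>C\<^esub> h"]) simp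
  qed
  show ?thesis
    using carrier lin_indpt_if_separated[OF V carrier sep] by simp
qed

end
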